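(* Consider the following statements. (a) $\mathsf{BCT}_{[0,1]}$: if $(O_n)_{n\in\mathbb N}$ is a decreasing sequence of dense open subsets of $[0,1]$, then $\bigcap_{n\in\mathbb N}O_n$ is non-empty. (b) For every upper semi-continuous $f:[0,1]\to\mathbb R$, there is $x\in[0,1]$ where $f$ is continuous. (c) For every upper semi-continuous $f:[0,1]\to\mathbb R$ which has an oscillation function $\mathrm{osc}_f:[0,1]\to\mathbb R$, there is $x\in[0,1]$ where $f$ is continuous. (d) For every upper semi-continuous $f:[0,1]\to\mathbb R$ which is its own oscillation function, there is $x\in[0,1]$ where $f$ is continuous. (e) For every upper semi-continuous and countably continuous $f:[0,1]\to\mathbb R$, there is $x\in[0,1]$ where $f$ is continuous. (f) For every upper semi-continuous $f:[0,1]\to\mathbb R$, there exist $q\in\mathbb Q$ and $c,d\in[0,1]$ with $c<d$ such that $(\forall y\in(c,d))(f(y)\ge q)$. (g) For every upper semi-continuous $f:[0,1]\to\mathbb R^{+}$, there are $c,d\in[0,1]$ with $c<d$ and $0<\inf_{x\in[c,d]}f(x)$. The theory $\mathsf{ACA}_0^{\omega}$ proves that (a)-(g) are equivalent, and this remains so under each of the following modifications: (1) replace "continuous" in the consequent of items (b)-(d) by any one of: regulated, quasi-continuous, lower quasi-continuous, cadlag, Darboux, or lower semi-continuous (at the point $x$); (2) restrict "upper semi-continuous" to "upper semi-continuous and such that $C_f$ has measure zero"; (3) restrict $\mathsf{BCT}_{[0,1]}$ to sequences of open sets such that $\bigcap_{n\in\mathbb N}O_n$ has measure zero.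
   Context: Formal setting. $\mathsf{RCA}_0^{\omega}$ is Kohlenbach's base theory of higher-order Reverse Mathematics: a classical theory in the language of all finite types (type $0$ is the natural numbers, $\sigma\to\tau$ is the type of maps from type $\sigma$ to type $\tau$ objects, $1:=0\to 0$, $n+1:=n\to 0$; equality at higher types is defined pointwise from equality at type $0$), with axioms: ordered semi-ring axioms for $0,1,<,+,\times$; combinator axioms giving $\lambda$-abstraction; primitive recursion $\mathbf R_0(f,m,0)=m$, $\mathbf R_0(f,m,n+1)=f(n,\mathbf R_0(f,m,n))$ for number-valued $f$ on numbers; extensionality $x=_\rho y\to\varphi(x)=_\tau\varphi(y)$ at all types; induction for quantifier-free formulas (parameters of any type allowed); and $\mathsf{QF\text{-}AC}^{1,0}$, where $\mathsf{QF\text{-}AC}^{\sigma,\tau}$ is the schema $(\forall x^\sigma)(\exists y^\tau)A(x,y)\to(\exists Y^{\sigma\to\tau})(\forall x^\sigma)A(x,Y(x))$ for quantifier-free $A$. $\mathsf{ACA}_0^{\omega}$ is $\mathsf{RCA}_0^{\omega}$ plus $(\exists^2)$: there is $\varphi:\mathbb N^{\mathbb N}\to\{0,1\}$ with $\varphi(f)=0\leftrightarrow(\exists n)(f(n)=0)$ for all $f\in\mathbb N^{\mathbb N}$. Reals are fast-converging Cauchy sequences of rationals ($|q_n-q_{n+i}|<2^{-n}$) with the usual $=_{\mathbb R},<_{\mathbb R}$; functions on reals are type $1\to1$ objects respecting $=_{\mathbb R}$. A set of reals is given by its characteristic function (a sequence of sets by a function of a real and a number). $O$ is open if for each $x\in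 O$ some ball $B(x,2^{-k})$ is contained in $O$ (no further representation is given), relative to $[0,1]$ for subsets of $[0,1]$; a set is closed if its complement is open. Suprema, infima and limits need not exist as objects; (in)equalities involving them are shorthand for the usual formulas. Definitions, for $f:[0,1]\to\mathbb R$. $f$ is upper (resp. lower) semi-continuous at $x_0$ if $f(x_0)\ge\limsup_{x\to x_0}f(x)$ (resp. $f(x_0)\le\liminf_{x\to x_0}f(x)$); a function has a property if it has it at all points. $f$ is regulated at $x_0$ if the left and right limits $f(x_0-)$, $f(x_0+)$ exist; cadlag at $x_0$ if it is right-continuous at $x_0$ and the left limit exists. $f$ is quasi-continuous (resp. lower quasi-continuous) at $x_0$ if for every $\epsilon>0$ and open neighbourhood $U$ of $x_0$ there is a non-empty open $G\subset U$ with $|f(x_0)-f(x)|<\epsilon$ (resp. $f(x)>f(x_0)-\epsilon$) for all $x\in G$. A real $y$ is a left (resp. right) cluster value of $f$ at $x$ if $y=\lim_nf(x_n)$ for some sequence $x_n\to x$ with all $x_n\le x$ (resp. $x_n\ge x$); $x$ is a Darboux point of $f$ if for every $\delta>0$, every left (resp. right) cluster value $y$ of $f$ at $x$ and every $z$ strictly between $y$ and $f(x)$ there is $w\in(x-\delta,x)$ (resp. $w\in(x,x+\delta)$) with $f(w)=z$. $f$ is countably continuous if there is a sequence of sets $(E_n)_{n\in\mathbb N}$ with $[0,1]=\bigcup_nE_n$ and each $f_{\upharpoonright E_n}$ continuous. $C_f$ is the set of continuity points of $f$. $\mathbb R^{+}$ denotes the strictly positive reals. $A\subset\mathbb R$ has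 measure zero if for every $\epsilon>0$ there is a sequence of open intervals $(I_n)_{n\in\mathbb N}$ covering $A$ with $\sum_n|I_n|<\epsilon$. For an interval $I$, $\mathrm{osc}_f(I):=\sup_{x\in I}f(x)-\inf_{x\in I}f(x)$, and an oscillation function of $f$ is a function $\mathrm{osc}_f:[0,1]\to\mathbb R$ with $\mathrm{osc}_f(x)=\lim_{k\to\infty}\mathrm{osc}_f(B(x,2^{-k}))$ for all $x$; $f$ is its own oscillation function if $\mathrm{osc}_f=f$. *)

theory Defs
  imports Main
begin

section \<open>The language of all finite types\<close>

datatype ty = T0 | Fn ty ty  (infixr "\<rightarrow>" 65)

abbreviation T1 :: ty where "T1 \<equiv> T0 \<rightarrow> T0"

datatype cst =
    Zero | One | Plus | Times
  | CombK ty ty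
  | CombS ty ty ty
  | Rec0

primrec cst_type :: "cst \<Rightarrow> ty" where
  "cst_type Zero = T0"
| "cst_type One = T0"
| "cst_type Plus = T0 \<rightarrow> T0 \<rightarrow> T0"
| "cst_type Times = T0 \<rightarrow> T0 \<rightarrow> T0"
| "cst_type (CombK \<rho> \<tau>) = \<rho> \<rightarrow> \<tau> \<rightarrow> \<rho>"
| "cst_type (CombS \<delta> \<rho> \<tau>) = (\<delta> \<rightarrow> \<rho> \<rightarrow> \<tau>) \<rightarrow> (\<delta> \<rightarrow> \<rho>) \<rightarrow> \<delta> \<rightarrow> \<tau>"
| "cst_type Rec0 = (T0 \<rightarrow> T0 \<rightarrow> T0) \<rightarrow> T0 \<rightarrow> T0 \<rightarrow> T0"

text \<open>Variables are de Bruijn indices. Equality and order are primitive at type 0 only. The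
  remaining connectives and the existential quantifier are classical abbreviations.\<close>

datatype tm = Var nat | Cst cst | App tm tm

datatype fm = Fls | Eq tm tm | Less tm tm | Imp fm fm | Forall ty fm

definition Neg :: "fm \<Rightarrow> fm" where "Neg A = Imp A Fls"
definition Exists :: "ty \<Rightarrow> fm \<Rightarrow> fm" where "Exists \<tau> A = Neg (Forall \<tau> (Neg A))"

text \<open>A typing context lists the types of the variables \<open>Var 0, Var 1, \<dots>\<close> in this order.\<close>

inductive has_type :: "ty list \<Rightarrow> tm \<Rightarrow> ty \<Rightarrow> bool" where
  "i < length \<Delta> \<Longrightarrow> has_type \<Delta> (Var i) (\<Delta> ! i)"
| "has_type \<Delta> (Cst c) (cst_type c)"
| "has_type \<Delta> s (\<rho> \<rightarrow> \<tau>) \<Longrightarrow> has_type \<Delta> t \<rho> \<Longrightarrow> has_type \<Delta> (App s t) \<tau>"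

primrec wff :: "ty list \<Rightarrow> fm \<Rightarrow> bool" where
  "wff \<Delta> Fls \<longleftrightarrow> True"
| "wff \<Delta> (Eq s t) \<longleftrightarrow> has_type \<Delta> s T0 \<and> has_type \<Delta> t T0"
| "wff \<Delta> (Less s t) \<longleftrightarrow> has_type \<Delta> s T0 \<and> has_type \<Delta> t T0"
| "wff \<Delta> (Imp A B) \<longleftrightarrow> wff \<Delta> A \<and> wff \<Delta> B"
| "wff \<Delta> (Forall \<tau> A) \<longleftrightarrow> wff (\<tau> # \<Delta>) A"

primrec quantifier_free :: "fm \<Rightarrow> bool" where
  "quantifier_free Fls \<longleftrightarrow> True"
| "quantifier_free (Eq s t) \<longleftrightarrow> True"
| "quantifier_free (Less s t) \<longleftrightarrow> True"
| "quantifier_free (Imp A B) \<longleftrightarrow> quantifier_free A \<and> quantifier_free B"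
| "quantifier_free (Forall \<tau> A) \<longleftrightarrow> False"

text \<open>Simultaneous substitution of \<open>\<sigma> i\<close> for \<open>Var i\<close>.\<close>

primrec sub_tm :: "(nat \<Rightarrow> tm) \<Rightarrow> tm \<Rightarrow> tm" where
  "sub_tm \<sigma> (Var i) = \<sigma> i"
| "sub_tm \<sigma> (Cst c) = Cst c"
| "sub_tm \<sigma> (App s t) = App (sub_tm \<sigma> s) (sub_tm \<sigma> t)"

definition up :: "(nat \<Rightarrow> tm) \<Rightarrow> nat \<Rightarrow> tm" where
  "up \<sigma> = case_nat (Var 0) (\<lambda>i. sub_tm (\<lambda>j. Var (Suc j)) (\<sigma> i))"

primrec sub_fm :: "(nat \<Rightarrow> tm) \<Rightarrow> fm \<Rightarrow> fm" where
  "sub_fm \<sigma> Fls = Fls"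
| "sub_fm \<sigma> (Eq s t) = Eq (sub_tm \<sigma> s) (sub_tm \<sigma> t)"
| "sub_fm \<sigma> (Less s t) = Less (sub_tm \<sigma> s) (sub_tm \<sigma> t)"
| "sub_fm \<sigma> (Imp A B) = Imp (sub_fm \<sigma> A) (sub_fm \<sigma> B)"
| "sub_fm \<sigma> (Forall \<tau> A) = Forall \<tau> (sub_fm (up \<sigma>) A)"

definition lift :: "fm \<Rightarrow> fm" where "lift = sub_fm (\<lambda>i. Var (Suc i))"
definition inst :: "tm \<Rightarrow> fm \<Rightarrow> fm" where "inst t = sub_fm (case_nat t Var)"


section \<open>Provability\<close>

text \<open>Classical many-sorted natural deduction with equality at type 0, from a set \<open>T\<close> of sentences:
  \<open>deriv T \<Delta> H A\<close> says that \<open>A\<close> follows from the open assumptions \<open>H\<close>, the free variables being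
  typed by \<open>\<Delta>\<close>.\<close>

inductive deriv :: "fm set \<Rightarrow> ty list \<Rightarrow> fm list \<Rightarrow> fm \<Rightarrow> bool" for T where
  Axm: "A \<in> T \<Longrightarrow> deriv T \<Delta> H A"
| Hyp: "A \<in> set H \<Longrightarrow> wff \<Delta> A \<Longrightarrow> deriv T \<Delta> H A"
| ImpI: "wff \<Delta> A \<Longrightarrow> deriv T \<Delta> (A # H) B \<Longrightarrow> deriv T \<Delta> H (Imp A B)"
| ImpE: "deriv T \<Delta> H (Imp A B) \<Longrightarrow> deriv T \<Delta> H A \<Longrightarrow> deriv T \<Delta> H B"
| Classical: "wff \<Delta> A \<Longrightarrow> deriv T \<Delta> (Neg A # H) Fls \<Longrightarrow> deriv T \<Delta> H A"
| AllI: "deriv T (\<tau> # \<Delta>) (map lift H) A \<Longrightarrow> deriv T \<Delta> H (Forall \<tau> A)"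
| AllE: "deriv T \<Delta> H (Forall \<tau> A) \<Longrightarrow> has_type \<Delta> t \<tau> \<Longrightarrow> deriv T \<Delta> H (inst t A)"
| EqI: "has_type \<Delta> t T0 \<Longrightarrow> deriv T \<Delta> H (Eq t t)"
| EqE: "deriv T \<Delta> H (Eq s t) \<Longrightarrow> has_type \<Delta> s T0 \<Longrightarrow> has_type \<Delta> t T0 \<Longrightarrow> wff (T0 # \<Delta>) A \<Longrightarrow>
        deriv T \<Delta> H (inst s A) \<Longrightarrow> deriv T \<Delta> H (inst t A)"

definition proves :: "fm set \<Rightarrow> fm \<Rightarrow> bool"  (infix "\<turnstile>" 50) where
  "T \<turnstile> A \<longleftrightarrow> deriv T [] [] A"


section \<open>Named-variable notation for formulas\<close>

text \<open>To write concrete formulas with named variables, a formula (or term) is presented as a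
  function of the number \<open>d\<close> of quantifiers in whose scope it is placed. A quantifier entered at
  depth \<open>d\<close> passes to its body a variable which, referred to at depth \<open>e > d\<close>, is the de Bruijn
  index \<open>e - Suc d\<close>. The sentence denoted by a closed \<open>A :: fmb\<close> is \<open>A 0\<close>.\<close>

type_synonym tmb = "nat \<Rightarrow> tm"
type_synonym fmb = "nat \<Rightarrow> fm"

definition cst :: "cst \<Rightarrow> tmb" where "cst c = (\<lambda>d. Cst c)"
definition app :: "tmb \<Rightarrow> tmb \<Rightarrow> tmb"  (infixl "\<cdot>" 90) where "s \<cdot> t = (\<lambda>d. App (s d) (t d))"

definition zero_b :: tmb  ("\<^bold>0") where "\<^bold>0 = cst Zero"
definition one_b :: tmb  ("\<^bold>1") where "\<^bold>1 = cst One"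
definition plus_b :: "tmb \<Rightarrow> tmb \<Rightarrow> tmb"  (infixl "\<^bold>+" 65) where "s \<^bold>+ t = cst Plus \<cdot> s \<cdot> t"
definition times_b :: "tmb \<Rightarrow> tmb \<Rightarrow> tmb"  (infixl "\<^bold>*" 70) where "s \<^bold>* t = cst Times \<cdot> s \<cdot> t"

definition eq_b :: "tmb \<Rightarrow> tmb \<Rightarrow> fmb"  (infix "\<^bold>=" 50) where "s \<^bold>= t = (\<lambda>d. Eq (s d) (t d))"
definition less_b :: "tmb \<Rightarrow> tmb \<Rightarrow> fmb"  (infix "\<^bold><" 50) where "s \<^bold>< t = (\<lambda>d. Less (s d) (t d))"
definition imp_b :: "fmb \<Rightarrow> fmb \<Rightarrow> fmb"  (infixr "\<^bold>\<longrightarrow>" 25) where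
  "(A \<^bold>\<longrightarrow> B) = (\<lambda>d. Imp (A d) (B d))"
definition not_b :: "fmb \<Rightarrow> fmb"  ("\<^bold>\<not> _" [40] 40) where "(\<^bold>\<not> A) = (\<lambda>d. Neg (A d))"
definition or_b :: "fmb \<Rightarrow> fmb \<Rightarrow> fmb"  (infixr "\<^bold>\<or>" 30) where "(A \<^bold>\<or> B) = (\<^bold>\<not> A \<^bold>\<longrightarrow> B)"
definition and_b :: "fmb \<Rightarrow> fmb \<Rightarrow> fmb"  (infixr "\<^bold>\<and>" 35) where "(A \<^bold>\<and> B) = (\<^bold>\<not> (A \<^bold>\<longrightarrow> \<^bold>\<not> B))"
definition iff_b :: "fmb \<Rightarrow> fmb \<Rightarrow> fmb"  (infixr "\<^bold>\<longleftrightarrow>" 25) where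
  "(A \<^bold>\<longleftrightarrow> B) = ((A \<^bold>\<longrightarrow> B) \<^bold>\<and> (B \<^bold>\<longrightarrow> A))"
definition le_b :: "tmb \<Rightarrow> tmb \<Rightarrow> fmb"  (infix "\<^bold>\<le>" 50) where "s \<^bold>\<le> t = (s \<^bold>< t \<^bold>\<or> s \<^bold>= t)"

definition all_b :: "ty \<Rightarrow> (tmb \<Rightarrow> fmb) \<Rightarrow> fmb" where
  "all_b \<tau> A = (\<lambda>d. Forall \<tau> (A (\<lambda>e. Var (e - Suc d)) (Suc d)))"
definition ex_b :: "ty \<Rightarrow> (tmb \<Rightarrow> fmb) \<Rightarrow> fmb" where
  "ex_b \<tau> A = (\<lambda>d. Exists \<tau> (A (\<lambda>e. Var (e - Suc d)) (Suc d)))"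

definition all_nat :: "(tmb \<Rightarrow> fmb) \<Rightarrow> fmb"  (binder "\<^bold>\<forall>\<^sub>N" 10) where "all_nat = all_b T0"
definition ex_nat :: "(tmb \<Rightarrow> fmb) \<Rightarrow> fmb"  (binder "\<^bold>\<exists>\<^sub>N" 10) where "ex_nat = ex_b T0"

primrec eq_at_type :: "ty \<Rightarrow> tmb \<Rightarrow> tmb \<Rightarrow> fmb" where
  "eq_at_type T0 = (\<lambda>s t. s \<^bold>= t)"
| "eq_at_type (\<rho> \<rightarrow> \<tau>) = (\<lambda>s t. all_b \<rho> (\<lambda>x. eq_at_type \<tau> (s \<cdot> x) (t \<cdot> x)))"


section \<open>The theories RCA and ACA at all finite types\<close>

definition semiring_axioms :: "fm set" where
  "semiring_axioms = (\<lambda>A. A 0) ` {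
     \<^bold>\<forall>\<^sub>N x. \<^bold>\<forall>\<^sub>N y. \<^bold>\<forall>\<^sub>N z. (x \<^bold>+ y) \<^bold>+ z \<^bold>= x \<^bold>+ (y \<^bold>+ z),
     \<^bold>\<forall>\<^sub>N x. \<^bold>\<forall>\<^sub>N y. x \<^bold>+ y \<^bold>= y \<^bold>+ x,
     \<^bold>\<forall>\<^sub>N x. x \<^bold>+ \<^bold>0 \<^bold>= x,
     \<^bold>\<forall>\<^sub>N x. \<^bold>\<forall>\<^sub>N y. \<^bold>\<forall>\<^sub>N z. (x \<^bold>* y) \<^bold>* z \<^bold>= x \<^bold>* (y \<^bold>* z),
     \<^bold>\<forall>\<^sub>N x. \<^bold>\<forall>\<^sub>N y. x \<^bold>* y \<^bold>= y \<^bold>* x,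
     \<^bold>\<forall>\<^sub>N x. x \<^bold>* \<^bold>1 \<^bold>= x,
     \<^bold>\<forall>\<^sub>N x. x \<^bold>* \<^bold>0 \<^bold>= \<^bold>0,
     \<^bold>\<forall>\<^sub>N x. \<^bold>\<forall>\<^sub>N y. \<^bold>\<forall>\<^sub>N z. x \<^bold>* (y \<^bold>+ z) \<^bold>= x \<^bold>* y \<^bold>+ x \<^bold>* z,
     \<^bold>\<forall>\<^sub>N x. \<^bold>\<not> x \<^bold>< x,
     \<^bold>\<forall>\<^sub>N x. \<^bold>\<forall>\<^sub>N y. \<^bold>\<forall>\<^sub>N z. x \<^bold>< y \<^bold>\<and> y \<^bold>< z \<^bold>\<longrightarrow> x \<^bold>< z,
     \<^bold>\<forall>\<^sub>N x. \<^bold>\<forall>\<^sub>N y. x \<^bold>< y \<^bold>\<or> x \<^bold>= y \<^bold>\<or> y \<^bold>< x,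
     \<^bold>\<forall>\<^sub>N x. \<^bold>\<forall>\<^sub>N y. \<^bold>\<forall>\<^sub>N z. x \<^bold>< y \<^bold>\<longrightarrow> x \<^bold>+ z \<^bold>< y \<^bold>+ z,
     \<^bold>\<forall>\<^sub>N x. \<^bold>\<forall>\<^sub>N y. \<^bold>\<forall>\<^sub>N z. x \<^bold>< y \<^bold>\<and> \<^bold>0 \<^bold>< z \<^bold>\<longrightarrow> x \<^bold>* z \<^bold>< y \<^bold>* z,
     \<^bold>0 \<^bold>< \<^bold>1,
     \<^bold>\<forall>\<^sub>N x. \<^bold>0 \<^bold>\<le> x}"

definition K_axiom :: "ty \<Rightarrow> ty \<Rightarrow> fm" where
  "K_axiom \<rho> \<tau> = all_b \<rho> (\<lambda>x. all_b \<tau> (\<lambda>y. eq_at_type \<rho> (cst (CombK \<rho> \<tau>) \<cdot> x \<cdot> y) x)) 0"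

definition S_axiom :: "ty \<Rightarrow> ty \<Rightarrow> ty \<Rightarrow> fm" where
  "S_axiom \<delta> \<rho> \<tau> =
     all_b (\<delta> \<rightarrow> \<rho> \<rightarrow> \<tau>) (\<lambda>x. all_b (\<delta> \<rightarrow> \<rho>) (\<lambda>y. all_b \<delta> (\<lambda>z.
       eq_at_type \<tau> (cst (CombS \<delta> \<rho> \<tau>) \<cdot> x \<cdot> y \<cdot> z) (x \<cdot> z \<cdot> (y \<cdot> z))))) 0"

definition rec_axioms :: "fm set" where
  "rec_axioms = {
     all_b (T0 \<rightarrow> T0 \<rightarrow> T0) (\<lambda>f. \<^bold>\<forall>\<^sub>N m. cst Rec0 \<cdot> f \<cdot> m \<cdot> \<^bold>0 \<^bold>= m) 0,
     all_b (T0 \<rightarrow> T0 \<rightarrow> T0) (\<lambda>f. \<^bold>\<forall>\<^sub>N m. \<^bold>\<forall>\<^sub>N n.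
       cst Rec0 \<cdot> f \<cdot> m \<cdot> (n \<^bold>+ \<^bold>1) \<^bold>= f \<cdot> n \<cdot> (cst Rec0 \<cdot> f \<cdot> m \<cdot> n)) 0}"

definition ext_axiom :: "ty \<Rightarrow> ty \<Rightarrow> fm" where
  "ext_axiom \<rho> \<tau> =
     all_b (\<rho> \<rightarrow> \<tau>) (\<lambda>F. all_b \<rho> (\<lambda>x. all_b \<rho> (\<lambda>y.
       eq_at_type \<rho> x y \<^bold>\<longrightarrow> eq_at_type \<tau> (F \<cdot> x) (F \<cdot> y)))) 0"

primrec close :: "ty list \<Rightarrow> fm \<Rightarrow> fm" where
  "close [] A = A"
| "close (\<tau> # \<Delta>) A = close \<Delta> (Forall \<tau> A)"

text \<open>In \<open>induction_axiom \<Delta> A\<close> the induction variable is \<open>Var 0\<close>; \<open>\<Delta>\<close> types the parameters.\<close>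

definition induction_axiom :: "ty list \<Rightarrow> fm \<Rightarrow> fm" where
  "induction_axiom \<Delta> A = close \<Delta>
     (Imp (inst (Cst Zero) A)
       (Imp (Forall T0 (Imp A
               (sub_fm (case_nat (App (App (Cst Plus) (Var 0)) (Cst One)) (\<lambda>i. Var (Suc i))) A)))
         (Forall T0 A)))"

text \<open>In \<open>choice_axiom \<sigma> \<tau> \<Delta> A\<close> the variable \<open>y\<close> of type \<open>\<tau>\<close> is \<open>Var 0\<close> and \<open>x\<close> of type \<open>\<sigma>\<close> is
  \<open>Var 1\<close>. Under the quantifiers over \<open>Y\<close> and \<open>x\<close> they become \<open>Y x = App (Var 1) (Var 0)\<close> and
  \<open>Var 0\<close>, and the parameters keep their indices.\<close>

definition choice_axiom :: "ty \<Rightarrow> ty \<Rightarrow> ty list \<Rightarrow> fm \<Rightarrow> fm" where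
  "choice_axiom \<sigma> \<tau> \<Delta> A = close \<Delta>
     (Imp (Forall \<sigma> (Exists \<tau> A))
       (Exists (\<sigma> \<rightarrow> \<tau>) (Forall \<sigma>
         (sub_fm (case_nat (App (Var 1) (Var 0)) (case_nat (Var 0) (\<lambda>i. Var (i + 2)))) A))))"

definition RCA0w :: "fm set" where
  "RCA0w =
     semiring_axioms
     \<union> {K_axiom \<rho> \<tau> | \<rho> \<tau>. True}
     \<union> {S_axiom \<delta> \<rho> \<tau> | \<delta> \<rho> \<tau>. True}
     \<union> rec_axioms
     \<union> {ext_axiom \<rho> \<tau> | \<rho> \<tau>. True}
     \<union> {induction_axiom \<Delta> A | \<Delta> A. wff (T0 # \<Delta>) A \<and> quantifier_free A}
     \<union> {choice_axiom T1 T0 \<Delta> A | \<Delta> A. wff (T0 # T1 # \<Delta>) A \<and> quantifier_free A}"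

definition exists2_axiom :: fm where
  "exists2_axiom = ex_b (T1 \<rightarrow> T0) (\<lambda>\<phi>. all_b T1 (\<lambda>f.
     (\<phi> \<cdot> f \<^bold>= \<^bold>0 \<^bold>\<or> \<phi> \<cdot> f \<^bold>= \<^bold>1) \<^bold>\<and> (\<phi> \<cdot> f \<^bold>= \<^bold>0 \<^bold>\<longleftrightarrow> (\<^bold>\<exists>\<^sub>N n. f \<cdot> n \<^bold>= \<^bold>0)))) 0"

definition ACA0w :: "fm set" where "ACA0w = insert exists2_axiom RCA0w"


section \<open>Rationals and reals\<close>

text \<open>\<open>2\<close> to the power \<open>k\<close>, as \<open>Rec0 (\<lambda>n v. v + v) 1 k\<close>; here \<open>CombS Plus (CombS CombK CombK)\<close> is
  \<open>\<lambda>v. v + v\<close>.\<close>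

definition two_pow :: "tmb \<Rightarrow> tmb" where
  "two_pow k =
     cst Rec0 \<cdot>
       (cst (CombK T1 T0) \<cdot>
         (cst (CombS T0 T0 T0) \<cdot> cst Plus \<cdot>
           (cst (CombS T0 T1 T0) \<cdot> cst (CombK T0 T1) \<cdot> cst (CombK T0 T0))))
       \<cdot> \<^bold>1 \<cdot> k"

text \<open>Cantor pairing \<open>p = (a + b) (a + b + 1) / 2 + a\<close> is a bijection, so every number \<open>q\<close> is the
  code of the rational \<open>(a - b) / (c + 1)\<close> for exactly one triple \<open>a, b, c\<close>.\<close>

definition pair_code :: "tmb \<Rightarrow> tmb \<Rightarrow> tmb \<Rightarrow> fmb" where
  "pair_code p a b = (p \<^bold>+ p \<^bold>= (a \<^bold>+ b) \<^bold>* (a \<^bold>+ b \<^bold>+ \<^bold>1) \<^bold>+ (a \<^bold>+ a))"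

definition rat_code :: "tmb \<Rightarrow> tmb \<Rightarrow> tmb \<Rightarrow> tmb \<Rightarrow> fmb" where
  "rat_code q a b c = (\<^bold>\<exists>\<^sub>N p. pair_code p b c \<^bold>\<and> pair_code q a p)"

definition lessQ :: "tmb \<Rightarrow> tmb \<Rightarrow> fmb"  (infix "<\<^sub>Q" 50) where
  "q <\<^sub>Q r = (\<^bold>\<exists>\<^sub>N a. \<^bold>\<exists>\<^sub>N b. \<^bold>\<exists>\<^sub>N c. \<^bold>\<exists>\<^sub>N a'. \<^bold>\<exists>\<^sub>N b'. \<^bold>\<exists>\<^sub>N c'.
     rat_code q a b c \<^bold>\<and> rat_code r a' b' c' \<^bold>\<and>
     a \<^bold>* (c' \<^bold>+ \<^bold>1) \<^bold>+ b' \<^bold>* (c \<^bold>+ \<^bold>1) \<^bold>< a' \<^bold>* (c \<^bold>+ \<^bold>1) \<^bold>+ b \<^bold>* (c' \<^bold>+ \<^bold>1))"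

text \<open>\<open>sumQ q r s\<close> says \<open>q + r = s\<close>, and \<open>dyadicQ q m k\<close> says \<open>q = m / 2 ^ k\<close>, as rationals.\<close>

definition sumQ :: "tmb \<Rightarrow> tmb \<Rightarrow> tmb \<Rightarrow> fmb" where
  "sumQ q r s = (\<^bold>\<exists>\<^sub>N a. \<^bold>\<exists>\<^sub>N b. \<^bold>\<exists>\<^sub>N c. \<^bold>\<exists>\<^sub>N a'. \<^bold>\<exists>\<^sub>N b'. \<^bold>\<exists>\<^sub>N c'. \<^bold>\<exists>\<^sub>N a''. \<^bold>\<exists>\<^sub>N b''. \<^bold>\<exists>\<^sub>N c''.
     rat_code q a b c \<^bold>\<and> rat_code r a' b' c' \<^bold>\<and> rat_code s a'' b'' c'' \<^bold>\<and>
     (a \<^bold>* (c' \<^bold>+ \<^bold>1) \<^bold>+ a' \<^bold>* (c \<^bold>+ \<^bold>1)) \<^bold>* (c'' \<^bold>+ \<^bold>1) \<^bold>+ b'' \<^bold>* ((c \<^bold>+ \<^bold>1) \<^bold>* (c' \<^bold>+ \<^bold>1)) \<^bold>=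
     (b \<^bold>* (c' \<^bold>+ \<^bold>1) \<^bold>+ b' \<^bold>* (c \<^bold>+ \<^bold>1)) \<^bold>* (c'' \<^bold>+ \<^bold>1) \<^bold>+ a'' \<^bold>* ((c \<^bold>+ \<^bold>1) \<^bold>* (c' \<^bold>+ \<^bold>1)))"

definition dyadicQ :: "tmb \<Rightarrow> tmb \<Rightarrow> tmb \<Rightarrow> fmb" where
  "dyadicQ q m k = (\<^bold>\<exists>\<^sub>N a. \<^bold>\<exists>\<^sub>N b. \<^bold>\<exists>\<^sub>N c.
     rat_code q a b c \<^bold>\<and> a \<^bold>* two_pow k \<^bold>= b \<^bold>* two_pow k \<^bold>+ m \<^bold>* (c \<^bold>+ \<^bold>1))"

text \<open>\<open>q < r + m / 2 ^ k\<close> and \<open>\<bar>q - r\<bar> < 1 / 2 ^ k\<close>.\<close>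

definition less_plusQ :: "tmb \<Rightarrow> tmb \<Rightarrow> tmb \<Rightarrow> tmb \<Rightarrow> fmb" where
  "less_plusQ q r m k = (\<^bold>\<exists>\<^sub>N e. \<^bold>\<exists>\<^sub>N s. dyadicQ e m k \<^bold>\<and> sumQ r e s \<^bold>\<and> q <\<^sub>Q s)"

definition closeQ :: "tmb \<Rightarrow> tmb \<Rightarrow> tmb \<Rightarrow> fmb" where
  "closeQ q r k = (less_plusQ q r \<^bold>1 k \<^bold>\<and> less_plusQ r q \<^bold>1 k)"

definition is_real :: "tmb \<Rightarrow> fmb" where
  "is_real x = (\<^bold>\<forall>\<^sub>N n. \<^bold>\<forall>\<^sub>N i. closeQ (x \<cdot> n) (x \<cdot> (n \<^bold>+ i)) n)"

text \<open>\<open>x < y\<close> iff \<open>x n + 2 / 2 ^ n < y n\<close> for some \<open>n\<close>; consequently \<open>x = y\<close> iff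
  \<open>\<bar>x n - y n\<bar> \<le> 2 / 2 ^ n\<close> for all \<open>n\<close>.\<close>

definition lessR :: "tmb \<Rightarrow> tmb \<Rightarrow> fmb"  (infix "<\<^sub>R" 50) where
  "x <\<^sub>R y = (\<^bold>\<exists>\<^sub>N n. \<^bold>\<exists>\<^sub>N e. \<^bold>\<exists>\<^sub>N s.
     dyadicQ e (\<^bold>1 \<^bold>+ \<^bold>1) n \<^bold>\<and> sumQ (x \<cdot> n) e s \<^bold>\<and> s <\<^sub>Q y \<cdot> n)"

definition leR :: "tmb \<Rightarrow> tmb \<Rightarrow> fmb"  (infix "\<le>\<^sub>R" 50) where "x \<le>\<^sub>R y = (\<^bold>\<not> y <\<^sub>R x)"
definition eqR :: "tmb \<Rightarrow> tmb \<Rightarrow> fmb"  (infix "=\<^sub>R" 50) where "x =\<^sub>R y = (x \<le>\<^sub>R y \<^bold>\<and> y \<le>\<^sub>R x)"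

definition all_real :: "(tmb \<Rightarrow> fmb) \<Rightarrow> fmb"  (binder "\<^bold>\<forall>\<^sub>R" 10) where
  "all_real A = all_b T1 (\<lambda>x. is_real x \<^bold>\<longrightarrow> A x)"
definition ex_real :: "(tmb \<Rightarrow> fmb) \<Rightarrow> fmb"  (binder "\<^bold>\<exists>\<^sub>R" 10) where
  "ex_real A = ex_b T1 (\<lambda>x. is_real x \<^bold>\<and> A x)"

text \<open>\<open>sumR x y z\<close> says \<open>x + y = z\<close>: the rationals \<open>(x n + y n) - z n\<close> tend to 0. The
  definitions after it express \<open>x < y + z\<close>, \<open>x \<le> y + z\<close> and \<open>\<bar>x - y\<bar> < e\<close>.\<close>

definition sumR :: "tmb \<Rightarrow> tmb \<Rightarrow> tmb \<Rightarrow> fmb" where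
  "sumR x y z = (\<^bold>\<forall>\<^sub>N k. \<^bold>\<exists>\<^sub>N m. \<^bold>\<forall>\<^sub>N n. m \<^bold>\<le> n \<^bold>\<longrightarrow>
     (\<^bold>\<exists>\<^sub>N s. sumQ (x \<cdot> n) (y \<cdot> n) s \<^bold>\<and> closeQ s (z \<cdot> n) k))"

definition less_plusR :: "tmb \<Rightarrow> tmb \<Rightarrow> tmb \<Rightarrow> fmb" where
  "less_plusR x y z = (\<^bold>\<exists>\<^sub>R s. sumR y z s \<^bold>\<and> x <\<^sub>R s)"
definition le_plusR :: "tmb \<Rightarrow> tmb \<Rightarrow> tmb \<Rightarrow> fmb" where
  "le_plusR x y z = (\<^bold>\<exists>\<^sub>R s. sumR y z s \<^bold>\<and> x \<le>\<^sub>R s)"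
definition distR_less :: "tmb \<Rightarrow> tmb \<Rightarrow> tmb \<Rightarrow> fmb" where
  "distR_less x y e = (less_plusR x y e \<^bold>\<and> less_plusR y x e)"

text \<open>A rational as a real: the constant sequence.\<close>

definition ratR :: "tmb \<Rightarrow> tmb" where "ratR q = cst (CombK T0 T0) \<cdot> q"

definition positiveR :: "tmb \<Rightarrow> fmb" where
  "positiveR x = (\<^bold>\<exists>\<^sub>N q. dyadicQ q \<^bold>0 \<^bold>0 \<^bold>\<and> ratR q <\<^sub>R x)"

definition in_unit :: "tmb \<Rightarrow> fmb" where
  "in_unit x = (is_real x \<^bold>\<and>
     (\<^bold>\<exists>\<^sub>N q. \<^bold>\<exists>\<^sub>N r. dyadicQ q \<^bold>0 \<^bold>0 \<^bold>\<and> dyadicQ r \<^bold>1 \<^bold>0 \<^bold>\<and> ratR q \<le>\<^sub>R x \<^bold>\<and> x \<le>\<^sub>R ratR r))"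

definition all_pos :: "(tmb \<Rightarrow> fmb) \<Rightarrow> fmb"  (binder "\<^bold>\<forall>\<^sub>+" 10) where
  "all_pos A = (\<^bold>\<forall>\<^sub>R e. positiveR e \<^bold>\<longrightarrow> A e)"
definition ex_pos :: "(tmb \<Rightarrow> fmb) \<Rightarrow> fmb"  (binder "\<^bold>\<exists>\<^sub>+" 10) where
  "ex_pos A = (\<^bold>\<exists>\<^sub>R e. positiveR e \<^bold>\<and> A e)"
definition all_unit :: "(tmb \<Rightarrow> fmb) \<Rightarrow> fmb"  (binder "\<^bold>\<forall>\<^sub>I" 10) where
  "all_unit A = all_b T1 (\<lambda>x. in_unit x \<^bold>\<longrightarrow> A x)"
definition ex_unit :: "(tmb \<Rightarrow> fmb) \<Rightarrow> fmb"  (binder "\<^bold>\<exists>\<^sub>I" 10) where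
  "ex_unit A = ex_b T1 (\<lambda>x. in_unit x \<^bold>\<and> A x)"

text \<open>\<open>y\<close> lies in \<open>B(x, 2 ^ (-k))\<close>.\<close>

definition in_ball :: "tmb \<Rightarrow> tmb \<Rightarrow> tmb \<Rightarrow> fmb" where
  "in_ball y x k = (\<^bold>\<exists>\<^sub>N q. dyadicQ q \<^bold>1 k \<^bold>\<and> distR_less x y (ratR q))"


section \<open>Functions on the unit interval\<close>

text \<open>A function on \<open>[0,1]\<close> is a type \<open>1 \<rightarrow> 1\<close> object whose values outside \<open>[0,1]\<close> are irrelevant;
  likewise for characteristic functions of subsets of \<open>[0,1]\<close> below.\<close>

definition is_function :: "tmb \<Rightarrow> fmb" where
  "is_function f = (\<^bold>\<forall>\<^sub>I x. is_real (f \<cdot> x) \<^bold>\<and> (\<^bold>\<forall>\<^sub>I y. x =\<^sub>R y \<^bold>\<longrightarrow> f \<cdot> x =\<^sub>R f \<cdot> y))"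

definition all_function :: "(tmb \<Rightarrow> fmb) \<Rightarrow> fmb"  (binder "\<^bold>\<forall>\<^sub>F" 10) where
  "all_function A = all_b (T1 \<rightarrow> T1) (\<lambda>f. is_function f \<^bold>\<longrightarrow> A f)"

definition cont_at :: "tmb \<Rightarrow> tmb \<Rightarrow> fmb" where
  "cont_at f x = (\<^bold>\<forall>\<^sub>+ e. \<^bold>\<exists>\<^sub>+ d. \<^bold>\<forall>\<^sub>I y. distR_less x y d \<^bold>\<longrightarrow> distR_less (f \<cdot> x) (f \<cdot> y) e)"

text \<open>\<open>limsup f(y) \<le> f(x)\<close> as \<open>y \<rightarrow> x\<close>, and dually. Allowing \<open>y = x\<close> adds nothing.\<close>

definition usc_at :: "tmb \<Rightarrow> tmb \<Rightarrow> fmb" where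
  "usc_at f x = (\<^bold>\<forall>\<^sub>+ e. \<^bold>\<exists>\<^sub>+ d. \<^bold>\<forall>\<^sub>I y. distR_less x y d \<^bold>\<longrightarrow> less_plusR (f \<cdot> y) (f \<cdot> x) e)"
definition lsc_at :: "tmb \<Rightarrow> tmb \<Rightarrow> fmb" where
  "lsc_at f x = (\<^bold>\<forall>\<^sub>+ e. \<^bold>\<exists>\<^sub>+ d. \<^bold>\<forall>\<^sub>I y. distR_less x y d \<^bold>\<longrightarrow> less_plusR (f \<cdot> x) (f \<cdot> y) e)"

definition usc :: "tmb \<Rightarrow> fmb" where "usc f = (\<^bold>\<forall>\<^sub>I x. usc_at f x)"

text \<open>At the end-points of \<open>[0,1]\<close> the limit from outside is vacuous.\<close>

definition left_limit :: "tmb \<Rightarrow> tmb \<Rightarrow> tmb \<Rightarrow> fmb" where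
  "left_limit f x l = (\<^bold>\<forall>\<^sub>+ e. \<^bold>\<exists>\<^sub>+ d. \<^bold>\<forall>\<^sub>I y.
     y <\<^sub>R x \<^bold>\<and> distR_less x y d \<^bold>\<longrightarrow> distR_less (f \<cdot> y) l e)"
definition right_limit :: "tmb \<Rightarrow> tmb \<Rightarrow> tmb \<Rightarrow> fmb" where
  "right_limit f x l = (\<^bold>\<forall>\<^sub>+ e. \<^bold>\<exists>\<^sub>+ d. \<^bold>\<forall>\<^sub>I y.
     x <\<^sub>R y \<^bold>\<and> distR_less x y d \<^bold>\<longrightarrow> distR_less (f \<cdot> y) l e)"

definition regulated_at :: "tmb \<Rightarrow> tmb \<Rightarrow> fmb" where
  "regulated_at f x = ((\<^bold>\<exists>\<^sub>R l. left_limit f x l) \<^bold>\<and> (\<^bold>\<exists>\<^sub>R r. right_limit f x r))"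
definition cadlag_at :: "tmb \<Rightarrow> tmb \<Rightarrow> fmb" where
  "cadlag_at f x = (right_limit f x (f \<cdot> x) \<^bold>\<and> (\<^bold>\<exists>\<^sub>R l. left_limit f x l))"


section \<open>Sets\<close>

text \<open>A set is given by its characteristic function \<open>X\<close>, mapping (terms for) reals to (terms for)
  numbers, so that the sections \<open>\<lambda>x. E \<cdot> x \<cdot> n\<close> of a sequence of sets \<open>E\<close> are sets as well.\<close>

definition mem :: "tmb \<Rightarrow> (tmb \<Rightarrow> tmb) \<Rightarrow> fmb" where "mem x X = (X x \<^bold>= \<^bold>1)"

definition is_set :: "(tmb \<Rightarrow> tmb) \<Rightarrow> fmb" where
  "is_set X = (\<^bold>\<forall>\<^sub>I x. (X x \<^bold>= \<^bold>0 \<^bold>\<or> X x \<^bold>= \<^bold>1) \<^bold>\<and> (\<^bold>\<forall>\<^sub>I y. x =\<^sub>R y \<^bold>\<longrightarrow> X x \<^bold>= X y))"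

definition is_open :: "(tmb \<Rightarrow> tmb) \<Rightarrow> fmb" where
  "is_open X = (is_set X \<^bold>\<and>
     (\<^bold>\<forall>\<^sub>I x. mem x X \<^bold>\<longrightarrow> (\<^bold>\<exists>\<^sub>N k. \<^bold>\<forall>\<^sub>I y. in_ball y x k \<^bold>\<longrightarrow> mem y X)))"

definition all_open :: "((tmb \<Rightarrow> tmb) \<Rightarrow> fmb) \<Rightarrow> fmb"  (binder "\<^bold>\<forall>\<^sub>O" 10) where
  "all_open A = all_b (T1 \<rightarrow> T0) (\<lambda>X. is_open (app X) \<^bold>\<longrightarrow> A (app X))"
definition ex_open :: "((tmb \<Rightarrow> tmb) \<Rightarrow> fmb) \<Rightarrow> fmb"  (binder "\<^bold>\<exists>\<^sub>O" 10) where
  "ex_open A = ex_b (T1 \<rightarrow> T0) (\<lambda>X. is_open (app X) \<^bold>\<and> A (app X))"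

definition dense_set :: "(tmb \<Rightarrow> tmb) \<Rightarrow> fmb" where
  "dense_set X = (\<^bold>\<forall>\<^sub>I x. \<^bold>\<forall>\<^sub>N k. \<^bold>\<exists>\<^sub>I y. in_ball y x k \<^bold>\<and> mem y X)"

definition section_set :: "tmb \<Rightarrow> tmb \<Rightarrow> tmb \<Rightarrow> tmb" where
  "section_set E n = (\<lambda>x. E \<cdot> x \<cdot> n)"

text \<open>Measure zero for the class \<open>{x \<in> [0,1]. A x}\<close>, which need not exist as a set. The intervals are
  \<open>(a n, b n)\<close>, \<open>s\<close> is the sequence of partial sums of their lengths, and \<open>\<Sum>\<^sub>n (b n - a n) < e\<close> is
  expressed by an upper bound \<open>r < e\<close> of \<open>s\<close>.\<close>

definition measure_zero :: "(tmb \<Rightarrow> fmb) \<Rightarrow> fmb" where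
  "measure_zero A = (\<^bold>\<forall>\<^sub>+ e. ex_b (T0 \<rightarrow> T1) (\<lambda>a. ex_b (T0 \<rightarrow> T1) (\<lambda>b.
     (\<^bold>\<forall>\<^sub>N n. is_real (a \<cdot> n) \<^bold>\<and> is_real (b \<cdot> n) \<^bold>\<and> a \<cdot> n <\<^sub>R b \<cdot> n) \<^bold>\<and>
     (\<^bold>\<forall>\<^sub>I x. A x \<^bold>\<longrightarrow> (\<^bold>\<exists>\<^sub>N n. a \<cdot> n <\<^sub>R x \<^bold>\<and> x <\<^sub>R b \<cdot> n)) \<^bold>\<and>
     ex_b (T0 \<rightarrow> T1) (\<lambda>s.
       (\<^bold>\<forall>\<^sub>N n. is_real (s \<cdot> n)) \<^bold>\<and>
       (\<^bold>\<exists>\<^sub>N q. dyadicQ q \<^bold>0 \<^bold>0 \<^bold>\<and> s \<cdot> \<^bold>0 =\<^sub>R ratR q) \<^bold>\<and>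
       (\<^bold>\<forall>\<^sub>N n. \<^bold>\<exists>\<^sub>R l. sumR (a \<cdot> n) l (b \<cdot> n) \<^bold>\<and> sumR (s \<cdot> n) l (s \<cdot> (n \<^bold>+ \<^bold>1))) \<^bold>\<and>
       (\<^bold>\<exists>\<^sub>R r. r <\<^sub>R e \<^bold>\<and> (\<^bold>\<forall>\<^sub>N n. s \<cdot> n \<le>\<^sub>R r))))))"


section \<open>Further properties of functions\<close>

definition quasi_cont_at :: "tmb \<Rightarrow> tmb \<Rightarrow> fmb" where
  "quasi_cont_at f x = (\<^bold>\<forall>\<^sub>+ e. \<^bold>\<forall>\<^sub>O U. mem x U \<^bold>\<longrightarrow>
     (\<^bold>\<exists>\<^sub>O G. (\<^bold>\<exists>\<^sub>I z. mem z G) \<^bold>\<and> (\<^bold>\<forall>\<^sub>I z. mem z G \<^bold>\<longrightarrow> mem z U) \<^bold>\<and>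
       (\<^bold>\<forall>\<^sub>I z. mem z G \<^bold>\<longrightarrow> distR_less (f \<cdot> x) (f \<cdot> z) e)))"

definition lower_quasi_cont_at :: "tmb \<Rightarrow> tmb \<Rightarrow> fmb" where
  "lower_quasi_cont_at f x = (\<^bold>\<forall>\<^sub>+ e. \<^bold>\<forall>\<^sub>O U. mem x U \<^bold>\<longrightarrow>
     (\<^bold>\<exists>\<^sub>O G. (\<^bold>\<exists>\<^sub>I z. mem z G) \<^bold>\<and> (\<^bold>\<forall>\<^sub>I z. mem z G \<^bold>\<longrightarrow> mem z U) \<^bold>\<and>
       (\<^bold>\<forall>\<^sub>I z. mem z G \<^bold>\<longrightarrow> less_plusR (f \<cdot> x) (f \<cdot> z) e)))"

definition converges :: "(tmb \<Rightarrow> tmb) \<Rightarrow> tmb \<Rightarrow> fmb" where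
  "converges u l = (\<^bold>\<forall>\<^sub>+ e. \<^bold>\<exists>\<^sub>N m. \<^bold>\<forall>\<^sub>N n. m \<^bold>\<le> n \<^bold>\<longrightarrow> distR_less (u n) l e)"

definition left_cluster :: "tmb \<Rightarrow> tmb \<Rightarrow> tmb \<Rightarrow> fmb" where
  "left_cluster f x y = ex_b (T0 \<rightarrow> T1) (\<lambda>u.
     (\<^bold>\<forall>\<^sub>N n. in_unit (u \<cdot> n) \<^bold>\<and> u \<cdot> n \<le>\<^sub>R x) \<^bold>\<and>
     converges (\<lambda>n. u \<cdot> n) x \<^bold>\<and> converges (\<lambda>n. f \<cdot> (u \<cdot> n)) y)"
definition right_cluster :: "tmb \<Rightarrow> tmb \<Rightarrow> tmb \<Rightarrow> fmb" where
  "right_cluster f x y = ex_b (T0 \<rightarrow> T1) (\<lambda>u.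
     (\<^bold>\<forall>\<^sub>N n. in_unit (u \<cdot> n) \<^bold>\<and> x \<le>\<^sub>R u \<cdot> n) \<^bold>\<and>
     converges (\<lambda>n. u \<cdot> n) x \<^bold>\<and> converges (\<lambda>n. f \<cdot> (u \<cdot> n)) y)"

definition strictly_between :: "tmb \<Rightarrow> tmb \<Rightarrow> tmb \<Rightarrow> fmb" where
  "strictly_between z a b = ((a <\<^sub>R z \<^bold>\<and> z <\<^sub>R b) \<^bold>\<or> (b <\<^sub>R z \<^bold>\<and> z <\<^sub>R a))"

definition Darboux_at :: "tmb \<Rightarrow> tmb \<Rightarrow> fmb" where
  "Darboux_at f x = (\<^bold>\<forall>\<^sub>+ d. \<^bold>\<forall>\<^sub>R y. \<^bold>\<forall>\<^sub>R z. strictly_between z y (f \<cdot> x) \<^bold>\<longrightarrow>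
     (left_cluster f x y \<^bold>\<longrightarrow> (\<^bold>\<exists>\<^sub>I w. w <\<^sub>R x \<^bold>\<and> distR_less x w d \<^bold>\<and> f \<cdot> w =\<^sub>R z)) \<^bold>\<and>
     (right_cluster f x y \<^bold>\<longrightarrow> (\<^bold>\<exists>\<^sub>I w. x <\<^sub>R w \<^bold>\<and> distR_less x w d \<^bold>\<and> f \<cdot> w =\<^sub>R z)))"

definition countably_cont :: "tmb \<Rightarrow> fmb" where
  "countably_cont f = ex_b (T1 \<rightarrow> T0 \<rightarrow> T0) (\<lambda>E.
     (\<^bold>\<forall>\<^sub>N n. is_set (section_set E n)) \<^bold>\<and>
     (\<^bold>\<forall>\<^sub>I x. \<^bold>\<exists>\<^sub>N n. mem x (section_set E n)) \<^bold>\<and>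
     (\<^bold>\<forall>\<^sub>N n. \<^bold>\<forall>\<^sub>I x. mem x (section_set E n) \<^bold>\<longrightarrow>
       (\<^bold>\<forall>\<^sub>+ e. \<^bold>\<exists>\<^sub>+ d. \<^bold>\<forall>\<^sub>I y. mem y (section_set E n) \<^bold>\<and> distR_less x y d \<^bold>\<longrightarrow>
          distR_less (f \<cdot> x) (f \<cdot> y) e)))"

text \<open>The oscillation of \<open>f\<close> on \<open>B(x, 2 ^ (-k))\<close>, relative to \<open>[0,1]\<close>, is at most \<open>r + e\<close> and greater
  than \<open>r - e\<close>. Suprema and infima need not exist: \<open>sup f - inf f\<close> is bounded above by \<open>c\<close> iff all
  differences \<open>f(y) - f(z)\<close> are, and exceeds \<open>c\<close> iff some difference does.\<close>

definition osc_ball_near :: "tmb \<Rightarrow> tmb \<Rightarrow> tmb \<Rightarrow> tmb \<Rightarrow> tmb \<Rightarrow> fmb" where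
  "osc_ball_near f x k r e =
     ((\<^bold>\<forall>\<^sub>I y. \<^bold>\<forall>\<^sub>I z. in_ball y x k \<^bold>\<and> in_ball z x k \<^bold>\<longrightarrow>
        (\<^bold>\<exists>\<^sub>R c. sumR r e c \<^bold>\<and> le_plusR (f \<cdot> y) (f \<cdot> z) c)) \<^bold>\<and>
      (\<^bold>\<exists>\<^sub>I y. \<^bold>\<exists>\<^sub>I z. in_ball y x k \<^bold>\<and> in_ball z x k \<^bold>\<and>
        (\<^bold>\<exists>\<^sub>R v. \<^bold>\<exists>\<^sub>R w. sumR (f \<cdot> z) r v \<^bold>\<and> sumR (f \<cdot> y) e w \<^bold>\<and> v <\<^sub>R w)))"

definition is_osc_function :: "tmb \<Rightarrow> tmb \<Rightarrow> fmb" where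
  "is_osc_function g f = (is_function g \<^bold>\<and>
     (\<^bold>\<forall>\<^sub>I x. \<^bold>\<forall>\<^sub>+ e. \<^bold>\<exists>\<^sub>N m. \<^bold>\<forall>\<^sub>N k. m \<^bold>\<le> k \<^bold>\<longrightarrow> osc_ball_near f x k (g \<cdot> x) e))"

definition usc_C_null :: "tmb \<Rightarrow> fmb" where
  "usc_C_null f = (usc f \<^bold>\<and> measure_zero (cont_at f))"


section \<open>The statements\<close>

definition BCT_for :: "(tmb \<Rightarrow> fmb) \<Rightarrow> fm" where
  "BCT_for H = all_b (T1 \<rightarrow> T0 \<rightarrow> T0) (\<lambda>E.
     (\<^bold>\<forall>\<^sub>N n. is_open (section_set E n) \<^bold>\<and> dense_set (section_set E n) \<^bold>\<and>
        (\<^bold>\<forall>\<^sub>I x. mem x (section_set E (n \<^bold>+ \<^bold>1)) \<^bold>\<longrightarrow> mem x (section_set E n))) \<^bold>\<and>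
     H E \<^bold>\<longrightarrow>
     (\<^bold>\<exists>\<^sub>I x. \<^bold>\<forall>\<^sub>N n. mem x (section_set E n))) 0"

definition BCT :: fm where
  "BCT = BCT_for (\<lambda>E. \<^bold>0 \<^bold>= \<^bold>0)"

definition BCT_null :: fm where
  "BCT_null = BCT_for (\<lambda>E. measure_zero (\<lambda>x. \<^bold>\<forall>\<^sub>N n. mem x (section_set E n)))"

text \<open>In the items below \<open>H\<close> stands for upper semi-continuity (possibly with a further restriction)
  and \<open>P\<close> for the property of \<open>f\<close> at a point claimed in the conclusion.\<close>

definition item_b :: "(tmb \<Rightarrow> fmb) \<Rightarrow> (tmb \<Rightarrow> tmb \<Rightarrow> fmb) \<Rightarrow> fm" where
  "item_b H P = (\<^bold>\<forall>\<^sub>F f. H f \<^bold>\<longrightarrow> (\<^bold>\<exists>\<^sub>I x. P f x)) 0"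

definition item_c :: "(tmb \<Rightarrow> fmb) \<Rightarrow> (tmb \<Rightarrow> tmb \<Rightarrow> fmb) \<Rightarrow> fm" where
  "item_c H P = (\<^bold>\<forall>\<^sub>F f. H f \<^bold>\<and> ex_b (T1 \<rightarrow> T1) (\<lambda>g. is_osc_function g f) \<^bold>\<longrightarrow> (\<^bold>\<exists>\<^sub>I x. P f x)) 0"

definition item_d :: "(tmb \<Rightarrow> fmb) \<Rightarrow> (tmb \<Rightarrow> tmb \<Rightarrow> fmb) \<Rightarrow> fm" where
  "item_d H P = (\<^bold>\<forall>\<^sub>F f. H f \<^bold>\<and> is_osc_function f f \<^bold>\<longrightarrow> (\<^bold>\<exists>\<^sub>I x. P f x)) 0"

definition item_e :: "(tmb \<Rightarrow> fmb) \<Rightarrow> fm" where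
  "item_e H = (\<^bold>\<forall>\<^sub>F f. H f \<^bold>\<and> countably_cont f \<^bold>\<longrightarrow> (\<^bold>\<exists>\<^sub>I x. cont_at f x)) 0"

definition item_f :: "(tmb \<Rightarrow> fmb) \<Rightarrow> fm" where
  "item_f H = (\<^bold>\<forall>\<^sub>F f. H f \<^bold>\<longrightarrow>
     (\<^bold>\<exists>\<^sub>N q. \<^bold>\<exists>\<^sub>I c. \<^bold>\<exists>\<^sub>I d. c <\<^sub>R d \<^bold>\<and>
       (\<^bold>\<forall>\<^sub>I y. c <\<^sub>R y \<^bold>\<and> y <\<^sub>R d \<^bold>\<longrightarrow> ratR q \<le>\<^sub>R f \<cdot> y))) 0"

text \<open>\<open>0 < inf\<close> of \<open>f\<close> over \<open>[c,d]\<close> says that \<open>f\<close> has a positive lower bound there.\<close>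

definition item_g :: "(tmb \<Rightarrow> fmb) \<Rightarrow> fm" where
  "item_g H = (\<^bold>\<forall>\<^sub>F f. H f \<^bold>\<and> (\<^bold>\<forall>\<^sub>I x. positiveR (f \<cdot> x)) \<^bold>\<longrightarrow>
     (\<^bold>\<exists>\<^sub>I c. \<^bold>\<exists>\<^sub>I d. c <\<^sub>R d \<^bold>\<and>
       (\<^bold>\<exists>\<^sub>+ e. \<^bold>\<forall>\<^sub>I y. c \<le>\<^sub>R y \<^bold>\<and> y \<le>\<^sub>R d \<^bold>\<longrightarrow> e \<le>\<^sub>R f \<cdot> y))) 0"

definition proves_equivalent :: "fm set \<Rightarrow> fm set \<Rightarrow> bool" where
  "proves_equivalent T \<Phi> \<longleftrightarrow> (\<forall>A\<in>\<Phi>. \<forall>B\<in>\<Phi>. T \<turnstile> Imp A B)"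

end

theory Submission
  imports Defs "HOL-Library.Countable" Complex_Main "HOL-Computational_Algebra.Fraction_Field"
begin

text \<open>By completeness of the calculus, an unprovable implication between two of the statements fails in an
  extensional Henkin model of ACA. So it suffices to show that in every model, whose natural numbers and reals
  may be nonstandard, the statements are all true or all false.

  If the category theorem holds in the model and \<open>f\<close> is upper semi-continuous, then a point in the intersection
  of suitable dense open sets \<open>O\<^sub>n\<close>, defined from the values of \<open>f\<close> at rationals, is a point of continuity.
  Conversely let \<open>E\<^sub>n\<close> be decreasing dense open sets with empty intersection, and let \<open>n(x)\<close> be the least \<open>n\<close> with
  \<open>x \<notin> E\<^sub>n\<close>. The function \<open>1 / 2 ^ n(x)\<close> is positive and upper semi-continuous, it is its own oscillation function and
  constant on the sets \<open>{x. n(x) = n}\<close>, but arbitrarily close to 0 on every interval; \<open>- n(x)\<close> is unbounded below on every interval.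
  To exclude one-sided limits, the sets \<open>E\<^sub>n\<close> are first pulled back along the map which deletes every other binary
  digit, so that every point is a limit of points at which the function is bounded away from 0.\<close>

section \<open>Completeness of the calculus\<close>

text \<open>No derivation is ever written out: the calculus enters only through completeness. The
  price is that the numbers of a model may be nonstandard, so induction, least elements and
  recursion are available only for predicates given by terms with parameters. Every auxiliary set,
  function and sequence is therefore shown definable; this is the purpose of \<open>deft\<close>,
  \<open>defn\<close>, \<open>defp\<close> and \<open>defr\<close>. The functional of the axiom for
  arithmetical comprehension turns quantifiers over numbers into terms, but not quantifiers over
  reals. The restrictions to measure zero come for free: where the category theorem fails, the
  intersection is empty and the counterexamples have no point of continuity at all. The map deleting
  digits may jump at reals with two expansions. It is therefore used in two versions, one for each
  choice of expansion, and a point is kept only if both of its images lie in E_n; this restores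
  openness. Flipping a deleted digit moves a point slightly without changing its image, so the
  points outside one fixed pulled-back set accumulate everywhere, which spoils one-sided
  limits.\<close>

lemma sub_tm_comp: "sub_tm \<tau> (sub_tm \<sigma> t) = sub_tm (\<lambda>i. sub_tm \<tau> (\<sigma> i)) t"
  by (induct t) auto

lemma up_comp: "(\<lambda>i. sub_tm (up \<tau>) (up \<sigma> i)) = up (\<lambda>i. sub_tm \<tau> (\<sigma> i))"
  by (rule ext) (simp add: up_def sub_tm_comp split: nat.split)

lemma sub_fm_comp: "sub_fm \<tau> (sub_fm \<sigma> A) = sub_fm (\<lambda>i. sub_tm \<tau> (\<sigma> i)) A"
  by (induct A arbitrary: \<sigma> \<tau>) (simp_all add: sub_tm_comp up_comp)

lemma sub_tm_Var [simp]: "sub_tm Var t = t"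
  by (induct t) auto

lemma up_Var [simp]: "up Var = Var"
  by (rule ext) (simp add: up_def split: nat.split)

lemma sub_fm_Var [simp]: "sub_fm Var A = A"
  by (induct A) simp_all

lemma sub_fm_Neg [simp]: "sub_fm \<sigma> (Neg A) = Neg (sub_fm \<sigma> A)"
  by (simp add: Neg_def)

lemma wff_Neg [simp]: "wff \<Delta> (Neg A) \<longleftrightarrow> wff \<Delta> A"
  by (simp add: Neg_def)

lemma inst_sub: "inst (sub_tm \<sigma> t) (sub_fm (up \<sigma>) A) = sub_fm \<sigma> (inst t A)"
proof -
  have "sub_tm (case_nat (sub_tm \<sigma> t) Var) (up \<sigma> i) = sub_tm \<sigma> (case_nat t Var i)" for i
    by (cases i) (simp_all add: up_def sub_tm_comp)
  then show ?thesis by (simp add: inst_def sub_fm_comp)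
qed

lemma lift_sub: "lift (sub_fm \<sigma> A) = sub_fm (up \<sigma>) (lift A)"
  by (simp add: lift_def sub_fm_comp up_def)

section \<open>Typed substitutions and their effect on derivations\<close>

definition typed_sub :: "ty list \<Rightarrow> (nat \<Rightarrow> tm) \<Rightarrow> ty list \<Rightarrow> bool" where
  "typed_sub \<Delta>' \<sigma> \<Delta> \<longleftrightarrow> (\<forall>i<length \<Delta>. has_type \<Delta>' (\<sigma> i) (\<Delta> ! i))"

inductive_cases has_type_VarE: "has_type \<Delta> (Var i) \<tau>"
inductive_cases has_type_CstE: "has_type \<Delta> (Cst c) \<tau>"
inductive_cases has_type_AppE: "has_type \<Delta> (App s t) \<tau>"

lemma has_type_Var: "has_type \<Delta> (Var i) \<tau> \<longleftrightarrow> i < length \<Delta> \<and> \<tau> = \<Delta> ! i"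
  by (auto intro: has_type.intros elim: has_type_VarE)

lemma has_type_Cst: "has_type \<Delta> (Cst c) \<tau> \<longleftrightarrow> \<tau> = cst_type c"
  by (auto intro: has_type.intros elim: has_type_CstE)

lemma has_type_App: "has_type \<Delta> (App s t) \<tau> \<longleftrightarrow> (\<exists>\<rho>. has_type \<Delta> s (\<rho> \<rightarrow> \<tau>) \<and> has_type \<Delta> t \<rho>)"
  by (auto intro: has_type.intros elim: has_type_AppE)

lemmas has_type_simps = has_type_Var has_type_Cst has_type_App

lemma has_type_unique: "has_type \<Delta> t \<tau> \<Longrightarrow> has_type \<Delta> t \<tau>' \<Longrightarrow> \<tau> = \<tau>'"
  by (induct t arbitrary: \<tau> \<tau>') (auto simp: has_type_simps)

lemma sub_tm_type: "has_type \<Delta> t \<tau> \<Longrightarrow> typed_sub \<Delta>' \<sigma> \<Delta> \<Longrightarrow> has_type \<Delta>' (sub_tm \<sigma> t) \<tau>"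
  by (induct t arbitrary: \<tau>) (auto simp: has_type_simps typed_sub_def)

lemma typed_sub_up: "typed_sub \<Delta>' \<sigma> \<Delta> \<Longrightarrow> typed_sub (\<tau> # \<Delta>') (up \<sigma>) (\<tau> # \<Delta>)"
proof -
  have w: "typed_sub (\<tau> # \<Delta>') (\<lambda>j. Var (Suc j)) \<Delta>'"
    by (simp add: typed_sub_def has_type_simps)
  assume "typed_sub \<Delta>' \<sigma> \<Delta>"
  then show ?thesis
    unfolding typed_sub_def up_def
    by (auto simp: nth_Cons has_type_simps split: nat.splits intro: sub_tm_type [OF _ w])
qed

lemma sub_fm_wff: "wff \<Delta> A \<Longrightarrow> typed_sub \<Delta>' \<sigma> \<Delta> \<Longrightarrow> wff \<Delta>' (sub_fm \<sigma> A)"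
  by (induct A arbitrary: \<Delta> \<Delta>' \<sigma>) (auto intro: sub_tm_type typed_sub_up)

lemma sub_tm_cong: "has_type \<Delta> t \<tau> \<Longrightarrow> (\<And>i. i < length \<Delta> \<Longrightarrow> \<sigma> i = \<sigma>' i) \<Longrightarrow> sub_tm \<sigma> t = sub_tm \<sigma>' t"
  by (induct t arbitrary: \<tau>) (auto simp: has_type_simps)

lemma sub_fm_cong: "wff \<Delta> A \<Longrightarrow> (\<And>i. i < length \<Delta> \<Longrightarrow> \<sigma> i = \<sigma>' i) \<Longrightarrow> sub_fm \<sigma> A = sub_fm \<sigma>' A"
proof (induct A arbitrary: \<Delta> \<sigma> \<sigma>')
  case (Forall \<tau> A)
  have "up \<sigma> i = up \<sigma>' i" if "i < length (\<tau> # \<Delta>)" for i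
    using that Forall.prems(2) by (auto simp: up_def split: nat.split)
  with Forall show ?case by (metis sub_fm.simps(5) wff.simps(5))
next
  case (Imp A B)
  then show ?case by (metis sub_fm.simps(4) wff.simps(4))
qed (simp_all, (meson sub_tm_cong)+)

lemma sub_fm_closed: "wff [] A \<Longrightarrow> sub_fm \<sigma> A = A"
  using sub_fm_cong [of "[]" A \<sigma> Var] by simp

lemma typed_sub_inst: "has_type \<Delta> t \<tau> \<Longrightarrow> typed_sub \<Delta> (case_nat t Var) (\<tau> # \<Delta>)"
  by (auto simp: typed_sub_def nth_Cons has_type_simps split: nat.split)

lemma inst_wff: "wff (\<tau> # \<Delta>) A \<Longrightarrow> has_type \<Delta> t \<tau> \<Longrightarrow> wff \<Delta> (inst t A)"
  unfolding inst_def by (erule sub_fm_wff) (rule typed_sub_inst)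

text \<open>Closed axioms are fixed by substitution, and \<open>lift\<close> and \<open>inst\<close>
  commute with it, so derivations can be transformed rule by rule. This serves both for enlarging
  contexts and for renaming a Henkin witness into a bound variable.\<close>

lemma deriv_sub:
  assumes "deriv T \<Delta> H A" "\<forall>B\<in>T. wff [] B"
  shows "typed_sub \<Delta>' \<sigma> \<Delta> \<Longrightarrow> deriv T \<Delta>' (map (sub_fm \<sigma>) H) (sub_fm \<sigma> A)"
  using assms(1)
proof (induct arbitrary: \<Delta>' \<sigma>)
  case (Axm A \<Delta> H) then show ?case
    using assms(2) by (auto intro: deriv.Axm simp: sub_fm_closed)
next
  case (Hyp A H \<Delta>) then show ?case by (auto intro!: deriv.Hyp intro: sub_fm_wff)
next
  case (ImpI \<Delta> A H B) then show ?case by (auto intro!: deriv.ImpI intro: sub_fm_wff)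
next
  case (ImpE \<Delta> H A B) then show ?case by (auto intro: deriv.ImpE [of _ _ _ "sub_fm \<sigma> A"])
next
  case (Classical \<Delta> A H) 
  have "deriv T \<Delta>' (Neg (sub_fm \<sigma> A) # map (sub_fm \<sigma>) H) Fls"
    using Classical.hyps(3) [OF Classical.prems] by simp
  with sub_fm_wff [OF Classical.hyps(1) Classical.prems] show ?case by (rule deriv.Classical)
next
  case (AllI \<tau> \<Delta> H A)
  have "map (sub_fm (up \<sigma>)) (map lift H) = map lift (map (sub_fm \<sigma>) H)"
    by (simp add: lift_sub)
  with AllI(2) [OF typed_sub_up [OF AllI(3)]]
  have "deriv T (\<tau> # \<Delta>') (map lift (map (sub_fm \<sigma>) H)) (sub_fm (up \<sigma>) A)"
    by metis
  then show ?case unfolding sub_fm.simps by (rule deriv.AllI)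
next
  case (AllE \<Delta> H \<tau> A t)
  then have "deriv T \<Delta>' (map (sub_fm \<sigma>) H) (inst (sub_tm \<sigma> t) (sub_fm (up \<sigma>) A))"
    by (auto intro: deriv.AllE sub_tm_type)
  then show ?case by (simp add: inst_sub)
next
  case (EqI \<Delta> t H) then show ?case by (auto intro: deriv.EqI sub_tm_type)
next
  case (EqE \<Delta> H s t A)
  have "deriv T \<Delta>' (map (sub_fm \<sigma>) H) (inst (sub_tm \<sigma> t) (sub_fm (up \<sigma>) A))"
  proof (rule deriv.EqE)
    show "deriv T \<Delta>' (map (sub_fm \<sigma>) H) (Eq (sub_tm \<sigma> s) (sub_tm \<sigma> t))" using EqE by auto
    show "deriv T \<Delta>' (map (sub_fm \<sigma>) H) (inst (sub_tm \<sigma> s) (sub_fm (up \<sigma>) A))"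
      using EqE by (auto simp: inst_sub)
  qed (use EqE in \<open>auto intro: sub_tm_type sub_fm_wff typed_sub_up\<close>)
  then show ?case by (simp add: inst_sub)
qed

lemma deriv_mono: "deriv T \<Delta> H A \<Longrightarrow> set H \<subseteq> set H' \<Longrightarrow> deriv T \<Delta> H' A"
proof (induct arbitrary: H' rule: deriv.induct)
  case (ImpI \<Delta> A H B)
  have "set (A # H) \<subseteq> set (A # H')" using ImpI by auto
  with ImpI show ?case by (metis deriv.ImpI)
next
  case (Classical \<Delta> A H)
  have "set (Neg A # H) \<subseteq> set (Neg A # H')" using Classical by auto
  with Classical show ?case by (metis deriv.Classical)
next
  case (AllI \<tau> \<Delta> H A)
  have "set (map lift H) \<subseteq> set (map lift H')" using AllI by auto
  with AllI show ?case by (metis deriv.AllI)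
qed (auto intro: deriv.intros)

text \<open>Contexts grow at the end, so the identity substitution is typed from the old context
  into the new one and no index is renumbered.\<close>

lemma deriv_weaken:
  assumes "deriv T \<Delta> H A" "\<forall>B\<in>T. wff [] B" "set H \<subseteq> set H'"
  shows "deriv T (\<Delta> @ \<Delta>') H' A"
proof -
  have "typed_sub (\<Delta> @ \<Delta>') Var \<Delta>"
    by (auto simp: typed_sub_def has_type_simps nth_append)
  from deriv_sub [OF assms(1,2) this] have "deriv T (\<Delta> @ \<Delta>') H A"
    by (simp cong: map_cong)
  with assms(3) show ?thesis by (blast intro: deriv_mono)
qed

section \<open>Maximal consistent theories with witnesses\<close>

instance ty :: countable by countable_datatype
instance cst :: countable by countable_datatype
instance tm :: countable by countable_datatype
instance fm :: countable by countable_datatype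

text \<open>A stage pairs a context, whose variables act as Henkin constants, with the finite list
  of formulas accepted so far.\<close>

definition consistent :: "fm set \<Rightarrow> ty list \<times> fm list \<Rightarrow> bool" where
  "consistent T S \<longleftrightarrow> \<not> deriv T (fst S) (snd S) Fls"

text \<open>The witness variable is appended at the end of the context, so its index is
  \<open>length \<Delta>\<close> and the formulas accepted earlier keep their meaning.\<close>

fun refute_step :: "ty list \<Rightarrow> fm list \<Rightarrow> fm \<Rightarrow> ty list \<times> fm list" where
  "refute_step \<Delta> H (Forall \<tau> B) =
     (\<Delta> @ [\<tau>], Neg (inst (Var (length \<Delta>)) B) # Neg (Forall \<tau> B) # H)"
| "refute_step \<Delta> H A = (\<Delta>, Neg A # H)"

definition henkin_step :: "fm set \<Rightarrow> ty list \<times> fm list \<Rightarrow> fm \<Rightarrow> ty list \<times> fm list" where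
  "henkin_step T S A =
     (if \<not> wff (fst S) A then S
      else if consistent T (fst S, A # snd S) then (fst S, A # snd S)
      else refute_step (fst S) (snd S) A)"

text \<open>Only the first component of the decoded pair is used, so every formula comes up at
  arbitrarily late stages, in particular after all of its variables have been declared.\<close>

primrec stage :: "fm set \<Rightarrow> fm \<Rightarrow> nat \<Rightarrow> ty list \<times> fm list" where
  "stage T A\<^sub>0 0 = ([], [Neg A\<^sub>0])"
| "stage T A\<^sub>0 (Suc n) = henkin_step T (stage T A\<^sub>0 n) (from_nat (fst (prod_decode n)))"

lemma refute_step_ext: "\<exists>\<Theta> G. refute_step \<Delta> H A = (\<Delta> @ \<Theta>, G @ Neg A # H)"
  by (cases A) auto

lemma henkin_step_ext: "\<exists>\<Theta> G. henkin_step T S A = (fst S @ \<Theta>, G @ snd S)"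
proof -
  obtain \<Theta> G where "refute_step (fst S) (snd S) A = (fst S @ \<Theta>, G @ Neg A # snd S)"
    using refute_step_ext by blast
  then have r: "refute_step (fst S) (snd S) A = (fst S @ \<Theta>, (G @ [Neg A]) @ snd S)" by simp
  consider "henkin_step T S A = (fst S @ [], [] @ snd S)" | "henkin_step T S A = (fst S @ [], [A] @ snd S)"
    | "henkin_step T S A = refute_step (fst S) (snd S) A"
    by (force simp: henkin_step_def split: if_splits)
  then show ?thesis by cases (metis r)+
qed

lemma stage_mono: "m \<le> n \<Longrightarrow> \<exists>\<Theta> G. stage T A\<^sub>0 n = (fst (stage T A\<^sub>0 m) @ \<Theta>, G @ snd (stage T A\<^sub>0 m))"
proof (induct n rule: dec_induct)
  case base show ?case by (rule exI [of _ "[]"], rule exI [of _ "[]"]) simp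
next
  case (step n)
  then obtain \<Theta> G where a: "stage T A\<^sub>0 n = (fst (stage T A\<^sub>0 m) @ \<Theta>, G @ snd (stage T A\<^sub>0 m))"
    by blast
  obtain \<Theta>' G' where "stage T A\<^sub>0 (Suc n) = (fst (stage T A\<^sub>0 n) @ \<Theta>', G' @ snd (stage T A\<^sub>0 n))"
    using henkin_step_ext by (metis stage.simps(2))
  with a show ?case
    by (intro exI [of _ "\<Theta> @ \<Theta>'"] exI [of _ "G' @ G"]) simp
qed

locale henkin =
  fixes T :: "fm set" and A\<^sub>0 :: fm
  assumes T_closed: "\<And>B. B \<in> T \<Longrightarrow> wff [] B"
    and A0_closed: "wff [] A\<^sub>0"
    and unprovable: "\<not> deriv T [] [] A\<^sub>0"
begin

abbreviation "ctx n \<equiv> fst (stage T A\<^sub>0 n)"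
abbreviation "hyps n \<equiv> snd (stage T A\<^sub>0 n)"

definition \<Gamma> :: "fm set" where "\<Gamma> = (\<Union>n. set (hyps n))"
definition typd :: "tm \<Rightarrow> ty \<Rightarrow> bool" where "typd t \<tau> \<longleftrightarrow> (\<exists>n. has_type (ctx n) t \<tau>)"
definition wfm :: "fm \<Rightarrow> bool" where "wfm A \<longleftrightarrow> (\<exists>n. wff (ctx n) A)"

text \<open>Inconsistency of \<open>A\<close> yields \<open>Neg A\<close> by \<open>ImpI\<close>;
  inconsistency of \<open>Neg A\<close> would yield \<open>A\<close> by \<open>Classical\<close>.
  Together they would refute the hypotheses themselves.\<close>

lemma consistent_refute:
  assumes "wff \<Delta> A" "consistent T (\<Delta>, H)" "\<not> consistent T (\<Delta>, A # H)"
  shows "consistent T (\<Delta>, Neg A # H)"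
proof -
  from assms have "deriv T \<Delta> H (Neg A)"
    by (auto simp: consistent_def Neg_def intro: deriv.ImpI)
  moreover have "deriv T \<Delta> H A" if "deriv T \<Delta> (Neg A # H) Fls"
    using assms(1) that by (rule Classical)
  ultimately show ?thesis
    using assms(2) unfolding consistent_def Neg_def fst_conv snd_conv by (blast intro: ImpE)
qed

text \<open>The fresh variable occurs in no hypothesis, so a refutation of the negated instance
  generalises to a proof of the universal formula.\<close>

lemma consistent_witness:
  assumes wf: "wff \<Delta> (Forall \<tau> B)" "\<forall>C\<in>set H. wff \<Delta> C" and con: "consistent T (\<Delta>, Neg (Forall \<tau> B) # H)"
  shows "consistent T (\<Delta> @ [\<tau>], Neg (inst (Var (length \<Delta>)) B) # Neg (Forall \<tau> B) # H)"
proof (rule ccontr)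
  let ?H = "Neg (Forall \<tau> B) # H"
  \<comment> \<open>Moves the witness, the last variable of the context, to index 0, where
    \<open>AllI\<close> binds it, and shifts the others; on formulas over \<open>\<Delta>\<close> it
    coincides with \<open>lift\<close>.\<close>
  let ?r = "\<lambda>i. if i = length \<Delta> then Var 0 else Var (Suc i)"
  assume "\<not> ?thesis"
  then have d: "deriv T (\<Delta> @ [\<tau>]) (Neg (inst (Var (length \<Delta>)) B) # ?H) Fls"
    by (simp add: consistent_def)
  have r: "typed_sub (\<tau> # \<Delta>) ?r (\<Delta> @ [\<tau>])"
    by (auto simp: typed_sub_def has_type_simps nth_append)
  have 1: "sub_fm ?r C = lift C" if "wff \<Delta> C" for C
    unfolding lift_def using that by (rule sub_fm_cong) simp
  then have 2: "map (sub_fm ?r) ?H = map lift ?H"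
    using wf 1 [of "Neg (Forall \<tau> B)"] by (auto simp del: wff.simps sub_fm_Neg sub_fm.simps)
  have 3: "sub_fm ?r (inst (Var (length \<Delta>)) B) = B"
  proof -
    have "sub_fm ?r (inst (Var (length \<Delta>)) B) = sub_fm Var B"
      unfolding inst_def sub_fm_comp
    proof (rule sub_fm_cong)
      show "wff (\<tau> # \<Delta>) B" using wf by simp
    qed (auto split: nat.split)
    then show ?thesis by simp
  qed
  have "deriv T (\<tau> # \<Delta>) (map (sub_fm ?r) (Neg (inst (Var (length \<Delta>)) B) # ?H)) (sub_fm ?r Fls)"
    using deriv_sub [OF d _ r] T_closed by blast
  moreover have "map (sub_fm ?r) (Neg (inst (Var (length \<Delta>)) B) # G) = Neg B # map (sub_fm ?r) G" for G
    using 3 by simp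
  ultimately have "deriv T (\<tau> # \<Delta>) (Neg B # map lift ?H) Fls"
    by (simp only: sub_fm.simps(1) 2)
  then have "deriv T (\<tau> # \<Delta>) (map lift ?H) B"
    using wf by - (rule Classical, simp_all)
  then have "deriv T \<Delta> ?H (Forall \<tau> B)"
    by (rule AllI)
  moreover have "deriv T \<Delta> ?H (Imp (Forall \<tau> B) Fls)"
    using wf by (intro Hyp) (auto simp: Neg_def)
  ultimately show False using con ImpE unfolding consistent_def fst_conv snd_conv by blast
qed

lemma stage_invariant: "consistent T (stage T A\<^sub>0 n) \<and> (\<forall>C\<in>set (hyps n). wff (ctx n) C)"
proof (induct n)
  case 0
  have "consistent T ([], [Neg A\<^sub>0])"
    using unprovable Classical [OF A0_closed] by (auto simp: consistent_def)
  then show ?case using A0_closed by simp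
next
  case (Suc n)
  let ?A = "from_nat (fst (prod_decode n)) :: fm"
  have ext: "wff (\<Delta> @ [\<tau>]) C" if "wff \<Delta> C" for \<Delta> \<tau> C
    using sub_fm_wff [OF that, of "\<Delta> @ [\<tau>]" Var] by (simp add: typed_sub_def has_type_simps nth_append)
  consider "stage T A\<^sub>0 (Suc n) = stage T A\<^sub>0 n"
    | "wff (ctx n) ?A" "consistent T (ctx n, ?A # hyps n)" "stage T A\<^sub>0 (Suc n) = (ctx n, ?A # hyps n)"
    | "wff (ctx n) ?A" "\<not> consistent T (ctx n, ?A # hyps n)"
      "stage T A\<^sub>0 (Suc n) = refute_step (ctx n) (hyps n) ?A"
    by (force simp: henkin_step_def split: if_splits)
  then show ?case
  proof cases
    case 3
    then have c: "consistent T (ctx n, Neg ?A # hyps n)"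
      using Suc consistent_refute by auto
    show ?thesis
    proof (cases "\<exists>\<tau> B. ?A = Forall \<tau> B")
      case True
      then obtain \<tau> B where A: "?A = Forall \<tau> B" by blast
      have "typed_sub (\<tau> # ctx n @ [\<tau>]) Var (\<tau> # ctx n)"
        by (auto simp: typed_sub_def has_type_simps nth_Cons nth_append split: nat.splits)
      then have w0: "wff (\<tau> # ctx n @ [\<tau>]) B"
        using 3(1) sub_fm_wff [of "\<tau> # ctx n" B _ Var] by (simp add: A)
      then have w: "wff (ctx n @ [\<tau>]) (inst (Var (length (ctx n))) B)"
        by (rule inst_wff) (simp add: has_type_simps)
      show ?thesis
        using 3 c A Suc w w0 consistent_witness [of "ctx n" \<tau> B "hyps n"] by (auto intro: ext)
    next
      case False
      then have "refute_step (ctx n) (hyps n) ?A = (ctx n, Neg ?A # hyps n)"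
        by (cases ?A) auto
      with 3 c Suc show ?thesis by auto
    qed
  qed (use Suc in auto)
qed

lemma ctx_mono: "m \<le> n \<Longrightarrow> \<exists>\<Theta>. ctx n = ctx m @ \<Theta>"
  using stage_mono [of m n T A\<^sub>0] by auto

lemma hyps_mono: "m \<le> n \<Longrightarrow> set (hyps m) \<subseteq> set (hyps n)"
  using stage_mono [of m n T A\<^sub>0] by auto

lemma typed_sub_ctx: "m \<le> n \<Longrightarrow> typed_sub (ctx n) Var (ctx m)"
  using ctx_mono [of m n] by (auto simp: typed_sub_def has_type_simps nth_append)

lemma has_type_mono: "m \<le> n \<Longrightarrow> has_type (ctx m) t \<tau> \<Longrightarrow> has_type (ctx n) t \<tau>"
  using sub_tm_type [of "ctx m" t \<tau> "ctx n" Var] typed_sub_ctx by simp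

lemma wff_mono: "m \<le> n \<Longrightarrow> wff (ctx m) A \<Longrightarrow> wff (ctx n) A"
  using sub_fm_wff [of "ctx m" A "ctx n" Var] typed_sub_ctx by simp

lemma deriv_stage_mono: "m \<le> n \<Longrightarrow> deriv T (ctx m) (hyps m) A \<Longrightarrow> deriv T (ctx n) (hyps n) A"
  using ctx_mono [of m n] hyps_mono [of m n] T_closed deriv_weaken by metis

lemma decided:
  assumes "wff (ctx n) A"
  shows "\<exists>m\<ge>n. A \<in> set (hyps m) \<or>
    (Neg A \<in> set (hyps m) \<and> (\<forall>\<tau> B. A = Forall \<tau> B \<longrightarrow> (\<exists>c. has_type (ctx m) c \<tau> \<and> Neg (inst c B) \<in> set (hyps m))))"
proof -
  \<comment> \<open>At this stage the formula \<open>A\<close> is examined, and \<open>k\<close> is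
    at least \<open>n\<close>, so that \<open>A\<close> is well-formed there.\<close>
  define k where "k = prod_encode (to_nat A, n)"
  have k: "n \<le> k" by (simp add: k_def le_prod_encode_2)
  have w: "wff (ctx k) A" using wff_mono [OF k assms] .
  have "stage T A\<^sub>0 (Suc k) = henkin_step T (stage T A\<^sub>0 k) A" by (simp add: k_def)
  then have "stage T A\<^sub>0 (Suc k) = (ctx k, A # hyps k) \<or> stage T A\<^sub>0 (Suc k) = refute_step (ctx k) (hyps k) A"
    using w by (auto simp: henkin_step_def)
  then have "A \<in> set (hyps (Suc k)) \<or>
    (Neg A \<in> set (hyps (Suc k)) \<and> (\<forall>\<tau> B. A = Forall \<tau> B \<longrightarrow>
       (\<exists>c. has_type (ctx (Suc k)) c \<tau> \<and> Neg (inst c B) \<in> set (hyps (Suc k)))))"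
  proof
    assume r: "stage T A\<^sub>0 (Suc k) = refute_step (ctx k) (hyps k) A"
    show ?thesis
    proof (cases "\<exists>\<tau> B. A = Forall \<tau> B")
      case True
      then obtain \<tau> B where A: "A = Forall \<tau> B" by blast
      have "has_type (ctx k @ [\<tau>]) (Var (length (ctx k))) \<tau>" by (simp add: has_type_simps)
      then show ?thesis unfolding r by (auto simp: A)
    next
      case False
      obtain \<Theta> G where "refute_step (ctx k) (hyps k) A = (ctx k @ \<Theta>, G @ Neg A # hyps k)"
        using refute_step_ext by blast
      with False show ?thesis unfolding r by auto
    qed
  qed auto
  with k show ?thesis by (meson le_SucI)
qed

lemma deriv_of_hyp: "A \<in> set (hyps n) \<Longrightarrow> deriv T (ctx n) (hyps n) A"
  using stage_invariant by (auto intro: Hyp)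

lemma not_both: "A \<in> \<Gamma> \<Longrightarrow> Neg A \<in> \<Gamma> \<Longrightarrow> False"
proof -
  assume "A \<in> \<Gamma>" "Neg A \<in> \<Gamma>"
  then obtain m n where "A \<in> set (hyps m)" "Neg A \<in> set (hyps n)" by (auto simp: \<Gamma>_def)
  then have "A \<in> set (hyps (max m n))" "Neg A \<in> set (hyps (max m n))"
    using hyps_mono [of m "max m n"] hyps_mono [of n "max m n"] by auto
  then have "deriv T (ctx (max m n)) (hyps (max m n)) Fls"
    by (intro ImpE [of _ _ _ A Fls]) (auto dest!: deriv_of_hyp simp: Neg_def)
  then show False using stage_invariant by (auto simp: consistent_def)
qed

text \<open>Otherwise \<open>Neg A\<close> would be accepted at a later stage, which still derives
  \<open>A\<close> and would be inconsistent.\<close>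

lemma in_\<Gamma>_of_deriv: "deriv T (ctx n) (hyps n) A \<Longrightarrow> wff (ctx n) A \<Longrightarrow> A \<in> \<Gamma>"
proof (rule ccontr)
  assume d: "deriv T (ctx n) (hyps n) A" and w: "wff (ctx n) A" and "A \<notin> \<Gamma>"
  then obtain m where m: "m \<ge> n" "Neg A \<in> set (hyps m)"
    using decided [OF w] by (auto simp: \<Gamma>_def)
  then have "deriv T (ctx m) (hyps m) Fls"
    using deriv_stage_mono [OF m(1) d] deriv_of_hyp [OF m(2)] by (auto simp: Neg_def intro: ImpE [of _ _ _ A])
  then show False using stage_invariant by (auto simp: consistent_def)
qed

lemma not_in_\<Gamma>: "wfm A \<Longrightarrow> A \<notin> \<Gamma> \<Longrightarrow> Neg A \<in> \<Gamma>"
proof -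
  assume "wfm A" "A \<notin> \<Gamma>"
  then obtain n where "wff (ctx n) A" by (auto simp: wfm_def)
  from decided [OF this] \<open>A \<notin> \<Gamma>\<close> show ?thesis by (auto simp: \<Gamma>_def)
qed

lemma stage_of: "A \<in> \<Gamma> \<Longrightarrow> \<exists>n\<ge>m. A \<in> set (hyps n)"
proof -
  assume "A \<in> \<Gamma>"
  then obtain n where "A \<in> set (hyps n)" by (auto simp: \<Gamma>_def)
  then have "A \<in> set (hyps (max m n))" using hyps_mono [of n "max m n"] by auto
  then show ?thesis by (intro exI [of _ "max m n"]) simp
qed

lemma Fls_notin: "Fls \<notin> \<Gamma>"
  using stage_invariant deriv_of_hyp by (auto simp: consistent_def \<Gamma>_def)

lemma Imp_in: assumes "wfm A" "wfm B" shows "Imp A B \<in> \<Gamma> \<longleftrightarrow> (A \<in> \<Gamma> \<longrightarrow> B \<in> \<Gamma>)"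
proof
  assume ab: "Imp A B \<in> \<Gamma>"
  show "A \<in> \<Gamma> \<longrightarrow> B \<in> \<Gamma>"
  proof
    assume "A \<in> \<Gamma>"
    then obtain m where m: "A \<in> set (hyps m)" by (auto simp: \<Gamma>_def)
    obtain n where n: "n \<ge> m" "Imp A B \<in> set (hyps n)" using stage_of [OF ab] by blast
    have "deriv T (ctx n) (hyps n) B"
      using n m hyps_mono [OF n(1)] by (intro ImpE [of _ _ _ A B] deriv_of_hyp) auto
    moreover have "wff (ctx n) B" using n stage_invariant by fastforce
    ultimately show "B \<in> \<Gamma>" by (rule in_\<Gamma>_of_deriv)
  qed
next
  assume imp: "A \<in> \<Gamma> \<longrightarrow> B \<in> \<Gamma>"
  obtain a b where "wff (ctx a) A" "wff (ctx b) B" using assms by (auto simp: wfm_def)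
  define k where "k = max a b"
  have w: "wff (ctx k) A" "wff (ctx k) B"
    using \<open>wff (ctx a) A\<close> \<open>wff (ctx b) B\<close> wff_mono [of a k] wff_mono [of b k] by (auto simp: k_def)
  show "Imp A B \<in> \<Gamma>"
  proof (cases "B \<in> \<Gamma>")
    case True
    then obtain n where n: "n \<ge> k" "B \<in> set (hyps n)" using stage_of by blast
    have w': "wff (ctx n) A" "wff (ctx n) B" using w wff_mono n by auto
    have "deriv T (ctx n) (hyps n) (Imp A B)"
      using n w' by - (rule ImpI, simp, rule Hyp, auto)
    with w' show ?thesis by (auto intro: in_\<Gamma>_of_deriv)
  next
    case False
    then have "Neg A \<in> \<Gamma>" using imp not_in_\<Gamma> assms by blast
    then obtain n where n: "n \<ge> k" "Neg A \<in> set (hyps n)" using stage_of by blast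
    have w': "wff (ctx n) A" "wff (ctx n) B" using w wff_mono n by auto
    have "deriv T (ctx n) (Neg B # A # hyps n) Fls"
      using n w' by - (rule ImpE [of _ _ _ A Fls], auto simp: Neg_def intro: Hyp)
    then have "deriv T (ctx n) (A # hyps n) B"
      using w' by - (rule Classical, simp_all)
    then have "deriv T (ctx n) (hyps n) (Imp A B)"
      using w' by - (rule ImpI, simp_all)
    with w' show ?thesis by (auto intro: in_\<Gamma>_of_deriv)
  qed
qed

text \<open>If the universal formula is missing, it was refuted at some stage, and
  \<open>decided\<close> provides the witness recorded there.\<close>

lemma Forall_in:
  assumes "wfm (Forall \<tau> B)"
  shows "Forall \<tau> B \<in> \<Gamma> \<longleftrightarrow> (\<forall>t. typd t \<tau> \<longrightarrow> inst t B \<in> \<Gamma>)"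
proof
  assume a: "Forall \<tau> B \<in> \<Gamma>"
  show "\<forall>t. typd t \<tau> \<longrightarrow> inst t B \<in> \<Gamma>"
  proof (intro allI impI)
    fix t assume "typd t \<tau>"
    then obtain m where m: "has_type (ctx m) t \<tau>" by (auto simp: typd_def)
    obtain n where n: "n \<ge> m" "Forall \<tau> B \<in> set (hyps n)" using stage_of [OF a] by blast
    have t: "has_type (ctx n) t \<tau>" using has_type_mono [OF n(1) m] .
    have "deriv T (ctx n) (hyps n) (inst t B)"
      using n t by - (rule AllE [of _ _ _ \<tau>], auto intro: deriv_of_hyp)
    moreover have "wff (\<tau> # ctx n) B" using n stage_invariant by fastforce
    ultimately show "inst t B \<in> \<Gamma>" using in_\<Gamma>_of_deriv inst_wff t by blast
  qed
next
  assume all: "\<forall>t. typd t \<tau> \<longrightarrow> inst t B \<in> \<Gamma>"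
  show "Forall \<tau> B \<in> \<Gamma>"
  proof (rule ccontr)
    assume "Forall \<tau> B \<notin> \<Gamma>"
    moreover obtain n where "wff (ctx n) (Forall \<tau> B)" using assms by (auto simp: wfm_def)
    ultimately obtain m c where "has_type (ctx m) c \<tau>" "Neg (inst c B) \<in> set (hyps m)"
      using decided [of n "Forall \<tau> B"] by (auto simp: \<Gamma>_def)
    then show False using all not_both by (auto simp: typd_def \<Gamma>_def)
  qed
qed

lemma Eq_refl_in: "typd t T0 \<Longrightarrow> Eq t t \<in> \<Gamma>"
  by (auto simp: typd_def intro: EqI in_\<Gamma>_of_deriv)

text \<open>The typing of \<open>A\<close> is demanded only at sufficiently late stages, because its
  parameters may be declared after those of \<open>s\<close> and \<open>t\<close>.\<close>

lemma Eq_replace: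
  assumes "Eq s t \<in> \<Gamma>" "typd s T0" "typd t T0" "\<And>n. has_type (ctx n) s T0 \<Longrightarrow> has_type (ctx n) t T0 \<Longrightarrow> \<exists>m\<ge>n. wff (T0 # ctx m) A" "inst s A \<in> \<Gamma>"
  shows "inst t A \<in> \<Gamma>"
proof -
  obtain a b where "has_type (ctx a) s T0" "has_type (ctx b) t T0" using assms by (auto simp: typd_def)
  then have "has_type (ctx (max a b)) s T0" "has_type (ctx (max a b)) t T0"
    using has_type_mono [of a "max a b"] has_type_mono [of b "max a b"] by auto
  then obtain m where m: "m \<ge> max a b" "wff (T0 # ctx m) A" using assms by blast
  obtain k1 where k1: "k1 \<ge> m" "Eq s t \<in> set (hyps k1)" using stage_of assms by blast
  obtain k where k: "k \<ge> k1" "inst s A \<in> set (hyps k)" using stage_of assms by blast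
  have st: "has_type (ctx k) s T0" "has_type (ctx k) t T0"
    using \<open>has_type (ctx (max a b)) s T0\<close> \<open>has_type (ctx (max a b)) t T0\<close> has_type_mono [of "max a b" k] m k1 k
    by auto
  have "typed_sub (T0 # ctx k) Var (T0 # ctx m)"
    using typed_sub_up [OF typed_sub_ctx [of m k], of T0] k k1 by simp
  then have w: "wff (T0 # ctx k) A" using sub_fm_wff [OF m(2)] by fastforce
  have "deriv T (ctx k) (hyps k) (inst t A)"
    by (rule EqE [OF _ st w]) (use k k1 hyps_mono [of k1 k] in \<open>auto intro: deriv_of_hyp\<close>)
  then show ?thesis using in_\<Gamma>_of_deriv inst_wff w st by blast
qed

end

section \<open>Structures and satisfaction\<close>

record 'a str =
  carr :: "ty \<Rightarrow> 'a set"
  ap :: "'a \<Rightarrow> 'a \<Rightarrow> 'a"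
  con :: "cst \<Rightarrow> 'a"
  eqr :: "'a \<Rightarrow> 'a \<Rightarrow> bool"
  ltr :: "'a \<Rightarrow> 'a \<Rightarrow> bool"

primrec eval :: "'a str \<Rightarrow> 'a list \<Rightarrow> tm \<Rightarrow> 'a" where
  "eval M e (Var i) = e ! i"
| "eval M e (Cst c) = con M c"
| "eval M e (App s t) = ap M (eval M e s) (eval M e t)"

primrec sat :: "'a str \<Rightarrow> 'a list \<Rightarrow> fm \<Rightarrow> bool" where
  "sat M e Fls \<longleftrightarrow> False"
| "sat M e (Eq s t) \<longleftrightarrow> eqr M (eval M e s) (eval M e t)"
| "sat M e (Less s t) \<longleftrightarrow> ltr M (eval M e s) (eval M e t)"
| "sat M e (Imp A B) \<longleftrightarrow> (sat M e A \<longrightarrow> sat M e B)"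
| "sat M e (Forall \<tau> A) \<longleftrightarrow> (\<forall>v\<in>carr M \<tau>. sat M (v # e) A)"

lemma sat_Neg [simp]: "sat M e (Neg A) \<longleftrightarrow> \<not> sat M e A"
  by (simp add: Neg_def)

lemma sat_Exists [simp]: "sat M e (Exists \<tau> A) \<longleftrightarrow> (\<exists>v\<in>carr M \<tau>. sat M (v # e) A)"
  by (simp add: Exists_def)

text \<open>The variable that a quantifier entered at depth \<open>d\<close> hands to its body,
  given a name so that rewriting can recognise it.\<close>

definition vr :: "nat \<Rightarrow> tmb" where "vr d = (\<lambda>e. Var (e - Suc d))"

lemma all_b_vr: "all_b \<tau> A d = Forall \<tau> (A (vr d) (Suc d))"
  by (simp add: all_b_def vr_def)

lemma ex_b_vr: "ex_b \<tau> A d = Exists \<tau> (A (vr d) (Suc d))"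
  by (simp add: ex_b_def vr_def)

definition vl :: "'a str \<Rightarrow> 'a list \<Rightarrow> tmb \<Rightarrow> 'a" where
  "vl M e s = eval M e (s (length e))"

text \<open>The value of \<open>s\<close> does not change when further quantifiers are entered.\<close>

definition stab :: "'a str \<Rightarrow> 'a list \<Rightarrow> tmb \<Rightarrow> bool" where
  "stab M e s \<longleftrightarrow> (\<forall>vs. eval M (vs @ e) (s (length vs + length e)) = vl M e s)"

lemma stab_Cons: "stab M e s \<Longrightarrow> stab M (v # e) s \<and> vl M (v # e) s = vl M e s"
proof -
  assume s: "stab M e s"
  then have "eval M ((vs @ [v]) @ e) (s (length (vs @ [v]) + length e)) = vl M e s" for vs
    unfolding stab_def by blast
  from this [of "[]"] this show ?thesis by (simp add: stab_def vl_def)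
qed

lemma stab_Cons_stab [simp]: "stab M e s \<Longrightarrow> stab M (v # e) s"
  and stab_Cons_vl [simp]: "stab M e s \<Longrightarrow> vl M (v # e) s = vl M e s"
  by (simp_all add: stab_Cons)

lemma stab_vr [simp]: "length e = d \<Longrightarrow> stab M (v # e) (vr d)"
  and vl_vr [simp]: "length e = d \<Longrightarrow> vl M (v # e) (vr d) = v"
  by (auto simp: stab_def vl_def vr_def nth_append)

lemma stab_app [simp]: "stab M e s \<Longrightarrow> stab M e t \<Longrightarrow> stab M e (s \<cdot> t)"
  and vl_app [simp]: "vl M e (s \<cdot> t) = ap M (vl M e s) (vl M e t)"
  by (auto simp: stab_def vl_def app_def)

lemma stab_cst [simp]: "stab M e (cst c)" and vl_cst [simp]: "vl M e (cst c) = con M c"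
  by (auto simp: stab_def vl_def cst_def)

primrec eqt :: "'a str \<Rightarrow> ty \<Rightarrow> 'a \<Rightarrow> 'a \<Rightarrow> bool" where
  "eqt M T0 a b \<longleftrightarrow> eqr M a b"
| "eqt M (\<rho> \<rightarrow> \<tau>) a b \<longleftrightarrow> (\<forall>x\<in>carr M \<rho>. eqt M \<tau> (ap M a x) (ap M b x))"

lemma sat_eq_at_type:
  "length e = d \<Longrightarrow> stab M e s \<Longrightarrow> stab M e t \<Longrightarrow>
    sat M e (eq_at_type \<tau> s t d) \<longleftrightarrow> eqt M \<tau> (vl M e s) (vl M e t)"
  by (induct \<tau> arbitrary: e d s t) (simp_all add: eq_b_def all_b_vr, simp add: vl_def)

lemma sat_ext_axiom:
  "sat M [] (ext_axiom \<rho> \<tau>) \<longleftrightarrow> (\<forall>F\<in>carr M (\<rho> \<rightarrow> \<tau>). \<forall>x\<in>carr M \<rho>. \<forall>y\<in>carr M \<rho>.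
     eqt M \<rho> x y \<longrightarrow> eqt M \<tau> (ap M F x) (ap M F y))"
  by (simp add: ext_axiom_def all_b_vr imp_b_def sat_eq_at_type)

locale typed_str =
  fixes M :: "'a str"
  assumes con_carr [simp]: "con M c \<in> carr M (cst_type c)"
    and ap_carr [simp]: "F \<in> carr M (\<rho> \<rightarrow> \<tau>) \<Longrightarrow> x \<in> carr M \<rho> \<Longrightarrow> ap M F x \<in> carr M \<tau>"
begin

abbreviation typed_env :: "'a list \<Rightarrow> ty list \<Rightarrow> bool" where
  "typed_env e \<Delta> \<equiv> list_all2 (\<lambda>v \<tau>. v \<in> carr M \<tau>) e \<Delta>"

lemma eval_carr: "has_type \<Delta> t \<tau> \<Longrightarrow> typed_env e \<Delta> \<Longrightarrow> eval M e t \<in> carr M \<tau>"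
  by (induct t arbitrary: \<tau>) (auto simp: has_type_simps list_all2_conv_all_nth intro: ap_carr)

end

section \<open>Quotient by hereditary pointwise equality\<close>

locale equality_str = typed_str M for M :: "'a str" +
  assumes disjoint: "a \<in> carr M \<sigma> \<Longrightarrow> a \<in> carr M \<tau> \<Longrightarrow> \<sigma> = \<tau>"
    and eqr_refl: "a \<in> carr M T0 \<Longrightarrow> eqr M a a"
    and eqr_sym: "a \<in> carr M T0 \<Longrightarrow> b \<in> carr M T0 \<Longrightarrow> eqr M a b \<Longrightarrow> eqr M b a"
    and eqr_trans: "a \<in> carr M T0 \<Longrightarrow> b \<in> carr M T0 \<Longrightarrow> c \<in> carr M T0 \<Longrightarrow>
          eqr M a b \<Longrightarrow> eqr M b c \<Longrightarrow> eqr M a c"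
    and ltr_cong: "a \<in> carr M T0 \<Longrightarrow> b \<in> carr M T0 \<Longrightarrow> c \<in> carr M T0 \<Longrightarrow> d \<in> carr M T0 \<Longrightarrow>
          eqr M a b \<Longrightarrow> eqr M c d \<Longrightarrow> ltr M a c \<Longrightarrow> ltr M b d"
    and ext: "F \<in> carr M (\<rho> \<rightarrow> \<tau>) \<Longrightarrow> x \<in> carr M \<rho> \<Longrightarrow> y \<in> carr M \<rho> \<Longrightarrow>
          eqt M \<rho> x y \<Longrightarrow> eqt M \<tau> (ap M F x) (ap M F y)"
begin

lemma eqt_refl: "a \<in> carr M \<tau> \<Longrightarrow> eqt M \<tau> a a"
  by (induct \<tau> arbitrary: a) (auto intro: eqr_refl)

lemma eqt_sym: "a \<in> carr M \<tau> \<Longrightarrow> b \<in> carr M \<tau> \<Longrightarrow> eqt M \<tau> a b \<Longrightarrow> eqt M \<tau> b a"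
  by (induct \<tau> arbitrary: a b) (auto intro: eqr_sym)

lemma eqt_trans: "a \<in> carr M \<tau> \<Longrightarrow> b \<in> carr M \<tau> \<Longrightarrow> c \<in> carr M \<tau> \<Longrightarrow>
    eqt M \<tau> a b \<Longrightarrow> eqt M \<tau> b c \<Longrightarrow> eqt M \<tau> a c"
proof (induct \<tau> arbitrary: a b c)
  case T0 then show ?case by (auto intro: eqr_trans)
next
  case (Fn \<rho> \<tau>)
  show ?case
    unfolding eqt.simps
  proof
    fix x assume "x \<in> carr M \<rho>"
    then show "eqt M \<tau> (ap M a x) (ap M c x)"
      using Fn(2) [of "ap M a x" "ap M b x" "ap M c x"] Fn.prems by auto
  qed
qed

text \<open>Extensionality of \<open>F\<close> replaces the argument, after which the pointwise
  hypothesis replaces the function.\<close>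

lemma ap_eqt:
  assumes "F \<in> carr M (\<rho> \<rightarrow> \<tau>)" "G \<in> carr M (\<rho> \<rightarrow> \<tau>)" "x \<in> carr M \<rho>" "y \<in> carr M \<rho>"
    "eqt M (\<rho> \<rightarrow> \<tau>) F G" "eqt M \<rho> x y"
  shows "eqt M \<tau> (ap M F x) (ap M G y)"
  using assms ext [of F \<rho> \<tau> x y] by (auto intro: eqt_trans [of _ _ "ap M F y"])

text \<open>Carriers of different types are disjoint, so an element determines its type and classes
  need no type index.\<close>

definition cl :: "'a \<Rightarrow> 'a set" where
  "cl a = {b. \<exists>\<tau>. a \<in> carr M \<tau> \<and> b \<in> carr M \<tau> \<and> eqt M \<tau> a b}"
definition rep :: "'a set \<Rightarrow> 'a" where "rep X = (SOME a. a \<in> X)"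

definition collapse :: "'a set str" where
  "collapse = \<lparr>carr = \<lambda>\<tau>. cl ` carr M \<tau>, ap = \<lambda>X Y. cl (ap M (rep X) (rep Y)),
     con = \<lambda>c. cl (con M c), eqr = (=), ltr = \<lambda>X Y. ltr M (rep X) (rep Y)\<rparr>"

lemma cl_eq: "a \<in> carr M \<tau> \<Longrightarrow> b \<in> carr M \<tau> \<Longrightarrow> cl a = cl b \<longleftrightarrow> eqt M \<tau> a b"
proof
  assume ab: "a \<in> carr M \<tau>" "b \<in> carr M \<tau>"
  { assume "cl a = cl b"
    moreover have "b \<in> cl b" using ab eqt_refl by (auto simp: cl_def)
    ultimately show "eqt M \<tau> a b" using ab disjoint by (auto simp: cl_def) }
  { assume e: "eqt M \<tau> a b"
    have "c \<in> cl a \<longleftrightarrow> c \<in> cl b" for c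
      using ab e disjoint eqt_sym [OF ab e] unfolding cl_def mem_Collect_eq by (metis eqt_trans)
    then show "cl a = cl b" by blast }
qed

lemma rep_cl: "a \<in> carr M \<tau> \<Longrightarrow> rep (cl a) \<in> carr M \<tau> \<and> eqt M \<tau> a (rep (cl a))"
proof -
  assume a: "a \<in> carr M \<tau>"
  then have "a \<in> cl a" using eqt_refl by (auto simp: cl_def)
  then have "rep (cl a) \<in> cl a" unfolding rep_def by (rule someI)
  then show ?thesis using a disjoint by (auto simp: cl_def)
qed

text \<open>By \<open>ap_eqt\<close> the class of the result does not depend on the representatives
  picked by \<open>rep\<close>.\<close>

lemma ap_collapse:
  "F \<in> carr M (\<rho> \<rightarrow> \<tau>) \<Longrightarrow> x \<in> carr M \<rho> \<Longrightarrow> ap collapse (cl F) (cl x) = cl (ap M F x)"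
  using rep_cl [of F "\<rho> \<rightarrow> \<tau>"] rep_cl [of x \<rho>] ap_eqt [of F \<rho> \<tau> "rep (cl F)" x "rep (cl x)"]
    cl_eq [of "ap M F x" \<tau> "ap M (rep (cl F)) (rep (cl x))"] ap_carr [of "rep (cl F)" \<rho> \<tau> "rep (cl x)"]
  by (simp add: collapse_def del: eqt.simps)

lemma eval_collapse:
  "has_type \<Delta> t \<tau> \<Longrightarrow> typed_env e \<Delta> \<Longrightarrow> eval collapse (map cl e) t = cl (eval M e t)"
proof (induct t arbitrary: \<tau>)
  case (App s t)
  then obtain \<rho> where "has_type \<Delta> s (\<rho> \<rightarrow> \<tau>)" "has_type \<Delta> t \<rho>" by (auto simp: has_type_simps)
  with App show ?case by (simp add: ap_collapse [of _ \<rho> \<tau>] eval_carr)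
qed (auto simp: has_type_simps list_all2_conv_all_nth collapse_def)

lemma ltr_collapse:
  assumes "a \<in> carr M T0" "b \<in> carr M T0"
  shows "ltr collapse (cl a) (cl b) \<longleftrightarrow> ltr M a b"
proof -
  let ?a = "rep (cl a)" and ?b = "rep (cl b)"
  have c: "?a \<in> carr M T0" "?b \<in> carr M T0" and e: "eqr M a ?a" "eqr M b ?b"
    using rep_cl [of a T0] rep_cl [of b T0] assms by auto
  have e': "eqr M ?a a" "eqr M ?b b" using eqr_sym assms c e by blast+
  show ?thesis
    using ltr_cong [OF assms(1) c(1) assms(2) c(2) e] ltr_cong [OF c(1) assms(1) c(2) assms(2) e']
    by (auto simp: collapse_def)
qed

text \<open>Atomic formulas live at type 0, where the quotient identifies exactly the elements that
  \<open>eqr\<close> relates, and every element of the quotient is a class.\<close>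

lemma sat_collapse:
  "wff \<Delta> A \<Longrightarrow> typed_env e \<Delta> \<Longrightarrow> sat collapse (map cl e) A \<longleftrightarrow> sat M e A"
proof (induct A arbitrary: \<Delta> e)
  case (Eq s t)
  then show ?case
    using eval_collapse [of \<Delta> s T0 e] eval_collapse [of \<Delta> t T0 e] cl_eq [of _ T0] eval_carr [of \<Delta> _ T0 e]
    by (simp add: collapse_def)
next
  case (Less s t)
  then show ?case
    using eval_collapse [of \<Delta> s T0 e] eval_collapse [of \<Delta> t T0 e] ltr_collapse eval_carr [of \<Delta> _ T0 e]
    by simp
next
  case (Forall \<tau> A)
  have "sat collapse (map cl e) (Forall \<tau> A) \<longleftrightarrow> (\<forall>v\<in>carr M \<tau>. sat collapse (map cl (v # e)) A)"
    by (simp add: collapse_def)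
  also have "\<dots> \<longleftrightarrow> sat M e (Forall \<tau> A)"
    using Forall(1) [of "\<tau> # \<Delta>"] Forall.prems by (simp del: list.map)
  finally show ?case .
qed auto

end

locale ext_str = typed_str M for M :: "'a str" +
  assumes eqr_eq: "eqr M = (=)"
    and ext_eq: "F \<in> carr M (\<rho> \<rightarrow> \<tau>) \<Longrightarrow> G \<in> carr M (\<rho> \<rightarrow> \<tau>) \<Longrightarrow>
      (\<And>x. x \<in> carr M \<rho> \<Longrightarrow> ap M F x = ap M G x) \<Longrightarrow> F = G"

lemma (in equality_str) ext_str_collapse: "ext_str collapse"
proof
  fix c show "con collapse c \<in> carr collapse (cst_type c)"
    by (simp add: collapse_def)
next
  fix F \<rho> \<tau> x assume "F \<in> carr collapse (\<rho> \<rightarrow> \<tau>)" "x \<in> carr collapse \<rho>"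
  then obtain G y where "G \<in> carr M (\<rho> \<rightarrow> \<tau>)" "F = cl G" "y \<in> carr M \<rho>" "x = cl y"
    by (auto simp: collapse_def)
  then show "ap collapse F x \<in> carr collapse \<tau>"
    by (simp add: ap_collapse [of _ \<rho> \<tau>]) (simp add: collapse_def)
next
  show "eqr collapse = (=)" by (simp add: collapse_def)
next
  fix F G \<rho> \<tau> assume "F \<in> carr collapse (\<rho> \<rightarrow> \<tau>)" "G \<in> carr collapse (\<rho> \<rightarrow> \<tau>)"
    and eq: "\<And>x. x \<in> carr collapse \<rho> \<Longrightarrow> ap collapse F x = ap collapse G x"
  then obtain F' G' where FG: "F' \<in> carr M (\<rho> \<rightarrow> \<tau>)" "F = cl F'" "G' \<in> carr M (\<rho> \<rightarrow> \<tau>)" "G = cl G'"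
    by (auto simp: collapse_def)
  have "eqt M \<tau> (ap M F' x) (ap M G' x)" if x: "x \<in> carr M \<rho>" for x
    using FG x eq [of "cl x"] by (simp add: ap_collapse [of _ \<rho> \<tau>] cl_eq [of _ \<tau>]) (simp add: collapse_def)
  then show "F = G" using FG by (simp add: cl_eq [of _ "\<rho> \<rightarrow> \<tau>"])
qed

section \<open>The term model and completeness\<close>

context henkin
begin

text \<open>An environment of terms read as a substitution. The value beyond its length is a filler
  which well-typed formulas never reach.\<close>

definition es :: "tm list \<Rightarrow> nat \<Rightarrow> tm" where
  "es e i = (if i < length e then e ! i else Cst Zero)"

definition TM :: "tm str" where
  "TM = \<lparr>carr = \<lambda>\<tau>. {t. typd t \<tau>}, ap = App, con = Cst,
     eqr = \<lambda>s t. Eq s t \<in> \<Gamma>, ltr = \<lambda>s t. Less s t \<in> \<Gamma>\<rparr>"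

lemma typd_common: "list_all2 typd e \<Delta> \<Longrightarrow> \<exists>n. \<forall>m\<ge>n. list_all2 (has_type (ctx m)) e \<Delta>"
proof (induct e \<Delta> rule: list_all2_induct)
  case (Cons t e \<tau> \<Delta>)
  then obtain n k where n: "\<forall>m\<ge>n. list_all2 (has_type (ctx m)) e \<Delta>" and k: "has_type (ctx k) t \<tau>"
    by (auto simp: typd_def)
  have "\<forall>m\<ge>max n k. list_all2 (has_type (ctx m)) (t # e) (\<tau> # \<Delta>)"
    using n has_type_mono [OF _ k] by simp
  then show ?case by blast
qed simp

lemma typed_sub_es: "list_all2 (has_type \<Theta>) e \<Delta> \<Longrightarrow> typed_sub \<Theta> (es e) \<Delta>"
  by (auto simp: typed_sub_def es_def list_all2_conv_all_nth)

lemma wfm_sub: "wff \<Delta> A \<Longrightarrow> list_all2 typd e \<Delta> \<Longrightarrow> wfm (sub_fm (es e) A)"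
  using typd_common [of e \<Delta>] sub_fm_wff typed_sub_es unfolding wfm_def by blast

lemma typd_unique: "typd t \<sigma> \<Longrightarrow> typd t \<tau> \<Longrightarrow> \<sigma> = \<tau>"
proof -
  assume "typd t \<sigma>" "typd t \<tau>"
  then obtain m n where "has_type (ctx m) t \<sigma>" "has_type (ctx n) t \<tau>" by (auto simp: typd_def)
  then have "has_type (ctx (max m n)) t \<sigma>" "has_type (ctx (max m n)) t \<tau>"
    using has_type_mono [of m "max m n"] has_type_mono [of n "max m n"] by auto
  then show ?thesis by (rule has_type_unique)
qed

lemma typed_str_TM: "typed_str TM"
proof
  fix c show "con TM c \<in> carr TM (cst_type c)" by (simp add: TM_def typd_def has_type_simps)
next
  fix F \<rho> \<tau> x assume "F \<in> carr TM (\<rho> \<rightarrow> \<tau>)" "x \<in> carr TM \<rho>"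
  then obtain m n where "has_type (ctx m) F (\<rho> \<rightarrow> \<tau>)" "has_type (ctx n) x \<rho>" by (auto simp: typd_def TM_def)
  then have "has_type (ctx (max m n)) F (\<rho> \<rightarrow> \<tau>)" "has_type (ctx (max m n)) x \<rho>"
    using has_type_mono [of m "max m n"] has_type_mono [of n "max m n"] by auto
  then show "ap TM F x \<in> carr TM \<tau>" by (auto simp: TM_def typd_def has_type_simps)
qed

lemma eval_TM: "has_type \<Delta> t \<tau> \<Longrightarrow> length e = length \<Delta> \<Longrightarrow> eval TM e t = sub_tm (es e) t"
  by (induct t arbitrary: \<tau>) (auto simp: has_type_simps TM_def es_def)

lemma inst_es: "inst t (sub_fm (up (es e)) A) = sub_fm (es (t # e)) A"
proof -
  have "sub_tm (case_nat t Var) (up (es e) i) = es (t # e) i" for i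
    by (cases i) (auto simp: up_def es_def sub_tm_comp)
  then show ?thesis by (simp add: inst_def sub_fm_comp)
qed

text \<open>\<open>Imp_in\<close> and \<open>Forall_in\<close> say that membership in
  \<open>\<Gamma>\<close> obeys the clauses of \<open>sat\<close>.\<close>

lemma truth: "wff \<Delta> A \<Longrightarrow> list_all2 typd e \<Delta> \<Longrightarrow> sat TM e A \<longleftrightarrow> sub_fm (es e) A \<in> \<Gamma>"
proof (induct A arbitrary: \<Delta> e)
  case Fls then show ?case by (simp add: Fls_notin)
next
  case (Eq s t)
  then have "length e = length \<Delta>" by (simp add: list_all2_lengthD)
  with Eq show ?case using eval_TM [of \<Delta> s T0 e] eval_TM [of \<Delta> t T0 e] by simp (simp add: TM_def)
next
  case (Less s t)
  then have "length e = length \<Delta>" by (simp add: list_all2_lengthD)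
  with Less show ?case using eval_TM [of \<Delta> s T0 e] eval_TM [of \<Delta> t T0 e] by simp (simp add: TM_def)
next
  case (Imp A B) then show ?case using wfm_sub [of \<Delta> _ e] Imp(1,2) [of \<Delta> e] by (simp add: Imp_in)
next
  case (Forall \<tau> A)
  have w: "wfm (Forall \<tau> (sub_fm (up (es e)) A))" using wfm_sub [OF Forall(2,3)] by simp
  have "sub_fm (es e) (Forall \<tau> A) \<in> \<Gamma> \<longleftrightarrow> (\<forall>t. typd t \<tau> \<longrightarrow> sub_fm (es (t # e)) A \<in> \<Gamma>)"
    using Forall_in [OF w] by (simp add: inst_es)
  also have "\<dots> \<longleftrightarrow> (\<forall>t. typd t \<tau> \<longrightarrow> sat TM (t # e) A)"
    using Forall(1) [of "\<tau> # \<Delta>"] Forall.prems by simp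
  also have "\<dots> \<longleftrightarrow> sat TM e (Forall \<tau> A)" by (simp add: TM_def)
  finally show ?case by simp
qed

text \<open>One place of replacement and two parameters are enough to derive symmetry, transitivity
  and the compatibility of the order with equality.\<close>

lemma Eq_subst:
  assumes st: "Eq s t \<in> \<Gamma>" and ty: "typd s T0" "typd t T0" "typd u T0" "typd v T0"
    and A: "wff [T0, T0, T0] A" and s: "sub_fm (es [s, u, v]) A \<in> \<Gamma>"
  shows "sub_fm (es [t, u, v]) A \<in> \<Gamma>"
proof -
  let ?A = "sub_fm (up (es [u, v])) A"
  have "inst t ?A \<in> \<Gamma>"
  proof (rule Eq_replace [OF st ty(1,2)])
    show "inst s ?A \<in> \<Gamma>" using s by (simp add: inst_es)
    fix n
    have "list_all2 typd [u, v] [T0, T0]" using ty by simp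
    from typd_common [OF this] obtain k where k: "\<forall>m\<ge>k. list_all2 (has_type (ctx m)) [u, v] [T0, T0]"
      by blast
    have "wff (T0 # ctx (max n k)) ?A"
      using sub_fm_wff [OF A typed_sub_up [OF typed_sub_es]] k by simp
    then show "\<exists>m\<ge>n. wff (T0 # ctx m) ?A" by (meson max.cobounded1)
  qed
  then show ?thesis by (simp add: inst_es)
qed

lemma Eq_sym_in: "Eq s t \<in> \<Gamma> \<Longrightarrow> typd s T0 \<Longrightarrow> typd t T0 \<Longrightarrow> Eq t s \<in> \<Gamma>"
  using Eq_subst [of s t s s "Eq (Var 0) (Var 1)"] Eq_refl_in
  by (simp add: has_type_simps es_def)

lemma Eq_trans_in:
  "Eq s t \<in> \<Gamma> \<Longrightarrow> Eq t u \<in> \<Gamma> \<Longrightarrow> typd s T0 \<Longrightarrow> typd t T0 \<Longrightarrow> typd u T0 \<Longrightarrow> Eq s u \<in> \<Gamma>"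
  using Eq_subst [of t s u u "Eq (Var 0) (Var 1)"] Eq_sym_in
  by (simp add: has_type_simps es_def)

lemma Less_cong_in:
  assumes "Eq s s' \<in> \<Gamma>" "Eq t t' \<in> \<Gamma>" "typd s T0" "typd s' T0" "typd t T0" "typd t' T0" "Less s t \<in> \<Gamma>"
  shows "Less s' t' \<in> \<Gamma>"
proof -
  have "Less s' t \<in> \<Gamma>"
    using Eq_subst [of s s' t t "Less (Var 0) (Var 1)"] assms by (simp add: has_type_simps es_def)
  then show ?thesis
    using Eq_subst [of t t' s' s' "Less (Var 1) (Var 0)"] assms by (simp add: has_type_simps es_def)
qed

end

text \<open>The extensionality axioms belong to \<open>T\<close>, so application in the term model
  respects pointwise equality and the quotient is a genuine extensional structure. Its elements are
  classes of terms, whence the type \<open>tm set\<close>.\<close>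

theorem countermodel:
  assumes closed: "\<And>B. B \<in> T \<Longrightarrow> wff [] B" and ext: "\<And>\<rho> \<tau>. ext_axiom \<rho> \<tau> \<in> T"
    and A: "wff [] A" "\<not> T \<turnstile> A"
  shows "\<exists>M :: tm set str. ext_str M \<and> (\<forall>B\<in>T. sat M [] B) \<and> \<not> sat M [] A"
proof -
  interpret henkin T A
    using closed A by unfold_locales (auto simp: proves_def)
  have nil: "es [] = (\<lambda>i. Cst Zero)" by (rule HOL.ext) (simp add: es_def)
  have sat: "sat TM [] B \<longleftrightarrow> B \<in> \<Gamma>" if "wff [] B" for B
    using truth [OF that, of "[]"] sub_fm_closed [OF that] by simp
  have T_in: "B \<in> \<Gamma>" if "B \<in> T" for B
    using that closed by (intro in_\<Gamma>_of_deriv [of 0]) (auto intro: Axm)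
  interpret t: typed_str TM by (rule typed_str_TM)
  interpret equality_str TM
  proof
    fix F \<rho> \<tau> x y
    assume "F \<in> carr TM (\<rho> \<rightarrow> \<tau>)" "x \<in> carr TM \<rho>" "y \<in> carr TM \<rho>" "eqt TM \<rho> x y"
    moreover have "sat TM [] (ext_axiom \<rho> \<tau>)" using ext closed T_in sat by blast
    ultimately show "eqt TM \<tau> (ap TM F x) (ap TM F y)" by (auto simp: sat_ext_axiom)
  qed (auto simp: TM_def typd_unique intro: Eq_refl_in Eq_sym_in Eq_trans_in Less_cong_in)
  have "Neg A \<in> \<Gamma>" unfolding \<Gamma>_def by (rule UN_I [of 0]) simp_all
  then have "A \<notin> \<Gamma>" using not_both by blast
  then have "\<not> sat TM [] A" using sat A by blast
  moreover have "\<forall>B\<in>T. sat TM [] B" using sat closed T_in by blast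
  ultimately show ?thesis
    using sat_collapse [of "[]" _ "[]"] A closed ext_str_collapse by (intro exI [of _ collapse]) auto
qed

section \<open>The axioms and the statements are sentences\<close>

text \<open>A named term is a function of the depth, so it has to be typed at every depth where it
  may occur; \<open>\<Theta>\<close> types the quantifiers entered later.\<close>

definition tyb :: "ty list \<Rightarrow> tmb \<Rightarrow> ty \<Rightarrow> bool" where
  "tyb \<Delta> s \<tau> \<longleftrightarrow> (\<forall>\<Theta>. has_type (\<Theta> @ \<Delta>) (s (length \<Theta> + length \<Delta>)) \<tau>)"

lemma tyb_Cons [simp]: "tyb \<Delta> s \<tau> \<Longrightarrow> tyb (\<sigma> # \<Delta>) s \<tau>"
  unfolding tyb_def
proof
  fix \<Theta> assume "\<forall>\<Theta>. has_type (\<Theta> @ \<Delta>) (s (length \<Theta> + length \<Delta>)) \<tau>"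
  from this [rule_format, of "\<Theta> @ [\<sigma>]"]
  show "has_type (\<Theta> @ \<sigma> # \<Delta>) (s (length \<Theta> + length (\<sigma> # \<Delta>))) \<tau>" by simp
qed

lemma tyb_vr [simp]: "length \<Delta> = d \<Longrightarrow> tyb (\<tau> # \<Delta>) (vr d) \<tau>"
  by (auto simp: tyb_def vr_def has_type_simps nth_append)

lemma tyb_cst [simp]: "tyb \<Delta> (cst c) \<tau> \<longleftrightarrow> \<tau> = cst_type c"
  by (auto simp: tyb_def cst_def has_type_simps)

lemma tyb_app: "tyb \<Delta> s (\<rho> \<rightarrow> \<tau>) \<Longrightarrow> tyb \<Delta> t \<rho> \<Longrightarrow> tyb \<Delta> (s \<cdot> t) \<tau>"
  by (auto simp: tyb_def app_def has_type_simps)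

text \<open>The argument type of an application cannot be read off from the goal, hence instances
  for the argument types that are common below.\<close>

lemmas tyb_app_0 [simp] = tyb_app [where \<rho> = T0]
lemmas tyb_app_1 [simp] = tyb_app [where \<rho> = T1]
lemmas tyb_app_2 [simp] = tyb_app [where \<rho> = "T0 \<rightarrow> T0 \<rightarrow> T0"]

lemma tyb_has_type: "tyb \<Delta> s \<tau> \<Longrightarrow> length \<Delta> = d \<Longrightarrow> has_type \<Delta> (s d) \<tau>"
  unfolding tyb_def by (metis append_Nil list.size(3) add_0)

lemma wff_eq [simp]: "length \<Delta> = d \<Longrightarrow> tyb \<Delta> s T0 \<Longrightarrow> tyb \<Delta> t T0 \<Longrightarrow> wff \<Delta> ((s \<^bold>= t) d)"
  and wff_less [simp]: "length \<Delta> = d \<Longrightarrow> tyb \<Delta> s T0 \<Longrightarrow> tyb \<Delta> t T0 \<Longrightarrow> wff \<Delta> ((s \<^bold>< t) d)"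
  and wff_imp [simp]: "wff \<Delta> ((A \<^bold>\<longrightarrow> B) d) \<longleftrightarrow> wff \<Delta> (A d) \<and> wff \<Delta> (B d)"
  and wff_not [simp]: "wff \<Delta> ((\<^bold>\<not> A) d) \<longleftrightarrow> wff \<Delta> (A d)"
  and wff_all_b [simp]: "wff \<Delta> (all_b \<tau> C d) \<longleftrightarrow> wff (\<tau> # \<Delta>) (C (vr d) (Suc d))"
  and wff_ex_b [simp]: "wff \<Delta> (ex_b \<tau> C d) \<longleftrightarrow> wff (\<tau> # \<Delta>) (C (vr d) (Suc d))"
  by (simp_all add: eq_b_def less_b_def imp_b_def not_b_def all_b_vr ex_b_vr Exists_def tyb_has_type)

lemma wff_connectives [simp]:
  "wff \<Delta> ((A \<^bold>\<and> B) d) \<longleftrightarrow> wff \<Delta> (A d) \<and> wff \<Delta> (B d)"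
  "wff \<Delta> ((A \<^bold>\<or> B) d) \<longleftrightarrow> wff \<Delta> (A d) \<and> wff \<Delta> (B d)"
  "wff \<Delta> ((A \<^bold>\<longleftrightarrow> B) d) \<longleftrightarrow> wff \<Delta> (A d) \<and> wff \<Delta> (B d)"
  "wff \<Delta> (all_nat C d) \<longleftrightarrow> wff (T0 # \<Delta>) (C (vr d) (Suc d))"
  "wff \<Delta> (ex_nat C d) \<longleftrightarrow> wff (T0 # \<Delta>) (C (vr d) (Suc d))"
  by (auto simp: and_b_def or_b_def iff_b_def all_nat_def ex_nat_def)

lemma wff_le [simp]: "length \<Delta> = d \<Longrightarrow> tyb \<Delta> s T0 \<Longrightarrow> tyb \<Delta> t T0 \<Longrightarrow> wff \<Delta> ((s \<^bold>\<le> t) d)"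
  by (simp add: le_b_def)

lemma tyb_arith [simp]:
  "tyb \<Delta> \<^bold>0 T0" "tyb \<Delta> \<^bold>1 T0"
  "tyb \<Delta> s T0 \<Longrightarrow> tyb \<Delta> t T0 \<Longrightarrow> tyb \<Delta> (s \<^bold>+ t) T0"
  "tyb \<Delta> s T0 \<Longrightarrow> tyb \<Delta> t T0 \<Longrightarrow> tyb \<Delta> (s \<^bold>* t) T0"
  by (simp_all add: zero_b_def one_b_def plus_b_def times_b_def)

lemma tyb_two_pow [simp]: "tyb \<Delta> k T0 \<Longrightarrow> tyb \<Delta> (two_pow k) T0"
  unfolding two_pow_def
  by (rule tyb_app [of _ _ T0] tyb_app [of _ _ "T0 \<rightarrow> T0 \<rightarrow> T0"] tyb_app [of _ _ T1]
      tyb_app [of _ _ "T0 \<rightarrow> T1 \<rightarrow> T0"] | simp)+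

lemma wff_eq_at_type:
  "length \<Delta> = d \<Longrightarrow> tyb \<Delta> s \<tau> \<Longrightarrow> tyb \<Delta> t \<tau> \<Longrightarrow> wff \<Delta> (eq_at_type \<tau> s t d)"
proof (induct \<tau> arbitrary: \<Delta> s t d)
  case (Fn \<rho> \<tau>)
  have "tyb (\<rho> # \<Delta>) (u \<cdot> vr d) \<tau>" if "tyb \<Delta> u (\<rho> \<rightarrow> \<tau>)" for u
    using that Fn.prems(1) by (auto intro: tyb_app [of _ _ \<rho>])
  with Fn show ?case by simp
qed simp

lemma wff_K_axiom: "wff [] (K_axiom \<rho> \<tau>)"
  unfolding K_axiom_def wff_all_b
  by (intro wff_eq_at_type tyb_app [of _ _ \<tau> \<rho>] tyb_app [of _ _ \<rho> "\<tau> \<rightarrow> \<rho>"]) simp_all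

lemma wff_S_axiom: "wff [] (S_axiom \<delta> \<rho> \<tau>)"
  unfolding S_axiom_def wff_all_b
  by (intro wff_eq_at_type tyb_app [of _ _ \<delta> \<tau>] tyb_app [of _ _ "\<delta> \<rightarrow> \<rho>" "\<delta> \<rightarrow> \<tau>"]
      tyb_app [of _ _ "\<delta> \<rightarrow> \<rho> \<rightarrow> \<tau>"] tyb_app [of _ _ \<rho> \<tau>] tyb_app [of _ _ \<delta> \<rho>] tyb_app [of _ _ \<delta> "\<rho> \<rightarrow> \<tau>"]) simp_all

lemma wff_ext_axiom: "wff [] (ext_axiom \<rho> \<tau>)"
  unfolding ext_axiom_def by (auto intro!: wff_eq_at_type intro: tyb_app [of _ _ \<rho>])

lemma wff_close: "wff \<Delta> A \<Longrightarrow> wff [] (close \<Delta> A)"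
  by (induct \<Delta> arbitrary: A) auto

lemma wff_induction_axiom: "wff (T0 # \<Delta>) A \<Longrightarrow> wff [] (induction_axiom \<Delta> A)"
  unfolding induction_axiom_def
  by (auto intro!: wff_close inst_wff [of T0] sub_fm_wff [of "T0 # \<Delta>"]
      simp: has_type_simps typed_sub_def nth_Cons split: nat.split)

lemma wff_choice_axiom: "wff (\<tau> # \<sigma> # \<Delta>) A \<Longrightarrow> wff [] (choice_axiom \<sigma> \<tau> \<Delta> A)"
  unfolding choice_axiom_def
  by (auto intro!: wff_close sub_fm_wff [of "\<tau> # \<sigma> # \<Delta>"]
      simp: has_type_simps typed_sub_def nth_Cons Exists_def split: nat.split)

lemma wff_ACA0w: "B \<in> ACA0w \<Longrightarrow> wff [] B"
  unfolding ACA0w_def RCA0w_def semiring_axioms_def rec_axioms_def exists2_axiom_def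
  by (elim insertE UnE imageE CollectE exE conjE emptyE)
    (auto intro: wff_K_axiom wff_S_axiom wff_ext_axiom wff_induction_axiom wff_choice_axiom)

section \<open>Well-formedness of the defined notions and of the statements\<close>

lemma wff_rationals [simp]:
  assumes [simp]: "length \<Delta> = d"
  shows "tyb \<Delta> p T0 \<Longrightarrow> tyb \<Delta> a T0 \<Longrightarrow> tyb \<Delta> b T0 \<Longrightarrow> wff \<Delta> (pair_code p a b d)"
    and "tyb \<Delta> q T0 \<Longrightarrow> tyb \<Delta> a T0 \<Longrightarrow> tyb \<Delta> b T0 \<Longrightarrow> tyb \<Delta> c T0 \<Longrightarrow> wff \<Delta> (rat_code q a b c d)"
  by (simp_all add: pair_code_def rat_code_def)

lemma wff_lessQ [simp]: "length \<Delta> = d \<Longrightarrow> tyb \<Delta> q T0 \<Longrightarrow> tyb \<Delta> r T0 \<Longrightarrow> wff \<Delta> ((q <\<^sub>Q r) d)"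
  by (simp add: lessQ_def)
lemma wff_sumQ [simp]:
  "length \<Delta> = d \<Longrightarrow> tyb \<Delta> q T0 \<Longrightarrow> tyb \<Delta> r T0 \<Longrightarrow> tyb \<Delta> s T0 \<Longrightarrow> wff \<Delta> (sumQ q r s d)"
  by (simp add: sumQ_def)
lemma wff_dyadicQ [simp]:
  "length \<Delta> = d \<Longrightarrow> tyb \<Delta> q T0 \<Longrightarrow> tyb \<Delta> r T0 \<Longrightarrow> tyb \<Delta> s T0 \<Longrightarrow> wff \<Delta> (dyadicQ q r s d)"
  by (simp add: dyadicQ_def)
lemma wff_less_plusQ [simp]:
  "length \<Delta> = d \<Longrightarrow> tyb \<Delta> q T0 \<Longrightarrow> tyb \<Delta> r T0 \<Longrightarrow> tyb \<Delta> m T0 \<Longrightarrow> tyb \<Delta> k T0 \<Longrightarrow>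
    wff \<Delta> (less_plusQ q r m k d)"
  by (simp add: less_plusQ_def)
lemma wff_closeQ [simp]:
  "length \<Delta> = d \<Longrightarrow> tyb \<Delta> q T0 \<Longrightarrow> tyb \<Delta> r T0 \<Longrightarrow> tyb \<Delta> s T0 \<Longrightarrow> wff \<Delta> (closeQ q r s d)"
  by (simp add: closeQ_def)
lemma wff_is_real [simp]: "length \<Delta> = d \<Longrightarrow> tyb \<Delta> x T1 \<Longrightarrow> wff \<Delta> (is_real x d)"
  by (simp add: is_real_def)
lemma wff_lessR [simp]: "length \<Delta> = d \<Longrightarrow> tyb \<Delta> x T1 \<Longrightarrow> tyb \<Delta> y T1 \<Longrightarrow> wff \<Delta> ((x <\<^sub>R y) d)"
  by (simp add: lessR_def)
lemma wff_leR [simp]: "length \<Delta> = d \<Longrightarrow> tyb \<Delta> x T1 \<Longrightarrow> tyb \<Delta> y T1 \<Longrightarrow> wff \<Delta> ((x \<le>\<^sub>R y) d)"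
  by (simp add: leR_def)
lemma wff_eqR [simp]: "length \<Delta> = d \<Longrightarrow> tyb \<Delta> x T1 \<Longrightarrow> tyb \<Delta> y T1 \<Longrightarrow> wff \<Delta> ((x =\<^sub>R y) d)"
  by (simp add: eqR_def)
lemma wff_real_quantifiers [simp]:
  assumes [simp]: "length \<Delta> = d"
  shows "wff \<Delta> (all_real A d) \<longleftrightarrow> wff (T1 # \<Delta>) (A (vr d) (Suc d))"
    and "wff \<Delta> (ex_real A d) \<longleftrightarrow> wff (T1 # \<Delta>) (A (vr d) (Suc d))"
  by (simp_all add: all_real_def ex_real_def)
lemma wff_sumR [simp]:
  "length \<Delta> = d \<Longrightarrow> tyb \<Delta> x T1 \<Longrightarrow> tyb \<Delta> y T1 \<Longrightarrow> tyb \<Delta> z T1 \<Longrightarrow> wff \<Delta> (sumR x y z d)"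
  by (simp add: sumR_def)
lemma wff_less_plusR [simp]:
  "length \<Delta> = d \<Longrightarrow> tyb \<Delta> x T1 \<Longrightarrow> tyb \<Delta> y T1 \<Longrightarrow> tyb \<Delta> z T1 \<Longrightarrow> wff \<Delta> (less_plusR x y z d)"
  by (simp add: less_plusR_def)
lemma wff_le_plusR [simp]:
  "length \<Delta> = d \<Longrightarrow> tyb \<Delta> x T1 \<Longrightarrow> tyb \<Delta> y T1 \<Longrightarrow> tyb \<Delta> z T1 \<Longrightarrow> wff \<Delta> (le_plusR x y z d)"
  by (simp add: le_plusR_def)
lemma wff_distR_less [simp]:
  "length \<Delta> = d \<Longrightarrow> tyb \<Delta> x T1 \<Longrightarrow> tyb \<Delta> y T1 \<Longrightarrow> tyb \<Delta> z T1 \<Longrightarrow> wff \<Delta> (distR_less x y z d)"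
  by (simp add: distR_less_def)
lemma tyb_ratR [simp]: "tyb \<Delta> q T0 \<Longrightarrow> tyb \<Delta> (ratR q) T1"
  by (simp add: ratR_def)
lemma wff_positiveR [simp]: "length \<Delta> = d \<Longrightarrow> tyb \<Delta> x T1 \<Longrightarrow> wff \<Delta> (positiveR x d)"
  by (simp add: positiveR_def)
lemma wff_in_unit [simp]: "length \<Delta> = d \<Longrightarrow> tyb \<Delta> x T1 \<Longrightarrow> wff \<Delta> (in_unit x d)"
  by (simp add: in_unit_def)
lemma wff_bounded_quantifiers [simp]:
  assumes [simp]: "length \<Delta> = d"
  shows "wff \<Delta> (all_pos A d) \<longleftrightarrow> wff (T1 # \<Delta>) (A (vr d) (Suc d))"
    and "wff \<Delta> (ex_pos A d) \<longleftrightarrow> wff (T1 # \<Delta>) (A (vr d) (Suc d))"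
    and "wff \<Delta> (all_unit A d) \<longleftrightarrow> wff (T1 # \<Delta>) (A (vr d) (Suc d))"
    and "wff \<Delta> (ex_unit A d) \<longleftrightarrow> wff (T1 # \<Delta>) (A (vr d) (Suc d))"
  by (simp_all add: all_pos_def ex_pos_def all_unit_def ex_unit_def)
lemma wff_in_ball [simp]:
  "length \<Delta> = d \<Longrightarrow> tyb \<Delta> y T1 \<Longrightarrow> tyb \<Delta> x T1 \<Longrightarrow> tyb \<Delta> k T0 \<Longrightarrow> wff \<Delta> (in_ball y x k d)"
  by (simp add: in_ball_def)
lemma wff_is_function [simp]: "length \<Delta> = d \<Longrightarrow> tyb \<Delta> f (T1 \<rightarrow> T1) \<Longrightarrow> wff \<Delta> (is_function f d)"
  by (simp add: is_function_def)
lemma wff_all_function [simp]: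
  "length \<Delta> = d \<Longrightarrow> wff \<Delta> (all_function A d) \<longleftrightarrow> wff ((T1 \<rightarrow> T1) # \<Delta>) (A (vr d) (Suc d))"
  by (simp add: all_function_def)
lemma wff_at [simp]:
  assumes [simp]: "length \<Delta> = d" "tyb \<Delta> f (T1 \<rightarrow> T1)" "tyb \<Delta> x T1"
  shows "wff \<Delta> (cont_at f x d)" "wff \<Delta> (usc_at f x d)" "wff \<Delta> (lsc_at f x d)"
    "tyb \<Delta> l T1 \<Longrightarrow> wff \<Delta> (left_limit f x l d)" "tyb \<Delta> l T1 \<Longrightarrow> wff \<Delta> (right_limit f x l d)"
  by (simp_all add: cont_at_def usc_at_def lsc_at_def left_limit_def right_limit_def)
lemma wff_regulated [simp]:
  assumes [simp]: "length \<Delta> = d" "tyb \<Delta> f (T1 \<rightarrow> T1)" "tyb \<Delta> x T1"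
  shows "wff \<Delta> (regulated_at f x d)" "wff \<Delta> (cadlag_at f x d)"
  by (simp_all add: regulated_at_def cadlag_at_def)
lemma wff_usc [simp]: "length \<Delta> = d \<Longrightarrow> tyb \<Delta> f (T1 \<rightarrow> T1) \<Longrightarrow> wff \<Delta> (usc f d)"
  by (simp add: usc_def)

text \<open>Sets are presented as functions on terms, so typing is demanded for all arguments
  available at later depths.\<close>

definition setb :: "ty list \<Rightarrow> (tmb \<Rightarrow> tmb) \<Rightarrow> bool" where
  "setb \<Delta> X \<longleftrightarrow> (\<forall>\<Theta> x. tyb (\<Theta> @ \<Delta>) x T1 \<longrightarrow> tyb (\<Theta> @ \<Delta>) (X x) T0)"

lemma setb_app: "setb \<Delta> X \<Longrightarrow> tyb \<Delta> x T1 \<Longrightarrow> tyb \<Delta> (X x) T0"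
  unfolding setb_def by (metis append_Nil)
lemma setb_Cons [simp]: "setb \<Delta> X \<Longrightarrow> setb (\<sigma> # \<Delta>) X"
  unfolding setb_def by (metis append.assoc append_Cons append_Nil)
lemma tyb_append: "tyb \<Delta> s \<tau> \<Longrightarrow> tyb (\<Theta> @ \<Delta>) s \<tau>"
  by (induct \<Theta>) auto
lemma setb_set [simp]: "tyb \<Delta> X (T1 \<rightarrow> T0) \<Longrightarrow> setb \<Delta> (app X)"
  by (auto simp: setb_def tyb_append)
lemma setb_section [simp]: "tyb \<Delta> E (T1 \<rightarrow> T0 \<rightarrow> T0) \<Longrightarrow> tyb \<Delta> n T0 \<Longrightarrow> setb \<Delta> (section_set E n)"
  by (auto simp: setb_def section_set_def tyb_append)
lemma wff_mem [simp]: "length \<Delta> = d \<Longrightarrow> setb \<Delta> X \<Longrightarrow> tyb \<Delta> x T1 \<Longrightarrow> wff \<Delta> (mem x X d)"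
  by (simp add: mem_def setb_app)
lemma wff_is_set [simp]: "length \<Delta> = d \<Longrightarrow> setb \<Delta> X \<Longrightarrow> wff \<Delta> (is_set X d)"
  by (simp add: is_set_def setb_app)
lemma wff_is_open [simp]: "length \<Delta> = d \<Longrightarrow> setb \<Delta> X \<Longrightarrow> wff \<Delta> (is_open X d)"
  by (simp add: is_open_def)
lemma wff_all_open [simp]:
  "length \<Delta> = d \<Longrightarrow> wff \<Delta> (all_open A d) \<longleftrightarrow> wff ((T1 \<rightarrow> T0) # \<Delta>) (A (app (vr d)) (Suc d))"
  and wff_ex_open [simp]:
  "length \<Delta> = d \<Longrightarrow> wff \<Delta> (ex_open A d) \<longleftrightarrow> wff ((T1 \<rightarrow> T0) # \<Delta>) (A (app (vr d)) (Suc d))"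
  by (simp_all add: all_open_def ex_open_def)
lemma wff_dense_set [simp]: "length \<Delta> = d \<Longrightarrow> setb \<Delta> X \<Longrightarrow> wff \<Delta> (dense_set X d)"
  by (simp add: dense_set_def)
lemma wff_measure_zero [simp]:
  assumes [simp]: "length \<Delta> = d"
    and A: "\<And>\<Theta> x e. length \<Theta> = e \<Longrightarrow> tyb (\<Theta> @ \<Delta>) x T1 \<Longrightarrow> wff (\<Theta> @ \<Delta>) (A x (e + d))"
  shows "wff \<Delta> (measure_zero A d)"
  \<comment> \<open>The class is placed below the quantifiers over e, a, b and x; their types are
    listed with the innermost first.\<close>
  using A [of "[T1, T0 \<rightarrow> T1, T0 \<rightarrow> T1, T1]" "Suc (Suc (Suc (Suc 0)))"] by (simp add: measure_zero_def)
lemma wff_quasi [simp]: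
  assumes [simp]: "length \<Delta> = d" "tyb \<Delta> f (T1 \<rightarrow> T1)" "tyb \<Delta> x T1"
  shows "wff \<Delta> (quasi_cont_at f x d)" "wff \<Delta> (lower_quasi_cont_at f x d)"
  by (simp_all add: quasi_cont_at_def lower_quasi_cont_at_def)
lemma wff_converges [simp]:
  "length \<Delta> = d \<Longrightarrow> tyb \<Delta> l T1 \<Longrightarrow>
    (\<And>m. tyb (T0 # T0 # T1 # \<Delta>) m T0 \<Longrightarrow> tyb (T0 # T0 # T1 # \<Delta>) (u m) T1) \<Longrightarrow>
    wff \<Delta> (converges u l d)"
  by (simp add: converges_def)
lemma wff_cluster [simp]:
  assumes [simp]: "length \<Delta> = d" "tyb \<Delta> f (T1 \<rightarrow> T1)" "tyb \<Delta> x T1" "tyb \<Delta> y T1"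
  shows "wff \<Delta> (left_cluster f x y d)" "wff \<Delta> (right_cluster f x y d)"
  by (simp_all add: left_cluster_def right_cluster_def)
lemma wff_Darboux [simp]:
  "length \<Delta> = d \<Longrightarrow> tyb \<Delta> f (T1 \<rightarrow> T1) \<Longrightarrow> tyb \<Delta> x T1 \<Longrightarrow> wff \<Delta> (Darboux_at f x d)"
  by (simp add: Darboux_at_def strictly_between_def)
lemma wff_countably_cont [simp]:
  "length \<Delta> = d \<Longrightarrow> tyb \<Delta> f (T1 \<rightarrow> T1) \<Longrightarrow> wff \<Delta> (countably_cont f d)"
  by (simp add: countably_cont_def)
lemma wff_is_osc_function [simp]:
  "length \<Delta> = d \<Longrightarrow> tyb \<Delta> g (T1 \<rightarrow> T1) \<Longrightarrow> tyb \<Delta> f (T1 \<rightarrow> T1) \<Longrightarrow> wff \<Delta> (is_osc_function g f d)"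
  by (simp add: is_osc_function_def osc_ball_near_def)
lemma wff_usc_C_null [simp]: "length \<Delta> = d \<Longrightarrow> tyb \<Delta> f (T1 \<rightarrow> T1) \<Longrightarrow> wff \<Delta> (usc_C_null f d)"
  by (simp add: usc_C_null_def tyb_append)

lemma wff_BCT: "wff [] BCT" "wff [] BCT_null"
  by (simp_all add: BCT_def BCT_null_def BCT_for_def tyb_append)

lemma wff_items:
  assumes "\<And>\<Delta> f d. length \<Delta> = d \<Longrightarrow> tyb \<Delta> f (T1 \<rightarrow> T1) \<Longrightarrow> wff \<Delta> (H f d)"
    and "\<And>\<Delta> f x d. length \<Delta> = d \<Longrightarrow> tyb \<Delta> f (T1 \<rightarrow> T1) \<Longrightarrow> tyb \<Delta> x T1 \<Longrightarrow> wff \<Delta> (P f x d)"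
  shows "wff [] (item_b H P)" "wff [] (item_c H P)" "wff [] (item_d H P)"
    "wff [] (item_e H)" "wff [] (item_f H)" "wff [] (item_g H)"
  using assms by (simp_all add: item_b_def item_c_def item_d_def item_e_def item_f_def item_g_def)

section \<open>Definability in models\<close>

lemma sat_eq [simp]: "length e = d \<Longrightarrow> sat M e ((s \<^bold>= t) d) \<longleftrightarrow> eqr M (vl M e s) (vl M e t)"
  and sat_less [simp]: "length e = d \<Longrightarrow> sat M e ((s \<^bold>< t) d) \<longleftrightarrow> ltr M (vl M e s) (vl M e t)"
  and sat_imp [simp]: "sat M e ((A \<^bold>\<longrightarrow> B) d) \<longleftrightarrow> (sat M e (A d) \<longrightarrow> sat M e (B d))"
  and sat_not [simp]: "sat M e ((\<^bold>\<not> A) d) \<longleftrightarrow> \<not> sat M e (A d)"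
  and sat_and [simp]: "sat M e ((A \<^bold>\<and> B) d) \<longleftrightarrow> sat M e (A d) \<and> sat M e (B d)"
  and sat_or [simp]: "sat M e ((A \<^bold>\<or> B) d) \<longleftrightarrow> sat M e (A d) \<or> sat M e (B d)"
  and sat_iff [simp]: "sat M e ((A \<^bold>\<longleftrightarrow> B) d) \<longleftrightarrow> (sat M e (A d) \<longleftrightarrow> sat M e (B d))"
  and sat_all_b [simp]: "sat M e (all_b \<tau> C d) \<longleftrightarrow> (\<forall>v\<in>carr M \<tau>. sat M (v # e) (C (vr d) (Suc d)))"
  and sat_ex_b [simp]: "sat M e (ex_b \<tau> C d) \<longleftrightarrow> (\<exists>v\<in>carr M \<tau>. sat M (v # e) (C (vr d) (Suc d)))"
  and sat_all_nat: "sat M e (all_nat C d) \<longleftrightarrow> (\<forall>v\<in>carr M T0. sat M (v # e) (C (vr d) (Suc d)))"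
  and sat_ex_nat: "sat M e (ex_nat C d) \<longleftrightarrow> (\<exists>v\<in>carr M T0. sat M (v # e) (C (vr d) (Suc d)))"
  by (auto simp: eq_b_def less_b_def imp_b_def not_b_def and_b_def or_b_def iff_b_def
      all_nat_def ex_nat_def all_b_vr ex_b_vr vl_def)

definition pl :: "'a str \<Rightarrow> 'a \<Rightarrow> 'a \<Rightarrow> 'a" where "pl M a b = ap M (ap M (con M Plus) a) b"
definition ti :: "'a str \<Rightarrow> 'a \<Rightarrow> 'a \<Rightarrow> 'a" where "ti M a b = ap M (ap M (con M Times) a) b"

lemma stab_arith [simp]:
  "stab M e \<^bold>0" "stab M e \<^bold>1"
  "stab M e s \<Longrightarrow> stab M e t \<Longrightarrow> stab M e (s \<^bold>+ t)" "stab M e s \<Longrightarrow> stab M e t \<Longrightarrow> stab M e (s \<^bold>* t)"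
  by (simp_all add: zero_b_def one_b_def plus_b_def times_b_def)

lemma vl_arith [simp]:
  "vl M e \<^bold>0 = con M Zero" "vl M e \<^bold>1 = con M One"
  "vl M e (s \<^bold>+ t) = pl M (vl M e s) (vl M e t)" "vl M e (s \<^bold>* t) = ti M (vl M e s) (vl M e t)"
  by (simp_all add: zero_b_def one_b_def plus_b_def times_b_def pl_def ti_def)

lemma sat_close: "sat M [] (close \<Delta> A) \<Longrightarrow> list_all2 (\<lambda>v \<tau>. v \<in> carr M \<tau>) e \<Delta> \<Longrightarrow> sat M e A"
proof (induct \<Delta> arbitrary: e A)
  case (Cons \<tau> \<Delta>)
  then obtain v e' where "e = v # e'" "v \<in> carr M \<tau>" "list_all2 (\<lambda>v \<tau>. v \<in> carr M \<tau>) e' \<Delta>"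
    by (auto simp: list_all2_Cons2)
  with Cons(1) [of "Forall \<tau> A" e'] Cons(2) show ?case by auto
qed simp

lemma eval_sub:
  "has_type \<Delta> t \<tau> \<Longrightarrow> (\<And>i. i < length \<Delta> \<Longrightarrow> e ! i = eval M e' (\<sigma> i)) \<Longrightarrow> eval M e' (sub_tm \<sigma> t) = eval M e t"
  by (induct t arbitrary: \<tau>) (auto simp: has_type_simps)

lemma sat_sub:
  "wff \<Delta> A \<Longrightarrow> (\<And>i. i < length \<Delta> \<Longrightarrow> e ! i = eval M e' (\<sigma> i)) \<Longrightarrow> sat M e' (sub_fm \<sigma> A) \<longleftrightarrow> sat M e A"
proof (induct A arbitrary: \<Delta> e e' \<sigma>)
  case (Eq s t) then show ?case using eval_sub [of \<Delta> _ T0 e M e' \<sigma>] by simp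
next
  case (Less s t) then show ?case using eval_sub [of \<Delta> _ T0 e M e' \<sigma>] by simp
next
  case (Imp A B)
  from Imp(1) [of \<Delta> e e' \<sigma>] Imp(2) [of \<Delta> e e' \<sigma>] Imp(3,4) show ?case by simp
next
  case (Forall \<tau> A)
  have "sat M (v # e') (sub_fm (up \<sigma>) A) \<longleftrightarrow> sat M (v # e) A" for v
  proof (rule Forall(1))
    show "wff (\<tau> # \<Delta>) A" using Forall by simp
    fix i assume "i < length (\<tau> # \<Delta>)"
    moreover have w: "eval M (v # e') (sub_tm (\<lambda>j. Var (Suc j)) s) = eval M e' s" for s
      by (induct s) auto
    ultimately show "(v # e) ! i = eval M (v # e') (up \<sigma> i)"
      using Forall(3) by (cases i) (auto simp: up_def)
  qed
  then show ?case by simp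
qed simp

context ext_str
begin

lemma eqt_eq: "a \<in> carr M \<tau> \<Longrightarrow> b \<in> carr M \<tau> \<Longrightarrow> eqt M \<tau> a b \<longleftrightarrow> a = b"
proof (induct \<tau> arbitrary: a b)
  case T0 then show ?case by (simp add: eqr_eq)
next
  case (Fn \<rho> \<tau>)
  then have "eqt M (\<rho> \<rightarrow> \<tau>) a b \<longleftrightarrow> (\<forall>x\<in>carr M \<rho>. ap M a x = ap M b x)"
    using Fn(2) [OF ap_carr ap_carr, OF Fn(3) _ Fn(4)] by simp
  also have "\<dots> \<longleftrightarrow> a = b" using ext_eq [of a \<rho> \<tau> b] Fn by blast
  finally show ?case .
qed

end

lemma ACA0w_axioms:
  "B \<in> semiring_axioms \<Longrightarrow> B \<in> ACA0w" "B \<in> rec_axioms \<Longrightarrow> B \<in> ACA0w"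
  "exists2_axiom \<in> ACA0w" "K_axiom \<rho> \<tau> \<in> ACA0w" "S_axiom \<delta> \<rho> \<tau> \<in> ACA0w" "ext_axiom \<rho> \<tau> \<in> ACA0w"
  "wff (T0 # \<Delta>) A \<Longrightarrow> quantifier_free A \<Longrightarrow> induction_axiom \<Delta> A \<in> ACA0w"
  "wff (T0 # T1 # \<Delta>) A \<Longrightarrow> quantifier_free A \<Longrightarrow> choice_axiom T1 T0 \<Delta> A \<in> ACA0w"
  unfolding ACA0w_def RCA0w_def by blast+

section \<open>Combinatory completeness and definability by terms\<close>

locale aca = ext_str M for M :: "'a str" +
  assumes ax: "B \<in> ACA0w \<Longrightarrow> sat M [] B"
begin

lemma con_types:
  "con M Zero \<in> carr M T0" "con M One \<in> carr M T0"
  "con M Plus \<in> carr M (T0 \<rightarrow> T0 \<rightarrow> T0)" "con M Times \<in> carr M (T0 \<rightarrow> T0 \<rightarrow> T0)"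
  "con M (CombK \<rho> \<tau>) \<in> carr M (\<rho> \<rightarrow> \<tau> \<rightarrow> \<rho>)"
  "con M (CombS \<delta> \<rho> \<tau>) \<in> carr M ((\<delta> \<rightarrow> \<rho> \<rightarrow> \<tau>) \<rightarrow> (\<delta> \<rightarrow> \<rho>) \<rightarrow> \<delta> \<rightarrow> \<tau>)"
  "con M Rec0 \<in> carr M ((T0 \<rightarrow> T0 \<rightarrow> T0) \<rightarrow> T0 \<rightarrow> T0 \<rightarrow> T0)"
  using con_carr [of Zero] con_carr [of One] con_carr [of Plus] con_carr [of Times]
    con_carr [of "CombK \<rho> \<tau>"] con_carr [of "CombS \<delta> \<rho> \<tau>"] con_carr [of Rec0] by simp_all

lemma K_ax: "x \<in> carr M \<rho> \<Longrightarrow> y \<in> carr M \<tau> \<Longrightarrow> ap M (ap M (con M (CombK \<rho> \<tau>)) x) y = x"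
proof -
  assume xy: "x \<in> carr M \<rho>" "y \<in> carr M \<tau>"
  have "sat M [] (K_axiom \<rho> \<tau>)" by (rule ax [OF ACA0w_axioms(4)])
  then have "eqt M \<rho> (ap M (ap M (con M (CombK \<rho> \<tau>)) x) y) x"
    using xy by (simp add: K_axiom_def sat_eq_at_type)
  moreover have "ap M (ap M (con M (CombK \<rho> \<tau>)) x) y \<in> carr M \<rho>"
    using ap_carr [OF ap_carr [OF con_types(5) xy(1)] xy(2)] .
  ultimately show ?thesis using xy eqt_eq by blast
qed

lemma K_carr: "x \<in> carr M \<rho> \<Longrightarrow> ap M (con M (CombK \<rho> \<tau>)) x \<in> carr M (\<tau> \<rightarrow> \<rho>)"
  by (rule ap_carr [OF con_types(5)])

lemma S_carr:
  "x \<in> carr M (\<delta> \<rightarrow> \<rho> \<rightarrow> \<tau>) \<Longrightarrow> y \<in> carr M (\<delta> \<rightarrow> \<rho>) \<Longrightarrow>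
    ap M (ap M (con M (CombS \<delta> \<rho> \<tau>)) x) y \<in> carr M (\<delta> \<rightarrow> \<tau>)"
  by (rule ap_carr [OF ap_carr [OF con_types(6)]])

lemma S_ax:
  "x \<in> carr M (\<delta> \<rightarrow> \<rho> \<rightarrow> \<tau>) \<Longrightarrow> y \<in> carr M (\<delta> \<rightarrow> \<rho>) \<Longrightarrow> z \<in> carr M \<delta> \<Longrightarrow>
    ap M (ap M (ap M (con M (CombS \<delta> \<rho> \<tau>)) x) y) z = ap M (ap M x z) (ap M y z)"
proof -
  assume xyz: "x \<in> carr M (\<delta> \<rightarrow> \<rho> \<rightarrow> \<tau>)" "y \<in> carr M (\<delta> \<rightarrow> \<rho>)" "z \<in> carr M \<delta>"
  have "sat M [] (S_axiom \<delta> \<rho> \<tau>)" by (rule ax [OF ACA0w_axioms(5)])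
  then have "eqt M \<tau> (ap M (ap M (ap M (con M (CombS \<delta> \<rho> \<tau>)) x) y) z) (ap M (ap M x z) (ap M y z))"
    using xyz by (simp add: S_axiom_def sat_eq_at_type)
  moreover have "ap M (ap M x z) (ap M y z) \<in> carr M \<tau>" using xyz by (meson ap_carr)
  moreover have "ap M (ap M (ap M (con M (CombS \<delta> \<rho> \<tau>)) x) y) z \<in> carr M \<tau>"
    using ap_carr [OF S_carr] xyz by blast
  ultimately show ?thesis using eqt_eq by blast
qed

text \<open>Bracket abstraction: S K K for the abstracted variable, K for any other variable or
  constant, S for an application.\<close>

lemma abstraction:
  "has_type (\<sigma> # \<Delta>) t \<tau> \<Longrightarrow> \<exists>t'. has_type \<Delta> t' (\<sigma> \<rightarrow> \<tau>) \<and>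
    (\<forall>e v. typed_env e \<Delta> \<longrightarrow> v \<in> carr M \<sigma> \<longrightarrow> ap M (eval M e t') v = eval M (v # e) t)"
proof (induct t arbitrary: \<tau>)
  case (Var i)
  show ?case
  proof (cases i)
    case 0
    let ?I = "App (App (Cst (CombS \<sigma> (\<sigma> \<rightarrow> \<sigma>) \<sigma>)) (Cst (CombK \<sigma> (\<sigma> \<rightarrow> \<sigma>)))) (Cst (CombK \<sigma> \<sigma>))"
    have "ap M (eval M e ?I) v = v" if "v \<in> carr M \<sigma>" for e v
      using that S_ax [OF con_types(5) con_types(5) that] K_ax [OF that K_carr [OF that]] by simp
    with Var 0 show ?thesis by (intro exI [of _ ?I]) (auto simp: has_type_simps)
  next
    case (Suc j)
    with Var show ?thesis
      by (intro exI [of _ "App (Cst (CombK \<tau> \<sigma>)) (Var j)"])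
        (auto simp: has_type_simps K_ax list_all2_conv_all_nth)
  qed
next
  case (Cst c)
  then show ?case
    by (intro exI [of _ "App (Cst (CombK \<tau> \<sigma>)) (Cst c)"]) (auto simp: has_type_simps K_ax)
next
  case (App s t)
  then obtain \<rho> where \<rho>: "has_type (\<sigma> # \<Delta>) s (\<rho> \<rightarrow> \<tau>)" "has_type (\<sigma> # \<Delta>) t \<rho>"
    by (auto simp: has_type_simps)
  from App(1) [OF \<rho>(1)] obtain s' where s': "has_type \<Delta> s' (\<sigma> \<rightarrow> \<rho> \<rightarrow> \<tau>)"
    "\<forall>e v. typed_env e \<Delta> \<longrightarrow> v \<in> carr M \<sigma> \<longrightarrow> ap M (eval M e s') v = eval M (v # e) s" by blast
  from App(2) [OF \<rho>(2)] obtain t' where t': "has_type \<Delta> t' (\<sigma> \<rightarrow> \<rho>)"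
    "\<forall>e v. typed_env e \<Delta> \<longrightarrow> v \<in> carr M \<sigma> \<longrightarrow> ap M (eval M e t') v = eval M (v # e) t" by blast
  show ?case
    using s' t' eval_carr
    by (intro exI [of _ "App (App (Cst (CombS \<sigma> \<rho> \<tau>)) s') t'"]) (auto simp: has_type_simps S_ax)
qed

text \<open>\<open>deft \<sigma>s \<tau> f\<close>: the function \<open>f\<close> of an environment of types \<open>\<sigma>s\<close> is given by a term of type \<open>\<tau>\<close>
  with parameters.\<close>

definition deft :: "ty list \<Rightarrow> ty \<Rightarrow> ('a list \<Rightarrow> 'a) \<Rightarrow> bool" where
  "deft \<sigma>s \<tau> f \<longleftrightarrow> (\<exists>\<Delta> ps t. typed_env ps \<Delta> \<and> has_type (\<sigma>s @ \<Delta>) t \<tau> \<and>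
     (\<forall>e. typed_env e \<sigma>s \<longrightarrow> f e = eval M (e @ ps) t))"

lemma deft_cong: "deft \<sigma>s \<tau> f \<Longrightarrow> (\<And>e. typed_env e \<sigma>s \<Longrightarrow> f e = g e) \<Longrightarrow> deft \<sigma>s \<tau> g"
  unfolding deft_def by metis

lemma deft_const: "v \<in> carr M \<tau> \<Longrightarrow> deft \<sigma>s \<tau> (\<lambda>e. v)"
  unfolding deft_def
  by (rule exI [of _ "[\<tau>]"], rule exI [of _ "[v]"], rule exI [of _ "Var (length \<sigma>s)"])
    (auto simp: has_type_simps nth_append dest: list_all2_lengthD)

lemma deft_var: "i < length \<sigma>s \<Longrightarrow> deft \<sigma>s (\<sigma>s ! i) (\<lambda>e. e ! i)"
  unfolding deft_def
  by (rule exI [of _ "[]"], rule exI [of _ "[]"], rule exI [of _ "Var i"])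
    (auto simp: has_type_simps nth_append dest: list_all2_lengthD)

lemma deft_carr: "deft \<sigma>s \<tau> f \<Longrightarrow> typed_env e \<sigma>s \<Longrightarrow> f e \<in> carr M \<tau>"
  unfolding deft_def by (metis eval_carr list_all2_appendI)

text \<open>When two lists of parameters are concatenated, those of the second list move past the
  first, while the proper arguments stay in front.\<close>

lemma shift_params:
  fixes \<sigma>s \<Delta> \<Delta>' :: "ty list"
  defines "r \<equiv> \<lambda>i. Var (if i < length \<sigma>s then i else i + length \<Delta>)"
  shows "typed_sub (\<sigma>s @ \<Delta> @ \<Delta>') r (\<sigma>s @ \<Delta>')"
    and "typed_env e \<sigma>s \<Longrightarrow> typed_env ps \<Delta> \<Longrightarrow> typed_env ps' \<Delta>' \<Longrightarrow> i < length (\<sigma>s @ \<Delta>') \<Longrightarrow>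
      (e @ ps') ! i = eval M (e @ ps @ ps') (r i)"
  by (auto simp: r_def typed_sub_def has_type_simps nth_append list_all2_conv_all_nth intro!: arg_cong [of _ _ "nth \<Delta>'"] arg_cong [of _ _ "nth ps'"])

lemma deft_common:
  assumes "deft \<sigma>s \<rho> f" "deft \<sigma>s \<tau> g"
  shows "\<exists>\<Delta> ps s t. typed_env ps \<Delta> \<and> has_type (\<sigma>s @ \<Delta>) s \<rho> \<and> has_type (\<sigma>s @ \<Delta>) t \<tau> \<and>
     (\<forall>e. typed_env e \<sigma>s \<longrightarrow> f e = eval M (e @ ps) s \<and> g e = eval M (e @ ps) t)"
proof -
  obtain \<Delta> ps s where f: "typed_env ps \<Delta>" "has_type (\<sigma>s @ \<Delta>) s \<rho>"
    "\<And>e. typed_env e \<sigma>s \<Longrightarrow> f e = eval M (e @ ps) s" using assms(1) unfolding deft_def by blast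
  obtain \<Delta>' ps' t where g: "typed_env ps' \<Delta>'" "has_type (\<sigma>s @ \<Delta>') t \<tau>"
    "\<And>e. typed_env e \<sigma>s \<Longrightarrow> g e = eval M (e @ ps') t" using assms(2) unfolding deft_def by blast
  let ?r = "\<lambda>i. Var (if i < length \<sigma>s then i else i + length \<Delta>)"
  have "typed_sub (\<sigma>s @ \<Delta> @ \<Delta>') Var (\<sigma>s @ \<Delta>)"
    by (auto simp: typed_sub_def has_type_simps nth_append)
  then have s: "has_type (\<sigma>s @ \<Delta> @ \<Delta>') s \<rho>" using sub_tm_type [OF f(2)] by fastforce
  have t: "has_type (\<sigma>s @ \<Delta> @ \<Delta>') (sub_tm ?r t) \<tau>"
    using sub_tm_type [OF g(2) shift_params(1)] .
  have "f e = eval M (e @ ps @ ps') s \<and> g e = eval M (e @ ps @ ps') (sub_tm ?r t)" if e: "typed_env e \<sigma>s" for e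
  proof
    have "eval M (e @ ps @ ps') (sub_tm Var s) = eval M (e @ ps) s"
      by (rule eval_sub [OF f(2)]) (use e f(1) in \<open>auto simp: nth_append dest!: list_all2_lengthD\<close>)
    then show "f e = eval M (e @ ps @ ps') s" using f(3) e by simp
    show "g e = eval M (e @ ps @ ps') (sub_tm ?r t)"
      using eval_sub [OF g(2) shift_params(2) [OF e f(1) g(1)]] g(3) e by simp
  qed
  moreover have "typed_env (ps @ ps') (\<Delta> @ \<Delta>')" using f g by (auto intro: list_all2_appendI)
  ultimately show ?thesis
    using s t by (intro exI [of _ "\<Delta> @ \<Delta>'"] exI [of _ "ps @ ps'"] exI [of _ s] exI [of _ "sub_tm ?r t"]) auto
qed

lemma deft_ap:
  assumes "deft \<sigma>s (\<rho> \<rightarrow> \<tau>) f" "deft \<sigma>s \<rho> g"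
  shows "deft \<sigma>s \<tau> (\<lambda>e. ap M (f e) (g e))"
proof -
  from deft_common [OF assms] obtain \<Delta> ps s t where "typed_env ps \<Delta>" "has_type (\<sigma>s @ \<Delta>) s (\<rho> \<rightarrow> \<tau>)"
    "has_type (\<sigma>s @ \<Delta>) t \<rho>" "\<forall>e. typed_env e \<sigma>s \<longrightarrow> f e = eval M (e @ ps) s \<and> g e = eval M (e @ ps) t" by blast
  then show ?thesis
    unfolding deft_def by (intro exI [of _ \<Delta>] exI [of _ ps] exI [of _ "App s t"]) (auto simp: has_type_simps)
qed

lemma deft_lam:
  assumes "deft (\<sigma> # \<sigma>s) \<tau> f"
  shows "\<exists>g. deft \<sigma>s (\<sigma> \<rightarrow> \<tau>) g \<and> (\<forall>e v. typed_env e \<sigma>s \<longrightarrow> v \<in> carr M \<sigma> \<longrightarrow> ap M (g e) v = f (v # e))"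
proof -
  from assms obtain \<Delta> ps t where t: "typed_env ps \<Delta>" "has_type (\<sigma> # \<sigma>s @ \<Delta>) t \<tau>"
    "\<And>e. typed_env e (\<sigma> # \<sigma>s) \<Longrightarrow> f e = eval M (e @ ps) t" unfolding deft_def by auto
  from abstraction [OF t(2)] obtain t' where t': "has_type (\<sigma>s @ \<Delta>) t' (\<sigma> \<rightarrow> \<tau>)"
    "\<And>e v. typed_env e (\<sigma>s @ \<Delta>) \<Longrightarrow> v \<in> carr M \<sigma> \<Longrightarrow> ap M (eval M e t') v = eval M (v # e) t" by blast
  show ?thesis
  proof (intro exI [of _ "\<lambda>e. eval M (e @ ps) t'"] conjI allI impI)
    show "deft \<sigma>s (\<sigma> \<rightarrow> \<tau>) (\<lambda>e. eval M (e @ ps) t')" unfolding deft_def using t t' by blast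
    fix e v assume "typed_env e \<sigma>s" "v \<in> carr M \<sigma>"
    then show "ap M (eval M (e @ ps) t') v = f (v # e)"
      using t t'(2) [of "e @ ps" v] by (auto intro: list_all2_appendI)
  qed
qed

lemma deft_tl: assumes "deft \<sigma>s \<tau> f" shows "deft (\<sigma> # \<sigma>s) \<tau> (\<lambda>e. f (tl e))"
proof -
  from assms obtain \<Delta> ps t where t: "typed_env ps \<Delta>" "has_type (\<sigma>s @ \<Delta>) t \<tau>"
    "\<And>e. typed_env e \<sigma>s \<Longrightarrow> f e = eval M (e @ ps) t" unfolding deft_def by auto
  let ?t = "sub_tm (\<lambda>i. Var (Suc i)) t"
  have "has_type ((\<sigma> # \<sigma>s) @ \<Delta>) ?t \<tau>"
    by (rule sub_tm_type [OF t(2)]) (simp add: typed_sub_def has_type_simps)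
  moreover have "f (tl e) = eval M (e @ ps) ?t" if e: "typed_env e (\<sigma> # \<sigma>s)" for e
  proof -
    from e obtain v e' where e': "e = v # e'" "typed_env e' \<sigma>s" by (auto simp: list_all2_Cons2)
    have "eval M ((v # e') @ ps) ?t = eval M (e' @ ps) t"
      by (rule eval_sub [OF t(2)]) simp
    with t(3) [OF e'(2)] e' show ?thesis by simp
  qed
  ultimately show ?thesis using t(1) unfolding deft_def by blast
qed

text \<open>The predicates to which the schemes of induction and choice apply directly.\<close>

definition defq :: "ty list \<Rightarrow> ('a list \<Rightarrow> bool) \<Rightarrow> bool" where
  "defq \<sigma>s P \<longleftrightarrow> (\<exists>\<Delta> ps A. typed_env ps \<Delta> \<and> wff (\<sigma>s @ \<Delta>) A \<and> quantifier_free A \<and>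
     (\<forall>e. typed_env e \<sigma>s \<longrightarrow> P e = sat M (e @ ps) A))"

lemma defq_eq: "deft \<sigma>s T0 f \<Longrightarrow> deft \<sigma>s T0 g \<Longrightarrow> defq \<sigma>s (\<lambda>e. f e = g e)"
  and defq_less: "deft \<sigma>s T0 f \<Longrightarrow> deft \<sigma>s T0 g \<Longrightarrow> defq \<sigma>s (\<lambda>e. ltr M (f e) (g e))"
proof -
  assume "deft \<sigma>s T0 f" "deft \<sigma>s T0 g"
  from deft_common [OF this] obtain \<Delta> ps s t where *: "typed_env ps \<Delta>" "has_type (\<sigma>s @ \<Delta>) s T0"
    "has_type (\<sigma>s @ \<Delta>) t T0" "\<forall>e. typed_env e \<sigma>s \<longrightarrow> f e = eval M (e @ ps) s \<and> g e = eval M (e @ ps) t" by blast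
  show "defq \<sigma>s (\<lambda>e. f e = g e)"
    unfolding defq_def
    by (rule exI [of _ \<Delta>], rule exI [of _ ps], rule exI [of _ "Eq s t"]) (use * in \<open>auto simp: eqr_eq\<close>)
  show "defq \<sigma>s (\<lambda>e. ltr M (f e) (g e))"
    unfolding defq_def
    by (rule exI [of _ \<Delta>], rule exI [of _ ps], rule exI [of _ "Less s t"]) (use * in auto)
qed

lemma defq_imp:
  assumes "defq \<sigma>s P" "defq \<sigma>s Q" shows "defq \<sigma>s (\<lambda>e. P e \<longrightarrow> Q e)"
proof -
  obtain \<Delta> ps A where f: "typed_env ps \<Delta>" "wff (\<sigma>s @ \<Delta>) A" "quantifier_free A"
    "\<And>e. typed_env e \<sigma>s \<Longrightarrow> P e = sat M (e @ ps) A" using assms(1) unfolding defq_def by blast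
  obtain \<Delta>' ps' B where g: "typed_env ps' \<Delta>'" "wff (\<sigma>s @ \<Delta>') B" "quantifier_free B"
    "\<And>e. typed_env e \<sigma>s \<Longrightarrow> Q e = sat M (e @ ps') B" using assms(2) unfolding defq_def by blast
  let ?r = "\<lambda>i. Var (if i < length \<sigma>s then i else i + length \<Delta>)"
  have qf: "quantifier_free (sub_fm \<sigma> C) \<longleftrightarrow> quantifier_free C" for \<sigma> C by (induct C arbitrary: \<sigma>) auto
  have "typed_sub (\<sigma>s @ \<Delta> @ \<Delta>') Var (\<sigma>s @ \<Delta>)"
    by (auto simp: typed_sub_def has_type_simps nth_append)
  then have s: "wff (\<sigma>s @ \<Delta> @ \<Delta>') A" using sub_fm_wff [OF f(2)] by fastforce
  have t: "wff (\<sigma>s @ \<Delta> @ \<Delta>') (sub_fm ?r B)"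
    using sub_fm_wff [OF g(2) shift_params(1)] .
  have "P e = sat M (e @ ps @ ps') A \<and> Q e = sat M (e @ ps @ ps') (sub_fm ?r B)" if e: "typed_env e \<sigma>s" for e
  proof
    have "sat M (e @ ps @ ps') (sub_fm Var A) = sat M (e @ ps) A"
      by (rule sat_sub [OF f(2)]) (use e f(1) in \<open>auto simp: nth_append dest!: list_all2_lengthD\<close>)
    then show "P e = sat M (e @ ps @ ps') A" using f(4) e by simp
    show "Q e = sat M (e @ ps @ ps') (sub_fm ?r B)"
      using sat_sub [OF g(2) shift_params(2) [OF e f(1) g(1)]] g(4) e by simp
  qed
  moreover have "typed_env (ps @ ps') (\<Delta> @ \<Delta>')" using f g by (auto intro: list_all2_appendI)
  ultimately show ?thesis
    unfolding defq_def
    by (intro exI [of _ "\<Delta> @ \<Delta>'"] exI [of _ "ps @ ps'"] exI [of _ "Imp A (sub_fm ?r B)"])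
      (use s t f(3) g(3) in \<open>auto simp: qf\<close>)
qed

lemma defq_False: "defq \<sigma>s (\<lambda>e. False)"
  unfolding defq_def by (rule exI [of _ "[]"], rule exI [of _ "[]"], rule exI [of _ Fls]) auto

lemma defq_not: "defq \<sigma>s P \<Longrightarrow> defq \<sigma>s (\<lambda>e. \<not> P e)"
  using defq_imp [OF _ defq_False] by simp

lemma defq_or: "defq \<sigma>s P \<Longrightarrow> defq \<sigma>s Q \<Longrightarrow> defq \<sigma>s (\<lambda>e. P e \<or> Q e)"
  using defq_imp [OF defq_not] by (simp add: disj_imp)

lemma induction_qf:
  assumes P: "defq [T0] (\<lambda>e. P (e ! 0))" and z: "P (con M Zero)"
    and s: "\<And>n. n \<in> carr M T0 \<Longrightarrow> P n \<Longrightarrow> P (pl M n (con M One))" and n: "n \<in> carr M T0"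
  shows "P n"
proof -
  obtain \<Delta> ps A where A': "typed_env ps \<Delta>" "wff ([T0] @ \<Delta>) A" "quantifier_free A"
    "\<forall>e. typed_env e [T0] \<longrightarrow> P (e ! 0) = sat M (e @ ps) A" using P unfolding defq_def by blast
  have A: "typed_env ps \<Delta>" "wff (T0 # \<Delta>) A" "quantifier_free A"
    "\<And>n. n \<in> carr M T0 \<Longrightarrow> P n = sat M (n # ps) A"
    using A'(1,2,3) A'(4) [rule_format, of "[_]"] by simp_all
  have "sat M [] (induction_axiom \<Delta> A)"
    by (rule ax [OF ACA0w_axioms(7)]) (use A in auto)
  from sat_close [OF this [unfolded induction_axiom_def] A(1)]
  have i: "sat M ps (inst (Cst Zero) A) \<longrightarrow> (\<forall>v\<in>carr M T0. sat M (v # ps) A \<longrightarrow>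
      sat M (v # ps) (sub_fm (case_nat (App (App (Cst Plus) (Var 0)) (Cst One)) (\<lambda>i. Var (Suc i))) A)) \<longrightarrow>
      (\<forall>v\<in>carr M T0. sat M (v # ps) A)" by simp
  note zc = con_types(1)
  have pc: "pl M v (con M One) \<in> carr M T0" if "v \<in> carr M T0" for v
    unfolding pl_def by (rule ap_carr [OF ap_carr [OF con_types(3) that] con_types(2)])
  have "sat M ps (inst (Cst Zero) A) \<longleftrightarrow> sat M (con M Zero # ps) A"
    unfolding inst_def by (rule sat_sub [OF A(2)]) (auto simp: nth_Cons split: nat.split)
  moreover have "sat M (v # ps) (sub_fm (case_nat (App (App (Cst Plus) (Var 0)) (Cst One)) (\<lambda>i. Var (Suc i))) A)
      \<longleftrightarrow> sat M (pl M v (con M One) # ps) A" for v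
    by (rule sat_sub [OF A(2)]) (auto simp: nth_Cons pl_def split: nat.split)
  moreover have "sat M (con M Zero # ps) A" using A(4) [OF zc] z by simp
  moreover have "sat M (pl M v (con M One) # ps) A" if "v \<in> carr M T0" "sat M (v # ps) A" for v
    using A(4) [OF pc [OF that(1)]] A(4) [OF that(1)] s [OF that(1)] that(2) by blast
  ultimately have "\<forall>v\<in>carr M T0. sat M (v # ps) A" using i by blast
  then show ?thesis using A(4) n by blast
qed

lemma choice_qf:
  assumes P: "defq [T0, T1] (\<lambda>e. P (e ! 1) (e ! 0))"
    and ex: "\<And>x. x \<in> carr M T1 \<Longrightarrow> \<exists>n\<in>carr M T0. P x n"
  shows "\<exists>Y\<in>carr M (T1 \<rightarrow> T0). \<forall>x\<in>carr M T1. P x (ap M Y x)"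
proof -
  obtain \<Delta> ps A where A': "typed_env ps \<Delta>" "wff ([T0, T1] @ \<Delta>) A" "quantifier_free A"
    "\<forall>e. typed_env e [T0, T1] \<longrightarrow> P (e ! 1) (e ! 0) = sat M (e @ ps) A" using P unfolding defq_def by blast
  have A: "typed_env ps \<Delta>" "wff (T0 # T1 # \<Delta>) A" "quantifier_free A"
    "\<And>x n. x \<in> carr M T1 \<Longrightarrow> n \<in> carr M T0 \<Longrightarrow> P x n = sat M (n # x # ps) A"
    using A'(1,2,3) A'(4) [rule_format, of "[_, _]"] by simp_all
  have "sat M [] (choice_axiom T1 T0 \<Delta> A)"
    by (rule ax [OF ACA0w_axioms(8)]) (use A in auto)
  from sat_close [OF this [unfolded choice_axiom_def] A(1)]
  have i: "(\<forall>x\<in>carr M T1. \<exists>n\<in>carr M T0. sat M (n # x # ps) A) \<longrightarrow>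
      (\<exists>Y\<in>carr M (T1 \<rightarrow> T0). \<forall>x\<in>carr M T1.
        sat M (x # Y # ps) (sub_fm (case_nat (App (Var 1) (Var 0)) (case_nat (Var 0) (\<lambda>i. Var (i + 2)))) A))"
    by simp
  have "sat M (x # Y # ps) (sub_fm (case_nat (App (Var 1) (Var 0)) (case_nat (Var 0) (\<lambda>i. Var (i + 2)))) A)
     \<longleftrightarrow> sat M (ap M Y x # x # ps) A" for x Y
    by (rule sat_sub [OF A(2)]) (auto simp: nth_Cons split: nat.split)
  moreover have "\<forall>x\<in>carr M T1. \<exists>n\<in>carr M T0. sat M (n # x # ps) A" using ex A(4) by metis
  ultimately obtain Y where "Y \<in> carr M (T1 \<rightarrow> T0)" "\<forall>x\<in>carr M T1. sat M (ap M Y x # x # ps) A"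
    using i by auto
  then show ?thesis using A(4) ap_carr by (intro bexI [of _ Y]) auto
qed

end

section \<open>Ordered fields over an ordered semiring\<close>

\<comment> \<open>Formal differences of an ordered semiring, built as the integers are built from
  the natural numbers.\<close>
quotient_type (overloaded) 'n dif = "'n::linordered_semidom \<times> 'n" / "\<lambda>(a, b) (c, d). a + d = c + b"
  morphisms Rep_dif Abs_dif
proof (rule equivpI)
  show "symp (\<lambda>(a, b) (c, d). a + d = c + (b :: 'n))" by (auto simp: symp_def)
  show "transp (\<lambda>(a, b) (c, d). a + d = c + (b :: 'n))"
  proof (clarsimp simp: transp_def)
    fix a b c d u v :: 'n assume "a + d = c + b" "c + v = u + d"
    then have "(a + v) + (c + d) = (u + b) + (c + d)" by (metis add.assoc add.commute)
    then show "a + v = u + b" by simp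
  qed
qed (auto simp: reflp_def)

instantiation dif :: (linordered_semidom) comm_ring_1
begin

lift_definition zero_dif :: "'a dif" is "(0, 0)" .
lift_definition one_dif :: "'a dif" is "(1, 0)" .
lift_definition plus_dif :: "'a dif \<Rightarrow> 'a dif \<Rightarrow> 'a dif" is "\<lambda>(a, b) (c, d). (a + c, b + d)"
  by (auto simp: algebra_simps) (metis add.assoc add.left_commute)
lift_definition uminus_dif :: "'a dif \<Rightarrow> 'a dif" is "\<lambda>(a, b). (b, a)"
  by (auto simp: add.commute)
lift_definition minus_dif :: "'a dif \<Rightarrow> 'a dif \<Rightarrow> 'a dif" is "\<lambda>(a, b) (c, d). (a + d, b + c)"
  by (auto simp: algebra_simps) (metis add.assoc add.left_commute)
lift_definition times_dif :: "'a dif \<Rightarrow> 'a dif \<Rightarrow> 'a dif" is "\<lambda>(a, b) (c, d). (a * c + b * d, a * d + b * c)"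
proof clarsimp
  fix a b a' b' c d c' d' :: 'a
  assume 1: "a + b' = a' + b" and 2: "c + d' = c' + d"
  \<comment> \<open>Both equations are multiplied crosswise; after expansion the two sides share
    four products, which are then cancelled.\<close>
  have "(a + b') * c + (a' + b) * d + a' * (c + d') + b' * (c' + d) =
        (a' + b) * c + (a + b') * d + a' * (c' + d) + b' * (c + d')"
    by (simp only: 1 2)
  then have "(a * c + b * d + (a' * d' + b' * c')) + (b' * c + a' * d + a' * c + b' * d) =
     (a' * c' + b' * d' + (a * d + b * c)) + (b' * c + a' * d + a' * c + b' * d)"
    by (simp add: algebra_simps)
  then show "a * c + b * d + (a' * d' + b' * c') = a' * c' + b' * d' + (a * d + b * c)"
    by (rule add_right_imp_eq)
qed

instance
  by standard (transfer; clarsimp simp: algebra_simps)+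

end

lift_definition mk_dif :: "'n::linordered_semidom \<Rightarrow> 'n \<Rightarrow> 'n dif" is Pair .

lemma mk_dif_cases: "\<exists>a b. x = mk_dif a b"
  by transfer auto

lemma mk_dif_zero: "0 = mk_dif 0 0"
  by transfer simp

lemma add_cross_mono:
  fixes a b c d e f :: "'n::linordered_semidom"
  assumes "a + d \<le> c + b" shows "e + a + (f + d) \<le> e + c + (f + b)"
proof -
  have "(e + f) + (a + d) \<le> (e + f) + (c + b)" using assms by (rule add_left_mono)
  then show ?thesis by (simp only: ac_simps)
qed

text \<open>With \<open>e = f + g\<close> and \<open>g\<close> positive, the two sides have a common
  part and differ only in \<open>g * (a + d)\<close> against \<open>g * (c + b)\<close>.\<close>

lemma mult_cross_mono:
  fixes a b c d e f :: "'n::linordered_semidom"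
  assumes "f < e" "a + d < c + b"
  shows "e * a + f * b + (e * d + f * c) < e * c + f * d + (e * b + f * a)"
proof -
  define g where "g = e - f"
  have e: "e = f + g" using assms(1) by (simp add: g_def less_imp_le)
  then have "f + 0 < f + g" using assms(1) by simp
  then have "0 < g" by (simp only: add_less_cancel_left)
  then have "g * (a + d) < g * (c + b)" using assms(2) by (simp add: mult_strict_left_mono)
  then have k: "f * (a + b + c + d) + g * (a + d) < f * (a + b + c + d) + g * (c + b)" by simp
  have 1: "e * a + f * b + (e * d + f * c) = f * (a + b + c + d) + g * (a + d)"
    by (simp add: e algebra_simps)
  have 2: "e * c + f * d + (e * b + f * a) = f * (a + b + c + d) + g * (c + b)"
    by (simp add: e algebra_simps)
  show ?thesis using k unfolding 1 2 .
qed

instantiation dif :: (linordered_semidom) linordered_idom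
begin

lift_definition less_eq_dif :: "'a dif \<Rightarrow> 'a dif \<Rightarrow> bool" is "\<lambda>(a, b) (c, d). a + d \<le> c + b"
proof clarsimp
  fix a b a' b' c d c' d' :: 'a
  assume 1: "a + b' = a' + b" and 2: "c + d' = c' + d"
  have "a + d \<le> c + b \<longleftrightarrow> (a + d) + (b' + d') \<le> (c + b) + (b' + d')" by simp
  also have "\<dots> \<longleftrightarrow> (a + b') + (d + d') \<le> (c + d') + (b + b')" by (simp only: ac_simps)
  also have "\<dots> \<longleftrightarrow> (a' + d') + (b + d) \<le> (c' + b') + (b + d)" by (simp only: 1 2 ac_simps)
  finally show "a + d \<le> c + b \<longleftrightarrow> a' + d' \<le> c' + b'" by simp
qed

definition less_dif :: "'a dif \<Rightarrow> 'a dif \<Rightarrow> bool" where "less_dif x y \<longleftrightarrow> x \<le> y \<and> \<not> y \<le> x"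
definition abs_dif :: "'a dif \<Rightarrow> 'a dif" where "abs_dif x = (if x < 0 then - x else x)"
definition sgn_dif :: "'a dif \<Rightarrow> 'a dif" where "sgn_dif x = (if x = 0 then 0 else if 0 < x then 1 else - 1)"

instance
proof
  fix x y z :: "'a dif"
  show "x < y \<longleftrightarrow> x \<le> y \<and> \<not> y \<le> x" by (rule less_dif_def)
  show "x \<le> x" by transfer auto
  show "x \<le> z" if "x \<le> y" "y \<le> z"
    using that
  proof (transfer, clarsimp)
    fix a b c d u v :: 'a assume "a + d \<le> c + b" "c + v \<le> u + d"
    then have "(a + d) + (c + v) \<le> (c + b) + (u + d)" by (rule add_mono)
    then have "(a + v) + (c + d) \<le> (u + b) + (c + d)" by (simp only: ac_simps)
    then show "a + v \<le> u + b" by simp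
  qed
  show "x = y" if "x \<le> y" "y \<le> x" using that by transfer auto
  show "x \<le> y \<or> y \<le> x" by transfer auto
  show "z + x \<le> z + y" if "x \<le> y"
    using that by transfer (auto intro: add_cross_mono)
  show "\<bar>x\<bar> = (if x < 0 then - x else x)" by (rule abs_dif_def)
  show "sgn x = (if x = 0 then 0 else if 0 < x then 1 else - 1)" by (rule sgn_dif_def)
  show "z * x < z * y" if "x < y" "0 < z"
  proof -
    obtain a b c d e f where *: "x = mk_dif a b" "y = mk_dif c d" "z = mk_dif e f"
      using mk_dif_cases by metis
    have less: "mk_dif p q < mk_dif r s \<longleftrightarrow> p + s < r + q" for p q r s :: 'a
      unfolding less_dif_def by transfer auto
    have times: "mk_dif p q * mk_dif r s = mk_dif (p * r + q * s) (p * s + q * r)" for p q r s :: 'a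
      by transfer simp
    have "f < e" using that(2) unfolding * mk_dif_zero less by simp
    then show ?thesis using that(1) unfolding * less times by (rule mult_cross_mono)
  qed
qed

end

lift_definition dif_of :: "'n::linordered_semidom \<Rightarrow> 'n dif" is "\<lambda>a. (a, 0)" .

lemma dif_of_hom: "dif_of (a + b) = dif_of a + dif_of b" "dif_of (a * b) = dif_of a * dif_of b"
  "dif_of 1 = 1" "dif_of 0 = 0"
  by (transfer; simp)+

lemma dif_of_le: "dif_of a \<le> dif_of b \<longleftrightarrow> a \<le> b"
  by transfer simp

lemma dif_cases: "\<exists>a b. x = dif_of a - dif_of b"
  by transfer auto

text \<open>The completion consists of Cauchy sequences indexed by an arbitrary linear order, which will
  be a possibly nonstandard model of the natural numbers.\<close>

definition cauchy :: "('n::linorder \<Rightarrow> 'k::linordered_field) \<Rightarrow> bool" where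
  "cauchy X \<longleftrightarrow> (\<forall>e>0. \<forall>\<^sub>F p in at_top \<times>\<^sub>F at_top. \<bar>X (fst p) - X (snd p)\<bar> < e)"

definition null :: "('n::linorder \<Rightarrow> 'k::linordered_field) \<Rightarrow> bool" where
  "null X \<longleftrightarrow> (\<forall>e>0. \<forall>\<^sub>F n in at_top. \<bar>X n\<bar> < e)"

definition pos :: "('n::linorder \<Rightarrow> 'k::linordered_field) \<Rightarrow> bool" where
  "pos X \<longleftrightarrow> (\<exists>r>0. \<forall>\<^sub>F n in at_top. r < X n)"

lemma eventually_fst_snd:
  assumes "eventually P F"
  shows "\<forall>\<^sub>F p in F \<times>\<^sub>F G. P (fst p)" "\<forall>\<^sub>F p in G \<times>\<^sub>F F. P (snd p)"
  unfolding eventually_prod_filter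
  by (rule exI [of _ P], rule exI [of _ "\<lambda>_. True"], simp add: assms)
    (rule exI [of _ "\<lambda>_. True"], rule exI [of _ P], simp add: assms)

lemma cauchyD:
  assumes "cauchy X" "0 < e"
  obtains k where "\<And>m n. k \<le> m \<Longrightarrow> k \<le> n \<Longrightarrow> \<bar>X m - X n\<bar> < e"
proof -
  obtain P Q where "eventually P at_top" "eventually Q at_top" and
    pq: "\<forall>x y. P x \<longrightarrow> Q y \<longrightarrow> \<bar>X x - X y\<bar> < e"
    using assms by (auto simp: cauchy_def eventually_prod_filter)
  then obtain i j where "\<And>n. i \<le> n \<Longrightarrow> P n" "\<And>n. j \<le> n \<Longrightarrow> Q n"
    by (auto simp: eventually_at_top_linorder)
  with pq show thesis by (intro that [of "max i j"]) auto
qed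

lemma cauchyI:
  fixes X :: "'n::linorder \<Rightarrow> 'k::linordered_field"
  assumes "\<And>e. 0 < e \<Longrightarrow> \<exists>k. \<forall>m\<ge>k. \<forall>n\<ge>k. \<bar>X m - X n\<bar> < e"
  shows "cauchy X"
  unfolding cauchy_def
proof (intro allI impI)
  fix e :: 'k assume "0 < e"
  with assms obtain k where k: "\<forall>m\<ge>k. \<forall>n\<ge>k. \<bar>X m - X n\<bar> < e" by blast
  have "\<forall>\<^sub>F n in at_top. k \<le> n" by (rule eventually_ge_at_top)
  then show "\<forall>\<^sub>F p in at_top \<times>\<^sub>F at_top. \<bar>X (fst p) - X (snd p)\<bar> < e"
    unfolding eventually_prod_filter
    by (intro exI [of _ "\<lambda>n. k \<le> n"] conjI) (use k in auto)
qed

lemma cauchy_bounded: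
  assumes "cauchy X" shows "\<exists>b>0. \<forall>\<^sub>F n in at_top. \<bar>X n\<bar> < b"
proof -
  obtain k where k: "\<And>m n. k \<le> m \<Longrightarrow> k \<le> n \<Longrightarrow> \<bar>X m - X n\<bar> < 1"
    using cauchyD [OF assms zero_less_one] by blast
  have "\<bar>X n\<bar> < \<bar>X k\<bar> + 1" if "k \<le> n" for n using k [of n k] that by auto
  then have "\<forall>\<^sub>F n in at_top. \<bar>X n\<bar> < \<bar>X k\<bar> + 1"
    unfolding eventually_at_top_linorder by blast
  then show ?thesis by (intro exI [of _ "\<bar>X k\<bar> + 1"]) auto
qed

lemma cauchy_const: "cauchy (\<lambda>n. c)" by (simp add: cauchy_def)

lemma cauchy_add: "cauchy X \<Longrightarrow> cauchy Y \<Longrightarrow> cauchy (\<lambda>n. X n + Y n)"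
  unfolding cauchy_def
proof (intro allI impI)
  fix e :: 'b assume X: "\<forall>e>0. \<forall>\<^sub>F p in at_top \<times>\<^sub>F at_top. \<bar>X (fst p) - X (snd p)\<bar> < e"
    and Y: "\<forall>e>0. \<forall>\<^sub>F p in at_top \<times>\<^sub>F at_top. \<bar>Y (fst p) - Y (snd p)\<bar> < e" and e: "0 < e"
  then have "0 < e / 2" by simp
  from X [rule_format, OF this] Y [rule_format, OF this]
  show "\<forall>\<^sub>F p in at_top \<times>\<^sub>F at_top. \<bar>X (fst p) + Y (fst p) - (X (snd p) + Y (snd p))\<bar> < e"
    by eventually_elim linarith
qed

lemma cauchy_uminus: "cauchy X \<Longrightarrow> cauchy (\<lambda>n. - X n)"
  unfolding cauchy_def by (simp add: abs_minus_commute)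

lemma null_add: "null X \<Longrightarrow> null Y \<Longrightarrow> null (\<lambda>n. X n + Y n)"
  unfolding null_def
proof (intro allI impI)
  fix e :: 'b assume X: "\<forall>e>0. \<forall>\<^sub>F n in at_top. \<bar>X n\<bar> < e" and Y: "\<forall>e>0. \<forall>\<^sub>F n in at_top. \<bar>Y n\<bar> < e" and "0 < e"
  then have "0 < e / 2" by simp
  from X [rule_format, OF this] Y [rule_format, OF this]
  show "\<forall>\<^sub>F n in at_top. \<bar>X n + Y n\<bar> < e"
    by eventually_elim linarith
qed

lemma null_uminus: "null X \<Longrightarrow> null (\<lambda>n. - X n)"
  unfolding null_def by simp

lemma null_mult_bounded:
  assumes "null X" "0 < b" "\<forall>\<^sub>F n in at_top. \<bar>Y n\<bar> < b"
  shows "null (\<lambda>n. X n * Y n)"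
  unfolding null_def
proof (intro allI impI)
  fix e :: 'b assume "0 < e"
  then have "\<forall>\<^sub>F n in at_top. \<bar>X n\<bar> < e / b" using assms by (auto simp: null_def)
  with assms(3) show "\<forall>\<^sub>F n in at_top. \<bar>X n * Y n\<bar> < e"
  proof eventually_elim
    case (elim n)
    have "\<bar>X n\<bar> * \<bar>Y n\<bar> < (e / b) * b" using elim by (intro mult_strict_mono) (use assms in auto)
    then show ?case using assms by (simp add: abs_mult)
  qed
qed

lemma cauchy_mult: assumes "cauchy X" "cauchy Y" shows "cauchy (\<lambda>n. X n * Y n)"
proof -
  obtain a b where a: "0 < a" "\<forall>\<^sub>F n in at_top. \<bar>X n\<bar> < a" and b: "0 < b" "\<forall>\<^sub>F n in at_top. \<bar>Y n\<bar> < b"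
    using cauchy_bounded assms by blast
  show ?thesis
    unfolding cauchy_def
  proof (intro allI impI)
    fix e :: 'b assume "0 < e"
    then have X: "\<forall>\<^sub>F p in at_top \<times>\<^sub>F at_top. \<bar>X (fst p) - X (snd p)\<bar> < e / 2 / b"
      and Y: "\<forall>\<^sub>F p in at_top \<times>\<^sub>F at_top. \<bar>Y (fst p) - Y (snd p)\<bar> < e / 2 / a"
      using assms a b by (auto simp: cauchy_def)
    from X Y eventually_fst_snd(2) [OF a(2)] eventually_fst_snd(1) [OF b(2)]
    show "\<forall>\<^sub>F p in at_top \<times>\<^sub>F at_top. \<bar>X (fst p) * Y (fst p) - X (snd p) * Y (snd p)\<bar> < e"
    proof eventually_elim
      case (elim p)
      obtain m n where p: "p = (m, n)" by force
      have "\<bar>X m - X n\<bar> * \<bar>Y m\<bar> < (e / 2 / b) * b" "\<bar>X n\<bar> * \<bar>Y m - Y n\<bar> < a * (e / 2 / a)"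
        using elim p a b by (intro mult_strict_mono; simp)+
      then have "\<bar>X m - X n\<bar> * \<bar>Y m\<bar> + \<bar>X n\<bar> * \<bar>Y m - Y n\<bar> < e" using a b by simp
      moreover have "X m * Y m - X n * Y n = (X m - X n) * Y m + X n * (Y m - Y n)"
        by (simp add: algebra_simps)
      ultimately show ?case
        unfolding p fst_conv snd_conv by (metis abs_mult abs_triangle_ineq le_less_trans)
    qed
  qed
qed

text \<open>Terms of absolute value at least \<open>e\<close> occur arbitrarily late, and from some
  index on all terms are within \<open>e / 2\<close> of each other, so the sign can no longer
  change.\<close>

lemma not_null:
  assumes "cauchy X" "\<not> null X" shows "pos X \<or> pos (\<lambda>n. - X n)"
proof -
  obtain e where "0 < e" and e: "\<And>k. \<exists>n\<ge>k. e \<le> \<bar>X n\<bar>"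
    using assms(2) by (auto simp: null_def eventually_at_top_linorder not_less)
  then have "0 < e / 2" by simp
  from cauchyD [OF assms(1) this] obtain k where k: "\<And>m n. k \<le> m \<Longrightarrow> k \<le> n \<Longrightarrow> \<bar>X m - X n\<bar> < e / 2"
    by blast
  obtain n where n: "k \<le> n" "e \<le> \<bar>X n\<bar>" using e by blast
  have *: "if X n > 0 then e / 2 < X m else e / 2 < - X m" if "k \<le> m" for m
    using k [OF that n(1)] n(2) by (auto simp: abs_if split: if_splits)
  show ?thesis
  proof (cases "X n > 0")
    case True
    with * have "\<forall>\<^sub>F m in at_top. e / 2 < X m" unfolding eventually_at_top_linorder by auto
    with \<open>0 < e / 2\<close> show ?thesis unfolding pos_def by blast
  next
    case False
    with * have "\<forall>\<^sub>F m in at_top. e / 2 < - X m" unfolding eventually_at_top_linorder by auto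
    with \<open>0 < e / 2\<close> show ?thesis unfolding pos_def by blast
  qed
qed

lemma not_null_away:
  assumes "cauchy X" "\<not> null X" shows "\<exists>r>0. \<forall>\<^sub>F n in at_top. r < \<bar>X n\<bar>"
proof -
  consider "pos X" | "pos (\<lambda>n. - X n)" using not_null [OF assms] by blast
  then show ?thesis
  proof cases
    case 1
    then obtain r where "0 < r" "\<forall>\<^sub>F n in at_top. r < X n" by (auto simp: pos_def)
    moreover from this(2) have "\<forall>\<^sub>F n in at_top. r < \<bar>X n\<bar>" by eventually_elim simp
    ultimately show ?thesis by blast
  next
    case 2
    then obtain r where "0 < r" "\<forall>\<^sub>F n in at_top. r < - X n" by (auto simp: pos_def)
    moreover from this(2) have "\<forall>\<^sub>F n in at_top. r < \<bar>X n\<bar>" by eventually_elim simp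
    ultimately show ?thesis by blast
  qed
qed

lemma inverse_bounded:
  assumes "cauchy X" "\<not> null X" shows "\<exists>b>0. \<forall>\<^sub>F n in at_top. X n \<noteq> 0 \<and> \<bar>inverse (X n)\<bar> < b"
proof -
  obtain r where r: "0 < r" "\<forall>\<^sub>F n in at_top. r < \<bar>X n\<bar>" using not_null_away assms by blast
  from r(2) have "\<forall>\<^sub>F n in at_top. X n \<noteq> 0 \<and> \<bar>inverse (X n)\<bar> < inverse r"
    by eventually_elim (use r(1) in \<open>auto simp: abs_inverse intro: less_imp_inverse_less\<close>)
  with r(1) show ?thesis by (intro exI [of _ "inverse r"]) simp
qed

lemma cauchy_inverse: assumes "cauchy X" "\<not> null X" shows "cauchy (\<lambda>n. inverse (X n))"
proof -
  obtain b where b: "0 < b" "\<forall>\<^sub>F n in at_top. X n \<noteq> 0 \<and> \<bar>inverse (X n)\<bar> < b"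
    using inverse_bounded assms by blast
  show ?thesis
    unfolding cauchy_def
  proof (intro allI impI)
    fix e :: 'b assume "0 < e"
    then have "0 < e / (b * b)" using b by simp
    then have X: "\<forall>\<^sub>F p in at_top \<times>\<^sub>F at_top. \<bar>X (fst p) - X (snd p)\<bar> < e / (b * b)"
      using assms(1) unfolding cauchy_def by blast
    from X eventually_fst_snd [OF b(2)]
    show "\<forall>\<^sub>F p in at_top \<times>\<^sub>F at_top. \<bar>inverse (X (fst p)) - inverse (X (snd p))\<bar> < e"
    proof eventually_elim
      case (elim p)
      obtain m n where p: "p = (m, n)" by force
      have "\<bar>inverse (X m)\<bar> * \<bar>X m - X n\<bar> \<le> b * \<bar>X m - X n\<bar>"
        using elim p by (intro mult_right_mono) auto
      also have "\<dots> < b * (e / (b * b))" using elim p b by (intro mult_strict_left_mono) auto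
      finally have "\<bar>inverse (X m)\<bar> * \<bar>X m - X n\<bar> * \<bar>inverse (X n)\<bar> < b * (e / (b * b)) * b"
        using elim p b \<open>0 < e\<close> by (intro mult_strict_mono) auto
      then have "\<bar>inverse (X m) * (X m - X n) * inverse (X n)\<bar> < e" using b by (simp add: abs_mult)
      moreover have "inverse (X m) * (X m - X n) * inverse (X n) = - (inverse (X m) - inverse (X n))"
        using elim p by (simp add: inverse_diff_inverse)
      ultimately show ?case unfolding p fst_conv snd_conv by (metis abs_minus_cancel)
    qed
  qed
qed

quotient_type (overloaded) ('n, 'k) cmp = "'n::linorder \<Rightarrow> 'k::linordered_field" / partial:
  "\<lambda>X Y. cauchy X \<and> cauchy Y \<and> null (\<lambda>n. X n - Y n)"
  morphisms Rep_cmp Abs_cmp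
proof (rule part_equivpI)
  show "\<exists>X :: 'n \<Rightarrow> 'k. cauchy X \<and> cauchy X \<and> null (\<lambda>n. X n - X n)"
    by (rule exI [of _ "\<lambda>n. 0"]) (simp add: cauchy_const null_def)
  show "symp (\<lambda>X Y :: 'n \<Rightarrow> 'k. cauchy X \<and> cauchy Y \<and> null (\<lambda>n. X n - Y n))"
    by (auto simp: symp_def dest: null_uminus)
  show "transp (\<lambda>X Y :: 'n \<Rightarrow> 'k. cauchy X \<and> cauchy Y \<and> null (\<lambda>n. X n - Y n))"
    by (auto simp: transp_def dest: null_add)
qed

lemma pos_cong: assumes "pos X" "null (\<lambda>n. X n - Y n)" shows "pos Y"
proof -
  obtain r where r: "0 < r" "\<forall>\<^sub>F n in at_top. r < X n" using assms by (auto simp: pos_def)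
  then have "0 < r / 2" by simp
  then have "\<forall>\<^sub>F n in at_top. \<bar>X n - Y n\<bar> < r / 2" using assms(2) unfolding null_def by blast
  with r(2) have "\<forall>\<^sub>F n in at_top. r / 2 < Y n" by eventually_elim linarith
  with r(1) show ?thesis unfolding pos_def by (intro exI [of _ "r / 2"]) simp
qed

lemma null_zero: "null (\<lambda>n. 0)" by (simp add: null_def)

instantiation cmp :: (linorder, linordered_field) field
begin

lift_definition zero_cmp :: "('a, 'b) cmp" is "\<lambda>n. 0" by (simp add: cauchy_const null_zero)
lift_definition one_cmp :: "('a, 'b) cmp" is "\<lambda>n. 1" by (simp add: cauchy_const null_zero)
lift_definition plus_cmp :: "('a, 'b) cmp \<Rightarrow> ('a, 'b) cmp \<Rightarrow> ('a, 'b) cmp" is "\<lambda>X Y n. X n + Y n"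
  using null_add by (fastforce simp: cauchy_add add_diff_add)
lift_definition uminus_cmp :: "('a, 'b) cmp \<Rightarrow> ('a, 'b) cmp" is "\<lambda>X n. - X n"
  by (auto simp: cauchy_uminus dest: null_uminus)
lift_definition times_cmp :: "('a, 'b) cmp \<Rightarrow> ('a, 'b) cmp \<Rightarrow> ('a, 'b) cmp" is "\<lambda>X Y n. X n * Y n"
proof -
  fix X X' Y Y' :: "'a \<Rightarrow> 'b"
  assume X: "cauchy X \<and> cauchy X' \<and> null (\<lambda>n. X n - X' n)" and Y: "cauchy Y \<and> cauchy Y' \<and> null (\<lambda>n. Y n - Y' n)"
  obtain a b where "0 < a" "\<forall>\<^sub>F n in at_top. \<bar>X' n\<bar> < a" "0 < b" "\<forall>\<^sub>F n in at_top. \<bar>Y n\<bar> < b"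
    using cauchy_bounded X Y by blast
  then have "null (\<lambda>n. (X n - X' n) * Y n + (Y n - Y' n) * X' n)"
    using X Y by (intro null_add null_mult_bounded) auto
  then have "null (\<lambda>n. X n * Y n - X' n * Y' n)" by (simp add: algebra_simps)
  with X Y show "cauchy (\<lambda>n. X n * Y n) \<and> cauchy (\<lambda>n. X' n * Y' n) \<and> null (\<lambda>n. X n * Y n - X' n * Y' n)"
    by (simp add: cauchy_mult)
qed
lift_definition inverse_cmp :: "('a, 'b) cmp \<Rightarrow> ('a, 'b) cmp" is
  "\<lambda>X. if null X then (\<lambda>n. 0) else (\<lambda>n. inverse (X n))"
proof -
  fix X Y :: "'a \<Rightarrow> 'b"
  assume a: "cauchy X \<and> cauchy Y \<and> null (\<lambda>n. X n - Y n)"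
  have iff: "null X \<longleftrightarrow> null Y"
    using a null_add [of X "\<lambda>n. - (X n - Y n)"] null_add [of Y "\<lambda>n. X n - Y n"]
      null_uminus [of "\<lambda>n. X n - Y n"] by auto
  show "cauchy (if null X then (\<lambda>n. 0) else (\<lambda>n. inverse (X n))) \<and>
    cauchy (if null Y then (\<lambda>n. 0) else (\<lambda>n. inverse (Y n))) \<and>
    null (\<lambda>n. (if null X then (\<lambda>n. 0) else (\<lambda>n. inverse (X n))) n - (if null Y then (\<lambda>n. 0) else (\<lambda>n. inverse (Y n))) n)"
  proof (cases "null X")
    case True with iff show ?thesis by (simp add: cauchy_const null_zero)
  next
    case False
    then have nY: "\<not> null Y" using iff by simp
    obtain b where b: "0 < b" "\<forall>\<^sub>F n in at_top. X n \<noteq> 0 \<and> \<bar>inverse (X n)\<bar> < b"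
      using inverse_bounded False a by blast
    obtain c where c: "0 < c" "\<forall>\<^sub>F n in at_top. Y n \<noteq> 0 \<and> \<bar>inverse (Y n)\<bar> < c"
      using inverse_bounded nY a by blast
    have "null (\<lambda>n. (X n - Y n) * inverse (X n) * inverse (Y n))"
      using b c a by (intro null_mult_bounded [of _ b] null_mult_bounded [of _ c]) (auto elim: eventually_mono)
    then have n: "null (\<lambda>n. - ((X n - Y n) * inverse (X n) * inverse (Y n)))" by (rule null_uminus)
    have "null (\<lambda>n. inverse (X n) - inverse (Y n))"
      unfolding null_def
    proof (intro allI impI)
      fix e :: 'b assume "0 < e"
      then have "\<forall>\<^sub>F n in at_top. \<bar>- ((X n - Y n) * inverse (X n) * inverse (Y n))\<bar> < e"
        using n by (auto simp: null_def)
      with b(2) c(2) show "\<forall>\<^sub>F n in at_top. \<bar>inverse (X n) - inverse (Y n)\<bar> < e"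
        by eventually_elim (simp add: inverse_diff_inverse mult.commute mult.left_commute abs_minus_commute)
    qed
    with False nY a show ?thesis by (simp add: cauchy_inverse)
  qed
qed

definition minus_cmp :: "('a, 'b) cmp \<Rightarrow> ('a, 'b) cmp \<Rightarrow> ('a, 'b) cmp" where "minus_cmp x y = x + - y"
definition divide_cmp :: "('a, 'b) cmp \<Rightarrow> ('a, 'b) cmp \<Rightarrow> ('a, 'b) cmp" where "divide_cmp x y = x * inverse y"

instance
proof
  fix x y z :: "('a, 'b) cmp"
  show "x + y + z = x + (y + z)" by transfer (auto simp: cauchy_add null_zero add.assoc)
  show "x + y = y + x" by transfer (auto simp: cauchy_add null_zero add.commute)
  show "0 + x = x" by transfer (auto simp: null_zero)
  show "- x + x = 0" by transfer (auto simp: cauchy_const null_zero)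
  show "x - y = x + - y" by (rule minus_cmp_def)
  show "x * y * z = x * (y * z)" by transfer (auto simp: cauchy_mult null_zero mult.assoc)
  show "x * y = y * x" by transfer (auto simp: cauchy_mult null_zero mult.commute)
  show "1 * x = x" by transfer (auto simp: null_zero)
  show "(x + y) * z = x * z + y * z"
    by transfer (auto simp: cauchy_add cauchy_mult null_zero distrib_right)
  show "0 \<noteq> (1 :: ('a, 'b) cmp)"
    by transfer (auto simp: null_def intro: exI [of _ 1])
  show "x div y = x * inverse y" by (rule divide_cmp_def)
  show "inverse (0 :: ('a, 'b) cmp) = 0" by transfer (auto simp: null_zero cauchy_const)
  show "inverse x * x = 1" if "x \<noteq> 0"
    using that
  proof transfer
    fix X :: "'a \<Rightarrow> 'b"
    assume "cauchy X \<and> cauchy X \<and> null (\<lambda>n. X n - X n)" and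
      "\<not> (cauchy X \<and> cauchy (\<lambda>n. 0 :: 'b) \<and> null (\<lambda>n. X n - 0))"
    then have X: "cauchy X" "\<not> null X" by (auto simp: cauchy_const)
    then obtain b where b: "\<forall>\<^sub>F n in at_top. X n \<noteq> 0 \<and> \<bar>inverse (X n)\<bar> < b"
      using inverse_bounded by blast
    have "null (\<lambda>n. inverse (X n) * X n - 1)"
      unfolding null_def using b by (auto elim: eventually_mono)
    then show "cauchy (\<lambda>n. (if null X then \<lambda>n. 0 else (\<lambda>n. inverse (X n))) n * X n) \<and>
      cauchy (\<lambda>n. 1 :: 'b) \<and> null (\<lambda>n. (if null X then \<lambda>n. 0 else (\<lambda>n. inverse (X n))) n * X n - 1)"
      using X by (simp add: cauchy_mult cauchy_inverse cauchy_const)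
  qed
qed

end

lift_definition positive :: "('n::linorder, 'k::linordered_field) cmp \<Rightarrow> bool" is pos
  using pos_cong null_uminus by fastforce

lemma positive_add: "positive x \<Longrightarrow> positive y \<Longrightarrow> positive (x + y)"
proof (transfer, clarify)
  fix X Y :: "'a \<Rightarrow> 'b" assume "pos X" "pos Y"
  then obtain r s where r: "0 < r" "\<forall>\<^sub>F n in at_top. r < X n" and s: "0 < s" "\<forall>\<^sub>F n in at_top. s < Y n"
    by (auto simp: pos_def)
  from r(2) s(2) have "\<forall>\<^sub>F n in at_top. r + s < X n + Y n" by eventually_elim (rule add_strict_mono)
  with r s show "pos (\<lambda>n. X n + Y n)" unfolding pos_def by (intro exI [of _ "r + s"]) simp
qed

lemma positive_mult: "positive x \<Longrightarrow> positive y \<Longrightarrow> positive (x * y)"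
proof (transfer, clarify)
  fix X Y :: "'a \<Rightarrow> 'b" assume "pos X" "pos Y"
  then obtain r s where r: "0 < r" "\<forall>\<^sub>F n in at_top. r < X n" and s: "0 < s" "\<forall>\<^sub>F n in at_top. s < Y n"
    by (auto simp: pos_def)
  from r(2) s(2) have "\<forall>\<^sub>F n in at_top. r * s < X n * Y n"
    by eventually_elim (rule mult_strict_mono, use r s in auto)
  with r s show "pos (\<lambda>n. X n * Y n)" unfolding pos_def by (intro exI [of _ "r * s"]) simp
qed

lemma positive_zero: "\<not> positive 0"
  by transfer (auto simp: pos_def)

lemma positive_cases: "x \<noteq> 0 \<Longrightarrow> positive x \<or> positive (- x)"
  by transfer (use not_null in \<open>auto simp: cauchy_const\<close>)

instantiation cmp :: (linorder, linordered_field) linordered_field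
begin

definition less_cmp :: "('a, 'b) cmp \<Rightarrow> ('a, 'b) cmp \<Rightarrow> bool" where "less_cmp x y \<longleftrightarrow> positive (y - x)"
definition less_eq_cmp :: "('a, 'b) cmp \<Rightarrow> ('a, 'b) cmp \<Rightarrow> bool" where "less_eq_cmp x y \<longleftrightarrow> x < y \<or> x = y"
definition abs_cmp :: "('a, 'b) cmp \<Rightarrow> ('a, 'b) cmp" where "abs_cmp x = (if x < 0 then - x else x)"
definition sgn_cmp :: "('a, 'b) cmp \<Rightarrow> ('a, 'b) cmp" where
  "sgn_cmp x = (if x = 0 then 0 else if 0 < x then 1 else - 1)"

instance
proof
  fix x y z :: "('a, 'b) cmp"
  have tr: "a < c" if "a < b" "b < c" for a b c :: "('a, 'b) cmp"
    using positive_add [of "b - a" "c - b"] that by (simp add: less_cmp_def)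
  have ir: "\<not> a < a" for a :: "('a, 'b) cmp" by (simp add: less_cmp_def positive_zero)
  show "x < y \<longleftrightarrow> x \<le> y \<and> \<not> y \<le> x" using tr [of x y x] ir [of x] by (auto simp: less_eq_cmp_def)
  show "x \<le> x" by (simp add: less_eq_cmp_def)
  show "x \<le> z" if "x \<le> y" "y \<le> z" using that tr [of x y z] by (auto simp: less_eq_cmp_def)
  show "x = y" if "x \<le> y" "y \<le> x" using that tr [of x y x] ir [of x] by (auto simp: less_eq_cmp_def)
  show "x \<le> y \<or> y \<le> x"
    using positive_cases [of "y - x"] by (auto simp: less_eq_cmp_def less_cmp_def)
  show "z + x \<le> z + y" if "x \<le> y" using that by (auto simp: less_eq_cmp_def less_cmp_def)
  show "\<bar>x\<bar> = (if x < 0 then - x else x)" by (rule abs_cmp_def)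
  show "sgn x = (if x = 0 then 0 else if 0 < x then 1 else - 1)" by (rule sgn_cmp_def)
  show "z * x < z * y" if "x < y" "0 < z"
    using positive_mult [of z "y - x"] that by (simp add: less_cmp_def right_diff_distrib)
qed

end

lift_definition cmp_of :: "'k::linordered_field \<Rightarrow> ('n::linorder, 'k) cmp" is "\<lambda>c n. c"
  by (simp add: cauchy_const null_zero)

lemma cmp_of_hom: "cmp_of (a + b) = cmp_of a + cmp_of b" "cmp_of (a * b) = cmp_of a * cmp_of b"
  "cmp_of 1 = 1" "cmp_of 0 = 0" "cmp_of (- a) = - cmp_of a"
  by (transfer; simp add: cauchy_const null_zero)+

lemma cmp_of_diff: "cmp_of (a - b) = cmp_of a - (cmp_of b :: ('n::linorder, 'k::linordered_field) cmp)"
  using cmp_of_hom(1) [of a "- b"] by (simp add: cmp_of_hom(5))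

lemma cmp_of_less: "(cmp_of a :: ('n::linorder, 'k::linordered_field) cmp) < cmp_of b \<longleftrightarrow> a < b"
proof -
  have "positive (cmp_of c :: ('n, 'k) cmp) \<longleftrightarrow> 0 < c" for c
    by transfer (auto simp: pos_def intro: exI [of _ "c / 2" for c])
  then show ?thesis unfolding less_cmp_def cmp_of_diff [symmetric] by simp
qed

lemma cmp_of_le: "(cmp_of a :: ('n::linorder, 'k::linordered_field) cmp) \<le> cmp_of b \<longleftrightarrow> a \<le> b"
  using cmp_of_less [of b a] by (auto simp: not_less [symmetric])

lemma cmp_of_inverse: "cmp_of (inverse a) = inverse (cmp_of a :: ('n::linorder, 'k::linordered_field) cmp)"
proof (cases "a = 0")
  case False
  then have "cmp_of (inverse a) * cmp_of a = (1 :: ('n, 'k) cmp)"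
    by (simp add: cmp_of_hom [symmetric])
  then show ?thesis by (metis inverse_unique mult.commute)
qed (simp add: cmp_of_hom)

lemma cmp_of_divide: "cmp_of (a / b) = cmp_of a / cmp_of b"
  by (simp add: divide_inverse cmp_of_hom cmp_of_inverse)

lift_definition cmp_lim :: "('n::linorder \<Rightarrow> 'k::linordered_field) \<Rightarrow> ('n, 'k) cmp" is
  "\<lambda>X. if cauchy X then X else (\<lambda>_. 0)"
  by (simp add: cauchy_const null_zero)

lemma cmp_lim_cases:
  fixes x :: "('n::linorder, 'k::linordered_field) cmp"
  obtains X where "cauchy X" "x = cmp_lim X"
proof -
  have "\<exists>X. cauchy X \<and> x = cmp_lim X"
  proof transfer
    fix x :: "'n \<Rightarrow> 'k" assume "cauchy x \<and> cauchy x \<and> null (\<lambda>n. x n - x n)"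
    then show "\<exists>X. cauchy X \<and> cauchy x \<and> cauchy (if cauchy X then X else (\<lambda>_. 0)) \<and>
        null (\<lambda>n. x n - (if cauchy X then X else (\<lambda>_. 0)) n)"
      by (intro exI [of _ x]) (simp add: null_zero)
  qed
  with that show thesis by blast
qed

lemma cmp_lim_le: "cauchy X \<Longrightarrow> \<forall>n\<ge>k. X n \<le> b \<Longrightarrow> cmp_lim X \<le> cmp_of b"
proof -
  assume "cauchy X" and b: "\<forall>n\<ge>k. X n \<le> b"
  then have "\<not> positive (cmp_lim X + cmp_of (- b))"
  proof (transfer fixing: k)
    fix X :: "'a \<Rightarrow> 'b" and b assume X: "cauchy X" "\<forall>n\<ge>k. X n \<le> b"
    show "\<not> pos (\<lambda>n. (if cauchy X then X else (\<lambda>_. 0)) n + - b)"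
    proof
      assume "pos (\<lambda>n. (if cauchy X then X else (\<lambda>_. 0)) n + - b)"
      then obtain r where "0 < r" "\<forall>\<^sub>F n in at_top. r < X n + - b" using X by (auto simp: pos_def)
      then obtain m where "\<forall>n\<ge>m. r < X n + - b" by (auto simp: eventually_at_top_linorder)
      then have "r < X (max k m) + - b" by simp
      moreover have "X (max k m) \<le> b" using X(2) by simp
      ultimately show False using \<open>0 < r\<close> by simp
    qed
  qed
  then have "\<not> cmp_of b < cmp_lim X" by (simp add: less_cmp_def cmp_of_hom)
  then show ?thesis by simp
qed

lemma cmp_lim_uminus: "cauchy X \<Longrightarrow> cmp_lim (\<lambda>n. - X n) = - cmp_lim X"
  by transfer (auto simp: cauchy_uminus null_zero)

lemma cmp_lim_ge: "cauchy X \<Longrightarrow> \<forall>n\<ge>k. a \<le> X n \<Longrightarrow> cmp_of a \<le> cmp_lim X"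
  using cmp_lim_le [of "\<lambda>n. - X n" k "- a"] by (simp add: cauchy_uminus cmp_lim_uminus cmp_of_hom)

lemma cmp_positive_lower: "0 < x \<Longrightarrow> \<exists>r>0. cmp_of r \<le> x"
proof -
  assume x: "0 < x"
  obtain X where X: "cauchy X" "x = cmp_lim X" by (rule cmp_lim_cases)
  have "positive (cmp_lim X) \<longrightarrow> pos X" using X(1) by transfer simp
  then have "pos X" using x X by (simp add: less_cmp_def)
  then obtain r k where "0 < r" "\<forall>n\<ge>k. r < X n" by (auto simp: pos_def eventually_at_top_linorder)
  then show ?thesis using cmp_lim_ge [OF X(1), of k r] X(2) by (auto intro: less_imp_le)
qed

lemma cmp_dense: "0 < e \<Longrightarrow> \<exists>c. \<bar>x - cmp_of c\<bar> \<le> cmp_of e"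
proof -
  assume e: "0 < e"
  obtain X where X: "cauchy X" "x = cmp_lim X" by (rule cmp_lim_cases)
  from cauchyD [OF X(1) e] obtain k where k: "\<And>m n. k \<le> m \<Longrightarrow> k \<le> n \<Longrightarrow> \<bar>X m - X n\<bar> < e" by blast
  have "X k - e \<le> X n \<and> X n \<le> X k + e" if "k \<le> n" for n using k [of n k] that by (auto simp: abs_less_iff)
  then have "cmp_of (X k - e) \<le> x" "x \<le> cmp_of (X k + e)"
    using cmp_lim_ge [OF X(1)] cmp_lim_le [OF X(1)] X(2) by blast+
  then show ?thesis by (intro exI [of _ "X k"]) (simp add: cmp_of_hom cmp_of_diff abs_le_iff algebra_simps)
qed

section \<open>Rationals and reals over an abstract type of numbers\<close>

class arith_nat = discrete_linordered_semidom +
  assumes nonneg [simp]: "0 \<le> a"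
    and diff_truncated: "a \<le> b \<Longrightarrow> a - b = 0"

text \<open>The completion of the fraction field of the differences. Cauchy sequences are indexed by
  the numbers themselves, so that everything is measured by the numbers of the model.\<close>

type_synonym 'n rl = "('n, 'n dif fract) cmp"

definition frac_of :: "'n::linordered_semidom \<Rightarrow> 'n dif fract" where "frac_of a = Fract (dif_of a) 1"

lemma frac_of_hom: "frac_of (a + b) = frac_of a + frac_of b" "frac_of (a * b) = frac_of a * frac_of b"
  "frac_of 0 = 0" "frac_of 1 = 1" "frac_of a \<le> frac_of b \<longleftrightarrow> a \<le> b"
  by (simp_all add: frac_of_def dif_of_hom dif_of_le Zero_fract_def One_fract_def)

lemma dif_of_less: "dif_of a < dif_of b \<longleftrightarrow> a < b"
  using dif_of_le [of b a] by (simp add: not_le [symmetric])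

lemma frac_of_less: "frac_of a < frac_of b \<longleftrightarrow> a < b"
  using frac_of_hom(5) [of b a] by (simp add: not_le [symmetric])

lemma positive_dif: assumes "0 < x" shows "\<exists>c. 0 < c \<and> x = dif_of c"
proof -
  obtain a b where x: "x = dif_of a - dif_of b" using dif_cases by blast
  then have "b < a" using assms by (simp add: dif_of_less)
  then have "a = b + (a - b)" by (simp add: less_imp_le)
  then have "dif_of a = dif_of b + dif_of (a - b)" using dif_of_hom(1) by metis
  with x have "x = dif_of (a - b)" by simp
  then show ?thesis using assms dif_of_less [of 0 "a - b"] by (auto simp: dif_of_hom)
qed

lemma Fract_frac_of: "c \<noteq> 0 \<Longrightarrow> Fract (dif_of a - dif_of b) (dif_of c) = (frac_of a - frac_of b) / frac_of c"
  by (simp add: frac_of_def)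

lemma frac_cases: "\<exists>a b c. 0 < c \<and> x = (frac_of a - frac_of b) / frac_of c"
proof (induct x rule: fract_induct_pos)
  case (Fract p q)
  obtain a b where "p = dif_of a - dif_of b" using dif_cases by blast
  moreover obtain c where "0 < c" "q = dif_of c" using positive_dif [OF Fract] by blast
  ultimately show ?case using Fract_frac_of [of c a b] by (metis less_irrefl)
qed

definition emb :: "'n::arith_nat \<Rightarrow> 'n rl" where "emb a = cmp_of (frac_of a)"

lemma emb_hom [simp]: "emb (a + b) = emb a + emb b" "emb (a * b) = emb a * emb b" "emb 0 = 0" "emb 1 = 1"
  and emb_le [simp]: "emb a \<le> emb b \<longleftrightarrow> a \<le> b"
  and emb_less [simp]: "emb a < emb b \<longleftrightarrow> a < b"
  by (simp_all add: emb_def frac_of_hom frac_of_less cmp_of_hom cmp_of_le cmp_of_less)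

lemma emb_eq [simp]: "emb a = emb b \<longleftrightarrow> a = b"
  by (metis emb_le order.antisym order.refl)

lemma emb_nonneg [simp]: "0 \<le> emb a"
  using emb_le [of 0 a] by (simp del: emb_le)

lemma emb_numeral: "emb (numeral k) = numeral k"
  by (induct k) (simp_all only: numeral.simps emb_hom)

lemma arith_nat_pos: "0 < c \<Longrightarrow> \<exists>d. c = d + 1" for c :: "'n::arith_nat"
  using less_iff_succ_less_eq [of 0 c] le_add_diff_inverse2 [of 1 c] by (intro exI [of _ "c - 1"]) simp

text \<open>Numbers are discrete, so a positive fraction with denominator \<open>c\<close> is at
  least 1 / c. The archimedean property holds relative to the possibly nonstandard numbers
  only.\<close>

lemma emb_archimedean:
  fixes v :: "'n::arith_nat rl" assumes "0 < v" shows "\<exists>n. 1 < v * emb n"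
proof -
  obtain r where r: "0 < r" "cmp_of r \<le> v" using cmp_positive_lower [OF assms] by blast
  obtain a b c where c: "0 < c" "r = (frac_of a - frac_of b) / frac_of c" using frac_cases by blast
  have c0: "0 < frac_of c" using c frac_of_less [of 0 c] by (simp add: frac_of_hom)
  then have "frac_of b < frac_of a" using r c by (simp add: zero_less_divide_iff)
  then have "frac_of (b + 1) \<le> frac_of a" using less_iff_succ_less_eq [of b a] by (simp add: frac_of_less frac_of_hom(5))
  then have "1 \<le> frac_of a - frac_of b" by (simp add: frac_of_hom)
  then have "1 / frac_of c \<le> r" unfolding c(2) using c0 by (simp add: divide_right_mono)
  then have "1 / frac_of c * (frac_of c + 1) \<le> r * frac_of (c + 1)"
    unfolding frac_of_hom using c0 by (intro mult_right_mono) auto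
  moreover have "1 < 1 / frac_of c * (frac_of c + 1)" using c0 by (simp add: field_simps)
  ultimately have "1 < r * frac_of (c + 1)" by (rule less_le_trans [rotated])
  then have "cmp_of 1 < (cmp_of (r * frac_of (c + 1)) :: 'n rl)" by (simp only: cmp_of_less)
  then have "1 < cmp_of r * emb (c + 1)" by (simp only: cmp_of_hom emb_def)
  also have "\<dots> \<le> v * emb (c + 1)" using r(2) by (rule mult_right_mono) (rule emb_nonneg)
  finally show ?thesis by blast
qed

definition rat :: "'n::arith_nat \<Rightarrow> 'n \<Rightarrow> 'n \<Rightarrow> 'n rl" where
  "rat a b c = (emb a - emb b) / (emb c + 1)"

lemma rat_cmp_of: "\<exists>a b c. cmp_of q = rat a b c"
proof -
  obtain a b c where "0 < c" "q = (frac_of a - frac_of b) / frac_of c" using frac_cases by blast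
  moreover obtain d where "c = d + 1" using arith_nat_pos \<open>0 < c\<close> by blast
  ultimately have "cmp_of q = rat a b d"
    by (simp add: rat_def emb_def cmp_of_divide cmp_of_diff cmp_of_hom frac_of_hom)
  then show ?thesis by blast
qed

lemma cmp_of_rat: "\<exists>q. rat a b c = cmp_of q"
  by (rule exI [of _ "(frac_of a - frac_of b) / (frac_of c + 1)"])
    (simp add: rat_def emb_def cmp_of_divide cmp_of_diff cmp_of_hom)

lemma rat_dense: "0 < e \<Longrightarrow> \<exists>a b c. \<bar>v - rat a b c\<bar> < e" for v :: "'n::arith_nat rl"
proof -
  assume "0 < e"
  then obtain r where r: "0 < r" "cmp_of r \<le> e" using cmp_positive_lower by blast
  then obtain q where "\<bar>v - cmp_of q\<bar> \<le> cmp_of (r / 2)" using cmp_dense [of "r / 2"] by auto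
  also have "\<dots> < cmp_of r" using r by (simp add: cmp_of_less)
  finally have "\<bar>v - cmp_of q\<bar> < e" using r by simp
  then show ?thesis using rat_cmp_of by metis
qed

text \<open>The limit is formed in the completion, hence \<open>X\<close> may be any sequence,
  definable or not. Rational terms and error bounds allow the argument to run in the base
  field.\<close>

lemma rl_complete:
  fixes X :: "'n::arith_nat \<Rightarrow> 'n rl"
  assumes rat: "\<And>n. \<exists>a b c. X n = rat a b c" and eps: "\<And>n. \<exists>a b c. \<epsilon> n = rat a b c"
    and X: "\<And>m n. n \<le> m \<Longrightarrow> \<bar>X n - X m\<bar> < \<epsilon> n" and small: "\<And>e. 0 < e \<Longrightarrow> \<exists>n. \<epsilon> n < e"
  shows "\<exists>v. \<forall>n. \<bar>X n - v\<bar> \<le> \<epsilon> n"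
proof -
  have "\<forall>n. \<exists>q. X n = cmp_of q" "\<forall>n. \<exists>q. \<epsilon> n = cmp_of q"
    using rat eps cmp_of_rat by (metis (no_types))+
  then obtain Y \<delta> where Y: "\<And>n. X n = cmp_of (Y n)" and \<delta>: "\<And>n. \<epsilon> n = cmp_of (\<delta> n)"
    by (auto dest!: choice)
  have cl: "cmp_of a \<le> (cmp_of b :: 'n rl) \<longleftrightarrow> a \<le> b" "cmp_of a < (cmp_of b :: 'n rl) \<longleftrightarrow> a < b" for a b
    by (simp_all add: cmp_of_le cmp_of_less)
  have Yn: "Y n - \<delta> n < Y m \<and> Y m < Y n + \<delta> n" if "n \<le> m" for m n
  proof -
    have "cmp_of (Y n - \<delta> n) < (cmp_of (Y m) :: 'n rl) \<and> cmp_of (Y m) < (cmp_of (Y n + \<delta> n) :: 'n rl)"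
      using X [OF that] unfolding Y \<delta> cmp_of_diff cmp_of_hom by (auto simp: abs_less_iff)
    then show ?thesis by (simp only: cl)
  qed
  have "cauchy Y"
  proof (rule cauchyI)
    fix e :: "'n dif fract" assume "0 < e"
    then have "0 < (cmp_of (e / 2) :: 'n rl)" using cl(2) [of 0 "e / 2"] by (simp add: cmp_of_hom)
    from small [OF this] obtain n where "\<delta> n < e / 2" unfolding \<delta> cl by blast
    then have "\<bar>Y i - Y j\<bar> < e" if "n \<le> i" "n \<le> j" for i j
      using Yn [OF that(1)] Yn [OF that(2)] by (auto simp: abs_less_iff)
    then show "\<exists>k. \<forall>m\<ge>k. \<forall>n\<ge>k. \<bar>Y m - Y n\<bar> < e" by blast
  qed
  then have "cmp_of (Y n - \<delta> n) \<le> cmp_lim Y \<and> cmp_lim Y \<le> cmp_of (Y n + \<delta> n)" for n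
    using Yn [of n] cmp_lim_ge [OF \<open>cauchy Y\<close>, of n "Y n - \<delta> n"] cmp_lim_le [OF \<open>cauchy Y\<close>, of n "Y n + \<delta> n"]
    by (simp add: less_imp_le)
  then show ?thesis
    by (intro exI [of _ "cmp_lim Y"]) (auto simp: Y \<delta> cmp_of_diff cmp_of_hom abs_le_iff algebra_simps)
qed

section \<open>Arithmetic in models\<close>

text \<open>The clauses \<open>subtract\<close> and \<open>discrete\<close> are not among the
  semiring axioms; in a model they come from quantifier-free induction.\<close>

locale nat_str =
  fixes N :: "'a set" and z u :: 'a and p t :: "'a \<Rightarrow> 'a \<Rightarrow> 'a" and l :: "'a \<Rightarrow> 'a \<Rightarrow> bool"
  assumes closed: "z \<in> N" "u \<in> N" "a \<in> N \<Longrightarrow> b \<in> N \<Longrightarrow> p a b \<in> N" "a \<in> N \<Longrightarrow> b \<in> N \<Longrightarrow> t a b \<in> N"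
    and p_assoc: "a \<in> N \<Longrightarrow> b \<in> N \<Longrightarrow> c \<in> N \<Longrightarrow> p (p a b) c = p a (p b c)"
    and p_comm: "a \<in> N \<Longrightarrow> b \<in> N \<Longrightarrow> p a b = p b a"
    and p_zero: "a \<in> N \<Longrightarrow> p a z = a"
    and t_assoc: "a \<in> N \<Longrightarrow> b \<in> N \<Longrightarrow> c \<in> N \<Longrightarrow> t (t a b) c = t a (t b c)"
    and t_comm: "a \<in> N \<Longrightarrow> b \<in> N \<Longrightarrow> t a b = t b a"
    and t_one: "a \<in> N \<Longrightarrow> t a u = a"
    and t_zero: "a \<in> N \<Longrightarrow> t a z = z"
    and distrib: "a \<in> N \<Longrightarrow> b \<in> N \<Longrightarrow> c \<in> N \<Longrightarrow> t a (p b c) = p (t a b) (t a c)"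
    and l_irrefl: "a \<in> N \<Longrightarrow> \<not> l a a"
    and l_trans: "a \<in> N \<Longrightarrow> b \<in> N \<Longrightarrow> c \<in> N \<Longrightarrow> l a b \<Longrightarrow> l b c \<Longrightarrow> l a c"
    and l_total: "a \<in> N \<Longrightarrow> b \<in> N \<Longrightarrow> l a b \<or> a = b \<or> l b a"
    and p_mono: "a \<in> N \<Longrightarrow> b \<in> N \<Longrightarrow> c \<in> N \<Longrightarrow> l a b \<Longrightarrow> l (p a c) (p b c)"
    and t_mono: "a \<in> N \<Longrightarrow> b \<in> N \<Longrightarrow> c \<in> N \<Longrightarrow> l a b \<Longrightarrow> l z c \<Longrightarrow> l (t a c) (t b c)"
    and zero_one: "l z u"
    and zero_least: "a \<in> N \<Longrightarrow> l z a \<or> z = a"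
    and subtract: "a \<in> N \<Longrightarrow> b \<in> N \<Longrightarrow> l a b \<Longrightarrow> \<exists>c\<in>N. p a c = b"
    and discrete: "a \<in> N \<Longrightarrow> b \<in> N \<Longrightarrow> l a b \<Longrightarrow> l (p a u) b \<or> p a u = b"

section \<open>Subtraction and discreteness from quantifier-free induction\<close>

context aca
begin

abbreviation "N \<equiv> carr M T0"
abbreviation "zer \<equiv> con M Zero"
abbreviation "one \<equiv> con M One"

lemma pl_closed [simp]: "a \<in> N \<Longrightarrow> b \<in> N \<Longrightarrow> pl M a b \<in> N"
  unfolding pl_def by (rule ap_carr [OF ap_carr [OF con_types(3)]])
lemma ti_closed [simp]: "a \<in> N \<Longrightarrow> b \<in> N \<Longrightarrow> ti M a b \<in> N"
  unfolding ti_def by (rule ap_carr [OF ap_carr [OF con_types(4)]])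

lemma semiring_raw:
  "(\<forall>a\<in>N. \<forall>b\<in>N. \<forall>c\<in>N. pl M (pl M a b) c = pl M a (pl M b c)) \<and>
   (\<forall>a\<in>N. \<forall>b\<in>N. pl M a b = pl M b a) \<and> (\<forall>a\<in>N. pl M a zer = a) \<and>
   (\<forall>a\<in>N. \<forall>b\<in>N. \<forall>c\<in>N. ti M (ti M a b) c = ti M a (ti M b c)) \<and>
   (\<forall>a\<in>N. \<forall>b\<in>N. ti M a b = ti M b a) \<and> (\<forall>a\<in>N. ti M a one = a) \<and> (\<forall>a\<in>N. ti M a zer = zer) \<and>
   (\<forall>a\<in>N. \<forall>b\<in>N. \<forall>c\<in>N. ti M a (pl M b c) = pl M (ti M a b) (ti M a c)) \<and>
   (\<forall>a\<in>N. \<not> ltr M a a) \<and>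
   (\<forall>a\<in>N. \<forall>b\<in>N. \<forall>c\<in>N. ltr M a b \<and> ltr M b c \<longrightarrow> ltr M a c) \<and>
   (\<forall>a\<in>N. \<forall>b\<in>N. ltr M a b \<or> a = b \<or> ltr M b a) \<and>
   (\<forall>a\<in>N. \<forall>b\<in>N. \<forall>c\<in>N. ltr M a b \<longrightarrow> ltr M (pl M a c) (pl M b c)) \<and>
   (\<forall>a\<in>N. \<forall>b\<in>N. \<forall>c\<in>N. ltr M a b \<and> ltr M zer c \<longrightarrow> ltr M (ti M a c) (ti M b c)) \<and>
   ltr M zer one \<and> (\<forall>a\<in>N. ltr M zer a \<or> zer = a)"
proof -
  have "\<forall>B\<in>semiring_axioms. sat M [] B" using ax ACA0w_axioms(1) by blast
  then show ?thesis unfolding semiring_axioms_def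
    by (simp only: image_insert image_empty ball_simps(5,7) sat_all_nat sat_eq sat_less sat_imp sat_and sat_or sat_not
        stab_vr stab_Cons_stab vl_vr stab_Cons_vl vl_arith le_b_def eqr_eq list.size One_nat_def add_0 add_Suc_right add_0_right simp_thms, elim conjE, intro conjI; (assumption | blast))
qed

lemmas pl_assoc = semiring_raw [THEN conjunct1, rule_format]
lemmas pl_comm = semiring_raw [THEN conjunct2, THEN conjunct1, rule_format]
lemmas pl_zer = semiring_raw [THEN conjunct2, THEN conjunct2, THEN conjunct1, rule_format]
lemmas ti_assoc = semiring_raw [THEN conjunct2, THEN conjunct2, THEN conjunct2, THEN conjunct1, rule_format]
lemmas ti_comm = semiring_raw [THEN conjunct2, THEN conjunct2, THEN conjunct2, THEN conjunct2, THEN conjunct1, rule_format]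
lemmas ti_one = semiring_raw [THEN conjunct2, THEN conjunct2, THEN conjunct2, THEN conjunct2, THEN conjunct2, THEN conjunct1, rule_format]
lemmas ti_zer = semiring_raw [THEN conjunct2, THEN conjunct2, THEN conjunct2, THEN conjunct2, THEN conjunct2, THEN conjunct2, THEN conjunct1, rule_format]
lemmas ti_distrib = semiring_raw [THEN conjunct2, THEN conjunct2, THEN conjunct2, THEN conjunct2, THEN conjunct2, THEN conjunct2, THEN conjunct2, THEN conjunct1, rule_format]
lemmas ltr_irrefl = semiring_raw [THEN conjunct2, THEN conjunct2, THEN conjunct2, THEN conjunct2, THEN conjunct2, THEN conjunct2, THEN conjunct2, THEN conjunct2, THEN conjunct1, rule_format]
lemmas ltr_trans = semiring_raw [THEN conjunct2, THEN conjunct2, THEN conjunct2, THEN conjunct2, THEN conjunct2, THEN conjunct2, THEN conjunct2, THEN conjunct2, THEN conjunct2, THEN conjunct1, rule_format]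
lemmas ltr_total = semiring_raw [THEN conjunct2, THEN conjunct2, THEN conjunct2, THEN conjunct2, THEN conjunct2, THEN conjunct2, THEN conjunct2, THEN conjunct2, THEN conjunct2, THEN conjunct2, THEN conjunct1, rule_format]
lemmas ltr_pl = semiring_raw [THEN conjunct2, THEN conjunct2, THEN conjunct2, THEN conjunct2, THEN conjunct2, THEN conjunct2, THEN conjunct2, THEN conjunct2, THEN conjunct2, THEN conjunct2, THEN conjunct2, THEN conjunct1, rule_format]
lemmas ltr_ti = semiring_raw [THEN conjunct2, THEN conjunct2, THEN conjunct2, THEN conjunct2, THEN conjunct2, THEN conjunct2, THEN conjunct2, THEN conjunct2, THEN conjunct2, THEN conjunct2, THEN conjunct2, THEN conjunct2, THEN conjunct1, rule_format]
lemmas ltr_zer_one = semiring_raw [THEN conjunct2, THEN conjunct2, THEN conjunct2, THEN conjunct2, THEN conjunct2, THEN conjunct2, THEN conjunct2, THEN conjunct2, THEN conjunct2, THEN conjunct2, THEN conjunct2, THEN conjunct2, THEN conjunct2, THEN conjunct1]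
lemmas ltr_zer = semiring_raw [THEN conjunct2, THEN conjunct2, THEN conjunct2, THEN conjunct2, THEN conjunct2, THEN conjunct2, THEN conjunct2, THEN conjunct2, THEN conjunct2, THEN conjunct2, THEN conjunct2, THEN conjunct2, THEN conjunct2, THEN conjunct2, rule_format]

lemma zer_pl: "a \<in> N \<Longrightarrow> pl M zer a = a"
  using pl_comm pl_zer con_types(1) by simp

lemma succ_shift: "n \<in> N \<Longrightarrow> m \<in> N \<Longrightarrow> pl M n (pl M m one) = pl M (pl M n one) m"
  using pl_comm [OF _ con_types(2), of m] pl_assoc [of n one m] con_types(2) by simp

lemma deft_ap_var: "deft \<sigma>s (T0 \<rightarrow> \<tau>) f \<Longrightarrow> deft (T0 # \<sigma>s) \<tau> (\<lambda>e. ap M (f (tl e)) (hd e))"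
proof -
  assume "deft \<sigma>s (T0 \<rightarrow> \<tau>) f"
  moreover have "deft (T0 # \<sigma>s) T0 hd"
    by (rule deft_cong [OF deft_var [of 0 "T0 # \<sigma>s", simplified]]) (auto simp: list_all2_Cons2)
  ultimately show ?thesis using deft_ap [OF deft_tl] by blast
qed

lemma deft_pl: "deft \<sigma>s T0 f \<Longrightarrow> deft \<sigma>s T0 g \<Longrightarrow> deft \<sigma>s T0 (\<lambda>e. pl M (f e) (g e))"
  unfolding pl_def by (rule deft_ap [OF deft_ap [OF deft_const [OF con_types(3)]]])
lemma deft_ti: "deft \<sigma>s T0 f \<Longrightarrow> deft \<sigma>s T0 g \<Longrightarrow> deft \<sigma>s T0 (\<lambda>e. ti M (f e) (g e))"
  unfolding ti_def by (rule deft_ap [OF deft_ap [OF deft_const [OF con_types(4)]]])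

lemma rec_raw:
  assumes "F \<in> carr M (T0 \<rightarrow> T0 \<rightarrow> T0)" "m \<in> N"
  shows "ap M (ap M (ap M (con M Rec0) F) m) zer = m"
    and "n \<in> N \<Longrightarrow> ap M (ap M (ap M (con M Rec0) F) m) (pl M n one) =
      ap M (ap M F n) (ap M (ap M (ap M (con M Rec0) F) m) n)"
proof -
  have "\<forall>B\<in>rec_axioms. sat M [] B" using ax ACA0w_axioms(2) by blast
  then show "ap M (ap M (ap M (con M Rec0) F) m) zer = m"
    and "n \<in> N \<Longrightarrow> ap M (ap M (ap M (con M Rec0) F) m) (pl M n one) =
      ap M (ap M F n) (ap M (ap M (ap M (con M Rec0) F) m) n)"
    using assms by (simp_all add: rec_axioms_def sat_all_nat eqr_eq)
qed

text \<open>The recursor is applied to an abstraction with parameters. In the environment of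
  \<open>f\<close> the previous value comes first and the index second.\<close>

lemma rec_ex:
  assumes f: "deft (T0 # T0 # \<sigma>s) T0 f" and m: "deft \<sigma>s T0 m"
  shows "\<exists>h. deft (T0 # \<sigma>s) T0 h \<and> (\<forall>e. typed_env e \<sigma>s \<longrightarrow> h (zer # e) = m e \<and>
    (\<forall>n\<in>N. h (pl M n one # e) = f (h (n # e) # n # e)))"
proof -
  obtain g where g: "deft (T0 # \<sigma>s) (T0 \<rightarrow> T0) g"
    "\<And>e v. typed_env e (T0 # \<sigma>s) \<Longrightarrow> v \<in> N \<Longrightarrow> ap M (g e) v = f (v # e)"
    using deft_lam [OF f] by blast
  obtain G where G: "deft \<sigma>s (T0 \<rightarrow> T0 \<rightarrow> T0) G"
    "\<And>e v. typed_env e \<sigma>s \<Longrightarrow> v \<in> N \<Longrightarrow> ap M (G e) v = g (v # e)"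
    using deft_lam [OF g(1)] by blast
  let ?R = "\<lambda>e. ap M (ap M (con M Rec0) (G e)) (m e)"
  have R: "deft \<sigma>s T1 ?R" by (rule deft_ap [OF deft_ap [OF deft_const [OF con_types(7)] G(1)] m])
  have h: "deft (T0 # \<sigma>s) T0 (\<lambda>e. ap M (?R (tl e)) (hd e))" by (rule deft_ap_var [OF R])
  show ?thesis
  proof (intro exI [of _ "\<lambda>e. ap M (?R (tl e)) (hd e)"] conjI allI impI ballI h)
    fix e assume e: "typed_env e \<sigma>s"
    have c: "G e \<in> carr M (T0 \<rightarrow> T0 \<rightarrow> T0)" "m e \<in> N" using deft_carr G(1) m e by blast+
    show "ap M (?R (tl (zer # e))) (hd (zer # e)) = m e" using rec_raw(1) [OF c] by simp
    fix n assume n: "n \<in> N"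
    have "ap M (?R e) n \<in> N" using ap_carr [OF deft_carr [OF R e] n] .
    then show "ap M (?R (tl (pl M n one # e))) (hd (pl M n one # e)) = f (ap M (?R (tl (n # e))) (hd (n # e)) # n # e)"
      using rec_raw(2) [OF c n] G(2) [OF e n] g(2) [of "n # e"] e n by simp
  qed
qed

lemma deft_nth: "i < length \<sigma>s \<Longrightarrow> \<sigma>s ! i = \<tau> \<Longrightarrow> deft \<sigma>s \<tau> (\<lambda>e. e ! i)"
  using deft_var by blast

lemma pred_raw: "\<exists>P\<in>carr M T1. ap M P zer = zer \<and> (\<forall>n\<in>N. ap M P (pl M n one) = n)"
proof -
  have "deft (T0 # T0 # []) T0 (\<lambda>e. e ! 1)" by (rule deft_nth) simp_all
  from rec_ex [OF this deft_const [OF con_types(1)]] obtain h where "deft (T0 # []) T0 h \<and>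
    (\<forall>e. typed_env e [] \<longrightarrow> h (zer # e) = zer \<and> (\<forall>n\<in>N. h (pl M n one # e) = (h (n # e) # n # e) ! 1))" by blast
  then have h: "deft [T0] T0 h" "h [zer] = zer" "\<And>n. n \<in> N \<Longrightarrow> h [pl M n one] = n"
    by simp_all
  obtain g where g: "deft [] T1 g" "\<And>v. v \<in> N \<Longrightarrow> ap M (g []) v = h [v]"
    using deft_lam [OF h(1)] by fastforce
  then have "g [] \<in> carr M T1" using deft_carr by blast
  with g(2) h con_types show ?thesis by (intro bexI [of _ "g []"]) auto
qed

text \<open>The predecessor function replaces the existential quantifier, so that the statement
  becomes quantifier-free and induction applies.\<close>

lemma zero_or_succ: "n \<in> N \<Longrightarrow> n = zer \<or> (\<exists>m\<in>N. n = pl M m one)"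
proof -
  obtain P where P: "P \<in> carr M T1" "ap M P zer = zer" "\<And>n. n \<in> N \<Longrightarrow> ap M P (pl M n one) = n"
    using pred_raw by blast
  have Pn: "ap M P n \<in> N" if "n \<in> N" for n using ap_carr [OF P(1) that] .
  have v: "deft [T0] T0 (\<lambda>e. e ! 0)" by (rule deft_nth) simp_all
  have "defq [T0] (\<lambda>e. (\<lambda>n. n = zer \<or> n = pl M (ap M P n) one) (e ! 0))"
    by (intro defq_or defq_eq deft_pl deft_ap [OF deft_const [OF P(1)]] deft_const con_types v)
  then have "n = zer \<or> n = pl M (ap M P n) one" if "n \<in> N" for n
    by (rule induction_qf [where P = "\<lambda>n. n = zer \<or> n = pl M (ap M P n) one"]) (use P that in simp_all)
  moreover assume "n \<in> N"
  ultimately have "n = zer \<or> n = pl M (ap M P n) one" by blast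
  with Pn \<open>n \<in> N\<close> show ?thesis by blast
qed

text \<open>The predecessor iterated \<open>b\<close> times, starting from \<open>a\<close>; the
  environment lists \<open>b\<close> before \<open>a\<close>. The case without truncation is settled
  first, because the induction for the other case falls back on it at the step where
  \<open>b\<close> passes \<open>a\<close>.\<close>

lemma monus_raw:
  "\<exists>s. deft [T0, T0] T0 s \<and> (\<forall>a\<in>N. \<forall>b\<in>N. (ltr M a b \<longrightarrow> s [b, a] = zer) \<and> (\<not> ltr M a b \<longrightarrow> pl M b (s [b, a]) = a))"
proof -
  note r = ltr_irrefl ltr_trans ltr_total
  obtain P where P: "P \<in> carr M T1" "ap M P zer = zer" "\<And>n. n \<in> N \<Longrightarrow> ap M P (pl M n one) = n"
    using pred_raw by blast
  have f: "deft [T0, T0, T0] T0 (\<lambda>e. ap M P (e ! 0))"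
    by (rule deft_ap [OF deft_const [OF P(1)] deft_nth]) simp_all
  have v: "deft [T0] T0 (\<lambda>e. e ! 0)" by (rule deft_nth) simp_all
  obtain h where "deft (T0 # [T0]) T0 h \<and> (\<forall>e. typed_env e [T0] \<longrightarrow> h (zer # e) = e ! 0 \<and>
      (\<forall>n\<in>N. h (pl M n one # e) = ap M P ((h (n # e) # n # e) ! 0)))"
    using rec_ex [OF f v] by blast
  then have h: "deft [T0, T0] T0 h" "\<And>a. a \<in> N \<Longrightarrow> h [zer, a] = a"
    "\<And>a n. a \<in> N \<Longrightarrow> n \<in> N \<Longrightarrow> h [pl M n one, a] = ap M P (h [n, a])"
    by (auto simp: list_all2_Cons2)
  have "(ltr M a b \<longrightarrow> h [b, a] = zer) \<and> (\<not> ltr M a b \<longrightarrow> pl M b (h [b, a]) = a)" if a: "a \<in> N" and b: "b \<in> N" for a b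
  proof -
    obtain H where H: "deft [T0] T1 H" "\<And>e v. typed_env e [T0] \<Longrightarrow> v \<in> N \<Longrightarrow> ap M (H e) v = h (v # e)"
      using deft_lam [OF h(1)] by blast
    have Ha: "H [a] \<in> carr M T1" using deft_carr [OF H(1)] a by simp
    have Hb: "ap M (H [a]) b = h [b, a]" if "b \<in> N" for b using H(2) a that by simp
    have hN: "h [b, a] \<in> N" if "b \<in> N" for b using ap_carr [OF Ha that] Hb [OF that] by simp
    have s: "deft [T0] T0 (\<lambda>e. ap M (H [a]) (e ! 0))" by (rule deft_ap [OF deft_const [OF Ha] v])
    let ?Q = "\<lambda>b. (ltr M a b \<longrightarrow> ap M (H [a]) b = zer)"
    let ?R = "\<lambda>b. (\<not> ltr M a b \<longrightarrow> pl M b (ap M (H [a]) b) = a)"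
    have "defq [T0] (\<lambda>e. ?R (e ! 0))"
      by (intro defq_imp defq_not defq_less defq_eq deft_pl s v deft_const a)
    then have R: "?R b" if "b \<in> N" for b
    proof (rule induction_qf [where P = ?R])
      have "pl M zer a = a" using zer_pl a .
      then show "?R zer" using Hb [OF con_types(1)] h(2) [OF a] by simp
      fix n assume n: "n \<in> N" and IH: "?R n"
      have n1: "pl M n one \<in> N" using n con_types by simp
      show "?R (pl M n one)"
      proof
        assume nl: "\<not> ltr M a (pl M n one)"
        have "ltr M (pl M zer n) (pl M one n)" by (rule ltr_pl [OF con_types(1,2) n ltr_zer_one])
        then have nn: "ltr M n (pl M n one)" using zer_pl n pl_comm [OF n con_types(2)] by simp
        then have na: "\<not> ltr M a n" using nl r a n n1 by blast
        then have e: "pl M n (h [n, a]) = a" using IH Hb n by simp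
        have "h [n, a] \<noteq> zer"
        proof
          assume "h [n, a] = zer"
          then have "n = a" using e pl_zer n by simp
          with nn nl show False by simp
        qed
        then obtain m where m: "m \<in> N" "h [n, a] = pl M m one" using zero_or_succ hN n by blast
        then have "h [pl M n one, a] = m" using h(3) a n P(3) by simp
        moreover have "pl M (pl M n one) m = pl M n (pl M m one)"
          using succ_shift [OF n m(1)] by simp
        ultimately show "pl M (pl M n one) (ap M (H [a]) (pl M n one)) = a"
          using Hb [OF n1] e m(2) by simp
      qed
    qed (use that in simp)
    have "defq [T0] (\<lambda>e. ?Q (e ! 0))"
      by (intro defq_imp defq_not defq_less defq_eq deft_pl s v deft_const a con_types)
    then have Q: "?Q b" if "b \<in> N" for b
    proof (rule induction_qf [where P = ?Q])
      have "\<not> ltr M a zer" using r a con_types(1) ltr_zer [OF a] by blast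
      then show "?Q zer" by simp
      fix n assume n: "n \<in> N" and IH: "?Q n"
      have n1: "pl M n one \<in> N" using n con_types by simp
      have "h [n, a] = zer" if l: "ltr M a (pl M n one)"
      proof (cases "ltr M a n")
        case True with IH Hb n show ?thesis by simp
      next
        case False
        then have e: "pl M n (h [n, a]) = a" using R [OF n] Hb [OF n] by simp
        show ?thesis
        proof (rule ccontr)
          assume "h [n, a] \<noteq> zer"
          then obtain m where m: "m \<in> N" "h [n, a] = pl M m one" using zero_or_succ hN n by blast
          have a': "a = pl M m (pl M n one)"
            using e m n succ_shift [OF n m(1)] pl_comm [of m "pl M n one"] con_types(2) by simp
          have "ltr M zer m \<or> zer = m" using ltr_zer m(1) .
          then have "ltr M (pl M n one) a \<or> pl M n one = a"
          proof
            assume "ltr M zer m"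
            then have "ltr M (pl M zer (pl M n one)) (pl M m (pl M n one))" using ltr_pl m n1 con_types(1) by blast
            moreover have "pl M zer (pl M n one) = pl M n one" using zer_pl n1 .
            ultimately show ?thesis using a' by simp
          next
            assume "zer = m"
            then have "pl M n one = a" using a' zer_pl n1 by simp
            then show ?thesis ..
          qed
          with l r a n1 show False by blast
        qed
      qed
      then show "?Q (pl M n one)" using Hb [OF n1] h(3) [OF a n] P(2) by simp
    qed (use that in simp)
    show ?thesis using Q [OF b] R [OF b] Hb [OF b] by simp
  qed
  with h(1) show ?thesis by blast
qed

lemma nat_str: "nat_str N zer one (pl M) (ti M) (ltr M)"
proof -
  note r = ltr_irrefl ltr_trans ltr_total
  have sub: "\<exists>c\<in>N. pl M a c = b" if ab: "a \<in> N" "b \<in> N" "ltr M a b" for a b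
  proof -
    obtain s where s: "deft [T0, T0] T0 s" "\<forall>a\<in>N. \<forall>b\<in>N. (ltr M a b \<longrightarrow> s [b, a] = zer) \<and> (\<not> ltr M a b \<longrightarrow> pl M b (s [b, a]) = a)"
      using monus_raw by blast
    have "\<not> ltr M b a" using r ab by blast
    moreover have "s [a, b] \<in> N" using deft_carr [OF s(1)] ab by simp
    ultimately show ?thesis using s(2) ab by blast
  qed
  have disc: "ltr M (pl M a one) b \<or> pl M a one = b" if ab: "a \<in> N" "b \<in> N" "ltr M a b" for a b
  proof -
    obtain c where c: "c \<in> N" "pl M a c = b" using sub ab by blast
    have "c \<noteq> zer" using c ab pl_zer ltr_irrefl by auto
    then obtain m where m: "m \<in> N" "c = pl M m one" using zero_or_succ c by blast
    have b': "b = pl M m (pl M a one)"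
      using c m ab succ_shift [of a m] pl_comm [of m "pl M a one"] con_types(2) by simp
    have a1: "pl M a one \<in> N" using ab con_types by simp
    have z': "pl M zer (pl M a one) = pl M a one" using zer_pl a1 .
    have "ltr M zer m \<or> zer = m" using ltr_zer m(1) .
    then show ?thesis
    proof
      assume "ltr M zer m"
      then have "ltr M (pl M zer (pl M a one)) (pl M m (pl M a one))" using ltr_pl m a1 con_types(1) by blast
      with z' b' show ?thesis by simp
    next
      assume "zer = m" with z' b' show ?thesis by simp
    qed
  qed
  show ?thesis
    by unfold_locales
      ((rule con_types(1) con_types(2) pl_closed ti_closed pl_assoc pl_comm pl_zer ti_assoc ti_comm ti_one
        ti_zer ti_distrib ltr_irrefl ltr_total ltr_pl ltr_zer_one ltr_zer sub disc; assumption) |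
        metis ltr_trans ltr_ti)+
qed

end

section \<open>Arithmetical definability over a type that copies the numbers\<close>

locale nmodel = aca M for M :: "'a str" +
  fixes nd :: "'n::arith_nat \<Rightarrow> 'a"
  assumes nd_bij: "bij_betw nd UNIV (carr M T0)"
    and nd_add: "pl M (nd a) (nd b) = nd (a + b)"
    and nd_mult: "ti M (nd a) (nd b) = nd (a * b)"
    and nd_0: "con M Zero = nd 0" and nd_1: "con M One = nd 1"
    and nd_less: "ltr M (nd a) (nd b) \<longleftrightarrow> a < b"
begin

definition nm :: "'a \<Rightarrow> 'n" where "nm = inv_into UNIV nd"

lemma nd_in [simp]: "nd n \<in> N" using nd_bij by (auto simp: bij_betw_def)
lemma nd_eq [simp]: "nd a = nd b \<longleftrightarrow> a = b" using nd_bij by (auto simp: bij_betw_def inj_on_def)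
lemma nm_nd [simp]: "nm (nd n) = n" unfolding nm_def using nd_bij by (simp add: bij_betw_def)
lemma nd_nm [simp]: "x \<in> N \<Longrightarrow> nd (nm x) = x"
  unfolding nm_def using nd_bij by (simp add: bij_betw_def f_inv_into_f)

lemma ball_N: "(\<forall>x\<in>N. P x) \<longleftrightarrow> (\<forall>n. P (nd n))"
  and bex_N: "(\<exists>x\<in>N. P x) \<longleftrightarrow> (\<exists>n. P (nd n))"
  using nd_nm nd_in by metis+

text \<open>The \<open>i\<close>-th entry of an environment, as a number and as an object. Below a quantifier over \<open>n\<close>
  the body \<open>P n e\<close> becomes \<open>P (nv 0 e) (tl e)\<close>.\<close>

definition nv :: "nat \<Rightarrow> 'a list \<Rightarrow> 'n" where "nv i e = nm (hd (drop i e))"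
definition xv :: "nat \<Rightarrow> 'a list \<Rightarrow> 'a" where "xv i e = hd (drop i e)"

lemma v_tl: "nv i (tl e) = nv (Suc i) e" "xv i (tl e) = xv (Suc i) e"
  by (simp_all add: nv_def xv_def drop_Suc)
lemma v_Cons [simp]: "nv 0 (x # e) = nm x" "xv 0 (x # e) = x"
  "nv (Suc i) (x # e) = nv i e" "xv (Suc i) (x # e) = xv i e"
  by (simp_all add: nv_def xv_def)

definition defn :: "ty list \<Rightarrow> ('a list \<Rightarrow> 'n) \<Rightarrow> bool" where
  "defn \<sigma>s t \<longleftrightarrow> deft \<sigma>s T0 (\<lambda>e. nd (t e))"
text \<open>Truth values are coded as numbers. Quantification over numbers then stays inside the
  notion, and every arithmetical predicate becomes an equation between terms.\<close>

definition defp :: "ty list \<Rightarrow> ('a list \<Rightarrow> bool) \<Rightarrow> bool" where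
  "defp \<sigma>s P \<longleftrightarrow> defn \<sigma>s (\<lambda>e. if P e then 1 else 0)"

lemma defn_cong: "defn \<sigma>s t \<Longrightarrow> (\<And>e. typed_env e \<sigma>s \<Longrightarrow> t e = r e) \<Longrightarrow> defn \<sigma>s r"
  unfolding defn_def by (erule deft_cong) simp
lemma defp_cong: "defp \<sigma>s P \<Longrightarrow> (\<And>e. typed_env e \<sigma>s \<Longrightarrow> P e = Q e) \<Longrightarrow> defp \<sigma>s Q"
  unfolding defp_def by (erule defn_cong) simp

lemma deft_xv: "i < length \<sigma>s \<Longrightarrow> \<sigma>s ! i = \<tau> \<Longrightarrow> deft \<sigma>s \<tau> (xv i)"
  by (rule deft_cong [OF deft_nth]) (auto simp: xv_def hd_drop_conv_nth dest: list_all2_lengthD)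

lemma defn_nm: "deft \<sigma>s T0 f \<Longrightarrow> defn \<sigma>s (\<lambda>e. nm (f e))"
  unfolding defn_def by (rule deft_cong, assumption) (simp add: deft_carr)
lemma defn_nv: "i < length \<sigma>s \<Longrightarrow> \<sigma>s ! i = T0 \<Longrightarrow> defn \<sigma>s (nv i)"
  using defn_nm [OF deft_xv] by (simp add: nv_def [abs_def] xv_def)
lemma defn_const: "defn \<sigma>s (\<lambda>e. n)"
  unfolding defn_def by (rule deft_const) simp
lemma defn_add: "defn \<sigma>s t \<Longrightarrow> defn \<sigma>s r \<Longrightarrow> defn \<sigma>s (\<lambda>e. t e + r e)"
  unfolding defn_def nd_add [symmetric] by (rule deft_pl)
lemma defn_mult: "defn \<sigma>s t \<Longrightarrow> defn \<sigma>s r \<Longrightarrow> defn \<sigma>s (\<lambda>e. t e * r e)"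
  unfolding defn_def nd_mult [symmetric] by (rule deft_ti)
lemma defn_ap: "deft \<sigma>s T1 u \<Longrightarrow> defn \<sigma>s t \<Longrightarrow> defn \<sigma>s (\<lambda>e. nm (ap M (u e) (nd (t e))))"
  unfolding defn_def [of \<sigma>s t] by (rule defn_nm [OF deft_ap])

lemma deft_subst:
  assumes "deft (\<sigma> # \<sigma>s) \<tau> (\<lambda>e. H (xv 0 e) (tl e))" "deft \<sigma>s \<sigma> u"
  shows "deft \<sigma>s \<tau> (\<lambda>e. H (u e) e)"
proof -
  obtain g where g: "deft \<sigma>s (\<sigma> \<rightarrow> \<tau>) g"
    "\<And>e v. typed_env e \<sigma>s \<Longrightarrow> v \<in> carr M \<sigma> \<Longrightarrow> ap M (g e) v = H v e"
    using deft_lam [OF assms(1)] by auto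
  show ?thesis
    by (rule deft_cong [OF deft_ap [OF g(1) assms(2)]]) (use g(2) deft_carr [OF assms(2)] in simp)
qed

lemma defn_subst:
  assumes "defn (T0 # \<sigma>s) (\<lambda>e. H (nv 0 e) (tl e))" "defn \<sigma>s t"
  shows "defn \<sigma>s (\<lambda>e. H (t e) e)"
  using deft_subst [of T0 \<sigma>s T0 "\<lambda>x e. nd (H (nm x) e)" "\<lambda>e. nd (t e)"] assms
  by (simp add: defn_def nv_def xv_def)

lemma defn_sub: "defn \<sigma>s t \<Longrightarrow> defn \<sigma>s r \<Longrightarrow> defn \<sigma>s (\<lambda>e. t e - r e)"
proof -
  obtain s where s: "deft [T0, T0] T0 s" "\<forall>a\<in>N. \<forall>b\<in>N. (ltr M a b \<longrightarrow> s [b, a] = zer) \<and> (\<not> ltr M a b \<longrightarrow> pl M b (s [b, a]) = a)"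
    using monus_raw by blast
  have sv: "s [nd b, nd a] = nd (a - b)" for a b
  proof (cases "a < b")
    case True
    then show ?thesis using s(2) by (simp add: ball_N nd_less nd_0 diff_truncated less_imp_le)
  next
    case False
    have c: "s [nd b, nd a] \<in> N" using deft_carr [OF s(1)] by simp
    have "pl M (nd b) (s [nd b, nd a]) = nd a" using s(2) False by (simp add: ball_N nd_less)
    then have "nd (b + nm (s [nd b, nd a])) = nd a" using c nd_add [of b "nm (s [nd b, nd a])"] by simp
    then have "nm (s [nd b, nd a]) = a - b" by (metis nd_eq add_diff_cancel_left')
    then show ?thesis using c by (metis nd_nm)
  qed
  obtain g where g: "deft [T0] (T0 \<rightarrow> T0) g" "\<And>e v. typed_env e [T0] \<Longrightarrow> v \<in> N \<Longrightarrow> ap M (g e) v = s (v # e)"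
    using deft_lam [OF s(1)] by blast
  obtain G where G: "deft [] (T0 \<rightarrow> T0 \<rightarrow> T0) G" "\<And>e v. typed_env e [] \<Longrightarrow> v \<in> N \<Longrightarrow> ap M (G e) v = g (v # e)"
    using deft_lam [OF g(1)] by blast
  assume "defn \<sigma>s t" "defn \<sigma>s r"
  then have "deft \<sigma>s T0 (\<lambda>e. ap M (ap M (G []) (nd (t e))) (nd (r e)))"
    unfolding defn_def using deft_carr [OF G(1), of "[]"] by (intro deft_ap [OF deft_ap [OF deft_const]]) simp_all
  then show ?thesis
    unfolding defn_def by (rule deft_cong) (simp add: G(2) g(2) sv)
qed

lemma defp_less: "defn \<sigma>s t \<Longrightarrow> defn \<sigma>s r \<Longrightarrow> defp \<sigma>s (\<lambda>e. t e < r e)"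
proof -
  \<comment> \<open>Subtraction is truncated, so subtracting from 1 twice computes the sign of
    \<open>b - a\<close>.\<close>
  have "(if a < b then 1 else 0) = 1 - (1 - (b - a))" for a b :: 'n
  proof (cases "a < b")
    case True
    then have "b = a + (b - a)" by (simp add: less_imp_le)
    then have "0 < b - a" using True by (metis add.right_neutral add_less_cancel_left)
    then have "1 \<le> b - a" using less_iff_succ_less_eq [of 0 "b - a"] by simp
    then have "1 - (b - a) = 0" by (rule diff_truncated)
    then show ?thesis using True by simp
  qed (simp add: diff_truncated not_less)
  moreover assume "defn \<sigma>s t" "defn \<sigma>s r"
  ultimately show ?thesis unfolding defp_def by (simp add: defn_sub defn_const)
qed

lemma defp_not: "defp \<sigma>s P \<Longrightarrow> defp \<sigma>s (\<lambda>e. \<not> P e)"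
  unfolding defp_def by (rule defn_cong [OF defn_sub [OF defn_const [of _ 1]]]) auto
lemma defp_and: assumes "defp \<sigma>s P" "defp \<sigma>s Q" shows "defp \<sigma>s (\<lambda>e. P e \<and> Q e)"
proof -
  have "(\<lambda>e. if P e \<and> Q e then 1 else (0 :: 'n)) = (\<lambda>e. (if P e then 1 else 0) * (if Q e then 1 else 0))" by auto
  with assms show ?thesis unfolding defp_def by (simp only: defn_mult)
qed
lemma defp_or: assumes "defp \<sigma>s P" "defp \<sigma>s Q" shows "defp \<sigma>s (\<lambda>e. P e \<or> Q e)"
  using defp_not [OF defp_and [OF defp_not defp_not, OF assms]] by simp
lemma defp_imp: "defp \<sigma>s P \<Longrightarrow> defp \<sigma>s Q \<Longrightarrow> defp \<sigma>s (\<lambda>e. P e \<longrightarrow> Q e)"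
  unfolding imp_conv_disj by (intro defp_or defp_not)
lemma defp_iff: "defp \<sigma>s P \<Longrightarrow> defp \<sigma>s Q \<Longrightarrow> defp \<sigma>s (\<lambda>e. P e = Q e)"
  unfolding iff_conv_conj_imp by (intro defp_and defp_imp)
lemma defp_le: "defn \<sigma>s t \<Longrightarrow> defn \<sigma>s r \<Longrightarrow> defp \<sigma>s (\<lambda>e. t e \<le> r e)"
  using defp_not [OF defp_less [of \<sigma>s r t]] by (simp add: not_less)
lemma defp_eq: "defn \<sigma>s t \<Longrightarrow> defn \<sigma>s r \<Longrightarrow> defp \<sigma>s (\<lambda>e. t e = r e)"
  unfolding order.eq_iff by (intro defp_and defp_le)
lemma defp_const: "defp \<sigma>s (\<lambda>e. b)"
  unfolding defp_def by (rule defn_const)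
lemma defn_if: "defp \<sigma>s P \<Longrightarrow> defn \<sigma>s t \<Longrightarrow> defn \<sigma>s r \<Longrightarrow> defn \<sigma>s (\<lambda>e. if P e then t e else r e)"
proof -
  assume "defp \<sigma>s P" "defn \<sigma>s t" "defn \<sigma>s r"
  then have "defn \<sigma>s (\<lambda>e. (if P e then 1 else 0) * t e + (if \<not> P e then 1 else 0) * r e)"
    by (intro defn_add defn_mult) (auto simp: defp_def [symmetric] intro: defp_not)
  then show ?thesis by (rule defn_cong) simp
qed

definition \<phi> :: 'a where
  "\<phi> = (SOME F. F \<in> carr M (T1 \<rightarrow> T0) \<and> (\<forall>f\<in>carr M T1. ap M F f = nd (if \<exists>n. ap M f (nd n) = nd 0 then 0 else 1)))"

lemma \<phi>: "\<phi> \<in> carr M (T1 \<rightarrow> T0)"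
  "f \<in> carr M T1 \<Longrightarrow> ap M \<phi> f = nd (if \<exists>n. ap M f (nd n) = nd 0 then 0 else 1)"
proof -
  have "sat M [] exists2_axiom" by (rule ax [OF ACA0w_axioms(3)])
  then obtain F where "F \<in> carr M (T1 \<rightarrow> T0)" "\<forall>f\<in>carr M T1. (ap M F f = nd 0 \<or> ap M F f = nd 1) \<and>
     (ap M F f = nd 0 \<longleftrightarrow> (\<exists>n. ap M f (nd n) = nd 0))"
    by (auto simp: exists2_axiom_def sat_ex_nat eqr_eq nd_0 nd_1 bex_N)
  then have "\<exists>F. F \<in> carr M (T1 \<rightarrow> T0) \<and> (\<forall>f\<in>carr M T1. ap M F f = nd (if \<exists>n. ap M f (nd n) = nd 0 then 0 else 1))"
    by (intro exI [of _ F]) auto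
  from someI_ex [OF this] show "\<phi> \<in> carr M (T1 \<rightarrow> T0)"
    "f \<in> carr M T1 \<Longrightarrow> ap M \<phi> f = nd (if \<exists>n. ap M f (nd n) = nd 0 then 0 else 1)"
    unfolding \<phi>_def by blast+
qed

lemma defn_lam:
  assumes "defn (T0 # \<sigma>s) (\<lambda>e. t (nv 0 e) (tl e))"
  shows "\<exists>g. deft \<sigma>s T1 g \<and> (\<forall>e n. typed_env e \<sigma>s \<longrightarrow> ap M (g e) (nd n) = nd (t n e))"
proof -
  obtain g where "deft \<sigma>s T1 g"
    "\<And>e v. typed_env e \<sigma>s \<Longrightarrow> v \<in> N \<Longrightarrow> ap M (g e) v = nd (t (nm v) e)"
    using deft_lam [OF assms [unfolded defn_def]] by auto
  then show ?thesis by (intro exI [of _ g]) auto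
qed

lemma defp_lam:
  assumes "defp (T0 # \<sigma>s) (\<lambda>e. P (nv 0 e) (tl e))"
  shows "\<exists>g. deft \<sigma>s T1 g \<and> (\<forall>e n. typed_env e \<sigma>s \<longrightarrow> ap M (g e) (nd n) = nd (if P n e then 1 else 0))"
  using defn_lam [of \<sigma>s "\<lambda>n e. if P n e then 1 else 0"] assms unfolding defp_def by blast

text \<open>The witnesses are the zeros of the characteristic function of the negation, and
  \<open>\<phi>\<close> decides whether that sequence has a zero.\<close>

lemma defp_ex:
  assumes "defp (T0 # \<sigma>s) (\<lambda>e. P (nv 0 e) (tl e))"
  shows "defp \<sigma>s (\<lambda>e. \<exists>n. P n e)"
proof -
  obtain g where g: "deft \<sigma>s T1 g"
    "\<And>e n. typed_env e \<sigma>s \<Longrightarrow> ap M (g e) (nd n) = nd (if \<not> P n e then 1 else 0)"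
    using defp_lam [of \<sigma>s "\<lambda>n e. \<not> P n e"] defp_not [OF assms] by blast
  have "defn \<sigma>s (\<lambda>e. 1 - nm (ap M \<phi> (g e)))"
    by (intro defn_sub defn_const defn_nm deft_ap [OF deft_const [OF \<phi>(1)] g(1)])
  then show ?thesis
    unfolding defp_def by (rule defn_cong) (simp add: \<phi>(2) deft_carr [OF g(1)] g(2))
qed

lemma defp_all: "defp (T0 # \<sigma>s) (\<lambda>e. P (nv 0 e) (tl e)) \<Longrightarrow> defp \<sigma>s (\<lambda>e. \<forall>n. P n e)"
  using defp_not [OF defp_ex [OF defp_not]] by simp

text \<open>\<open>induction\<close> and \<open>lst\<close> are stated for predicates of a single
  number; here the other variables are frozen by taking the sequence \<open>g e\<close> as a
  parameter.\<close>

lemma defp_special: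
  assumes P: "defp (T0 # \<sigma>s) (\<lambda>e. P (nv 0 e) (tl e))" and e: "typed_env e \<sigma>s"
  shows "defp [T0] (\<lambda>e'. P (nv 0 e') e)"
proof -
  obtain g where g: "deft \<sigma>s T1 g"
    "\<And>e n. typed_env e \<sigma>s \<Longrightarrow> ap M (g e) (nd n) = nd (if P n e then 1 else 0)"
    using defp_lam [OF P] by blast
  have "defn [T0] (\<lambda>e'. nm (ap M (g e) (nd (nv 0 e'))))"
    by (intro defn_ap deft_const deft_carr [OF g(1) e] defn_nv) simp_all
  then show ?thesis unfolding defp_def using g(2) [OF e] by simp
qed

lemma defq_cong: "defq \<sigma>s P \<Longrightarrow> (\<And>e. typed_env e \<sigma>s \<Longrightarrow> P e = Q e) \<Longrightarrow> defq \<sigma>s Q"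
  unfolding defq_def by (elim exE conjE, intro exI conjI, assumption+) simp

lemma defp_fun: "defp [T0] (\<lambda>e. P (nv 0 e)) \<Longrightarrow> defn \<sigma>s t \<Longrightarrow> defp \<sigma>s (\<lambda>e. P (t e))"
proof -
  assume P: "defp [T0] (\<lambda>e. P (nv 0 e))" and t: "defn \<sigma>s t"
  obtain g where g: "deft [] T1 g"
    "\<And>e n. typed_env e [] \<Longrightarrow> ap M (g e) (nd n) = nd (if P n then 1 else 0)"
    using defp_lam [of "[]" "\<lambda>n e. P n"] P by blast
  have "defn \<sigma>s (\<lambda>e. nm (ap M (g []) (nd (t e))))"
    by (intro defn_ap deft_const t deft_carr [OF g(1)]) simp
  then show ?thesis unfolding defp_def using g(2) [of "[]"] by simp
qed

text \<open>The characteristic function turns \<open>P\<close> into an equation, so the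
  quantifier-free scheme yields induction for every arithmetical predicate with parameters.\<close>

lemma induction:
  assumes P: "defp [T0] (\<lambda>e. P (nv 0 e))" and z: "P 0" and s: "\<And>n. P n \<Longrightarrow> P (n + 1)"
  shows "P n"
proof -
  have q: "defq [T0] (\<lambda>e. nd (if P (nv 0 e) then 1 else 0) = nd 1)"
    by (rule defq_eq [OF _ deft_const]) (use P in \<open>simp_all add: defp_def defn_def\<close>)
  have "defq [T0] (\<lambda>e. P (nm (e ! 0)))"
    by (rule defq_cong [OF q]) (auto simp: list_all2_Cons2)
  then have "P (nm (nd n))"
  proof (rule induction_qf [where P = "\<lambda>x. P (nm x)"])
    show "P (nm zer)" using z by (simp add: nd_0)
    show "P (nm (pl M x one))" if "x \<in> N" "P (nm x)" for x
      using s [OF that(2)] nd_add [of "nm x" 1] that(1) by (simp add: nd_1)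
  qed simp
  then show ?thesis by simp
qed

lemma less_Suc: "m < n + 1 \<longleftrightarrow> m \<le> n" for m n :: 'n
  using less_eq_iff_succ_less [of m n] by simp

lemma Suc_le: "n + 1 \<le> m \<longleftrightarrow> n < m" for m n :: 'n
  using less_iff_succ_less_eq [of n m] by simp

definition lst :: "('n \<Rightarrow> bool) \<Rightarrow> 'n" where
  "lst P = (if \<exists>n. P n then THE n. P n \<and> (\<forall>m<n. \<not> P m) else 0)"

lemma lst_eq: "P n \<Longrightarrow> \<forall>m<n. \<not> P m \<Longrightarrow> lst P = n"
  unfolding lst_def by (auto intro!: the_equality) (meson linorder_neqE)

lemma lst:
  assumes P: "defp [T0] (\<lambda>e. P (nv 0 e))" and ex: "P k"
  shows "P (lst P)" "m < lst P \<Longrightarrow> \<not> P m"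
proof -
  have "\<exists>n. P n \<and> (\<forall>m<n. \<not> P m)"
  proof (rule ccontr)
    assume no: "\<nexists>n. P n \<and> (\<forall>m<n. \<not> P m)"
    have "defp [T0] (\<lambda>e. \<forall>m. m < nv 0 e \<longrightarrow> \<not> P m)"
      by (rule defp_all defp_imp defp_less defp_not defn_nv defp_fun [OF P] | simp only: v_tl | (simp; fail))+
    then have "\<forall>m. m < n \<longrightarrow> \<not> P m" for n
    proof (rule induction [where P = "\<lambda>n. \<forall>m. m < n \<longrightarrow> \<not> P m"])
      show "\<forall>m. m < 0 \<longrightarrow> \<not> P m" by (simp add: not_less [THEN iffD2])
      fix n assume n: "\<forall>m. m < n \<longrightarrow> \<not> P m"
      then have "\<not> P n" using no by blast
      with n show "\<forall>m. m < n + 1 \<longrightarrow> \<not> P m" by (auto simp: less_Suc le_less)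
    qed
    from this [of "k + 1"] ex show False by (simp add: less_Suc)
  qed
  then obtain n where "P n" "\<forall>m<n. \<not> P m" by blast
  then show "P (lst P)" "m < lst P \<Longrightarrow> \<not> P m" using lst_eq by auto
qed


text \<open>Choice provides some witness as a functional of the characteristic function. Applied to
  \<open>Q\<close>, which only the least witness satisfies, it has no freedom left.\<close>

lemma defn_lst:
  assumes P: "defp (T0 # \<sigma>s) (\<lambda>e. P (nv 0 e) (tl e))"
  shows "defn \<sigma>s (\<lambda>e. lst (\<lambda>n. P n e))"
proof -
  define Q where "Q n e \<longleftrightarrow> P n e \<and> (\<forall>m. m < n \<longrightarrow> \<not> P m e)" for n e
  have P2: "defp (T0 # T0 # \<sigma>s) (\<lambda>e. P (nv 0 e) (tl (tl e)))"
  proof -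
    obtain g where g: "deft \<sigma>s T1 g" "\<And>e n. typed_env e \<sigma>s \<Longrightarrow> ap M (g e) (nd n) = nd (if P n e then 1 else 0)"
      using defp_lam [OF P] by blast
    have "defn (T0 # T0 # \<sigma>s) (\<lambda>e. nm (ap M (g (tl (tl e))) (nd (nv 0 e))))"
      by (intro defn_ap deft_tl g(1) defn_nv) simp_all
    then show ?thesis
      unfolding defp_def
    proof (rule defn_cong)
      fix e assume "typed_env e (T0 # T0 # \<sigma>s)"
      then obtain x y e' where e: "e = x # y # e'" "x \<in> N" "typed_env e' \<sigma>s" by (auto simp: list_all2_Cons2)
      have "ap M (g e') (nd (nm x)) = nd (if P (nm x) e' then 1 else 0)" using g(2) [OF e(3)] .
      then show "nm (ap M (g (tl (tl e))) (nd (nv 0 e))) = (if P (nv 0 e) (tl (tl e)) then 1 else 0)"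
        by (simp add: e(1))
    qed
  qed
  have "defp (T0 # \<sigma>s) (\<lambda>e. Q (nv 0 e) (tl e))"
    unfolding Q_def by (rule defp_and defp_all defp_imp defp_not defp_less P P2 defn_nv | simp only: v_tl | (simp; fail))+
  then obtain g where g: "deft \<sigma>s T1 g"
    "\<And>e n. typed_env e \<sigma>s \<Longrightarrow> ap M (g e) (nd n) = nd (if \<not> Q n e then 1 else 0)"
    using defp_lam [of \<sigma>s "\<lambda>n e. \<not> Q n e"] defp_not by blast
  have q: "defp \<sigma>s (\<lambda>e. \<exists>n. Q n e)" by (rule defp_ex) fact
  have x: "deft [T0, T1] T0 (\<lambda>e. ap M (e ! 1) (e ! 0))"
    by (rule deft_ap [OF deft_nth deft_nth]) simp_all
  have y: "deft [T0, T1] T0 (\<lambda>e. ap M \<phi> (e ! 1))"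
    by (rule deft_ap [OF deft_const [OF \<phi>(1)] deft_nth]) simp_all
  \<comment> \<open>One functional finds a zero of every sequence that has one. The second
    alternative, quantifier-free thanks to \<open>\<phi>\<close>, covers the sequences without
    zeros, so that the premise of choice holds for all sequences.\<close>
  have "\<exists>Y\<in>carr M (T1 \<rightarrow> T0). \<forall>x\<in>carr M T1. ap M x (ap M Y x) = nd 0 \<or> \<not> ap M \<phi> x = nd 0"
  proof (rule choice_qf [where P = "\<lambda>x n. ap M x n = nd 0 \<or> \<not> ap M \<phi> x = nd 0"])
    show "defq [T0, T1] (\<lambda>e. ap M (e ! 1) (e ! 0) = nd 0 \<or> \<not> ap M \<phi> (e ! 1) = nd 0)"
      by (intro defq_or defq_not defq_eq x y deft_const nd_in)
    show "\<exists>n\<in>N. ap M x n = nd 0 \<or> \<not> ap M \<phi> x = nd 0" if "x \<in> carr M T1" for x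
      using \<phi>(2) [OF that] by (auto simp: bex_N)
  qed
  then obtain Y where Y: "Y \<in> carr M (T1 \<rightarrow> T0)" "\<And>x. x \<in> carr M T1 \<Longrightarrow> ap M x (ap M Y x) = nd 0 \<or> ap M \<phi> x \<noteq> nd 0"
    by blast
  have "defn \<sigma>s (\<lambda>e. if \<exists>n. Q n e then nm (ap M Y (g e)) else 0)"
    by (intro defn_if q defn_const defn_nm deft_ap [OF deft_const [OF Y(1)] g(1)])
  then show ?thesis
  proof (rule defn_cong)
    fix e assume e: "typed_env e \<sigma>s"
    have c: "g e \<in> carr M T1" using deft_carr [OF g(1) e] .
    have PQ: "(\<exists>n. Q n e) \<longleftrightarrow> (\<exists>n. P n e)"
      using lst [OF defp_special [OF P e]] unfolding Q_def by blast
    show "(if \<exists>n. Q n e then nm (ap M Y (g e)) else 0) = lst (\<lambda>n. P n e)"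
    proof (cases "\<exists>n. Q n e")
      case True
      then have "ap M \<phi> (g e) = nd 0" using \<phi>(2) [OF c] g(2) [OF e] by auto
      then have "ap M (g e) (ap M Y (g e)) = nd 0" using Y(2) [OF c] by blast
      moreover have "ap M Y (g e) \<in> N" using ap_carr [OF Y(1) c] .
      ultimately have "Q (nm (ap M Y (g e))) e" using g(2) [OF e, of "nm (ap M Y (g e))"] by (auto split: if_splits)
      then show ?thesis using True lst_eq [of "\<lambda>n. P n e"] unfolding Q_def by auto
    next
      case False
      then show ?thesis using PQ by (simp add: lst_def)
    qed
  qed
qed

lemma recursion:
  assumes g: "defn (T0 # T0 # \<sigma>s) (\<lambda>e. g (nv 0 e) (nv 1 e) (tl (tl e)))" and m: "defn \<sigma>s m"
  shows "\<exists>h. defn (T0 # \<sigma>s) (\<lambda>e. h (nv 0 e) (tl e)) \<and>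
    (\<forall>e. typed_env e \<sigma>s \<longrightarrow> h 0 e = m e \<and> (\<forall>n. h (n + 1) e = g (h n e) n e))"
proof -
  obtain h where h: "deft (T0 # \<sigma>s) T0 h" "\<And>e. typed_env e \<sigma>s \<Longrightarrow> h (zer # e) = nd (m e) \<and>
    (\<forall>n\<in>N. h (pl M n one # e) = nd (g (nm (h (n # e))) (nm n) e))"
    using rec_ex [OF g [unfolded defn_def] m [unfolded defn_def]] by auto
  show ?thesis
  proof (intro exI [of _ "\<lambda>n e. nm (h (nd n # e))"] conjI allI impI)
    show "defn (T0 # \<sigma>s) (\<lambda>e. nm (h (nd (nv 0 e) # tl e)))"
      by (rule defn_cong [OF defn_nm [OF h(1)]]) (auto simp: list_all2_Cons2)
    fix e assume e: "typed_env e \<sigma>s"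
    show "nm (h (nd 0 # e)) = m e" using h(2) [OF e] by (simp add: nd_0)
    show "nm (h (nd (n + 1) # e)) = g (nm (h (nd n # e))) n e" for n
      using h(2) [OF e] by (simp add: ball_N nd_1 nd_add)
  qed
qed

lemmas num_intros = defp_and defp_or defp_not defp_imp defp_iff defp_all defp_ex defp_less defp_le defp_eq
  defp_const defn_nv defn_const defn_add defn_mult defn_sub defn_if defn_lst

end

section \<open>Rationals and reals in models\<close>

context nmodel
begin

lemma defp_tl: "defp \<sigma>s P \<Longrightarrow> defp (\<tau> # \<sigma>s) (\<lambda>e. P (tl e))"
  unfolding defp_def defn_def by (rule deft_tl)

lemma defn_tl: "defn \<sigma>s t \<Longrightarrow> defn (\<tau> # \<sigma>s) (\<lambda>e. t (tl e))"
  unfolding defn_def by (rule deft_tl)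

section \<open>Powers of two, pairing and codes of rationals\<close>

definition two_pow_fun :: 'a where
  "two_pow_fun = ap M (ap M (con M Rec0) (ap M (con M (CombK T1 T0)) (ap M (ap M (con M (CombS T0 T0 T0)) (con M Plus))
     (ap M (ap M (con M (CombS T0 T1 T0)) (con M (CombK T0 T1))) (con M (CombK T0 T0)))))) (con M One)"

definition pw :: "'n \<Rightarrow> 'n" where "pw n = nm (ap M two_pow_fun (nd n))"

lemma two_pow_fun:
  "two_pow_fun \<in> carr M T1" "ap M two_pow_fun (nd 0) = nd 1"
  "ap M two_pow_fun (nd (n + 1)) = pl M (ap M two_pow_fun (nd n)) (ap M two_pow_fun (nd n))"
proof -
  define J where "J = ap M (ap M (con M (CombS T0 T1 T0)) (con M (CombK T0 T1))) (con M (CombK T0 T0))"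
  define D where "D = ap M (ap M (con M (CombS T0 T0 T0)) (con M Plus)) J"
  define F where "F = ap M (con M (CombK T1 T0)) D"
  have J: "J \<in> carr M (T0 \<rightarrow> T0)" unfolding J_def by (rule S_carr [OF con_types(5) con_types(5)])
  have Jv: "ap M J v = v" if "v \<in> N" for v
    unfolding J_def using S_ax [OF con_types(5) con_types(5) that] K_ax [OF that K_carr [OF that]] by simp
  have D: "D \<in> carr M T1" unfolding D_def by (rule S_carr [OF con_types(3) J])
  have Dv: "ap M D v = pl M v v" if "v \<in> N" for v
    unfolding D_def using S_ax [OF con_types(3) J that] Jv [OF that] by (simp add: pl_def)
  have F: "F \<in> carr M (T0 \<rightarrow> T0 \<rightarrow> T0)" unfolding F_def by (rule K_carr [OF D])
  have t: "two_pow_fun = ap M (ap M (con M Rec0) F) (con M One)"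
    by (simp add: two_pow_fun_def F_def D_def J_def)
  show c: "two_pow_fun \<in> carr M T1" unfolding t by (rule ap_carr [OF ap_carr [OF con_types(7) F] con_types(2)])
  show "ap M two_pow_fun (nd 0) = nd 1" unfolding t using rec_raw(1) [OF F con_types(2)] by (simp add: nd_0 nd_1)
  have n: "ap M two_pow_fun (nd n) \<in> N" by (rule ap_carr [OF c nd_in])
  have "ap M (ap M F (nd n)) v = pl M v v" if "v \<in> N" for v
    unfolding F_def using K_ax [OF D nd_in, of n] Dv [OF that] by simp
  then show "ap M two_pow_fun (nd (n + 1)) = pl M (ap M two_pow_fun (nd n)) (ap M two_pow_fun (nd n))"
    using rec_raw(2) [OF F con_types(2) nd_in, of n] n unfolding t by (simp add: nd_1 nd_add)
qed

lemma pw_0 [simp]: "pw 0 = 1" and pw_Suc: "pw (n + 1) = pw n + pw n"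
proof -
  show "pw 0 = 1" by (simp add: pw_def two_pow_fun)
  have "ap M two_pow_fun (nd n) = nd (pw n)" for n
    unfolding pw_def using ap_carr [OF two_pow_fun(1) nd_in] by simp
  then show "pw (n + 1) = pw n + pw n"
    using two_pow_fun(3) [of n] by (simp add: nd_add)
qed

lemma defn_pw: "defn \<sigma>s t \<Longrightarrow> defn \<sigma>s (\<lambda>e. pw (t e))"
  using defn_ap [OF deft_const [OF two_pow_fun(1)]] by (simp add: pw_def)

lemma pos_1: "0 < x \<longleftrightarrow> 1 \<le> x" for x :: 'n
  using less_iff_succ_less_eq [of 0 x] by simp

lemma pw_pos [simp]: "0 < pw n"
proof (rule induction [where P = "\<lambda>n. 0 < pw n"])
  show "defp [T0] (\<lambda>e. 0 < pw (nv 0 e))"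
    by (rule num_intros defn_pw | simp only: v_tl | (simp; fail))+
qed (simp_all add: pw_Suc add_pos_pos)

lemma less_pw: "n < pw n"
proof (rule induction [where P = "\<lambda>n. n < pw n"])
  show "defp [T0] (\<lambda>e. nv 0 e < pw (nv 0 e))"
    by (rule num_intros defn_pw | simp only: v_tl | (simp; fail))+
  fix n assume "n < pw n"
  then have "n + 1 \<le> pw n" by (simp add: Suc_le)
  also have "pw n < pw n + pw n" by simp
  finally show "n + 1 < pw (n + 1)" by (simp add: pw_Suc)
qed simp

lemma pw_add: "pw (m + n) = pw m * pw n"
proof (rule induction [where P = "\<lambda>n. pw (m + n) = pw m * pw n"])
  show "defp [T0] (\<lambda>e. pw (m + nv 0 e) = pw m * pw (nv 0 e))"
    by (rule num_intros defn_pw | simp only: v_tl | (simp; fail))+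
  show "pw (m + (n + 1)) = pw m * pw (n + 1)" if "pw (m + n) = pw m * pw n" for n
    using that pw_Suc [of "m + n"] by (simp add: pw_Suc add.assoc distrib_left)
qed simp

lemma pw_mono: "m \<le> n \<Longrightarrow> pw m \<le> pw n"
proof -
  assume "m \<le> n"
  then have "n = m + (n - m)" by simp
  then have "pw n = pw m * pw (n - m)" using pw_add by metis
  moreover have "pw m * 1 \<le> pw m * pw (n - m)" using pw_pos [of "n - m"] by (intro mult_left_mono) (simp_all add: pos_1)
  ultimately show ?thesis by simp
qed

definition eps :: "'n \<Rightarrow> 'n rl" where "eps n = 1 / emb (pw n)"

lemma emb_pw_pos [simp]: "0 < emb (pw n)"
  using emb_less [of 0 "pw n"] by (simp del: emb_less)
lemma eps_pos [simp]: "0 < eps n" by (simp add: eps_def)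
lemma eps_0 [simp]: "eps 0 = 1" by (simp add: eps_def)
lemma eps_Suc: "eps (n + 1) = eps n / 2" by (simp add: eps_def pw_Suc)
lemma eps_add: "eps (m + n) = eps m * eps n" by (simp add: eps_def pw_add)
lemma eps_mono: "m \<le> n \<Longrightarrow> eps n \<le> eps m"
  using pw_mono [of m n] by (simp add: eps_def frac_le)
text \<open>Combines the relative archimedean property with \<open>n < pw n\<close>.\<close>

lemma eps_small: "0 < v \<Longrightarrow> \<exists>n. eps n < v"
proof -
  assume v: "0 < v"
  then obtain n where "1 < v * emb n" using emb_archimedean by blast
  also have "\<dots> \<le> v * emb (pw n)" using v less_pw [of n] by (intro mult_left_mono) (simp_all add: less_imp_le)
  finally have "eps n < v" by (simp add: eps_def divide_less_eq)
  then show ?thesis ..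
qed
lemma rat_eps: "\<exists>a b c. eps n = rat a b c"
proof -
  obtain d where "pw n = d + 1" using arith_nat_pos [OF pw_pos] by blast
  then have "eps n = rat 1 0 d" by (simp add: eps_def rat_def)
  then show ?thesis by blast
qed
lemma eps_between: assumes "x < y" shows "\<exists>n. x + eps n < y"
proof -
  from assms have "0 < y - x" by simp
  from eps_small [OF this] obtain n where "eps n < y - x" by blast
  then show ?thesis by (intro exI [of _ n]) linarith
qed

definition PC :: "'n \<Rightarrow> 'n \<Rightarrow> 'n \<Rightarrow> bool" where
  "PC p a b \<longleftrightarrow> p + p = (a + b) * (a + b + 1) + (a + a)"

text \<open>Walk along the antidiagonals: the pair after (a, b) is (a + 1, b - 1), or (0, a + 1)
  when \<open>b = 0\<close>.\<close>

lemma PC_ex: "\<exists>a b. PC p a b"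
proof (rule induction [where P = "\<lambda>p. \<exists>a b. PC p a b"])
  show "defp [T0] (\<lambda>e. \<exists>a b. PC (nv 0 e) a b)"
    unfolding PC_def by (rule num_intros | simp only: v_tl | (simp; fail))+
  show "\<exists>a b. PC 0 a b" unfolding PC_def by (intro exI [of _ 0]) simp
  fix n assume "\<exists>a b. PC n a b"
  then obtain a b where ab: "n + n = (a + b) * (a + b + 1) + (a + a)" unfolding PC_def by blast
  have two: "n + 1 + (n + 1) = (n + n) + (1 + 1)" by (simp add: algebra_simps del: one_add_one)
  show "\<exists>a b. PC (n + 1) a b"
  proof (cases "b = 0")
    case True
    then show ?thesis
      unfolding PC_def two ab by - (rule exI [of _ 0], rule exI [of _ "a + 1"], simp add: algebra_simps del: one_add_one)
  next
    case False
    then have "0 < b" using nonneg [of b] by (simp add: le_less)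
    then obtain c where "b = c + 1" using arith_nat_pos by blast
    then show ?thesis
      unfolding PC_def two ab by - (rule exI [of _ "a + 1"], rule exI [of _ c], simp add: algebra_simps del: one_add_one)
  qed
qed

text \<open>The code requires half of \<open>s * (s + 1)\<close>; that this product is even is
  proved by induction in the model.\<close>

lemma PC_fun: "\<exists>p. PC p a b"
proof -
  have "\<exists>t. t + t = s * (s + 1)" for s :: 'n
  proof (rule induction [where P = "\<lambda>s :: 'n. \<exists>t. t + t = s * (s + 1)"])
    show "defp [T0] (\<lambda>e. \<exists>t. t + t = nv 0 e * (nv 0 e + 1))"
      by (rule num_intros | simp only: v_tl | (simp; fail))+
    fix n :: 'n assume "\<exists>t. t + t = n * (n + 1)"
    then obtain t where t: "t + t = n * (n + 1)" by blast
    have "(t + n + 1) + (t + n + 1) = (t + t) + (n + n + 1 + 1)" by (simp add: algebra_simps del: one_add_one)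
    also have "\<dots> = (n + 1) * (n + 1 + 1)" unfolding t by (simp add: algebra_simps del: one_add_one)
    finally show "\<exists>t. t + t = (n + 1) * (n + 1 + 1)" by blast
  qed (intro exI [of _ 0], simp)
  then obtain t where t: "t + t = (a + b) * (a + b + 1)" by blast
  have "t + a + (t + a) = (t + t) + (a + a)" by (simp add: algebra_simps del: one_add_one)
  then show ?thesis unfolding PC_def t by blast
qed

text \<open>On the antidiagonal with sum S the doubled codes run from S (S + 1) to S (S + 1) + 2 S,
  which is less than (S + 1) (S + 2), where the next antidiagonal begins.\<close>

lemma PC_le: assumes "PC p a b" "PC p c d" shows "a + b \<le> c + d"
proof (rule ccontr)
  assume "\<not> a + b \<le> c + d"
  then have "(c + d) + 1 \<le> a + b" by (simp add: Suc_le)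
  then have "emb (c + d + 1) \<le> emb (a + b)" by (simp only: emb_le)
  then have st: "emb (c + d) + 1 \<le> emb (a + b)" by (simp only: emb_hom)
  define S T where "S = emb (c + d)" and "T = emb (a + b)"
  have ST: "S + 1 \<le> T" "0 \<le> S" using st by (simp_all only: S_def T_def emb_nonneg)
  have 1: "emb p + emb p = T * (T + 1) + (emb a + emb a)"
    using arg_cong [OF assms(1) [unfolded PC_def], of emb] by (simp add: T_def)
  have 2: "emb p + emb p = S * (S + 1) + (emb c + emb c)"
    using arg_cong [OF assms(2) [unfolded PC_def], of emb] by (simp add: S_def)
  have "emb c \<le> S" unfolding S_def by (simp del: emb_hom)
  moreover have "(S + 1) * (S + 2) \<le> T * (T + 1)" using ST by (intro mult_mono) auto
  then have "S * S + 3 * S + 2 \<le> T * T + T" by (simp add: algebra_simps)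
  moreover have "emb p + emb p = T * T + T + (emb a + emb a)" "emb p + emb p = S * S + S + (emb c + emb c)"
    using 1 2 by (simp_all add: algebra_simps)
  ultimately show False using emb_nonneg [of a] by linarith
qed

lemma PC_inj: assumes "PC p a b" "PC p c d" shows "a = c \<and> b = d"
proof -
  have s: "a + b = c + d" using PC_le assms by (blast intro: order.antisym)
  then have "a + a = c + c" using assms by (simp add: PC_def)
  then have "emb a + emb a = emb c + emb c" by (metis emb_hom(1))
  then have "emb a = emb c" by (simp add: mult_2 [symmetric])
  then show ?thesis using s by simp
qed

definition rc :: "'n \<Rightarrow> 'n \<Rightarrow> 'n \<Rightarrow> 'n \<Rightarrow> bool" where
  "rc q a b c \<longleftrightarrow> (\<exists>p. PC p b c \<and> PC q a p)"

lemma rc_ex: "\<exists>a b c. rc q a b c" and rc_fun: "\<exists>q. rc q a b c"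
  using PC_ex PC_fun by (meson rc_def)+
lemma rc_inj: "rc q a b c \<Longrightarrow> rc q a' b' c' \<Longrightarrow> a = a' \<and> b = b' \<and> c = c'"
  unfolding rc_def using PC_inj by blast

definition rq :: "'n \<Rightarrow> 'n rl" where "rq q = (THE v. \<exists>a b c. rc q a b c \<and> v = rat a b c)"

lemma rq_eq: "rc q a b c \<Longrightarrow> rq q = rat a b c"
  unfolding rq_def using rc_inj by (intro the_equality) blast+

lemma rat_rq: "\<exists>q. rat a b c = rq q" using rc_fun rq_eq by metis
lemma rq_rat: "\<exists>a b c. rq q = rat a b c" using rc_ex rq_eq by metis

lemma rq_dense: "x < y \<Longrightarrow> \<exists>q. x < rq q \<and> rq q < y"
proof -
  assume "x < y"
  then have "0 < (y - x) / 2" by simp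
  from rat_dense [OF this, of "(x + y) / 2"] obtain a b c where "\<bar>(x + y) / 2 - rat a b c\<bar> < (y - x) / 2" by blast
  then have "x < rat a b c" "rat a b c < y" by (auto simp: abs_less_iff field_simps)
  then show ?thesis using rat_rq by metis
qed

text \<open>Rational-valued terms, represented by numerator parts and denominator.\<close>

definition defq_rat :: "ty list \<Rightarrow> ('a list \<Rightarrow> 'n rl) \<Rightarrow> bool" where
  "defq_rat \<sigma>s w \<longleftrightarrow> (\<exists>a b c. defn \<sigma>s a \<and> defn \<sigma>s b \<and> defn \<sigma>s c \<and>
     (\<forall>e. typed_env e \<sigma>s \<longrightarrow> w e = rat (a e) (b e) (c e)))"

lemma defq_ratI: "defn \<sigma>s a \<Longrightarrow> defn \<sigma>s b \<Longrightarrow> defn \<sigma>s c \<Longrightarrow>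
    (\<And>e. typed_env e \<sigma>s \<Longrightarrow> w e = rat (a e) (b e) (c e)) \<Longrightarrow> defq_rat \<sigma>s w"
  unfolding defq_rat_def by blast

lemma defq_ratE:
  assumes "defq_rat \<sigma>s w"
  obtains a b c where "defn \<sigma>s a" "defn \<sigma>s b" "defn \<sigma>s c" "\<And>e. typed_env e \<sigma>s \<Longrightarrow> w e = rat (a e) (b e) (c e)"
  using assms unfolding defq_rat_def by (elim exE conjE) (rule that, assumption+, simp)

lemma emb_ne: "emb c + 1 \<noteq> 0"
  using emb_nonneg [of c] by linarith

lemma rat_add: "rat a b c + rat a' b' c' =
    rat (a * (c' + 1) + a' * (c + 1)) (b * (c' + 1) + b' * (c + 1)) (c * c' + c + c')"
proof -
  have "emb (c * c' + c + c') + 1 = (emb c + 1) * (emb c' + 1)" by (simp add: algebra_simps)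
  then show ?thesis unfolding rat_def using emb_ne [of c] emb_ne [of c'] by (simp add: divide_simps) (simp add: algebra_simps)
qed
lemma rat_mult: "rat a b c * rat a' b' c' = rat (a * a' + b * b') (a * b' + b * a') (c * c' + c + c')"
proof -
  have "emb (c * c' + c + c') + 1 = (emb c + 1) * (emb c' + 1)" by (simp add: algebra_simps)
  then show ?thesis unfolding rat_def by simp (simp add: algebra_simps)
qed
lemma rat_uminus: "- rat a b c = rat b a c"
  by (simp add: rat_def minus_divide_left)
lemma rat_less: "rat a b c < rat a' b' c' \<longleftrightarrow> a * (c' + 1) + b' * (c + 1) < a' * (c + 1) + b * (c' + 1)"
proof -
  have p: "0 < emb c + 1" "0 < emb c' + 1" using emb_nonneg [of c] emb_nonneg [of c'] by linarith+
  have "rat a b c < rat a' b' c' \<longleftrightarrow> (emb a - emb b) * (emb c' + 1) < (emb a' - emb b') * (emb c + 1)"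
    unfolding rat_def using p by (simp add: divide_less_eq pos_less_divide_eq mult.commute)
  also have "\<dots> \<longleftrightarrow> emb (a * (c' + 1) + b' * (c + 1)) < emb (a' * (c + 1) + b * (c' + 1))"
    by (simp add: algebra_simps del: emb_less)
  finally show ?thesis unfolding emb_less .
qed

lemma defq_add: "defq_rat \<sigma>s w \<Longrightarrow> defq_rat \<sigma>s w' \<Longrightarrow> defq_rat \<sigma>s (\<lambda>e. w e + w' e)"
proof -
  assume w: "defq_rat \<sigma>s w" and w': "defq_rat \<sigma>s w'"
  obtain a b c where 1: "defn \<sigma>s a" "defn \<sigma>s b" "defn \<sigma>s c" "\<And>e. typed_env e \<sigma>s \<Longrightarrow> w e = rat (a e) (b e) (c e)"
    using w by (rule defq_ratE) blast
  obtain a' b' c' where 2: "defn \<sigma>s a'" "defn \<sigma>s b'" "defn \<sigma>s c'" "\<And>e. typed_env e \<sigma>s \<Longrightarrow> w' e = rat (a' e) (b' e) (c' e)"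
    using w' by (rule defq_ratE) blast
  note * = 1(1-3) 2(1-3)
  show ?thesis
    by (rule defq_ratI [where a = "\<lambda>e. a e * (c' e + 1) + a' e * (c e + 1)"
          and b = "\<lambda>e. b e * (c' e + 1) + b' e * (c e + 1)"
          and c = "\<lambda>e. c e * c' e + c e + c' e"]; (intro defn_add defn_mult defn_const * | simp add: 1(4) 2(4) rat_add))
qed
lemma defq_mult: "defq_rat \<sigma>s w \<Longrightarrow> defq_rat \<sigma>s w' \<Longrightarrow> defq_rat \<sigma>s (\<lambda>e. w e * w' e)"
proof -
  assume w: "defq_rat \<sigma>s w" and w': "defq_rat \<sigma>s w'"
  obtain a b c where 1: "defn \<sigma>s a" "defn \<sigma>s b" "defn \<sigma>s c" "\<And>e. typed_env e \<sigma>s \<Longrightarrow> w e = rat (a e) (b e) (c e)"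
    using w by (rule defq_ratE) blast
  obtain a' b' c' where 2: "defn \<sigma>s a'" "defn \<sigma>s b'" "defn \<sigma>s c'" "\<And>e. typed_env e \<sigma>s \<Longrightarrow> w' e = rat (a' e) (b' e) (c' e)"
    using w' by (rule defq_ratE) blast
  note * = 1(1-3) 2(1-3)
  show ?thesis
    by (rule defq_ratI [where a = "\<lambda>e. a e * a' e + b e * b' e" and b = "\<lambda>e. a e * b' e + b e * a' e"
          and c = "\<lambda>e. c e * c' e + c e + c' e"]; (intro defn_add defn_mult defn_const * | simp add: 1(4) 2(4) rat_mult))
qed
lemma defq_uminus: "defq_rat \<sigma>s w \<Longrightarrow> defq_rat \<sigma>s (\<lambda>e. - w e)"
  by (erule defq_ratE) (rule defq_ratI [where w = "\<lambda>e. - w e"]; simp add: rat_uminus)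
lemma defq_diff: "defq_rat \<sigma>s w \<Longrightarrow> defq_rat \<sigma>s w' \<Longrightarrow> defq_rat \<sigma>s (\<lambda>e. w e - w' e)"
  using defq_add [OF _ defq_uminus] by simp
lemma defq_emb: "defn \<sigma>s t \<Longrightarrow> defq_rat \<sigma>s (\<lambda>e. emb (t e))"
  by (rule defq_ratI [of _ t "\<lambda>e. 0" "\<lambda>e. 0"]) (simp_all add: defn_const rat_def)
lemma defq_eps: "defn \<sigma>s t \<Longrightarrow> defq_rat \<sigma>s (\<lambda>e. eps (t e))"
proof (rule defq_ratI [of _ "\<lambda>e. 1" "\<lambda>e. 0" "\<lambda>e. pw (t e) - 1"])
  fix e
  have "pw (t e) = (pw (t e) - 1) + 1" using pw_pos [of "t e"] by (simp add: pos_1)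
  then have "emb (pw (t e)) = emb (pw (t e) - 1) + 1" by (metis emb_hom(1,4))
  then show "eps (t e) = rat 1 0 (pw (t e) - 1)" by (simp add: eps_def rat_def)
qed (auto intro!: num_intros defn_pw)
text \<open>Each component of a decoded triple is the only solution of an arithmetical condition,
  hence its least solution, and least solutions are definable.\<close>

lemma defq_rq: "defn \<sigma>s t \<Longrightarrow> defq_rat \<sigma>s (\<lambda>e. rq (t e))"
proof -
  assume t: "defn \<sigma>s t"
  define A B C where "A q = lst (\<lambda>a. \<exists>b c p. PC p b c \<and> PC q a p)" and "B q = lst (\<lambda>b. \<exists>a c p. PC p b c \<and> PC q a p)"
    and "C q = lst (\<lambda>c. \<exists>a b p. PC p b c \<and> PC q a p)" for q
  have "rq q = rat (A q) (B q) (C q)" for q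
  proof -
    obtain a b c where r: "rc q a b c" using rc_ex by blast
    have u: "(\<exists>b c. rc q x b c) \<longleftrightarrow> x = a" "(\<exists>a c. rc q a x c) \<longleftrightarrow> x = b" "(\<exists>a b. rc q a b x) \<longleftrightarrow> x = c" for x
      using r rc_inj [OF r] by blast+
    have "lst (\<lambda>x. x = y) = y" for y by (rule lst_eq) auto
    then show ?thesis using rq_eq [OF r] by (simp add: A_def B_def C_def u [unfolded rc_def])
  qed
  moreover have "defn \<sigma>s (\<lambda>e. A (t e))" "defn \<sigma>s (\<lambda>e. B (t e))" "defn \<sigma>s (\<lambda>e. C (t e))"
    unfolding A_def B_def C_def PC_def by (rule num_intros defn_tl [OF t] t defn_tl | simp only: v_tl | (simp; fail))+
  ultimately show ?thesis by (intro defq_ratI [of _ "\<lambda>e. A (t e)" "\<lambda>e. B (t e)" "\<lambda>e. C (t e)"]) auto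
qed
lemma defq_0: "defq_rat \<sigma>s (\<lambda>e. 0)" and defq_1: "defq_rat \<sigma>s (\<lambda>e. 1)" and defq_num: "defq_rat \<sigma>s (\<lambda>e. numeral k)"
  using defq_emb [OF defn_const, of \<sigma>s 0] defq_emb [OF defn_const, of \<sigma>s 1] defq_emb [OF defn_const, of \<sigma>s "numeral k"]
  by (simp_all add: emb_numeral)

lemma defp_qless: "defq_rat \<sigma>s w \<Longrightarrow> defq_rat \<sigma>s w' \<Longrightarrow> defp \<sigma>s (\<lambda>e. w e < w' e)"
proof -
  assume w: "defq_rat \<sigma>s w" and w': "defq_rat \<sigma>s w'"
  obtain a b c where 1: "defn \<sigma>s a" "defn \<sigma>s b" "defn \<sigma>s c" "\<And>e. typed_env e \<sigma>s \<Longrightarrow> w e = rat (a e) (b e) (c e)"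
    using w by (rule defq_ratE) blast
  obtain a' b' c' where 2: "defn \<sigma>s a'" "defn \<sigma>s b'" "defn \<sigma>s c'" "\<And>e. typed_env e \<sigma>s \<Longrightarrow> w' e = rat (a' e) (b' e) (c' e)"
    using w' by (rule defq_ratE) blast
  note * = 1(1-3) 2(1-3)
  have "defp \<sigma>s (\<lambda>e. a e * (c' e + 1) + b' e * (c e + 1) < a' e * (c e + 1) + b e * (c' e + 1))"
    by (intro defp_less defn_add defn_mult defn_const *)
  then show ?thesis by (rule defp_cong) (simp add: 1(4) 2(4) rat_less)
qed
lemma defp_qle: "defq_rat \<sigma>s w \<Longrightarrow> defq_rat \<sigma>s w' \<Longrightarrow> defp \<sigma>s (\<lambda>e. w e \<le> w' e)"
  using defp_not [OF defp_qless [of \<sigma>s w' w]] by (simp add: not_less)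
lemma defp_qeq: "defq_rat \<sigma>s w \<Longrightarrow> defq_rat \<sigma>s w' \<Longrightarrow> defp \<sigma>s (\<lambda>e. w e = w' e)"
  unfolding order.eq_iff by (intro defp_and defp_qle)

definition sq :: "'a \<Rightarrow> 'n \<Rightarrow> 'n rl" where "sq x n = rq (nm (ap M x (nd n)))"

definition isreal :: "'a \<Rightarrow> bool" where
  "isreal x \<longleftrightarrow> x \<in> carr M T1 \<and> (\<forall>n i. \<bar>sq x n - sq x (n + i)\<bar> < eps n)"

text \<open>The limit of the sequence in the completion. The value 0 on other objects keeps
  \<open>rv\<close> definable on the whole of type 1.\<close>

definition rv :: "'a \<Rightarrow> 'n rl" where
  "rv x = (if isreal x then (THE v. \<forall>n. \<bar>sq x n - v\<bar> \<le> eps n) else 0)"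

lemma eps_unique: assumes "\<And>n. \<bar>u - v\<bar> \<le> 2 * eps n" shows "u = v"
proof (rule ccontr)
  assume "u \<noteq> v"
  then have "0 < \<bar>u - v\<bar> / 2" by simp
  from eps_small [OF this] obtain n where "eps n < \<bar>u - v\<bar> / 2" by blast
  then have "2 * eps n < \<bar>u - v\<bar>" by (simp add: field_simps)
  with assms [of n] show False by simp
qed

lemma rv_eq: "isreal x \<Longrightarrow> (\<And>n. \<bar>sq x n - v\<bar> \<le> eps n) \<Longrightarrow> rv x = v"
proof -
  assume x: "isreal x" and v: "\<And>n. \<bar>sq x n - v\<bar> \<le> eps n"
  have "u = v" if u: "\<forall>n. \<bar>sq x n - u\<bar> \<le> eps n" for u
  proof (rule eps_unique)
    fix n show "\<bar>u - v\<bar> \<le> 2 * eps n" using u [rule_format, of n] v [of n] by linarith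
  qed
  then show ?thesis unfolding rv_def using x v by (simp add: the_equality)
qed

lemma rv: "isreal x \<Longrightarrow> \<bar>sq x n - rv x\<bar> \<le> eps n"
proof -
  assume x: "isreal x"
  have "\<exists>v. \<forall>n. \<bar>sq x n - v\<bar> \<le> eps n"
  proof (rule rl_complete)
    show "\<exists>a b c. sq x n = rat a b c" for n unfolding sq_def by (rule rq_rat)
    show "\<bar>sq x n - sq x m\<bar> < eps n" if "n \<le> m" for m n
    proof -
      have "m = n + (m - n)" using that by simp
      then show ?thesis using x unfolding isreal_def by metis
    qed
  qed (auto intro: rat_eps eps_small)
  then show ?thesis using rv_eq [OF x] by blast
qed

text \<open>Real-valued terms, represented by their lower cuts.\<close>

definition defr :: "ty list \<Rightarrow> ('a list \<Rightarrow> 'n rl) \<Rightarrow> bool" where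
  "defr \<sigma>s v \<longleftrightarrow> defp (T0 # \<sigma>s) (\<lambda>e. rq (nv 0 e) < v (tl e))"

lemma defr_tl: "defr \<sigma>s v \<Longrightarrow> defr (\<tau> # \<sigma>s) (\<lambda>e. v (tl e))"
proof -
  assume v: "defr \<sigma>s v"
  then obtain g where g: "deft \<sigma>s T1 g"
    "\<And>e n. typed_env e \<sigma>s \<Longrightarrow> ap M (g e) (nd n) = nd (if rq n < v e then 1 else 0)"
    using defp_lam [of \<sigma>s "\<lambda>n e. rq n < v e"] unfolding defr_def by blast
  have "defn (T0 # \<tau> # \<sigma>s) (\<lambda>e. nm (ap M (g (tl (tl e))) (nd (nv 0 e))))"
    by (intro defn_ap deft_tl g(1) defn_nv) simp_all
  then show ?thesis unfolding defr_def defp_def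
    by (rule defn_cong) (auto simp: g(2) list_all2_Cons2 simp del: nd_nm)
qed

lemma defp_cut: "defr \<sigma>s v \<Longrightarrow> defn \<sigma>s t \<Longrightarrow> defp \<sigma>s (\<lambda>e. rq (t e) < v e)"
  using defn_subst [of \<sigma>s "\<lambda>n e. if rq n < v e then 1 else 0" t] by (simp add: defr_def defp_def)

lemma defr_cong: "defr \<sigma>s v \<Longrightarrow> (\<And>e. typed_env e \<sigma>s \<Longrightarrow> v e = w e) \<Longrightarrow> defr \<sigma>s w"
  unfolding defr_def by (erule defp_cong) (auto simp: list_all2_Cons2)

end

context nmodel
begin

text \<open>Expresses the order by a quantifier over codes of rationals, which is what makes
  comparisons of reals arithmetical.\<close>

lemma cut_less: "(\<exists>q. \<not> rq q < x \<and> rq q < y) \<longleftrightarrow> x < y"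
  using rq_dense [of x y] by (auto simp: not_less intro: less_imp_le le_less_trans)

lemma defp_rless: assumes u: "defr \<sigma>s u" and v: "defr \<sigma>s v" shows "defp \<sigma>s (\<lambda>e. u e < v e)"
proof -
  have "defp \<sigma>s (\<lambda>e. \<exists>q. \<not> rq q < u e \<and> rq q < v e)"
    by (rule defp_ex defp_and defp_not defp_cut defr_tl [OF u] defr_tl [OF v] defn_nv | (simp; fail))+
  then show ?thesis by (simp add: cut_less)
qed

lemma defq_tl: "defq_rat \<sigma>s w \<Longrightarrow> defq_rat (\<tau> # \<sigma>s) (\<lambda>e. w (tl e))"
  by (erule defq_ratE, rule defq_ratI [where w = "\<lambda>e. w (tl e)"], erule defn_tl, erule defn_tl, erule defn_tl)
    (auto simp: list_all2_Cons2)

lemma defr_q: "defq_rat \<sigma>s w \<Longrightarrow> defr \<sigma>s w"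
  unfolding defr_def by (rule defp_qless defq_rq defn_nv defq_tl | assumption | (simp; fail))+

lemma defr_add: assumes u: "defr \<sigma>s u" and v: "defr \<sigma>s v" shows "defr \<sigma>s (\<lambda>e. u e + v e)"
proof -
  have cut: "(\<exists>p r. rq p < x \<and> rq r < y \<and> z \<le> rq p + rq r) \<longleftrightarrow> z < x + y" for x y z
  proof
    assume z: "z < x + y"
    \<comment> \<open>Half of the slack: each summand may be approximated from below with error less
      than \<open>h\<close>.\<close>
    define h where "h = (x + y - z) / 2"
    have h: "0 < h" "z = x + y - (h + h)" using z by (simp_all add: h_def field_simps)
    obtain p where p: "x - h < rq p" "rq p < x" using rq_dense [of "x - h" x] h by auto
    obtain r where r: "y - h < rq r" "rq r < y" using rq_dense [of "y - h" y] h by auto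
    have "z \<le> rq p + rq r" using p r h by linarith
    with p r show "\<exists>p r. rq p < x \<and> rq r < y \<and> z \<le> rq p + rq r" by blast
  qed (auto intro: add_strict_mono le_less_trans)
  have "defp (T0 # \<sigma>s) (\<lambda>e. \<exists>p r. rq p < u (tl e) \<and> rq r < v (tl e) \<and> rq (nv 0 e) \<le> rq p + rq r)"
    by (rule defp_ex defp_and defp_cut defp_qle defq_add defq_rq defr_tl [OF defr_tl [OF defr_tl [OF u]]]
        defr_tl [OF defr_tl [OF defr_tl [OF v]]] defn_nv | simp only: v_tl | (simp; fail))+
  then show ?thesis unfolding defr_def cut .
qed

lemma defr_uminus: assumes v: "defr \<sigma>s v" shows "defr \<sigma>s (\<lambda>e. - v e)"
proof -
  have "defp (T0 # \<sigma>s) (\<lambda>e. \<exists>r. \<not> rq r < v (tl e) \<and> rq r < - rq (nv 0 e))"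
    by (rule defp_ex defp_and defp_not defp_cut [OF defr_tl [OF defr_tl [OF v]]] defp_qless defq_uminus defq_rq defn_nv
        | simp only: v_tl | (simp; fail))+
  moreover have "x < - z \<longleftrightarrow> z < - x" for x z :: "'n rl" by linarith
  ultimately show ?thesis by (simp add: defr_def cut_less)
qed

lemma defr_diff: "defr \<sigma>s u \<Longrightarrow> defr \<sigma>s v \<Longrightarrow> defr \<sigma>s (\<lambda>e. u e - v e)"
  using defr_add [OF _ defr_uminus] by simp

lemma defr_if: assumes P: "defp \<sigma>s P" and u: "defr \<sigma>s u" and v: "defr \<sigma>s v"
  shows "defr \<sigma>s (\<lambda>e. if P e then u e else v e)"
proof -
  have "defp (T0 # \<sigma>s) (\<lambda>e. (P (tl e) \<and> rq (nv 0 e) < u (tl e)) \<or> (\<not> P (tl e) \<and> rq (nv 0 e) < v (tl e)))"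
    by (rule defp_or defp_and defp_not defp_tl [OF P] defp_cut [OF defr_tl [OF u]] defp_cut [OF defr_tl [OF v]] defn_nv | (simp; fail))+
  then show ?thesis unfolding defr_def by (rule defp_cong) auto
qed

lemma defr_abs: assumes v: "defr \<sigma>s v" shows "defr \<sigma>s (\<lambda>e. \<bar>v e\<bar>)"
  unfolding abs_if by (intro defr_if defr_uminus defp_rless v defr_q [OF defq_0])

text \<open>For a positive rational factor the lower cut of the product is the scaled lower cut, so
  no product of two irrational cuts has to be formed.\<close>

lemma defr_scale: assumes w: "defq_rat \<sigma>s w" "\<And>e. typed_env e \<sigma>s \<Longrightarrow> 0 < w e" and u: "defr \<sigma>s u"
  shows "defr \<sigma>s (\<lambda>e. w e * u e)"
proof -
  have cut: "(\<exists>r. rq r < y \<and> z \<le> x * rq r) \<longleftrightarrow> z < x * y" if "0 < x" for x y z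
  proof
    assume "z < x * y"
    then have "z / x < y" using that by (simp add: divide_less_eq mult.commute)
    then obtain r where "z / x < rq r" "rq r < y" using rq_dense by blast
    then show "\<exists>r. rq r < y \<and> z \<le> x * rq r"
      using that by (intro exI [of _ r]) (simp add: divide_less_eq mult.commute less_imp_le)
  qed (use that in \<open>auto intro: le_less_trans\<close>)
  have "defp (T0 # \<sigma>s) (\<lambda>e. \<exists>r. rq r < u (tl e) \<and> rq (nv 0 e) \<le> w (tl e) * rq r)"
    by (rule defp_ex defp_and defp_cut [OF defr_tl [OF defr_tl [OF u]]] defp_qle defq_mult defq_tl [OF defq_tl [OF w(1)]] defq_rq defn_nv
        | simp only: v_tl | (simp; fail))+
  then show ?thesis unfolding defr_def
  proof (rule defp_cong)
    fix e assume "typed_env e (T0 # \<sigma>s)"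
    then have "0 < w (tl e)" using w(2) by (auto simp: list_all2_Cons2)
    then show "(\<exists>r. rq r < u (tl e) \<and> rq (nv 0 e) \<le> w (tl e) * rq r) = (rq (nv 0 e) < w (tl e) * u (tl e))"
      by (rule cut)
  qed
qed

lemma defp_isreal: assumes u: "deft \<sigma>s T1 u" shows "defp \<sigma>s (\<lambda>e. isreal (u e))"
proof -
  have "defp \<sigma>s (\<lambda>e. \<forall>n i. sq (u e) n - sq (u e) (n + i) < eps n \<and> sq (u e) (n + i) - sq (u e) n < eps n)"
    unfolding sq_def
    by (rule defp_all defp_and defp_qless defq_diff defq_eps defq_rq defn_ap deft_tl [OF deft_tl [OF u]] defn_add defn_nv
        | simp only: v_tl | (simp; fail))+
  then show ?thesis by (rule defp_cong) (auto simp: isreal_def deft_carr [OF u] abs_less_iff)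
qed

lemma defr_rv: assumes u: "deft \<sigma>s T1 u" shows "defr \<sigma>s (\<lambda>e. rv (u e))"
proof -
  have "defp (T0 # \<sigma>s) (\<lambda>e. (isreal (u (tl e)) \<and> (\<exists>n. rq (nv 0 e) + eps n < sq (u (tl e)) n)) \<or>
      (\<not> isreal (u (tl e)) \<and> rq (nv 0 e) < 0))"
    unfolding sq_def
    by (rule defp_or defp_and defp_not defp_ex defp_isreal [OF deft_tl [OF u]] defp_qless defq_add defq_eps defq_0 defq_rq defn_ap
        deft_tl [OF deft_tl [OF u]] defn_nv | simp only: v_tl | (simp; fail))+
  then show ?thesis unfolding defr_def
  proof (rule defp_cong)
    fix e assume "typed_env e (T0 # \<sigma>s)"
    let ?x = "u (tl e)" and ?q = "rq (nv 0 e)"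
    have "(\<exists>n. ?q + eps n < sq ?x n) \<longleftrightarrow> ?q < rv ?x" if x: "isreal ?x"
    proof
      assume "\<exists>n. ?q + eps n < sq ?x n"
      then obtain n where "?q + eps n < sq ?x n" ..
      then show "?q < rv ?x" using rv [OF x, of n] by linarith
    next
      assume "?q < rv ?x"
      then obtain n where "?q + eps n < rv ?x" using eps_between by blast
      \<comment> \<open>Halving the margin leaves one half for the distance of term
        \<open>n + 1\<close> from the limit and the other half for the required inequality.\<close>
      moreover have "eps n = eps (n + 1) + eps (n + 1)" by (simp add: eps_Suc)
      ultimately have "?q + eps (n + 1) < sq ?x (n + 1)" using rv [OF x, of "n + 1"] by linarith
      then show "\<exists>n. ?q + eps n < sq ?x n" ..
    qed
    then show "((isreal ?x \<and> (\<exists>n. ?q + eps n < sq ?x n)) \<or> (\<not> isreal ?x \<and> ?q < 0)) = (?q < rv ?x)"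
      by (auto simp: rv_def)
  qed
qed

text \<open>Passes back from cuts to sequences: the term with index \<open>n\<close> is the least
  code of a rational approximating the value up to \<open>eps (n + 1)\<close>.\<close>

lemma defr_code:
  assumes v: "defr \<sigma>s v"
  shows "\<exists>u. deft \<sigma>s T1 u \<and> (\<forall>e. typed_env e \<sigma>s \<longrightarrow> isreal (u e) \<and> rv (u e) = v e)"
proof -
  \<comment> \<open>One of the two bounds is strict. That makes the difference of two approximations
    strictly less than the sum of their errors, as fast convergence demands.\<close>
  define D where "D q n e \<longleftrightarrow> rq q - eps (n + 1) < v e \<and> \<not> rq q + eps (n + 1) < v e" for q n e
  define t where "t n e = lst (\<lambda>q. D q n e)" for n e
  have D: "defp (T0 # T0 # \<sigma>s) (\<lambda>e. D (nv 0 e) (nv 1 e) (tl (tl e)))"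
    unfolding D_def
    by (rule defp_and defp_not defp_rless defr_tl [OF defr_tl [OF v]] defr_q defq_diff defq_add defq_eps defq_rq defn_add defn_const defn_nv
        | simp only: v_tl | (simp; fail))+
  have "defn (T0 # \<sigma>s) (\<lambda>e. t (nv 0 e) (tl e))"
    unfolding t_def by (rule defn_lst) (use D in \<open>simp add: v_tl\<close>)
  then obtain u where u: "deft \<sigma>s T1 u" "\<And>e n. typed_env e \<sigma>s \<Longrightarrow> ap M (u e) (nd n) = nd (t n e)"
    using defn_lam by blast
  have "isreal (u e) \<and> rv (u e) = v e" if e: "typed_env e \<sigma>s" for e
  proof -
    have Dt: "D (t n e) n e" for n
    proof -
      have "v e - eps (n + 1) < v e + eps (n + 1)" using eps_pos [of "n + 1"] by linarith
      then obtain q where "v e - eps (n + 1) < rq q" "rq q < v e + eps (n + 1)" using rq_dense by blast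
      then have q: "D q n e" unfolding D_def by linarith
      have "defp [T0] (\<lambda>e'. D (nv 0 e') n e)"
        using defp_special [of "T0 # \<sigma>s" "\<lambda>q e. D q (nv 0 e) (tl e)" "nd n # e"] D e by (simp add: v_tl)
      from lst(1) [OF this q] show ?thesis by (simp add: t_def)
    qed
    have s: "sq (u e) n - eps (n + 1) < v e \<and> \<not> sq (u e) n + eps (n + 1) < v e" for n
      using Dt [of n] u(2) [OF e] by (simp add: D_def sq_def)
    have half: "eps n = eps (n + 1) + eps (n + 1)" for n by (simp add: eps_Suc)
    have "isreal (u e)"
      unfolding isreal_def
    proof (intro conjI allI)
      show "u e \<in> carr M T1" using deft_carr [OF u(1) e] .
      fix n i
      have "eps (n + i + 1) \<le> eps (n + 1)" by (rule eps_mono) simp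
      then show "\<bar>sq (u e) n - sq (u e) (n + i)\<bar> < eps n"
        using s [of n] s [of "n + i"] half [of n] by linarith
    qed
    moreover from this have "rv (u e) = v e"
    proof (rule rv_eq)
      show "\<bar>sq (u e) n - v e\<bar> \<le> eps n" for n
        using s [of n] half [of n] eps_pos [of "n + 1"] by linarith
    qed
    ultimately show ?thesis ..
  qed
  with u(1) show ?thesis by blast
qed

section \<open>Reals, functions, sets and sequences of the model\<close>

definition RM :: "'n rl set" where "RM = rv ` {x. isreal x}"
definition RP :: "'n rl set" where "RP = {v \<in> RM. 0 < v}"
definition UC :: "'a set" where "UC = {x. isreal x \<and> 0 \<le> rv x \<and> rv x \<le> 1}"
definition UI :: "'n rl set" where "UI = rv ` UC"

lemma isreal_T1: "isreal x \<Longrightarrow> x \<in> carr M T1" by (simp add: isreal_def)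
lemma UC_real: "x \<in> UC \<Longrightarrow> isreal x" by (simp add: UC_def)
lemma UC_T1 [simp]: "x \<in> UC \<Longrightarrow> x \<in> carr M T1" using isreal_T1 by (simp add: UC_def)
lemma UI_iff: "v \<in> UI \<longleftrightarrow> v \<in> RM \<and> 0 \<le> v \<and> v \<le> 1" by (auto simp: UI_def UC_def RM_def)

text \<open>The completion may contain more points than the model has reals; those with a definable
  cut are exactly the values of reals of the model. Closure properties reduce to those of
  \<open>defr\<close>.\<close>

lemma RM_iff: "v \<in> RM \<longleftrightarrow> defr [] (\<lambda>e. v)"
proof
  assume "v \<in> RM"
  then obtain x where "isreal x" "v = rv x" by (auto simp: RM_def)
  then show "defr [] (\<lambda>e. v)" using defr_rv [OF deft_const [OF isreal_T1]] by simp
next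
  assume "defr [] (\<lambda>e. v)"
  from defr_code [OF this] obtain u where "isreal (u []) \<and> rv (u []) = v" by auto
  then show "v \<in> RM" by (auto simp: RM_def)
qed

lemma defr_const: "v \<in> RM \<Longrightarrow> defr \<sigma>s (\<lambda>e. v)"
proof -
  assume "v \<in> RM"
  then obtain x where "isreal x" "v = rv x" by (auto simp: RM_def)
  then show ?thesis using defr_rv [OF deft_const [OF isreal_T1]] by simp
qed

lemma RM_add [simp]: "u \<in> RM \<Longrightarrow> v \<in> RM \<Longrightarrow> u + v \<in> RM"
  and RM_diff [simp]: "u \<in> RM \<Longrightarrow> v \<in> RM \<Longrightarrow> u - v \<in> RM"
  and RM_uminus [simp]: "u \<in> RM \<Longrightarrow> - u \<in> RM"
  and RM_0 [simp]: "0 \<in> RM" and RM_1 [simp]: "1 \<in> RM" and RM_numeral [simp]: "numeral k \<in> RM"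
  and RM_eps [simp]: "eps n \<in> RM" and RM_emb [simp]: "emb n \<in> RM" and RM_rq [simp]: "rq q \<in> RM"
  by (simp_all add: RM_iff defr_add defr_diff defr_uminus defr_q defq_0 defq_1 defq_num defq_eps defq_emb defq_rq defn_const)

lemma RM_scale: "defq_rat [] (\<lambda>e. w) \<Longrightarrow> 0 < w \<Longrightarrow> v \<in> RM \<Longrightarrow> w * v \<in> RM"
  by (simp add: RM_iff defr_scale)
lemma RM_emb_mult [simp]: "v \<in> RM \<Longrightarrow> emb (pw n) * v \<in> RM"
  by (rule RM_scale) (simp_all add: defq_emb defn_const)
lemma RM_eps_mult [simp]: "v \<in> RM \<Longrightarrow> eps n * v \<in> RM"
  by (rule RM_scale) (simp_all add: defq_eps defn_const)
lemma RM_half [simp]: "v \<in> RM \<Longrightarrow> v / 2 \<in> RM"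
proof -
  assume "v \<in> RM"
  moreover have "eps (0 + 1) = eps 0 / 2" by (rule eps_Suc)
  then have h: "eps 1 = 1 / 2" by (simp only: add_0 eps_0)
  ultimately show ?thesis using RM_eps_mult [of v 1] unfolding h by simp
qed
lemma RP_eps [simp]: "eps n \<in> RP" by (simp add: RP_def)
lemma RP_eps_ex: "e \<in> RP \<Longrightarrow> \<exists>n. eps n < e" using eps_small by (auto simp: RP_def)

definition isfun :: "'a \<Rightarrow> bool" where
  "isfun f \<longleftrightarrow> f \<in> carr M (T1 \<rightarrow> T1) \<and> (\<forall>x\<in>UC. isreal (ap M f x) \<and> (\<forall>y\<in>UC. rv x = rv y \<longrightarrow> rv (ap M f x) = rv (ap M f y)))"
text \<open>A code of \<open>v\<close> is chosen; for objects satisfying \<open>isfun\<close> the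
  choice does not affect the value.\<close>

definition fv :: "'a \<Rightarrow> 'n rl \<Rightarrow> 'n rl" where "fv f v = rv (ap M f (SOME x. x \<in> UC \<and> rv x = v))"

lemma fv: "isfun f \<Longrightarrow> x \<in> UC \<Longrightarrow> rv (ap M f x) = fv f (rv x)"
proof -
  assume f: "isfun f" and x: "x \<in> UC"
  then have "(SOME y. y \<in> UC \<and> rv y = rv x) \<in> UC \<and> rv (SOME y. y \<in> UC \<and> rv y = rv x) = rv x"
    by (intro someI [of "\<lambda>y. y \<in> UC \<and> rv y = rv x"]) simp
  with f x show ?thesis unfolding fv_def isfun_def by metis
qed

lemma fv_RM: "isfun f \<Longrightarrow> v \<in> UI \<Longrightarrow> fv f v \<in> RM"
proof -
  assume f: "isfun f" and "v \<in> UI"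
  then obtain x where x: "x \<in> UC" "v = rv x" by (auto simp: UI_def)
  have "isreal (ap M f x)" using f x(1) by (simp add: isfun_def)
  then have "rv (ap M f x) \<in> RM" unfolding RM_def by blast
  then show ?thesis using fv [OF f x(1)] x(2) by simp
qed

text \<open>An object of the model acts on codes, not on cuts, so the argument is first given a code
  by \<open>defr_code\<close>.\<close>

lemma defr_fv:
  assumes f: "isfun f" and u: "defr \<sigma>s u" "\<And>e. typed_env e \<sigma>s \<Longrightarrow> u e \<in> UI"
  shows "defr \<sigma>s (\<lambda>e. fv f (u e))"
proof -
  obtain c where c: "deft \<sigma>s T1 c" "\<And>e. typed_env e \<sigma>s \<Longrightarrow> isreal (c e) \<and> rv (c e) = u e"
    using defr_code [OF u(1)] by blast
  have "defr \<sigma>s (\<lambda>e. rv (ap M f (c e)))"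
    by (rule defr_rv [OF deft_ap [OF deft_const c(1)]]) (use f in \<open>simp add: isfun_def\<close>)
  then show ?thesis
  proof (rule defr_cong)
    fix e assume e: "typed_env e \<sigma>s"
    then have "c e \<in> UC" using c(2) [OF e] u(2) [OF e] by (simp add: UC_def UI_iff)
    then show "rv (ap M f (c e)) = fv f (u e)" using fv [OF f] c(2) [OF e] by simp
  qed
qed

lemma fun_ex:
  assumes h: "defr [T1] (\<lambda>e. h (rv (xv 0 e)))"
  shows "\<exists>f. isfun f \<and> (\<forall>v\<in>UI. fv f v = h v)"
proof -
  obtain u where u: "deft [T1] T1 u" "\<And>e. typed_env e [T1] \<Longrightarrow> isreal (u e) \<and> rv (u e) = h (rv (xv 0 e))"
    using defr_code [OF h] by blast
  obtain g where g: "deft [] (T1 \<rightarrow> T1) g" "\<And>e v. typed_env e [] \<Longrightarrow> v \<in> carr M T1 \<Longrightarrow> ap M (g e) v = u (v # e)"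
    using deft_lam [OF u(1)] by blast
  have a: "isreal (ap M (g []) x) \<and> rv (ap M (g []) x) = h (rv x)" if "x \<in> UC" for x
    using g(2) [of "[]" x] u(2) [of "[x]"] that by simp
  have "isfun (g [])" using a deft_carr [OF g(1), of "[]"] by (simp add: isfun_def)
  moreover have "fv (g []) v = h v" if "v \<in> UI" for v
    using that a fv [OF \<open>isfun (g [])\<close>] by (auto simp: UI_def)
  ultimately show ?thesis by blast
qed

definition isset :: "('a \<Rightarrow> 'a) \<Rightarrow> bool" where
  "isset X \<longleftrightarrow> (\<forall>x\<in>UC. (X x = nd 0 \<or> X x = nd 1) \<and> (\<forall>y\<in>UC. rv x = rv y \<longrightarrow> X x = X y))"
definition sv :: "('a \<Rightarrow> 'a) \<Rightarrow> 'n rl set" where "sv X = rv ` {x \<in> UC. X x = nd 1}"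

lemma sv: assumes X: "isset X" and x: "x \<in> UC" shows "X x = nd 1 \<longleftrightarrow> rv x \<in> sv X"
proof
  assume "X x = nd 1"
  then show "rv x \<in> sv X" unfolding sv_def using x by blast
next
  assume "rv x \<in> sv X"
  then obtain y where y: "y \<in> UC" "X y = nd 1" "rv x = rv y" unfolding sv_def by blast
  have "X x = X y" using X x y(1,3) unfolding isset_def by blast
  then show "X x = nd 1" using y(2) by simp
qed

lemma sv_UI: "sv X \<subseteq> UI" by (auto simp: sv_def UI_def)

lemma defp_sv:
  assumes X: "E \<in> carr M (T1 \<rightarrow> T0 \<rightarrow> T0)" "\<And>n. isset (\<lambda>x. ap M (ap M E x) (nd n))"
    and t: "defn \<sigma>s t" and u: "defr \<sigma>s u" "\<And>e. typed_env e \<sigma>s \<Longrightarrow> u e \<in> UI"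
  shows "defp \<sigma>s (\<lambda>e. u e \<in> sv (\<lambda>x. ap M (ap M E x) (nd (t e))))"
proof -
  obtain c where c: "deft \<sigma>s T1 c" "\<And>e. typed_env e \<sigma>s \<Longrightarrow> isreal (c e) \<and> rv (c e) = u e"
    using defr_code [OF u(1)] by blast
  have "defp \<sigma>s (\<lambda>e. nm (ap M (ap M E (c e)) (nd (t e))) = 1)"
    by (rule defp_eq [OF defn_ap [OF deft_ap [OF deft_const [OF X(1)] c(1)] t] defn_const])
  then show ?thesis
  proof (rule defp_cong)
    fix e assume e: "typed_env e \<sigma>s"
    then have ce: "c e \<in> UC" using c(2) [OF e] u(2) [OF e] by (simp add: UC_def UI_iff)
    have "ap M (ap M E (c e)) (nd (t e)) \<in> N"
      by (rule ap_carr [OF ap_carr [OF X(1)] nd_in]) (use ce in simp)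
    then have "nm (ap M (ap M E (c e)) (nd (t e))) = 1 \<longleftrightarrow> ap M (ap M E (c e)) (nd (t e)) = nd 1"
      by (metis nm_nd nd_nm)
    then show "(nm (ap M (ap M E (c e)) (nd (t e))) = 1) = (u e \<in> sv (\<lambda>x. ap M (ap M E x) (nd (t e))))"
      using sv [OF X(2) ce] c(2) [OF e] by simp
  qed
qed

lemma sets_ex:
  assumes "defp [T0, T1] (\<lambda>e. S (nv 0 e) (rv (xv 1 e)))"
  shows "\<exists>E\<in>carr M (T1 \<rightarrow> T0 \<rightarrow> T0). \<forall>n. isset (\<lambda>x. ap M (ap M E x) (nd n)) \<and> sv (\<lambda>x. ap M (ap M E x) (nd n)) = {v \<in> UI. S n v}"
proof -
  have "defp (T0 # [T1]) (\<lambda>e. S (nv 0 e) (rv (xv 0 (tl e))))" using assms by (simp add: v_tl)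
  then obtain g where g: "deft [T1] T1 g"
    "\<And>e n. typed_env e [T1] \<Longrightarrow> ap M (g e) (nd n) = nd (if S n (rv (xv 0 e)) then 1 else 0)"
    using defp_lam [of "[T1]" "\<lambda>n e. S n (rv (xv 0 e))"] by blast
  obtain G where G: "deft [] (T1 \<rightarrow> T1) G" "\<And>e v. typed_env e [] \<Longrightarrow> v \<in> carr M T1 \<Longrightarrow> ap M (G e) v = g (v # e)"
    using deft_lam [OF g(1)] by blast
  have a: "ap M (ap M (G []) x) (nd n) = nd (if S n (rv x) then 1 else 0)" if "x \<in> UC" for x n
    using G(2) [of "[]" x] g(2) [of "[x]"] that by simp
  then have "isset (\<lambda>x. ap M (ap M (G []) x) (nd n)) \<and> sv (\<lambda>x. ap M (ap M (G []) x) (nd n)) = {v \<in> UI. S n v}" for n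
    by (auto simp: isset_def sv_def UI_def split: if_splits)
  moreover have "G [] \<in> carr M (T1 \<rightarrow> T0 \<rightarrow> T0)" using deft_carr [OF G(1), of "[]"] by simp
  ultimately show ?thesis by blast
qed

lemma set_ex:
  assumes "defp [T1] (\<lambda>e. S (rv (xv 0 e)))"
  shows "\<exists>X\<in>carr M (T1 \<rightarrow> T0). isset (ap M X) \<and> sv (ap M X) = {v \<in> UI. S v}"
proof -
  obtain G where G: "deft [] (T1 \<rightarrow> T0) G"
    "\<And>e v. typed_env e [] \<Longrightarrow> v \<in> carr M T1 \<Longrightarrow> ap M (G e) v = nd (if S (rv v) then 1 else 0)"
    using deft_lam [OF assms [unfolded defp_def defn_def]] by auto
  then have "isset (ap M (G [])) \<and> sv (ap M (G [])) = {v \<in> UI. S v}"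
    by (auto simp: isset_def sv_def UI_def split: if_splits)
  moreover have "G [] \<in> carr M (T1 \<rightarrow> T0)" using deft_carr [OF G(1), of "[]"] by simp
  ultimately show ?thesis by blast
qed

definition SEQ :: "('n \<Rightarrow> 'n rl) set" where
  "SEQ = {s. \<exists>u\<in>carr M (T0 \<rightarrow> T1). \<forall>n. isreal (ap M u (nd n)) \<and> rv (ap M u (nd n)) = s n}"

lemma SEQ_I: assumes "defr [T0] (\<lambda>e. s (nv 0 e))" shows "s \<in> SEQ"
proof -
  obtain u where u: "deft [T0] T1 u" "\<And>e. typed_env e [T0] \<Longrightarrow> isreal (u e) \<and> rv (u e) = s (nv 0 e)"
    using defr_code [OF assms] by blast
  obtain g where g: "deft [] (T0 \<rightarrow> T1) g" "\<And>e v. typed_env e [] \<Longrightarrow> v \<in> N \<Longrightarrow> ap M (g e) v = u (v # e)"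
    using deft_lam [OF u(1)] by blast
  have "isreal (ap M (g []) (nd n)) \<and> rv (ap M (g []) (nd n)) = s n" for n
    using g(2) [of "[]" "nd n"] u(2) [of "[nd n]"] by simp
  moreover have "g [] \<in> carr M (T0 \<rightarrow> T1)" using deft_carr [OF g(1), of "[]"] by simp
  ultimately show ?thesis unfolding SEQ_def by blast
qed

end

section \<open>The meaning of the formulas\<close>

context nmodel
begin

lemma zer_one_N [simp]: "zer \<in> N" "one \<in> N" by (rule con_types)+
lemma nm_zer_one [simp]: "nm zer = 0" "nm one = 1" by (simp_all add: nd_0 nd_1)
lemma nm_pl [simp]: "x \<in> N \<Longrightarrow> y \<in> N \<Longrightarrow> nm (pl M x y) = nm x + nm y"
  using nd_add [of "nm x" "nm y"] by (simp add: nd_nm)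
lemma nm_ti [simp]: "x \<in> N \<Longrightarrow> y \<in> N \<Longrightarrow> nm (ti M x y) = nm x * nm y"
  using nd_mult [of "nm x" "nm y"] by (simp add: nd_nm)
lemma eqr_nm [simp]: "x \<in> N \<Longrightarrow> y \<in> N \<Longrightarrow> eqr M x y \<longleftrightarrow> nm x = nm y"
  unfolding eqr_eq by (metis nd_nm)
lemma ltr_nm [simp]: "x \<in> N \<Longrightarrow> y \<in> N \<Longrightarrow> ltr M x y \<longleftrightarrow> nm x < nm y"
  by (metis nd_nm nd_less)
lemma ap_typed [simp]:
  "x \<in> carr M T1 \<Longrightarrow> n \<in> N \<Longrightarrow> ap M x n \<in> N"
  "f \<in> carr M (T1 \<rightarrow> T1) \<Longrightarrow> x \<in> carr M T1 \<Longrightarrow> ap M f x \<in> carr M T1"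
  "X \<in> carr M (T1 \<rightarrow> T0) \<Longrightarrow> x \<in> carr M T1 \<Longrightarrow> ap M X x \<in> N"
  "E \<in> carr M (T1 \<rightarrow> T0 \<rightarrow> T0) \<Longrightarrow> x \<in> carr M T1 \<Longrightarrow> ap M E x \<in> carr M T1"
  "u \<in> carr M (T0 \<rightarrow> T1) \<Longrightarrow> n \<in> N \<Longrightarrow> ap M u n \<in> carr M T1"
  by (auto dest: ap_carr)
lemma sat_nat [simp]:
  "sat M e (all_nat C d) \<longleftrightarrow> (\<forall>n. sat M (nd n # e) (C (vr d) (Suc d)))"
  "sat M e (ex_nat C d) \<longleftrightarrow> (\<exists>n. sat M (nd n # e) (C (vr d) (Suc d)))"
  by (simp_all add: sat_all_nat sat_ex_nat ball_N bex_N)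
lemma sat_le [simp]:
  "length e = d \<Longrightarrow> vl M e s \<in> N \<Longrightarrow> vl M e t \<in> N \<Longrightarrow> sat M e ((s \<^bold>\<le> t) d) \<longleftrightarrow> nm (vl M e s) \<le> nm (vl M e t)"
  by (simp add: le_b_def le_less)
lemma two_pow_simps [simp]:
  "stab M e k \<Longrightarrow> stab M e (two_pow k)" "vl M e (two_pow k) = ap M two_pow_fun (vl M e k)"
  "v \<in> N \<Longrightarrow> ap M two_pow_fun v \<in> N" "v \<in> N \<Longrightarrow> nm (ap M two_pow_fun v) = pw (nm v)"
  using two_pow_fun(1) by (simp_all add: two_pow_def two_pow_fun_def one_b_def pw_def)

abbreviation "val e s \<equiv> nm (vl M e s)"

lemma sat_pair_code [simp]:
  "length e = d \<Longrightarrow> stab M e p \<Longrightarrow> stab M e a \<Longrightarrow> stab M e b \<Longrightarrow> vl M e p \<in> N \<Longrightarrow> vl M e a \<in> N \<Longrightarrow> vl M e b \<in> N \<Longrightarrow>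
    sat M e (pair_code p a b d) \<longleftrightarrow> PC (val e p) (val e a) (val e b)"
  by (simp add: pair_code_def PC_def)
lemma sat_rat_code [simp]:
  "length e = d \<Longrightarrow> stab M e q \<Longrightarrow> stab M e a \<Longrightarrow> stab M e b \<Longrightarrow> stab M e c \<Longrightarrow>
    vl M e q \<in> N \<Longrightarrow> vl M e a \<in> N \<Longrightarrow> vl M e b \<in> N \<Longrightarrow> vl M e c \<in> N \<Longrightarrow>
    sat M e (rat_code q a b c d) \<longleftrightarrow> rc (val e q) (val e a) (val e b) (val e c)"
  by (simp add: rat_code_def rc_def)

lemma rat_eq: "rat a b c = rat a' b' c' \<longleftrightarrow> a * (c' + 1) + b' * (c + 1) = a' * (c + 1) + b * (c' + 1)"
  using rat_less [of a b c a' b' c'] rat_less [of a' b' c' a b c] by (metis linorder_neqE less_irrefl)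

lemma lessQ_iff: "rq q < rq r \<longleftrightarrow> (\<exists>a b c a' b' c'. rc q a b c \<and> rc r a' b' c' \<and>
    a * (c' + 1) + b' * (c + 1) < a' * (c + 1) + b * (c' + 1))"
proof -
  obtain a b c a' b' c' where r: "rc q a b c" "rc r a' b' c'" using rc_ex by metis
  have iff: "rq q < rq r \<longleftrightarrow> a * (c' + 1) + b' * (c + 1) < a' * (c + 1) + b * (c' + 1)"
    unfolding rq_eq [OF r(1)] rq_eq [OF r(2)] by (rule rat_less)
  show ?thesis
  proof
    assume "rq q < rq r"
    with r show "\<exists>a b c a' b' c'. rc q a b c \<and> rc r a' b' c' \<and> a * (c' + 1) + b' * (c + 1) < a' * (c + 1) + b * (c' + 1)"
      unfolding iff by (intro exI conjI)
  next
    assume "\<exists>a b c a' b' c'. rc q a b c \<and> rc r a' b' c' \<and> a * (c' + 1) + b' * (c + 1) < a' * (c + 1) + b * (c' + 1)"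
    then show "rq q < rq r"
    proof (elim exE conjE)
      fix u v w u' v' w'
      assume h: "rc q u v w" "rc r u' v' w'" "u * (w' + 1) + v' * (w + 1) < u' * (w + 1) + v * (w' + 1)"
      show ?thesis
        unfolding iff using rc_inj [OF r(1) h(1)] rc_inj [OF r(2) h(2)] h(3) by (elim conjE) (simp only:)
    qed
  qed
qed

lemma sumQ_iff: "rq q + rq r = rq s \<longleftrightarrow> (\<exists>a b c a' b' c' a'' b'' c''. rc q a b c \<and> rc r a' b' c' \<and> rc s a'' b'' c'' \<and>
    (a * (c' + 1) + a' * (c + 1)) * (c'' + 1) + b'' * ((c + 1) * (c' + 1)) =
    (b * (c' + 1) + b' * (c + 1)) * (c'' + 1) + a'' * ((c + 1) * (c' + 1)))"
proof -
  obtain a b c where r1: "rc q a b c" using rc_ex by blast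
  obtain a' b' c' where r2: "rc r a' b' c'" using rc_ex by blast
  obtain a'' b'' c'' where r3: "rc s a'' b'' c''" using rc_ex by blast
  have "c * c' + c + c' + 1 = (c + 1) * (c' + 1)" by (simp add: algebra_simps)
  then have "rq q + rq r = rq s \<longleftrightarrow> (a * (c' + 1) + a' * (c + 1)) * (c'' + 1) + b'' * ((c + 1) * (c' + 1)) =
    a'' * ((c + 1) * (c' + 1)) + (b * (c' + 1) + b' * (c + 1)) * (c'' + 1)"
    unfolding rq_eq [OF r1] rq_eq [OF r2] rq_eq [OF r3] rat_add rat_eq by (simp only:)
  then have iff: "rq q + rq r = rq s \<longleftrightarrow> (a * (c' + 1) + a' * (c + 1)) * (c'' + 1) + b'' * ((c + 1) * (c' + 1)) =
    (b * (c' + 1) + b' * (c + 1)) * (c'' + 1) + a'' * ((c + 1) * (c' + 1))"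
    by (simp only: add.commute [of "a'' * _"])
  show ?thesis
  proof
    assume "rq q + rq r = rq s"
    with r1 r2 r3 show "\<exists>a b c a' b' c' a'' b'' c''. rc q a b c \<and> rc r a' b' c' \<and> rc s a'' b'' c'' \<and>
      (a * (c' + 1) + a' * (c + 1)) * (c'' + 1) + b'' * ((c + 1) * (c' + 1)) =
      (b * (c' + 1) + b' * (c + 1)) * (c'' + 1) + a'' * ((c + 1) * (c' + 1))"
      unfolding iff by (intro exI conjI)
  next
    assume "\<exists>a b c a' b' c' a'' b'' c''. rc q a b c \<and> rc r a' b' c' \<and> rc s a'' b'' c'' \<and>
      (a * (c' + 1) + a' * (c + 1)) * (c'' + 1) + b'' * ((c + 1) * (c' + 1)) =
      (b * (c' + 1) + b' * (c + 1)) * (c'' + 1) + a'' * ((c + 1) * (c' + 1))"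
    then show "rq q + rq r = rq s"
    proof (elim exE conjE)
      fix u v w u' v' w' u'' v'' w''
      assume h: "rc q u v w" "rc r u' v' w'" "rc s u'' v'' w''"
        "(u * (w' + 1) + u' * (w + 1)) * (w'' + 1) + v'' * ((w + 1) * (w' + 1)) =
         (v * (w' + 1) + v' * (w + 1)) * (w'' + 1) + u'' * ((w + 1) * (w' + 1))"
      show ?thesis
        unfolding iff using rc_inj [OF r1 h(1)] rc_inj [OF r2 h(2)] rc_inj [OF r3 h(3)] h(4) by (elim conjE) (simp only:)
    qed
  qed
qed

lemma dyadicQ_iff: "rq q = emb m * eps k \<longleftrightarrow> (\<exists>a b c. rc q a b c \<and> a * pw k = b * pw k + m * (c + 1))"
proof -
  obtain a b c where r: "rc q a b c" using rc_ex by blast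
  have "rq q = emb m * eps k \<longleftrightarrow> (emb a - emb b) * emb (pw k) = emb m * (emb c + 1)"
    unfolding rq_eq [OF r] rat_def eps_def using emb_ne [of c] emb_pw_pos [of k] by (simp add: divide_simps less_imp_neq [THEN not_sym]) (simp add: mult.commute)?
  also have "\<dots> \<longleftrightarrow> emb (a * pw k) = emb (b * pw k + m * (c + 1))"
    unfolding emb_hom left_diff_distrib by (auto simp: algebra_simps)
  finally have "rq q = emb m * eps k \<longleftrightarrow> a * pw k = b * pw k + m * (c + 1)" unfolding emb_eq .
  then show ?thesis using r rc_inj [OF r] by blast
qed

lemma sat_lessQ [simp]:
  "length e = d \<Longrightarrow> stab M e q \<Longrightarrow> stab M e r \<Longrightarrow> vl M e q \<in> N \<Longrightarrow> vl M e r \<in> N \<Longrightarrow>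
    sat M e ((q <\<^sub>Q r) d) \<longleftrightarrow> rq (val e q) < rq (val e r)"
  by (simp add: lessQ_def lessQ_iff)
lemma sat_sumQ [simp]:
  "length e = d \<Longrightarrow> stab M e q \<Longrightarrow> stab M e r \<Longrightarrow> stab M e s \<Longrightarrow> vl M e q \<in> N \<Longrightarrow> vl M e r \<in> N \<Longrightarrow> vl M e s \<in> N \<Longrightarrow>
    sat M e (sumQ q r s d) \<longleftrightarrow> rq (val e q) + rq (val e r) = rq (val e s)"
  by (simp add: sumQ_def sumQ_iff)
lemma sat_dyadicQ [simp]:
  "length e = d \<Longrightarrow> stab M e q \<Longrightarrow> stab M e r \<Longrightarrow> stab M e s \<Longrightarrow> vl M e q \<in> N \<Longrightarrow> vl M e r \<in> N \<Longrightarrow> vl M e s \<in> N \<Longrightarrow>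
    sat M e (dyadicQ q r s d) \<longleftrightarrow> rq (val e q) = emb (val e r) * eps (val e s)"
  by (simp add: dyadicQ_def dyadicQ_iff)

lemma rq_closed: "\<exists>s. rq s = rq q + rq r" "\<exists>s. rq s = emb m * eps k"
proof -
  show "\<exists>s. rq s = rq q + rq r" using rq_rat [of q] rq_rat [of r] rat_add rat_rq by metis
  obtain a b c where "eps k = rat a b c" using rat_eps by blast
  moreover have "emb m = rat m 0 0" by (simp add: rat_def)
  ultimately show "\<exists>s. rq s = emb m * eps k" using rat_mult rat_rq by metis
qed

lemma sat_less_plusQ [simp]:
  "length e = d \<Longrightarrow> stab M e q \<Longrightarrow> stab M e r \<Longrightarrow> stab M e m \<Longrightarrow> stab M e k \<Longrightarrow>
    vl M e q \<in> N \<Longrightarrow> vl M e r \<in> N \<Longrightarrow> vl M e m \<in> N \<Longrightarrow> vl M e k \<in> N \<Longrightarrow>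
    sat M e (less_plusQ q r m k d) \<longleftrightarrow> rq (val e q) < rq (val e r) + emb (val e m) * eps (val e k)"
proof -
  have *: "(\<exists>i s. rq i = y \<and> rq j + rq i = rq s \<and> x < rq s) \<longleftrightarrow> x < rq j + y" if "\<exists>i. rq i = y" for j x y
    using that rq_closed(1) by metis
  show "length e = d \<Longrightarrow> stab M e q \<Longrightarrow> stab M e r \<Longrightarrow> stab M e m \<Longrightarrow> stab M e k \<Longrightarrow>
    vl M e q \<in> N \<Longrightarrow> vl M e r \<in> N \<Longrightarrow> vl M e m \<in> N \<Longrightarrow> vl M e k \<in> N \<Longrightarrow> ?thesis"
    using * [OF rq_closed(2)] by (simp add: less_plusQ_def)
qed
lemma sat_closeQ [simp]:
  "length e = d \<Longrightarrow> stab M e q \<Longrightarrow> stab M e r \<Longrightarrow> stab M e k \<Longrightarrow> vl M e q \<in> N \<Longrightarrow> vl M e r \<in> N \<Longrightarrow> vl M e k \<in> N \<Longrightarrow>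
    sat M e (closeQ q r k d) \<longleftrightarrow> \<bar>rq (val e q) - rq (val e r)\<bar> < eps (val e k)"
  by (simp add: closeQ_def abs_less_iff) linarith
lemma sat_is_real [simp]:
  "length e = d \<Longrightarrow> stab M e x \<Longrightarrow> vl M e x \<in> carr M T1 \<Longrightarrow> sat M e (is_real x d) \<longleftrightarrow> isreal (vl M e x)"
  by (simp add: is_real_def isreal_def sq_def nd_add)

lemma less_rv_iff: assumes "isreal x" "isreal y"
  shows "rv x < rv y \<longleftrightarrow> (\<exists>n. sq x n + 2 * eps n < sq y n)"
proof
  assume "rv x < rv y"
  then obtain n where n: "rv x + eps n < rv y" using eps_between by blast
  \<comment> \<open>At index \<open>n + 3\<close> the two approximation errors and the margin 2 eps
    amount to four times \<open>eps n / 8\<close>, which fits below \<open>eps n\<close>.\<close>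
  have "eps (n + 1 + 1) = eps n / 4" unfolding eps_Suc by simp
  moreover have "eps (n + 1 + 1 + 1) = eps (n + 1 + 1) / 2" by (rule eps_Suc)
  moreover have "0 < eps n" by simp
  ultimately have "sq x (n + 1 + 1 + 1) + 2 * eps (n + 1 + 1 + 1) < sq y (n + 1 + 1 + 1)"
    using n rv [OF assms(1), of "n + 1 + 1 + 1"] rv [OF assms(2), of "n + 1 + 1 + 1"] by linarith
  then show "\<exists>n. sq x n + 2 * eps n < sq y n" ..
next
  assume "\<exists>n. sq x n + 2 * eps n < sq y n"
  then obtain n where "sq x n + 2 * eps n < sq y n" ..
  then show "rv x < rv y" using rv [OF assms(1), of n] rv [OF assms(2), of n] by linarith
qed

lemma sat_lessR [simp]:
  assumes "length e = d" "stab M e x" "stab M e y" "isreal (vl M e x)" "isreal (vl M e y)"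
  shows "sat M e ((x <\<^sub>R y) d) \<longleftrightarrow> rv (vl M e x) < rv (vl M e y)"
proof -
  have *: "(\<exists>i. rq i = y \<and> (\<exists>s. rq j + rq i = rq s \<and> rq s < x)) \<longleftrightarrow> rq j + y < x" if "\<exists>i. rq i = y" for j x y
    using that rq_closed(1) by metis
  have two: "emb (2 :: 'n) = 2" by (rule emb_numeral)
  have **: "(\<exists>i. rq i = emb 2 * eps n \<and> (\<exists>s. rq j + rq i = rq s \<and> rq s < x)) \<longleftrightarrow> rq j + 2 * eps n < x" for n j x
    using * [OF rq_closed(2), of 2 n j x] unfolding two .
  show ?thesis
    using assms isreal_T1 [OF assms(4)] isreal_T1 [OF assms(5)]
    by (simp add: lessR_def less_rv_iff sq_def **)
qed

lemma sat_leR [simp]: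
  "length e = d \<Longrightarrow> stab M e x \<Longrightarrow> stab M e y \<Longrightarrow> isreal (vl M e x) \<Longrightarrow> isreal (vl M e y) \<Longrightarrow>
    sat M e ((x \<le>\<^sub>R y) d) \<longleftrightarrow> rv (vl M e x) \<le> rv (vl M e y)"
  by (simp add: leR_def not_less)
lemma sat_eqR [simp]:
  "length e = d \<Longrightarrow> stab M e x \<Longrightarrow> stab M e y \<Longrightarrow> isreal (vl M e x) \<Longrightarrow> isreal (vl M e y) \<Longrightarrow>
    sat M e ((x =\<^sub>R y) d) \<longleftrightarrow> rv (vl M e x) = rv (vl M e y)"
  by (simp add: eqR_def order.eq_iff)

lemma all_T1_real: "(\<forall>x\<in>carr M T1. isreal x \<longrightarrow> P x) \<longleftrightarrow> (\<forall>x. isreal x \<longrightarrow> P x)"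
  and ex_T1_real: "(\<exists>x\<in>carr M T1. isreal x \<and> P x) \<longleftrightarrow> (\<exists>x. isreal x \<and> P x)"
  using isreal_T1 by blast+

lemma sat_real_quantifiers [simp]:
  assumes "length e = d"
  shows "sat M e (all_real A d) \<longleftrightarrow> (\<forall>x. isreal x \<longrightarrow> sat M (x # e) (A (vr d) (Suc d)))"
    and "sat M e (ex_real A d) \<longleftrightarrow> (\<exists>x. isreal x \<and> sat M (x # e) (A (vr d) (Suc d)))"
  using assms by (simp_all add: all_real_def ex_real_def all_T1_real ex_T1_real cong: conj_cong)

lemma sum_rv_iff: assumes "isreal x" "isreal y" "isreal z"
  shows "rv x + rv y = rv z \<longleftrightarrow> (\<forall>k. \<exists>m. \<forall>n. m \<le> n \<longrightarrow> \<bar>sq x n + sq y n - sq z n\<bar> < eps k)"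
proof
  assume s: "rv x + rv y = rv z"
  show "\<forall>k. \<exists>m. \<forall>n. m \<le> n \<longrightarrow> \<bar>sq x n + sq y n - sq z n\<bar> < eps k"
  proof
    fix k
    \<comment> \<open>Three terms are each off by at most \<open>eps k / 4\<close>.\<close>
    have "\<bar>sq x n + sq y n - sq z n\<bar> < eps k" if "k + 1 + 1 \<le> n" for n
    proof -
      have "eps n \<le> eps (k + 1 + 1)" using that by (rule eps_mono)
      also have "eps (k + 1 + 1) = eps k / 4" unfolding eps_Suc by simp
      finally show ?thesis
        using s rv [OF assms(1), of n] rv [OF assms(2), of n] rv [OF assms(3), of n] eps_pos [of k] by linarith
    qed
    then show "\<exists>m. \<forall>n. m \<le> n \<longrightarrow> \<bar>sq x n + sq y n - sq z n\<bar> < eps k" by blast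
  qed
next
  assume *: "\<forall>k. \<exists>m. \<forall>n. m \<le> n \<longrightarrow> \<bar>sq x n + sq y n - sq z n\<bar> < eps k"
  show "rv x + rv y = rv z"
  proof (rule ccontr)
    assume "rv x + rv y \<noteq> rv z"
    then have "0 < \<bar>rv x + rv y - rv z\<bar>" by simp
    from eps_small [OF this] obtain k where k: "eps k < \<bar>rv x + rv y - rv z\<bar>" by blast
    obtain m where m: "\<And>n. m \<le> n \<Longrightarrow> \<bar>sq x n + sq y n - sq z n\<bar> < eps (k + 1)" using * by blast
    define n where "n = m + (k + 1 + 1 + 1)"
    have mn: "m \<le> n" by (simp add: n_def)
    have "eps n \<le> eps (k + 1 + 1 + 1)" unfolding n_def by (rule eps_mono) simp
    also have "eps (k + 1 + 1 + 1) = eps k / 8" unfolding eps_Suc by simp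
    finally have "eps n \<le> eps k / 8" .
    moreover have "eps (k + 1) = eps k / 2" by (rule eps_Suc)
    ultimately have "\<bar>rv x + rv y - rv z\<bar> \<le> eps k"
      using m [OF mn] rv [OF assms(1), of n] rv [OF assms(2), of n] rv [OF assms(3), of n] eps_pos [of k]
      by linarith
    with k show False by simp
  qed
qed

lemma sat_sumR [simp]:
  assumes "length e = d" "stab M e x" "stab M e y" "stab M e z"
    "isreal (vl M e x)" "isreal (vl M e y)" "isreal (vl M e z)"
  shows "sat M e (sumR x y z d) \<longleftrightarrow> rv (vl M e x) + rv (vl M e y) = rv (vl M e z)"
proof -
  have *: "(\<exists>s. rq i + rq j = rq s \<and> \<bar>rq s - x\<bar> < y) \<longleftrightarrow> \<bar>rq i + rq j - x\<bar> < y" for i j x y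
    using rq_closed(1) [of i j] by metis
  show ?thesis
    using assms isreal_T1 [OF assms(5)] isreal_T1 [OF assms(6)] isreal_T1 [OF assms(7)]
    by (simp add: sumR_def sum_rv_iff sq_def *)
qed

lemma sum_code: "isreal x \<Longrightarrow> isreal y \<Longrightarrow> \<exists>z. isreal z \<and> rv z = rv x + rv y"
proof -
  assume "isreal x" "isreal y"
  then have "rv x + rv y \<in> RM" by (intro RM_add) (auto simp: RM_def)
  then show ?thesis by (auto simp: RM_def)
qed

lemma sat_less_plusR [simp]:
  assumes "length e = d" "stab M e x" "stab M e y" "stab M e z"
    "isreal (vl M e x)" "isreal (vl M e y)" "isreal (vl M e z)"
  shows "sat M e (less_plusR x y z d) \<longleftrightarrow> rv (vl M e x) < rv (vl M e y) + rv (vl M e z)"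
    and "sat M e (le_plusR x y z d) \<longleftrightarrow> rv (vl M e x) \<le> rv (vl M e y) + rv (vl M e z)"
proof -
  obtain s where s: "isreal s" "rv s = rv (vl M e y) + rv (vl M e z)" using sum_code assms by blast
  show "sat M e (less_plusR x y z d) \<longleftrightarrow> rv (vl M e x) < rv (vl M e y) + rv (vl M e z)"
    using assms s by (auto simp: less_plusR_def cong: conj_cong)
  show "sat M e (le_plusR x y z d) \<longleftrightarrow> rv (vl M e x) \<le> rv (vl M e y) + rv (vl M e z)"
    using assms s by (auto simp: le_plusR_def cong: conj_cong)
qed

lemma sat_distR_less [simp]:
  "length e = d \<Longrightarrow> stab M e x \<Longrightarrow> stab M e y \<Longrightarrow> stab M e z \<Longrightarrow>
    isreal (vl M e x) \<Longrightarrow> isreal (vl M e y) \<Longrightarrow> isreal (vl M e z) \<Longrightarrow>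
    sat M e (distR_less x y z d) \<longleftrightarrow> \<bar>rv (vl M e x) - rv (vl M e y)\<bar> < rv (vl M e z)"
  by (simp add: distR_less_def abs_less_iff) linarith

lemma ratR_simps [simp]:
  "stab M e q \<Longrightarrow> stab M e (ratR q)"
  "vl M e q \<in> N \<Longrightarrow> isreal (vl M e (ratR q))"
  "vl M e q \<in> N \<Longrightarrow> rv (vl M e (ratR q)) = rq (val e q)"
proof -
  show "stab M e q \<Longrightarrow> stab M e (ratR q)" by (simp add: ratR_def)
  assume q: "vl M e q \<in> N"
  let ?x = "vl M e (ratR q)"
  have x: "?x \<in> carr M T1" unfolding ratR_def using q K_carr by simp
  have s: "sq ?x n = rq (val e q)" for n unfolding ratR_def sq_def using q K_ax [OF q nd_in, of n] by simp
  show r: "isreal ?x" using x s by (simp add: isreal_def)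
  show "rv ?x = rq (val e q)" by (rule rv_eq [OF r]) (simp add: s less_imp_le)
qed

lemma rq_special: "\<exists>q. rq q = 0" "\<exists>q. rq q = 1" "\<exists>q. rq q = eps n"
  using rq_closed(2) [of 0 0] rq_closed(2) [of 1 0] rq_closed(2) [of 1 n] by simp_all

lemma sat_positiveR [simp]:
  "length e = d \<Longrightarrow> stab M e x \<Longrightarrow> isreal (vl M e x) \<Longrightarrow> sat M e (positiveR x d) \<longleftrightarrow> 0 < rv (vl M e x)"
  using rq_special(1) by (auto simp: positiveR_def cong: conj_cong)
lemma sat_in_unit [simp]:
  "length e = d \<Longrightarrow> stab M e x \<Longrightarrow> vl M e x \<in> carr M T1 \<Longrightarrow> sat M e (in_unit x d) \<longleftrightarrow> vl M e x \<in> UC"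
  using rq_special(1,2) by (auto simp: in_unit_def UC_def cong: conj_cong)

lemma all_T1_UC: "(\<forall>x\<in>carr M T1. x \<in> UC \<longrightarrow> P x) \<longleftrightarrow> (\<forall>x\<in>UC. P x)"
  and ex_T1_UC: "(\<exists>x\<in>carr M T1. x \<in> UC \<and> P x) \<longleftrightarrow> (\<exists>x\<in>UC. P x)"
  using UC_T1 by blast+

definition PCd :: "'a set" where "PCd = {x. isreal x \<and> 0 < rv x}"
lemma PCd_real: "x \<in> PCd \<Longrightarrow> isreal x" and PCd_T1: "x \<in> PCd \<Longrightarrow> x \<in> carr M T1"
  using isreal_T1 by (auto simp: PCd_def)
declare PCd_real [simp] UC_real [simp]

lemma all_PCd: "(\<forall>x. isreal x \<longrightarrow> 0 < rv x \<longrightarrow> P x) \<longleftrightarrow> (\<forall>x\<in>PCd. P x)"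
  and ex_PCd: "(\<exists>x. isreal x \<and> 0 < rv x \<and> P x) \<longleftrightarrow> (\<exists>x\<in>PCd. P x)"
  unfolding PCd_def by blast+

lemma sat_bounded_quantifiers [simp]:
  assumes "length e = d"
  shows "sat M e (all_pos A d) \<longleftrightarrow> (\<forall>x\<in>PCd. sat M (x # e) (A (vr d) (Suc d)))"
    and "sat M e (ex_pos A d) \<longleftrightarrow> (\<exists>x\<in>PCd. sat M (x # e) (A (vr d) (Suc d)))"
    and "sat M e (all_unit A d) \<longleftrightarrow> (\<forall>x\<in>UC. sat M (x # e) (A (vr d) (Suc d)))"
    and "sat M e (ex_unit A d) \<longleftrightarrow> (\<exists>x\<in>UC. sat M (x # e) (A (vr d) (Suc d)))"
  using assms
  by (simp_all add: all_pos_def ex_pos_def all_unit_def ex_unit_def all_T1_UC ex_T1_UC all_PCd ex_PCd cong: conj_cong)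

lemma sat_in_ball [simp]:
  assumes "length e = d" "stab M e y" "stab M e x" "stab M e k" "isreal (vl M e y)" "isreal (vl M e x)" "vl M e k \<in> N"
  shows "sat M e (in_ball y x k d) \<longleftrightarrow> \<bar>rv (vl M e x) - rv (vl M e y)\<bar> < eps (val e k)"
  using assms rq_special(3) by (auto simp: in_ball_def cong: conj_cong)

lemma sat_is_function [simp]:
  "length e = d \<Longrightarrow> stab M e f \<Longrightarrow> vl M e f \<in> carr M (T1 \<rightarrow> T1) \<Longrightarrow> sat M e (is_function f d) \<longleftrightarrow> isfun (vl M e f)"
  by (simp add: is_function_def isfun_def ball_conj_distrib cong: ball_cong conj_cong)

lemma isfun_carr [simp]: "isfun f \<Longrightarrow> f \<in> carr M (T1 \<rightarrow> T1)" by (simp add: isfun_def)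
lemma isfun_real [simp]: "isfun f \<Longrightarrow> x \<in> UC \<Longrightarrow> isreal (ap M f x)" by (simp add: isfun_def)
declare fv [simp]

lemma sat_all_function [simp]:
  "length e = d \<Longrightarrow> sat M e (all_function A d) \<longleftrightarrow> (\<forall>f. isfun f \<longrightarrow> sat M (f # e) (A (vr d) (Suc d)))"
  by (simp add: all_function_def Ball_def cong: conj_cong) (metis isfun_carr)

end

section \<open>Analytic notions on the values, matching the formulas\<close>

context nmodel
begin

lemma RP_image: "RP = rv ` PCd" unfolding RP_def RM_def PCd_def by blast

lemmas quantifier_simps = RP_image UI_def RM_def
lemmas bounded_cong = ball_cong bex_cong conj_cong

definition cont :: "('n rl \<Rightarrow> 'n rl) \<Rightarrow> 'n rl \<Rightarrow> bool" where
  "cont f v \<longleftrightarrow> (\<forall>e\<in>RP. \<exists>d\<in>RP. \<forall>w\<in>UI. \<bar>v - w\<bar> < d \<longrightarrow> \<bar>f v - f w\<bar> < e)"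
definition uscont :: "('n rl \<Rightarrow> 'n rl) \<Rightarrow> 'n rl \<Rightarrow> bool" where
  "uscont f v \<longleftrightarrow> (\<forall>e\<in>RP. \<exists>d\<in>RP. \<forall>w\<in>UI. \<bar>v - w\<bar> < d \<longrightarrow> f w < f v + e)"
definition lscont :: "('n rl \<Rightarrow> 'n rl) \<Rightarrow> 'n rl \<Rightarrow> bool" where
  "lscont f v \<longleftrightarrow> (\<forall>e\<in>RP. \<exists>d\<in>RP. \<forall>w\<in>UI. \<bar>v - w\<bar> < d \<longrightarrow> f v < f w + e)"
definition llim :: "('n rl \<Rightarrow> 'n rl) \<Rightarrow> 'n rl \<Rightarrow> 'n rl \<Rightarrow> bool" where
  "llim f v l \<longleftrightarrow> (\<forall>e\<in>RP. \<exists>d\<in>RP. \<forall>w\<in>UI. w < v \<and> \<bar>v - w\<bar> < d \<longrightarrow> \<bar>f w - l\<bar> < e)"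
definition rlim :: "('n rl \<Rightarrow> 'n rl) \<Rightarrow> 'n rl \<Rightarrow> 'n rl \<Rightarrow> bool" where
  "rlim f v l \<longleftrightarrow> (\<forall>e\<in>RP. \<exists>d\<in>RP. \<forall>w\<in>UI. v < w \<and> \<bar>v - w\<bar> < d \<longrightarrow> \<bar>f w - l\<bar> < e)"

lemma sat_point_properties [simp]:
  assumes "length e = d" "stab M e f" "stab M e x" "isfun (vl M e f)" "vl M e x \<in> UC"
  shows "sat M e (cont_at f x d) \<longleftrightarrow> cont (fv (vl M e f)) (rv (vl M e x))"
    and "sat M e (usc_at f x d) \<longleftrightarrow> uscont (fv (vl M e f)) (rv (vl M e x))"
    and "sat M e (lsc_at f x d) \<longleftrightarrow> lscont (fv (vl M e f)) (rv (vl M e x))"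
  using assms
  by (simp_all add: cont_at_def cont_def usc_at_def uscont_def lsc_at_def lscont_def quantifier_simps cong: bounded_cong)

lemma sat_limits [simp]:
  assumes "length e = d" "stab M e f" "stab M e x" "stab M e l" "isfun (vl M e f)" "vl M e x \<in> UC" "isreal (vl M e l)"
  shows "sat M e (left_limit f x l d) \<longleftrightarrow> llim (fv (vl M e f)) (rv (vl M e x)) (rv (vl M e l))"
    and "sat M e (right_limit f x l d) \<longleftrightarrow> rlim (fv (vl M e f)) (rv (vl M e x)) (rv (vl M e l))"
  using assms
  by (simp_all add: left_limit_def llim_def right_limit_def rlim_def quantifier_simps cong: bounded_cong)

lemma sat_usc [simp]:
  "length e = d \<Longrightarrow> stab M e f \<Longrightarrow> isfun (vl M e f) \<Longrightarrow> sat M e (usc f d) \<longleftrightarrow> (\<forall>v\<in>UI. uscont (fv (vl M e f)) v)"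
  by (simp add: usc_def UI_def cong: bounded_cong)

lemma sat_one_sided [simp]:
  assumes "length e = d" "stab M e f" "stab M e x" "isfun (vl M e f)" "vl M e x \<in> UC"
  shows "sat M e (regulated_at f x d) \<longleftrightarrow>
      (\<exists>l\<in>RM. llim (fv (vl M e f)) (rv (vl M e x)) l) \<and> (\<exists>l\<in>RM. rlim (fv (vl M e f)) (rv (vl M e x)) l)"
    and "sat M e (cadlag_at f x d) \<longleftrightarrow>
      rlim (fv (vl M e f)) (rv (vl M e x)) (fv (vl M e f) (rv (vl M e x))) \<and> (\<exists>l\<in>RM. llim (fv (vl M e f)) (rv (vl M e x)) l)"
  using assms by (simp_all add: regulated_at_def cadlag_at_def RM_def cong: bounded_cong)

definition opn :: "'n rl set \<Rightarrow> bool" where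
  "opn U \<longleftrightarrow> (\<forall>v\<in>U. \<exists>k. \<forall>w\<in>UI. \<bar>v - w\<bar> < eps k \<longrightarrow> w \<in> U)"
definition dns :: "'n rl set \<Rightarrow> bool" where
  "dns U \<longleftrightarrow> (\<forall>v\<in>UI. \<forall>k. \<exists>w\<in>U. \<bar>v - w\<bar> < eps k)"

abbreviation "Sec E n \<equiv> sv (\<lambda>x. ap M (ap M E x) (nd n))"
abbreviation "isseq E \<equiv> E \<in> carr M (T1 \<rightarrow> T0 \<rightarrow> T0) \<and> (\<forall>n. isset (\<lambda>x. ap M (ap M E x) (nd n)))"

lemma sv_app: "isset (ap M X) \<Longrightarrow> x \<in> UC \<Longrightarrow> ap M X x = nd 1 \<longleftrightarrow> rv x \<in> sv (ap M X)"
  by (rule sv)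
lemma sv_sec: "isset (\<lambda>x. ap M (ap M E x) n) \<Longrightarrow> x \<in> UC \<Longrightarrow> ap M (ap M E x) n = nd 1 \<longleftrightarrow> rv x \<in> sv (\<lambda>x. ap M (ap M E x) n)"
  by (rule sv)

lemma ball_UI_sv: "(\<forall>v\<in>sv X. P v) \<longleftrightarrow> (\<forall>x\<in>UC. rv x \<in> sv X \<longrightarrow> P (rv x))"
  and bex_UI_sv: "(\<exists>v\<in>sv X. P v) \<longleftrightarrow> (\<exists>x\<in>UC. rv x \<in> sv X \<and> P (rv x))"
  using sv_UI [of X] by (auto simp: UI_def)

lemma sat_mem_app [simp]:
  "length e = d \<Longrightarrow> stab M e X \<Longrightarrow> stab M e x \<Longrightarrow> vl M e X \<in> carr M (T1 \<rightarrow> T0) \<Longrightarrow> isset (ap M (vl M e X)) \<Longrightarrow> vl M e x \<in> UC \<Longrightarrow>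
    sat M e (mem x (app X) d) \<longleftrightarrow> rv (vl M e x) \<in> sv (ap M (vl M e X))"
  by (simp add: mem_def eqr_eq nd_1 sv_app del: eqr_nm)
lemma sat_mem_section [simp]:
  "length e = d \<Longrightarrow> stab M e E \<Longrightarrow> stab M e n \<Longrightarrow> stab M e x \<Longrightarrow> vl M e E \<in> carr M (T1 \<rightarrow> T0 \<rightarrow> T0) \<Longrightarrow> vl M e n \<in> N \<Longrightarrow>
    isset (\<lambda>x. ap M (ap M (vl M e E) x) (vl M e n)) \<Longrightarrow> vl M e x \<in> UC \<Longrightarrow>
    sat M e (mem x (section_set E n) d) \<longleftrightarrow> rv (vl M e x) \<in> sv (\<lambda>x. ap M (ap M (vl M e E) x) (vl M e n))"
  by (simp add: mem_def section_set_def eqr_eq nd_1 sv_sec del: eqr_nm)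
lemma sat_is_set [simp]:
  "length e = d \<Longrightarrow> stab M e X \<Longrightarrow> vl M e X \<in> carr M (T1 \<rightarrow> T0) \<Longrightarrow> sat M e (is_set (app X) d) \<longleftrightarrow> isset (ap M (vl M e X))"
  "length e = d \<Longrightarrow> stab M e E \<Longrightarrow> stab M e n \<Longrightarrow> vl M e E \<in> carr M (T1 \<rightarrow> T0 \<rightarrow> T0) \<Longrightarrow> vl M e n \<in> N \<Longrightarrow>
    sat M e (is_set (section_set E n) d) \<longleftrightarrow> isset (\<lambda>x. ap M (ap M (vl M e E) x) (vl M e n))"
  by (simp_all add: is_set_def isset_def section_set_def eqr_eq nd_1 nd_0 del: eqr_nm cong: bounded_cong)
lemma sat_is_open [simp]:
  "length e = d \<Longrightarrow> stab M e X \<Longrightarrow> vl M e X \<in> carr M (T1 \<rightarrow> T0) \<Longrightarrow>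
    sat M e (is_open (app X) d) \<longleftrightarrow> isset (ap M (vl M e X)) \<and> opn (sv (ap M (vl M e X)))"
  "length e = d \<Longrightarrow> stab M e E \<Longrightarrow> stab M e n \<Longrightarrow> vl M e E \<in> carr M (T1 \<rightarrow> T0 \<rightarrow> T0) \<Longrightarrow> vl M e n \<in> N \<Longrightarrow>
    sat M e (is_open (section_set E n) d) \<longleftrightarrow>
      isset (\<lambda>x. ap M (ap M (vl M e E) x) (vl M e n)) \<and> opn (sv (\<lambda>x. ap M (ap M (vl M e E) x) (vl M e n)))"
  by (simp_all add: is_open_def opn_def ball_UI_sv UI_def cong: bounded_cong)

text \<open>Only open sets with a characteristic function in the model are counted, since the
  formulas quantify over nothing else.\<close>

definition OP :: "'n rl set set" where
  "OP = {U. \<exists>X\<in>carr M (T1 \<rightarrow> T0). isset (ap M X) \<and> opn (sv (ap M X)) \<and> U = sv (ap M X)}"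

definition quasi :: "('n rl \<Rightarrow> 'n rl) \<Rightarrow> 'n rl \<Rightarrow> bool" where
  "quasi f v \<longleftrightarrow> (\<forall>e\<in>RP. \<forall>U\<in>OP. v \<in> U \<longrightarrow> (\<exists>G\<in>OP. (\<exists>w\<in>UI. w \<in> G) \<and> (\<forall>w\<in>UI. w \<in> G \<longrightarrow> w \<in> U) \<and>
     (\<forall>w\<in>UI. w \<in> G \<longrightarrow> \<bar>f v - f w\<bar> < e)))"
definition lquasi :: "('n rl \<Rightarrow> 'n rl) \<Rightarrow> 'n rl \<Rightarrow> bool" where
  "lquasi f v \<longleftrightarrow> (\<forall>e\<in>RP. \<forall>U\<in>OP. v \<in> U \<longrightarrow> (\<exists>G\<in>OP. (\<exists>w\<in>UI. w \<in> G) \<and> (\<forall>w\<in>UI. w \<in> G \<longrightarrow> w \<in> U) \<and>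
     (\<forall>w\<in>UI. w \<in> G \<longrightarrow> f v < f w + e)))"

lemma ball_OP: "(\<forall>U\<in>OP. P U) \<longleftrightarrow> (\<forall>X\<in>carr M (T1 \<rightarrow> T0). isset (ap M X) \<and> opn (sv (ap M X)) \<longrightarrow> P (sv (ap M X)))"
  and bex_OP: "(\<exists>U\<in>OP. P U) \<longleftrightarrow> (\<exists>X\<in>carr M (T1 \<rightarrow> T0). (isset (ap M X) \<and> opn (sv (ap M X))) \<and> P (sv (ap M X)))"
  unfolding OP_def by blast+

lemma sat_open_quantifiers [simp]:
  assumes "length e = d"
  shows "sat M e (all_open A d) \<longleftrightarrow>
      (\<forall>X\<in>carr M (T1 \<rightarrow> T0). isset (ap M X) \<and> opn (sv (ap M X)) \<longrightarrow> sat M (X # e) (A (app (vr d)) (Suc d)))"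
    and "sat M e (ex_open A d) \<longleftrightarrow>
      (\<exists>X\<in>carr M (T1 \<rightarrow> T0). (isset (ap M X) \<and> opn (sv (ap M X))) \<and> sat M (X # e) (A (app (vr d)) (Suc d)))"
  using assms by (simp_all add: all_open_def ex_open_def cong: bounded_cong)

lemma sat_quasi [simp]:
  assumes "length e = d" "stab M e f" "stab M e x" "isfun (vl M e f)" "vl M e x \<in> UC"
  shows "sat M e (quasi_cont_at f x d) \<longleftrightarrow> quasi (fv (vl M e f)) (rv (vl M e x))"
    and "sat M e (lower_quasi_cont_at f x d) \<longleftrightarrow> lquasi (fv (vl M e f)) (rv (vl M e x))"
  using assms
  by (simp_all add: quasi_cont_at_def lower_quasi_cont_at_def quasi_def lquasi_def ball_OP bex_OP UI_def RP_image cong: bounded_cong)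

definition conv :: "('n \<Rightarrow> 'n rl) \<Rightarrow> 'n rl \<Rightarrow> bool" where
  "conv s l \<longleftrightarrow> (\<forall>e\<in>RP. \<exists>m. \<forall>n. m \<le> n \<longrightarrow> \<bar>s n - l\<bar> < e)"
definition lcluster :: "('n rl \<Rightarrow> 'n rl) \<Rightarrow> 'n rl \<Rightarrow> 'n rl \<Rightarrow> bool" where
  "lcluster f v y \<longleftrightarrow> (\<exists>s\<in>SEQ. (\<forall>n. s n \<in> UI \<and> s n \<le> v) \<and> conv s v \<and> conv (\<lambda>n. f (s n)) y)"
definition rcluster :: "('n rl \<Rightarrow> 'n rl) \<Rightarrow> 'n rl \<Rightarrow> 'n rl \<Rightarrow> bool" where
  "rcluster f v y \<longleftrightarrow> (\<exists>s\<in>SEQ. (\<forall>n. s n \<in> UI \<and> v \<le> s n) \<and> conv s v \<and> conv (\<lambda>n. f (s n)) y)"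
definition between :: "'n rl \<Rightarrow> 'n rl \<Rightarrow> 'n rl \<Rightarrow> bool" where
  "between z a b \<longleftrightarrow> a < z \<and> z < b \<or> b < z \<and> z < a"
definition darboux :: "('n rl \<Rightarrow> 'n rl) \<Rightarrow> 'n rl \<Rightarrow> bool" where
  "darboux f v \<longleftrightarrow> (\<forall>d\<in>RP. \<forall>y\<in>RM. \<forall>z\<in>RM. between z y (f v) \<longrightarrow>
     (lcluster f v y \<longrightarrow> (\<exists>w\<in>UI. w < v \<and> \<bar>v - w\<bar> < d \<and> f w = z)) \<and>
     (rcluster f v y \<longrightarrow> (\<exists>w\<in>UI. v < w \<and> \<bar>v - w\<bar> < d \<and> f w = z)))"

lemma SEQ_UC:
  "(\<exists>s\<in>SEQ. (\<forall>n. s n \<in> UI \<and> R (s n)) \<and> Q s) \<longleftrightarrow>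
    (\<exists>u\<in>carr M (T0 \<rightarrow> T1). (\<forall>n. ap M u (nd n) \<in> UC \<and> R (rv (ap M u (nd n)))) \<and> Q (\<lambda>n. rv (ap M u (nd n))))"
  (is "?L \<longleftrightarrow> ?R")
proof
  assume ?L
  then obtain s u where s: "\<forall>n. s n \<in> UI \<and> R (s n)" "Q s" "u \<in> carr M (T0 \<rightarrow> T1)"
    "\<forall>n. isreal (ap M u (nd n)) \<and> rv (ap M u (nd n)) = s n" unfolding SEQ_def by blast
  from s(4) have e: "(\<lambda>n. rv (ap M u (nd n))) = s" by (intro ext) blast
  have c: "ap M u (nd n) \<in> UC \<and> R (rv (ap M u (nd n)))" for n
  proof -
    have r: "isreal (ap M u (nd n))" "rv (ap M u (nd n)) = s n" using s(4) by blast+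
    have "0 \<le> s n" "s n \<le> 1" "R (s n)" using s(1) unfolding UI_iff by blast+
    with r show ?thesis unfolding UC_def by simp
  qed
  show ?R by (rule bexI [OF _ s(3)]) (use c s(2) in \<open>simp only: e simp_thms\<close>)
next
  assume ?R
  then obtain u where u: "u \<in> carr M (T0 \<rightarrow> T1)" "\<forall>n. ap M u (nd n) \<in> UC \<and> R (rv (ap M u (nd n)))"
    "Q (\<lambda>n. rv (ap M u (nd n)))" by blast
  have "(\<lambda>n. rv (ap M u (nd n))) \<in> SEQ"
    unfolding SEQ_def by (rule CollectI, rule bexI [OF _ u(1)]) (use u(2) UC_real in blast)
  then show ?L by (rule rev_bexI) (use u(2,3) in \<open>unfold UI_def, blast\<close>)
qed

lemma lcluster_iff: "lcluster f v y \<longleftrightarrow> (\<exists>u\<in>carr M (T0 \<rightarrow> T1). (\<forall>n. ap M u (nd n) \<in> UC \<and> rv (ap M u (nd n)) \<le> v) \<and>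
    conv (\<lambda>n. rv (ap M u (nd n))) v \<and> conv (\<lambda>n. f (rv (ap M u (nd n)))) y)"
  unfolding lcluster_def by (rule SEQ_UC [of "\<lambda>x. x \<le> v" "\<lambda>s. conv s v \<and> conv (\<lambda>n. f (s n)) y"])
lemma rcluster_iff: "rcluster f v y \<longleftrightarrow> (\<exists>u\<in>carr M (T0 \<rightarrow> T1). (\<forall>n. ap M u (nd n) \<in> UC \<and> v \<le> rv (ap M u (nd n))) \<and>
    conv (\<lambda>n. rv (ap M u (nd n))) v \<and> conv (\<lambda>n. f (rv (ap M u (nd n)))) y)"
  unfolding rcluster_def by (rule SEQ_UC [of "\<lambda>x. v \<le> x" "\<lambda>s. conv s v \<and> conv (\<lambda>n. f (s n)) y"])

lemma sat_cluster [simp]: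
  assumes "length e = d" "stab M e f" "stab M e x" "stab M e y" "isfun (vl M e f)" "vl M e x \<in> UC" "isreal (vl M e y)"
  shows "sat M e (left_cluster f x y d) \<longleftrightarrow> lcluster (fv (vl M e f)) (rv (vl M e x)) (rv (vl M e y))"
    and "sat M e (right_cluster f x y d) \<longleftrightarrow> rcluster (fv (vl M e f)) (rv (vl M e x)) (rv (vl M e y))"
  unfolding lcluster_iff rcluster_iff conv_def using assms
  by (simp_all add: left_cluster_def right_cluster_def converges_def RP_image all_conj_distrib cong: bounded_cong)

lemma sat_Darboux [simp]:
  assumes "length e = d" "stab M e f" "stab M e x" "isfun (vl M e f)" "vl M e x \<in> UC"
  shows "sat M e (Darboux_at f x d) \<longleftrightarrow> darboux (fv (vl M e f)) (rv (vl M e x))"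
  using assms
  by (simp add: Darboux_at_def darboux_def strictly_between_def between_def quantifier_simps cong: bounded_cong)

definition ccont :: "('n rl \<Rightarrow> 'n rl) \<Rightarrow> bool" where
  "ccont f \<longleftrightarrow> (\<exists>E. isseq E \<and> (\<forall>v\<in>UI. \<exists>n. v \<in> Sec E n) \<and>
    (\<forall>n. \<forall>v\<in>UI. v \<in> Sec E n \<longrightarrow> (\<forall>e\<in>RP. \<exists>d\<in>RP. \<forall>w\<in>UI. w \<in> Sec E n \<and> \<bar>v - w\<bar> < d \<longrightarrow> \<bar>f v - f w\<bar> < e)))"

lemma sat_countably_cont [simp]:
  assumes "length e = d" "stab M e f" "isfun (vl M e f)"
  shows "sat M e (countably_cont f d) \<longleftrightarrow> ccont (fv (vl M e f))"
  using assms
  by (simp add: countably_cont_def ccont_def Bex_def [of "carr M (T1 \<rightarrow> T0 \<rightarrow> T0)"] UI_def RP_image cong: bounded_cong)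

definition osc :: "('n rl \<Rightarrow> 'n rl) \<Rightarrow> ('n rl \<Rightarrow> 'n rl) \<Rightarrow> bool" where
  "osc g f \<longleftrightarrow> (\<forall>v\<in>UI. \<forall>e\<in>RP. \<exists>m. \<forall>k. m \<le> k \<longrightarrow>
     (\<forall>y\<in>UI. \<forall>z\<in>UI. \<bar>v - y\<bar> < eps k \<and> \<bar>v - z\<bar> < eps k \<longrightarrow> f y \<le> f z + (g v + e)) \<and>
     (\<exists>y\<in>UI. \<exists>z\<in>UI. \<bar>v - y\<bar> < eps k \<and> \<bar>v - z\<bar> < eps k \<and> f z + g v < f y + e))"

lemma ex_sum_le: "isreal r \<Longrightarrow> isreal s \<Longrightarrow> (\<exists>c. isreal c \<and> rv r + rv s = rv c \<and> p \<le> q + rv c) \<longleftrightarrow> p \<le> q + (rv r + rv s)"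
  using sum_code by metis
lemma ex_sum_less:
  assumes "isreal p" "isreal r" "isreal q" "isreal s"
  shows "(\<exists>v. isreal v \<and> (\<exists>w. isreal w \<and> rv p + rv r = rv v \<and> rv q + rv s = rv w \<and> rv v < rv w)) \<longleftrightarrow>
    rv p + rv r < rv q + rv s"
  using sum_code [OF assms(1,2)] sum_code [OF assms(3,4)] by metis

lemma sat_is_osc_function [simp]:
  assumes "length e = d" "stab M e f" "stab M e g" "isfun (vl M e f)" "vl M e g \<in> carr M (T1 \<rightarrow> T1)"
  shows "sat M e (is_osc_function g f d) \<longleftrightarrow> isfun (vl M e g) \<and> osc (fv (vl M e g)) (fv (vl M e f))"
  using assms
  by (simp add: is_osc_function_def osc_def osc_ball_near_def UI_def RP_image conj_assoc ex_sum_le ex_sum_less del: fv cong: bounded_cong)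
    (simp cong: bounded_cong)

text \<open>The intervals \<open>(0, eps (k + n + 1))\<close> have total length \<open>eps k\<close>.\<close>

lemma sat_measure_zero_empty:
  assumes d: "length e = d" and A: "\<And>x b a u. x \<in> UC \<Longrightarrow> \<not> sat M (x # b # a # u # e) (A (vr (Suc (Suc (Suc d)))) (Suc (Suc (Suc (Suc d)))))"
  shows "sat M e (measure_zero A d)"
proof -
  have "\<exists>a\<in>carr M (T0 \<rightarrow> T1). \<exists>b\<in>carr M (T0 \<rightarrow> T1).
      (\<forall>n. isreal (ap M a (nd n)) \<and> isreal (ap M b (nd n)) \<and> rv (ap M a (nd n)) < rv (ap M b (nd n))) \<and>
      (\<exists>s\<in>carr M (T0 \<rightarrow> T1). (\<forall>n. isreal (ap M s (nd n))) \<and> rv (ap M s (nd 0)) = 0 \<and>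
        (\<forall>n. \<exists>l. isreal l \<and> rv (ap M a (nd n)) + rv l = rv (ap M b (nd n)) \<and> rv (ap M s (nd n)) + rv l = rv (ap M s (nd (n + 1)))) \<and>
        (\<exists>r. isreal r \<and> rv r < rv u \<and> (\<forall>n. rv (ap M s (nd n)) \<le> rv r)))" if "u \<in> PCd" for u
  proof -
    have u: "0 < rv u" using that by (simp add: PCd_def del: PCd_real)
    from eps_small [OF u] obtain k where k: "eps k < rv u" by blast
    have a0: "(\<lambda>n. 0) \<in> SEQ" by (rule SEQ_I) (intro defr_q defq_0)
    have b0: "(\<lambda>n. eps (k + n + 1)) \<in> SEQ"
      by (rule SEQ_I) (rule defr_q defq_eps defn_add defn_const defn_nv | (simp; fail))+
    have s0: "(\<lambda>n. eps k - eps (k + n)) \<in> SEQ"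
      by (rule SEQ_I) (rule defr_q defq_diff defq_eps defn_add defn_const defn_nv | (simp; fail))+
    from a0 b0 s0 obtain a b s where
      a: "a \<in> carr M (T0 \<rightarrow> T1)" "\<forall>n. isreal (ap M a (nd n)) \<and> rv (ap M a (nd n)) = 0" and
      b: "b \<in> carr M (T0 \<rightarrow> T1)" "\<forall>n. isreal (ap M b (nd n)) \<and> rv (ap M b (nd n)) = eps (k + n + 1)" and
      s: "s \<in> carr M (T0 \<rightarrow> T1)" "\<forall>n. isreal (ap M s (nd n)) \<and> rv (ap M s (nd n)) = eps k - eps (k + n)"
      unfolding SEQ_def by blast
    obtain r where r: "isreal r" "rv r = eps k" using RM_eps [of k] by (auto simp: RM_def)
    have step: "\<exists>l. isreal l \<and> rv (ap M a (nd n)) + rv l = rv (ap M b (nd n)) \<and> rv (ap M s (nd n)) + rv l = rv (ap M s (nd (n + 1)))" for n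
    proof -
      have "eps (k + n) = eps (k + n + 1) + eps (k + n + 1)" unfolding eps_Suc by simp
      then show ?thesis
        using a(2) b(2) s(2) by (intro exI [of _ "ap M b (nd n)"]) (simp add: add.assoc)
    qed
    have bound: "\<exists>r. isreal r \<and> rv r < rv u \<and> (\<forall>n. rv (ap M s (nd n)) \<le> rv r)"
      using r k s(2) by (intro exI [of _ r]) (simp add: less_imp_le)
    have ab: "\<forall>n. isreal (ap M a (nd n)) \<and> isreal (ap M b (nd n)) \<and> rv (ap M a (nd n)) < rv (ap M b (nd n))"
      using a(2) b(2) by simp
    have s1: "\<forall>n. isreal (ap M s (nd n))" "rv (ap M s (nd 0)) = 0" using s(2) by simp_all
    show ?thesis
      by (rule bexI [OF _ a(1)], rule bexI [OF _ b(1)], rule conjI [OF ab], rule bexI [OF _ s(1)])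
        (intro conjI s1 allI step bound)
  qed
  then show ?thesis
    using d A rq_special(1) by (simp add: measure_zero_def nd_1 nd_0 nd_add del: nm_zer_one cong: bounded_cong)
qed

end

section \<open>The category theorem in a model and points of continuity\<close>

context nmodel
begin

lemma ex_RP_eps: "(\<exists>d\<in>RP. \<forall>w\<in>UI. Q w \<and> \<bar>v - w\<bar> < d \<longrightarrow> P w) \<longleftrightarrow> (\<exists>k. \<forall>w\<in>UI. Q w \<and> \<bar>v - w\<bar> < eps k \<longrightarrow> P w)"
proof
  assume "\<exists>d\<in>RP. \<forall>w\<in>UI. Q w \<and> \<bar>v - w\<bar> < d \<longrightarrow> P w"
  then obtain d where d: "d \<in> RP" "\<forall>w\<in>UI. Q w \<and> \<bar>v - w\<bar> < d \<longrightarrow> P w" by blast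
  obtain k where "eps k < d" using RP_eps_ex [OF d(1)] by blast
  with d(2) show "\<exists>k. \<forall>w\<in>UI. Q w \<and> \<bar>v - w\<bar> < eps k \<longrightarrow> P w" by (meson order.strict_trans)
next
  assume "\<exists>k. \<forall>w\<in>UI. Q w \<and> \<bar>v - w\<bar> < eps k \<longrightarrow> P w"
  then obtain k where "\<forall>w\<in>UI. Q w \<and> \<bar>v - w\<bar> < eps k \<longrightarrow> P w" by blast
  then show "\<exists>d\<in>RP. \<forall>w\<in>UI. Q w \<and> \<bar>v - w\<bar> < d \<longrightarrow> P w" by (rule bexI [OF _ RP_eps])
qed

lemmas ex_RP_eps' = ex_RP_eps [where Q = "\<lambda>w. True", simplified]

lemma RP_I: "v \<in> RM \<Longrightarrow> 0 < v \<Longrightarrow> v \<in> RP" by (simp add: RP_def)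
lemma RP_D: "v \<in> RP \<Longrightarrow> v \<in> RM \<and> 0 < v" by (simp add: RP_def)
lemma UI_I: "v \<in> RM \<Longrightarrow> 0 \<le> v \<Longrightarrow> v \<le> 1 \<Longrightarrow> v \<in> UI" by (simp add: UI_iff)
lemma UI_RM [simp]: "v \<in> UI \<Longrightarrow> v \<in> RM" and UI_nonneg [simp]: "v \<in> UI \<Longrightarrow> 0 \<le> v" and UI_le_1 [simp]: "v \<in> UI \<Longrightarrow> v \<le> 1"
  by (simp_all add: UI_iff)
lemma eps_min: assumes "0 < a" "0 < b" shows "\<exists>n. eps n < a \<and> eps n < b"
  using eps_small [of "min a b"] assms by simp
lemma emb_above: "\<exists>n. v < emb n"
proof (cases "0 < v")
  case True
  then have "0 < inverse v" by simp
  from emb_archimedean [OF this] obtain n where "1 < inverse v * emb n" by blast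
  then have "v < emb n" using True by (simp add: field_simps)
  then show ?thesis ..
next
  case False
  then have "v < emb 1" by simp
  then show ?thesis ..
qed

lemma sat_dense_set [simp]:
  assumes "length e = d" "stab M e E" "stab M e n" "vl M e E \<in> carr M (T1 \<rightarrow> T0 \<rightarrow> T0)" "vl M e n \<in> N"
    "isset (\<lambda>x. ap M (ap M (vl M e E) x) (vl M e n))"
  shows "sat M e (dense_set (section_set E n) d) \<longleftrightarrow> dns (sv (\<lambda>x. ap M (ap M (vl M e E) x) (vl M e n)))"
  using assms
  by (simp add: dense_set_def dns_def bex_UI_sv UI_def conj_commute cong: bounded_cong)

lemma sv_subset: "sv X \<subseteq> sv Y \<longleftrightarrow> (\<forall>x\<in>UC. rv x \<in> sv X \<longrightarrow> rv x \<in> sv Y)"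
  using sv_UI [of X] unfolding UI_def by blast

lemma sat_all_b_Nil: "sat M [] (all_b \<tau> A 0) \<longleftrightarrow> (\<forall>x\<in>carr M \<tau>. sat M [x] (A (vr 0) (Suc 0)))"
  by simp

definition fits :: "'a \<Rightarrow> bool" where
  "fits E \<longleftrightarrow> isseq E \<and> (\<forall>n. opn (Sec E n) \<and> dns (Sec E n) \<and> Sec E (n + 1) \<subseteq> Sec E n)"

lemma sat_BCT_for:
  "sat M [] (BCT_for H) \<longleftrightarrow> (\<forall>E. fits E \<and> sat M [E] (H (vr 0) (Suc 0)) \<longrightarrow> (\<exists>v\<in>UI. \<forall>n. v \<in> Sec E n))"
proof -
  have "sat M [] (BCT_for H) \<longleftrightarrow>
    (\<forall>E\<in>carr M (T1 \<rightarrow> T0 \<rightarrow> T0). fits E \<and> sat M [E] (H (vr 0) (Suc 0)) \<longrightarrow> (\<exists>v\<in>UI. \<forall>n. v \<in> Sec E n))"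
    unfolding BCT_for_def sat_all_b_Nil
  proof (rule ball_cong [OF refl], goal_cases)
    case (1 E)
    show ?case
    proof (cases "\<forall>n. isset (\<lambda>x. ap M (ap M E x) (nd n))")
      case True
      then show ?thesis using 1 by (simp add: fits_def UI_def sv_subset nd_1 nd_add del: nm_zer_one cong: bounded_cong)
    next
      case False
      then obtain n where n: "\<not> isset (\<lambda>x. ap M (ap M E x) (nd n))" by blast
      have "\<not> sat M (nd n # [E]) (is_open (section_set (vr 0) (vr (Suc 0))) (Suc (Suc 0)))"
        using 1 n by simp
      then show ?thesis using n by (auto simp: fits_def)
    qed
  qed
  then show ?thesis by (auto simp: fits_def)
qed

definition bct :: bool where "bct \<longleftrightarrow> (\<forall>E. fits E \<longrightarrow> (\<exists>v\<in>UI. \<forall>n. v \<in> Sec E n))"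

lemma sat_BCT: "sat M [] BCT \<longleftrightarrow> bct"
  unfolding BCT_def sat_BCT_for bct_def by simp

text \<open>A counterexample to the category theorem has an empty intersection, which has measure
  zero, so it is a counterexample to the restricted statement as well.\<close>

lemma sat_BCT_null: "sat M [] BCT_null \<longleftrightarrow> bct"
proof
  assume n: "sat M [] BCT_null"
  show bct
    unfolding bct_def
  proof (intro allI impI, rule ccontr)
    fix E assume E: "fits E" and no: "\<not> (\<exists>v\<in>UI. \<forall>n. v \<in> Sec E n)"
    have "sat M [E] (measure_zero (\<lambda>x. \<^bold>\<forall>\<^sub>N n. mem x (section_set (vr 0) n)) (Suc 0))"
    proof (rule sat_measure_zero_empty)
      show "\<not> sat M (x # b # a # u # [E])
         ((\<^bold>\<forall>\<^sub>N n. mem (vr (Suc (Suc (Suc (Suc 0))))) (section_set (vr 0) n)) (Suc (Suc (Suc (Suc (Suc 0))))))" if "x \<in> UC" for x b a u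
        using E no that by (simp add: fits_def UI_def)
    qed simp
    with n E no show False unfolding BCT_null_def sat_BCT_for by blast
  qed
next
  assume bct
  then show "sat M [] BCT_null" unfolding BCT_null_def sat_BCT_for bct_def by blast
qed

text \<open>The set of continuity points is empty and therefore of measure zero.\<close>

lemma sat_usc_C_null:
  assumes f: "isfun f" and u: "\<forall>v\<in>UI. uscont (fv f) v" and c: "\<forall>v\<in>UI. \<not> cont (fv f) v"
  shows "sat M [f] (usc_C_null (vr 0) (Suc 0))"
proof -
  have "sat M [f] (measure_zero (cont_at (vr 0)) (Suc 0))"
  proof (rule sat_measure_zero_empty)
    show "\<not> sat M (x # b # a # w # [f]) (cont_at (vr 0) (vr (Suc (Suc (Suc (Suc 0))))) (Suc (Suc (Suc (Suc (Suc 0))))))"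
      if "x \<in> UC" for x b a w
      using f c that by (simp add: UI_def)
  qed simp
  then show ?thesis using f u by (simp add: usc_C_null_def)
qed
lemma sat_usc_C_null_D: "isfun f \<Longrightarrow> sat M [f] (usc_C_null (vr 0) (Suc 0)) \<Longrightarrow> \<forall>v\<in>UI. uscont (fv f) v"
  by (simp add: usc_C_null_def)

lemma defp_rle: "defr \<sigma>s u \<Longrightarrow> defr \<sigma>s v \<Longrightarrow> defp \<sigma>s (\<lambda>e. u e \<le> v e)"
  using defp_not [OF defp_rless [of \<sigma>s v u]] by (simp add: not_less)
lemma defr_RM: assumes "defr \<sigma>s u" "typed_env e \<sigma>s" shows "u e \<in> RM"
proof -
  obtain c where "\<forall>e. typed_env e \<sigma>s \<longrightarrow> isreal (c e) \<and> rv (c e) = u e" using defr_code [OF assms(1)] by blast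
  with assms(2) have "isreal (c e)" "u e = rv (c e)" by auto
  then show ?thesis unfolding RM_def by blast
qed
text \<open>Quantified variables and rational codes may denote reals outside the unit interval; this
  retraction, constantly 0 outside, keeps the arguments of functions legal in definitions.\<close>

definition cl :: "'n rl \<Rightarrow> 'n rl" where "cl v = (if 0 \<le> v \<and> v \<le> 1 then v else 0)"
lemma cl_UI [simp]: "v \<in> RM \<Longrightarrow> cl v \<in> UI"
  unfolding cl_def by (cases "0 \<le> v \<and> v \<le> 1") (auto intro: UI_I)
lemma cl_id [simp]: "v \<in> UI \<Longrightarrow> cl v = v"
  by (simp add: cl_def)
lemma defr_cl: "defr \<sigma>s u \<Longrightarrow> defr \<sigma>s (\<lambda>e. cl (u e))"
  unfolding cl_def by (intro defr_if defp_and defp_rle defr_q [OF defq_0] defr_q [OF defq_1])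
lemma defr_fcl: "isfun f \<Longrightarrow> defr \<sigma>s u \<Longrightarrow> defr \<sigma>s (\<lambda>e. fv f (cl (u e)))"
  by (rule defr_fv) (auto intro!: defr_cl cl_UI intro: defr_RM)

lemmas rl_intros = defp_and defp_or defp_not defp_imp defp_iff defp_all defp_ex defp_less defp_le defp_eq defp_rless defp_rle
  defr_add defr_uminus defr_diff defr_abs defr_cl defr_q [OF defq_rq] defr_q [OF defq_emb] defr_q [OF defq_eps] defr_q [OF defq_0]
  defr_q [OF defq_1] defr_q [OF defq_num] defr_q [OF defq_mult] defq_emb defq_eps defq_rq defq_num defr_rv deft_xv
  defn_nv defn_add defn_mult defn_sub defn_pw defn_const defp_const

lemma defq_code: "defq_rat [] (\<lambda>e. w) \<Longrightarrow> \<exists>q. rq q = w"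
proof (erule defq_ratE)
  fix a b c :: "'a list \<Rightarrow> 'n" assume "\<And>e. typed_env e [] \<Longrightarrow> w = rat (a e) (b e) (c e)"
  then have "w = rat (a []) (b []) (c [])" by simp
  then show "\<exists>q. rq q = w" using rat_rq by metis
qed

text \<open>The rational is sought to the left of a positive \<open>y\<close>, and to the right if
  \<open>y\<close> is 0, so that it stays in the unit interval.\<close>

lemma rational_near:
  assumes y: "y \<in> UI" "a < y" "y < b" shows "\<exists>r. a < rq r \<and> rq r < b \<and> rq r \<in> UI"
proof (cases "0 < y")
  case True
  then have "max a 0 < y" using y by simp
  from rq_dense [OF this] obtain r where "max a 0 < rq r" "rq r < y" by blast
  moreover have "rq r \<le> 1" using \<open>rq r < y\<close> UI_le_1 [OF y(1)] by linarith
  ultimately have "a < rq r \<and> rq r < b \<and> rq r \<in> UI" using y by (intro conjI UI_I) simp_all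
  then show ?thesis ..
next
  case False
  then have "0 < min b 1" "a < 0" using y UI_nonneg [OF y(1)] by auto
  from rq_dense [OF this(1)] obtain r where "0 < rq r" "rq r < min b 1" by blast
  then have "a < rq r \<and> rq r < b \<and> rq r \<in> UI" using \<open>a < 0\<close> by (intro conjI UI_I) simp_all
  then show ?thesis ..
qed

text \<open>If \<open>fv F y\<close> were below \<open>q\<close>, upper semi-continuity would push
  the values below \<open>q\<close> on a whole neighbourhood, including some rational. Thus bounds
  checked on rationals are bounds on all reals.\<close>

lemma uscont_lower_bound:
  assumes f: "isfun F" and u: "uscont (fv F) y" and y: "y \<in> UI" "a < y" "y < b"
    and q: "q \<in> RM" "\<And>r. a < rq r \<Longrightarrow> rq r < b \<Longrightarrow> rq r \<in> UI \<Longrightarrow> q \<le> fv F (rq r)"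
  shows "q \<le> fv F y"
proof (rule ccontr)
  assume "\<not> q \<le> fv F y"
  then have "q - fv F y \<in> RP" using f y(1) q(1) by (intro RP_I) (simp_all add: fv_RM)
  with u obtain k where k: "\<forall>w\<in>UI. \<bar>y - w\<bar> < eps k \<longrightarrow> fv F w < fv F y + (q - fv F y)"
    unfolding uscont_def ex_RP_eps' by blast
  have "max a (y - eps k) < y" "y < min b (y + eps k)" using y by simp_all
  from rational_near [OF y(1) this] obtain r where
    r: "max a (y - eps k) < rq r" "rq r < min b (y + eps k)" "rq r \<in> UI" by blast
  have "\<bar>y - rq r\<bar> < eps k" using r by (auto simp: abs_less_iff)
  then have "fv F (rq r) < q" using k r(3) by simp
  moreover have "q \<le> fv F (rq r)" using r by (intro q(2)) simp_all
  ultimately show False by simp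
qed

text \<open>The sets \<open>{x. f x < - n \<or> (\<exists>a b q. a < x < b \<and> f \<ge> q on the rationals of (a, b) \<and> f x < q + eps n)}\<close> are
  open and dense, and their intersection consists of continuity points. Only rationals are quantified,
  so that these sets exist in the model.\<close>

lemma bct_cont:
  assumes bct: bct and F: "isfun F" and u: "\<forall>v\<in>UI. uscont (fv F) v"
  shows "\<exists>v\<in>UI. cont (fv F) v"
proof -
  let ?f = "fv F"
  define L where "L a b q \<longleftrightarrow> (\<forall>r. rq a < rq r \<and> rq r < rq b \<and> 0 \<le> rq r \<and> rq r \<le> 1 \<longrightarrow> q \<le> ?f (cl (rq r)))" for a b q
  \<comment> \<open>\<open>L\<close> is spelled out with a rational bound and all arguments go
    through \<open>cl\<close>, so that the rules for definability apply to the body.\<close>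
  define S where "S n x \<longleftrightarrow> ?f (cl x) < - emb n \<or>
    (\<exists>a b q. rq a < x \<and> x < rq b \<and> (\<forall>r. rq a < rq r \<and> rq r < rq b \<and> 0 \<le> rq r \<and> rq r \<le> 1 \<longrightarrow> rq q \<le> ?f (cl (rq r))) \<and>
      ?f (cl x) < rq q + eps n)" for n x
  have S: "S n x \<longleftrightarrow> ?f x < - emb n \<or> (\<exists>a b q. rq a < x \<and> x < rq b \<and> L a b (rq q) \<and> ?f x < rq q + eps n)" if "x \<in> UI" for n x
    using that by (simp add: S_def L_def)
  have L: "q \<le> ?f (rq r)" if "L a b q" "rq a < rq r" "rq r < rq b" "rq r \<in> UI" for a b q r
    using that unfolding L_def UI_iff by (metis cl_id UI_iff)
  have low: "q \<le> ?f y" if "L a b q" "q \<in> RM" "y \<in> UI" "rq a < y" "y < rq b" for a b q y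
    by (rule uscont_lower_bound [OF F _ that(3-5) that(2)]) (use u that L in blast)+
  have "defp [T0, T1] (\<lambda>e. S (nv 0 e) (rv (xv 1 e)))"
    unfolding S_def by (rule rl_intros defr_fcl [OF F] | simp only: v_tl | (simp; fail))+
  then obtain E where E: "E \<in> carr M (T1 \<rightarrow> T0 \<rightarrow> T0)" "\<And>n. isset (\<lambda>x. ap M (ap M E x) (nd n))" "\<And>n. Sec E n = {v \<in> UI. S n v}"
    using sets_ex [of S] by blast
  have usc: "\<exists>k. \<forall>w\<in>UI. \<bar>v - w\<bar> < eps k \<longrightarrow> ?f w < c" if "v \<in> UI" "?f v < c" "c \<in> RM" for v c
  proof -
    have "c - ?f v \<in> RP" using that F by (intro RP_I) (simp_all add: fv_RM)
    then have "\<exists>k. \<forall>w\<in>UI. \<bar>v - w\<bar> < eps k \<longrightarrow> ?f w < ?f v + (c - ?f v)"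
      using u that(1) unfolding uscont_def ex_RP_eps' by blast
    then show ?thesis by simp
  qed
  have opn: "opn (Sec E n)" for n
    unfolding opn_def
  proof
    fix v assume "v \<in> Sec E n"
    then have v: "v \<in> UI" "S n v" using E(3) by auto
    from v(2) consider "?f v < - emb n" | a b q where "rq a < v" "v < rq b" "L a b (rq q)" "?f v < rq q + eps n"
      unfolding S [OF v(1)] by blast
    then show "\<exists>k. \<forall>w\<in>UI. \<bar>v - w\<bar> < eps k \<longrightarrow> w \<in> Sec E n"
    proof cases
      case 1
      from usc [OF v(1) this] obtain k where "\<forall>w\<in>UI. \<bar>v - w\<bar> < eps k \<longrightarrow> ?f w < - emb n" by auto
      then show ?thesis using S E(3) by blast
    next
      case 2
      from usc [OF v(1) 2(4)] obtain k where k: "\<forall>w\<in>UI. \<bar>v - w\<bar> < eps k \<longrightarrow> ?f w < rq q + eps n" by auto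
      obtain j where j: "eps j < v - rq a" "eps j < rq b - v" using eps_min [of "v - rq a" "rq b - v"] 2 by auto
      obtain i where i: "eps i < eps j" "eps i < eps k" using eps_min [of "eps j" "eps k"] by auto
      have "w \<in> Sec E n" if "w \<in> UI" "\<bar>v - w\<bar> < eps i" for w
      proof -
        have "\<bar>v - w\<bar> < eps k" using that(2) i(2) by linarith
        moreover have "rq a < w" "w < rq b" using that(2) i(1) j by linarith+
        ultimately have "S n w" using k that(1) 2(3) unfolding S [OF that(1)] by blast
        then show ?thesis using E(3) that(1) by blast
      qed
      then show ?thesis by blast
    qed
  qed
  have dec: "Sec E (n + 1) \<subseteq> Sec E n" for n
  proof
    fix v assume "v \<in> Sec E (n + 1)"
    then have v: "v \<in> UI" "S (n + 1) v" using E(3) by auto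
    have "eps (n + 1) \<le> eps n" by (rule eps_mono) simp
    then have "S n v" using v(2) unfolding S [OF v(1)] by (force intro: order.strict_trans2)
    then show "v \<in> Sec E n" using v(1) E(3) by blast
  qed
  have dns: "dns (Sec E n)" for n
    unfolding dns_def
  proof (intro ballI allI, rule ccontr)
    fix v k assume v: "v \<in> UI" and none: "\<not> (\<exists>w\<in>Sec E n. \<bar>v - w\<bar> < eps k)"
    obtain B where B: "?f v < emb B" using emb_above by blast
    from usc [OF v B] obtain k1 where k1: "\<forall>w\<in>UI. \<bar>v - w\<bar> < eps k1 \<longrightarrow> ?f w < emb B" by auto
    obtain d where d: "eps d < eps k" "eps d < eps k1" using eps_min [of "eps k" "eps k1"] by auto
    obtain a0 where a0: "v - eps d < rq a0" "rq a0 < v" using rq_dense [of "v - eps d" v] by auto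
    obtain b0 where b0: "v < rq b0" "rq b0 < v + eps d" using rq_dense [of v "v + eps d"] by auto
    have near: "?f w < emb B" "\<not> S n w" if "w \<in> UI" "rq a0 < w" "w < rq b0" for w
    proof -
      have "\<bar>v - w\<bar> < eps d" using that a0 b0 by linarith
      then have "\<bar>v - w\<bar> < eps k1" "\<bar>v - w\<bar> < eps k" using d by linarith+
      then show "?f w < emb B" "\<not> S n w" using k1 none that(1) E(3) by blast+
    qed
    \<comment> \<open>On the assumed interval no point lies in the set with index \<open>n\<close>.
      Hence a lower bound q for the values at rationals improves at once to q + eps n. Starting from
      - n, the bound is raised in steps until it contradicts the local upper bound
      \<open>emb B\<close>.\<close>
    define Q where "Q j \<longleftrightarrow> (\<exists>a b. rq a0 \<le> rq a \<and> rq b \<le> rq b0 \<and> rq a < rq b \<and> rq a < 1 \<and> 0 < rq b \<and>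
      (\<forall>r. rq a < rq r \<and> rq r < rq b \<and> 0 \<le> rq r \<and> rq r \<le> 1 \<longrightarrow> - emb n + emb j * eps (n + 1) \<le> ?f (cl (rq r))))" for j
    have Q_iff: "Q j \<longleftrightarrow> (\<exists>a b. rq a0 \<le> rq a \<and> rq b \<le> rq b0 \<and> rq a < rq b \<and> rq a < 1 \<and> 0 < rq b \<and> L a b (- emb n + emb j * eps (n + 1)))" for j
      by (simp add: Q_def L_def)
    have "Q j" for j
    proof (rule induction [where P = Q])
      show "defp [T0] (\<lambda>e. Q (nv 0 e))"
        unfolding Q_def by (rule rl_intros defr_fcl [OF F] | simp only: v_tl | (simp; fail))+
      have "- emb n \<le> ?f (cl (rq r))" if "rq a0 < rq r" "rq r < rq b0" "0 \<le> rq r" "rq r \<le> 1" for r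
      proof -
        have r: "rq r \<in> UI" using that by (intro UI_I) simp_all
        have "\<not> S n (rq r)" by (rule near(2) [OF r that(1,2)])
        then show ?thesis unfolding S [OF r] using r by (simp add: not_less)
      qed
      then have "L a0 b0 (- emb n + emb 0 * eps (n + 1))" by (simp add: L_def)
      moreover have "rq a0 < 1" "0 < rq b0" "rq a0 < rq b0"
        using a0(2) b0(1) UI_le_1 [OF v] UI_nonneg [OF v] by linarith+
      ultimately show "Q 0" unfolding Q_iff by blast
    next
      fix j assume "Q j"
      then obtain a b where ab: "rq a0 \<le> rq a" "rq b \<le> rq b0" "rq a < rq b" "rq a < 1" "0 < rq b"
        "L a b (- emb n + emb j * eps (n + 1))" unfolding Q_iff by blast
      obtain q where q: "rq q = - emb n + emb j * eps (n + 1)"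
        using defq_code [OF defq_add [OF defq_uminus [OF defq_emb [OF defn_const]] defq_mult [OF defq_emb [OF defn_const] defq_eps [OF defn_const]]]]
        by blast
      have "- emb n + emb (j + 1) * eps (n + 1) \<le> ?f (cl (rq r))" if "rq a < rq r" "rq r < rq b" "0 \<le> rq r" "rq r \<le> 1" for r
      proof (rule ccontr)
        assume "\<not> ?thesis"
        moreover have r: "rq r \<in> UI" using that by (intro UI_I) simp_all
        moreover have "eps (n + 1) \<le> eps n" by (rule eps_mono) simp
        ultimately have "?f (rq r) < rq q + eps n" by (simp add: q distrib_right)
        then have "S n (rq r)" unfolding S [OF r] using that ab(6) q by metis
        moreover have "rq a0 < rq r" "rq r < rq b0" using that ab by linarith+
        ultimately show False using near(2) [OF r] by blast
      qed
      then have "L a b (- emb n + emb (j + 1) * eps (n + 1))" by (simp add: L_def)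
      then show "Q (j + 1)" unfolding Q_iff using ab by blast
    qed
    \<comment> \<open>With this number of steps of size \<open>eps (n + 1)\<close> the bound has
      climbed from \<open>- emb n\<close> to \<open>emb B\<close>.\<close>
    then obtain a b where ab: "rq a0 \<le> rq a" "rq b \<le> rq b0" "rq a < rq b" "rq a < 1" "0 < rq b"
        "L a b (- emb n + emb ((B + n) * pw (n + 1)) * eps (n + 1))" unfolding Q_iff by blast
    have "max (rq a) 0 < min (rq b) 1" using ab by simp
    from rq_dense [OF this] obtain r where r: "max (rq a) 0 < rq r" "rq r < min (rq b) 1" by blast
    then have rU: "rq r \<in> UI" by (intro UI_I) simp_all
    have "emb (pw (n + 1)) \<noteq> 0" using emb_pw_pos [of "n + 1"] by (rule less_imp_neq [THEN not_sym])
    then have e: "emb ((B + n) * pw (n + 1)) * eps (n + 1) = emb B + emb n" by (simp add: eps_def)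
    have "- emb n + emb ((B + n) * pw (n + 1)) * eps (n + 1) \<le> ?f (rq r)"
      by (rule L [OF ab(6) _ _ rU]) (use r in simp_all)
    then have "emb B \<le> ?f (rq r)" unfolding e by simp
    moreover have "?f (rq r) < emb B" by (rule near(1) [OF rU]) (use r ab in simp_all)
    ultimately show False by simp
  qed
  have "fits E" unfolding fits_def using E opn dns dec by blast
  then obtain v where v: "v \<in> UI" "\<And>n. v \<in> Sec E n" using bct unfolding bct_def by blast
  have Sv: "S n v" for n using v(2) [of n] E(3) by blast
  have "cont ?f v"
    unfolding cont_def ex_RP_eps'
  proof
    fix e assume e: "e \<in> RP"
    \<comment> \<open>\<open>n1\<close> excludes the alternative of a very negative value and
      \<open>n2\<close> makes the error smaller than \<open>e\<close>; the index
      \<open>n1 + n2\<close> achieves both.\<close>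
    obtain n1 where n1: "- ?f v < emb n1" using emb_above by blast
    obtain n2 where n2: "eps n2 < e" using RP_eps_ex [OF e] by blast
    have "?f v \<ge> - emb (n1 + n2)" using n1 emb_nonneg [of n2] unfolding emb_hom by linarith
    then obtain a b q where ab: "rq a < v" "v < rq b" "L a b (rq q)" "?f v < rq q + eps (n1 + n2)"
      using Sv [of "n1 + n2"] unfolding S [OF v(1)] by auto
    have "eps (n1 + n2) \<le> eps n2" by (rule eps_mono) simp
    then have lo: "?f v < rq q + e" using ab(4) n2 by linarith
    have "?f v + e \<in> RM" using fv_RM [OF F v(1)] RP_D [OF e] by simp
    from usc [OF v(1) _ this] obtain k where k: "\<forall>w\<in>UI. \<bar>v - w\<bar> < eps k \<longrightarrow> ?f w < ?f v + e" using RP_D [OF e] by auto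
    obtain j where j: "eps j < v - rq a" "eps j < rq b - v" using eps_min [of "v - rq a" "rq b - v"] ab by auto
    obtain i where i: "eps i < eps j" "eps i < eps k" using eps_min [of "eps j" "eps k"] by auto
    have "\<bar>?f v - ?f w\<bar> < e" if "w \<in> UI" "\<bar>v - w\<bar> < eps i" for w
    proof -
      have "\<bar>v - w\<bar> < eps k" using that(2) i(2) by linarith
      then have "?f w < ?f v + e" using k that(1) by blast
      moreover have "rq a < w" "w < rq b" using that(2) i(1) j by linarith+
      then have "rq q \<le> ?f w" using low [OF ab(3) RM_rq that(1)] by blast
      ultimately show ?thesis using lo by linarith
    qed
    then show "\<exists>k. \<forall>w\<in>UI. \<bar>v - w\<bar> < eps k \<longrightarrow> \<bar>?f v - ?f w\<bar> < e" by blast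
  qed
  with v(1) show ?thesis by blast
qed

end

section \<open>Functions without points of continuity\<close>

context nmodel
begin

lemma cont_lscont: "cont f v \<Longrightarrow> lscont f v"
  unfolding cont_def lscont_def abs_less_iff by (auto simp: less_diff_eq add.commute) (metis add.commute diff_less_eq)

lemma OP_D: "G \<in> OP \<Longrightarrow> G \<subseteq> UI \<and> opn G"
  using sv_UI unfolding OP_def by blast

lemma OP_I: assumes "defp [T1] (\<lambda>e. S (rv (xv 0 e)))" "opn {v \<in> UI. S v}" shows "{v \<in> UI. S v} \<in> OP"
proof -
  obtain X where "X \<in> carr M (T1 \<rightarrow> T0)" "isset (ap M X)" "sv (ap M X) = {v \<in> UI. S v}"
    using set_ex [OF assms(1)] by blast
  with assms(2) show ?thesis unfolding OP_def by (intro CollectI bexI [of _ X]) simp_all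
qed

lemma UI_OP: "UI \<in> OP"
  using OP_I [of "\<lambda>v. True"] by (simp add: defp_const opn_def)

text \<open>Supplies the open sets \<open>G\<close> for quasi-continuity, which have to exist as
  sets of the model.\<close>

lemma ball_in_OP: assumes v: "v \<in> UI" shows "{w \<in> UI. \<bar>v - w\<bar> < eps k} \<in> OP"
proof (rule OP_I)
  show "defp [T1] (\<lambda>e. \<bar>v - rv (xv 0 e)\<bar> < eps k)"
    by (rule rl_intros defr_const [OF UI_RM [OF v]] | (simp; fail))+
  show "opn {w \<in> UI. \<bar>v - w\<bar> < eps k}"
    unfolding opn_def
  proof
    fix w assume "w \<in> {w \<in> UI. \<bar>v - w\<bar> < eps k}"
    then have "0 < eps k - \<bar>v - w\<bar>" by simp
    from eps_small [OF this] obtain j where "eps j < eps k - \<bar>v - w\<bar>" by blast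
    then have "\<bar>v - x\<bar> < eps k" if "\<bar>w - x\<bar> < eps j" for x using that by linarith
    then show "\<exists>j. \<forall>x\<in>UI. \<bar>w - x\<bar> < eps j \<longrightarrow> x \<in> {w \<in> UI. \<bar>v - w\<bar> < eps k}" by blast
  qed
qed

lemma cont_quasi: assumes c: "cont f v" and v: "v \<in> UI" shows "quasi f v"
  unfolding quasi_def
proof (intro ballI impI)
  fix e U assume e: "e \<in> RP" and U: "U \<in> OP" "v \<in> U"
  obtain k where k: "\<forall>w\<in>UI. \<bar>v - w\<bar> < eps k \<longrightarrow> \<bar>f v - f w\<bar> < e" using c e unfolding cont_def ex_RP_eps' by blast
  obtain j where j: "\<forall>w\<in>UI. \<bar>v - w\<bar> < eps j \<longrightarrow> w \<in> U" using U OP_D [OF U(1)] unfolding opn_def by blast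
  have m: "eps (k + j) \<le> eps k" "eps (k + j) \<le> eps j" by (rule eps_mono, simp)+
  show "\<exists>G\<in>OP. (\<exists>w\<in>UI. w \<in> G) \<and> (\<forall>w\<in>UI. w \<in> G \<longrightarrow> w \<in> U) \<and> (\<forall>w\<in>UI. w \<in> G \<longrightarrow> \<bar>f v - f w\<bar> < e)"
  proof (rule bexI [OF _ ball_in_OP [OF v, of "k + j"]], intro conjI)
    show "\<exists>w\<in>UI. w \<in> {w \<in> UI. \<bar>v - w\<bar> < eps (k + j)}" using v by (intro bexI [OF _ v]) simp
  qed (use k j m in \<open>auto dest: order.strict_trans2\<close>)
qed

lemma quasi_lquasi: "quasi f v \<Longrightarrow> lquasi f v"
proof -
  have *: "\<bar>a - b\<bar> < e \<Longrightarrow> a < b + e" for a b e :: "'n rl" by linarith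
  show "quasi f v \<Longrightarrow> lquasi f v" unfolding quasi_def lquasi_def using * by meson
qed

lemma cont_limits: assumes "cont f v" shows "llim f v (f v)" "rlim f v (f v)"
proof -
  have c: "\<exists>d\<in>RP. \<forall>w\<in>UI. \<bar>v - w\<bar> < d \<longrightarrow> \<bar>f w - f v\<bar> < e" if "e \<in> RP" for e
    using assms that unfolding cont_def abs_minus_commute [of "f v"] by blast
  show "llim f v (f v)" "rlim f v (f v)" unfolding llim_def rlim_def using c by meson+
qed

lemma cont_cluster:
  assumes c: "cont f v" and s: "\<And>n. s n \<in> UI" "conv s v" "conv (\<lambda>n. f (s n)) y" shows "y = f v"
proof (rule ccontr)
  assume "y \<noteq> f v"
  then have "0 < \<bar>y - f v\<bar>" by simp
  from eps_small [OF this] obtain k where k: "eps k < \<bar>y - f v\<bar>" by blast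
  have "eps k = eps (k + 1) + eps (k + 1)" unfolding eps_Suc by simp
  moreover obtain j where j: "\<forall>w\<in>UI. \<bar>v - w\<bar> < eps j \<longrightarrow> \<bar>f v - f w\<bar> < eps (k + 1)"
    using c RP_eps [of "k + 1"] unfolding cont_def ex_RP_eps' by blast
  obtain m1 where m1: "\<forall>n. m1 \<le> n \<longrightarrow> \<bar>s n - v\<bar> < eps j" using s(2) RP_eps [of j] unfolding conv_def by blast
  obtain m2 where m2: "\<forall>n. m2 \<le> n \<longrightarrow> \<bar>f (s n) - y\<bar> < eps (k + 1)" using s(3) RP_eps [of "k + 1"] unfolding conv_def by blast
  have "\<bar>s (m1 + m2) - v\<bar> < eps j" "\<bar>f (s (m1 + m2)) - y\<bar> < eps (k + 1)" using m1 m2 by simp_all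
  moreover from this(1) have "\<bar>f v - f (s (m1 + m2))\<bar> < eps (k + 1)"
    using j s(1) by (simp add: abs_minus_commute [of v])
  ultimately show False using k by linarith
qed

text \<open>At a point of continuity every cluster value equals the value of the function, so
  nothing lies strictly between them.\<close>

lemma cont_darboux: assumes c: "cont f v" shows "darboux f v"
proof -
  have "y = f v" if "lcluster f v y \<or> rcluster f v y" for y
    using that cont_cluster [OF c] unfolding lcluster_def rcluster_def by blast
  then show ?thesis unfolding darboux_def between_def by (metis less_asym)
qed

end

section \<open>Counterexamples from dense open sets with empty intersection\<close>

locale cover = nmodel M nd for M :: "'a str" and nd :: "'n::arith_nat \<Rightarrow> 'a" +
  fixes E :: 'a
  assumes fits: "fits E"
    and empty: "v \<in> UI \<Longrightarrow> \<exists>n. v \<notin> Sec E n"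
    and accumulation: "v \<in> UI \<Longrightarrow> \<exists>m. \<forall>k. \<exists>w\<in>UI. w \<noteq> v \<and> \<bar>v - w\<bar> < eps k \<and> w \<notin> Sec E m"
begin

abbreviation "S \<equiv> Sec E"
definition nn :: "'n rl \<Rightarrow> 'n" where "nn v = lst (\<lambda>n. v \<notin> S n)"

lemma E: "E \<in> carr M (T1 \<rightarrow> T0 \<rightarrow> T0)" "isset (\<lambda>x. ap M (ap M E x) (nd n))"
  and S_opn: "opn (S n)" and S_dns: "dns (S n)" and S_dec: "S (n + 1) \<subseteq> S n"
  using fits unfolding fits_def by blast+

lemma defp_S: "defn \<sigma>s t \<Longrightarrow> defr \<sigma>s u \<Longrightarrow> defp \<sigma>s (\<lambda>e. cl (u e) \<in> S (t e))"
  by (rule defp_sv [OF E]) (auto intro!: defr_cl cl_UI intro: defr_RM)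
lemma defp_S_const: "v \<in> UI \<Longrightarrow> defn \<sigma>s t \<Longrightarrow> defp \<sigma>s (\<lambda>e. v \<in> S (t e))"
  using defp_S [OF _ defr_const, of \<sigma>s t v] by simp

lemma defn_nn: assumes u: "defr \<sigma>s u" shows "defn \<sigma>s (\<lambda>e. nn (cl (u e)))"
  unfolding nn_def by (rule defn_lst defp_not defp_S defn_nv defr_tl [OF u] | (simp; fail))+

text \<open>Only the inclusions of successive sets are given. That a point once outside remains
  outside requires induction in the model, which applies because membership is definable.\<close>

lemma S_iff: assumes v: "v \<in> UI" shows "v \<in> S m \<longleftrightarrow> m < nn v"
proof -
  have d: "defp [T0] (\<lambda>e. v \<notin> S (nv 0 e))" by (rule defp_not defp_S_const defn_nv v | (simp; fail))+
  obtain k where k: "v \<notin> S k" using empty [OF v] by blast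
  have n: "v \<notin> S (nn v)" unfolding nn_def by (rule lst(1) [OF d k])
  have "v \<notin> S (nn v + j)" for j
  proof (rule induction [where P = "\<lambda>j. v \<notin> S (nn v + j)"])
    show "defp [T0] (\<lambda>e. v \<notin> S (nn v + nv 0 e))"
      by (rule defp_not defp_S_const defn_add defn_const defn_nv v | (simp; fail))+
    show "v \<notin> S (nn v + 0)" using n by simp
    show "v \<notin> S (nn v + j) \<Longrightarrow> v \<notin> S (nn v + (j + 1))" for j
      using S_dec [of "nn v + j"] by (auto simp: add.assoc)
  qed
  from this [of "m - nn v"] have "v \<notin> S m" if "nn v \<le> m" using le_add_diff_inverse2 [OF that] by (simp add: add.commute)
  moreover have "v \<in> S m" if "m < nn v" using lst(2) [OF d k] that unfolding nn_def by blast
  ultimately show ?thesis by (meson not_less)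
qed

text \<open>Openness of the last set containing \<open>v\<close>; this is what makes
  \<open>eps (nn v)\<close> and \<open>- emb (nn v)\<close> upper semi-continuous.\<close>

lemma nn_locally_min: assumes v: "v \<in> UI" shows "\<exists>k. \<forall>w\<in>UI. \<bar>v - w\<bar> < eps k \<longrightarrow> nn v \<le> nn w"
proof (cases "0 < nn v")
  case True
  from arith_nat_pos [OF this] obtain m where m: "nn v = m + 1" by blast
  then have "v \<in> S m" unfolding S_iff [OF v] by (simp add: less_Suc)
  then obtain k where "\<forall>w\<in>UI. \<bar>v - w\<bar> < eps k \<longrightarrow> w \<in> S m" using S_opn [of m] unfolding opn_def by blast
  then have "\<forall>w\<in>UI. \<bar>v - w\<bar> < eps k \<longrightarrow> nn v \<le> nn w" using S_iff m Suc_le by metis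
  then show ?thesis ..
next
  case False
  then have "nn v = 0" using nonneg [of "nn v"] by (simp add: not_less)
  then show ?thesis by simp
qed

lemma nn_unbounded: assumes v: "v \<in> UI" shows "\<exists>w\<in>UI. \<bar>v - w\<bar> < eps k \<and> j < nn w"
proof -
  obtain w where w: "w \<in> S j" "\<bar>v - w\<bar> < eps k" using S_dns [of j] v unfolding dns_def by blast
  then have "w \<in> UI" using sv_UI by blast
  with w S_iff [OF this] show ?thesis by blast
qed

text \<open>Density gives a point of high rank near the midpoint, and openness passes the rank on to
  a rational close to it. Rational witnesses can be found by a search in the model.\<close>

lemma nn_unbounded_rational:
  assumes ab: "a \<in> UI" "b \<in> UI" "a < b"
  shows "\<exists>r. rq r \<in> UI \<and> a < rq r \<and> rq r < b \<and> j < nn (rq r)"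
proof -
  define c where "c = (a + b) / 2"
  have c: "a < c" "c < b" using ab(3) by (simp_all add: c_def field_simps)
  have cU: "c \<in> UI"
  proof (rule UI_I)
    show "c \<in> RM" unfolding c_def using ab by simp
    show "0 \<le> c" "c \<le> 1" using c UI_nonneg [OF ab(1)] UI_le_1 [OF ab(2)] by linarith+
  qed
  obtain k where k: "eps k < c - a" "eps k < b - c" using eps_min [of "c - a" "b - c"] c by auto
  obtain w where w: "w \<in> UI" "\<bar>c - w\<bar> < eps k" "j < nn w" using nn_unbounded [OF cU] by blast
  then have "w \<in> S j" using S_iff by blast
  then obtain i where i: "\<forall>x\<in>UI. \<bar>w - x\<bar> < eps i \<longrightarrow> x \<in> S j" using S_opn [of j] unfolding opn_def by blast
  have "a < w" "w < b" using w(2) k by linarith+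
  then have "max a (w - eps i) < w" "w < min b (w + eps i)" by simp_all
  from rational_near [OF w(1) this] obtain r where
    r: "max a (w - eps i) < rq r" "rq r < min b (w + eps i)" "rq r \<in> UI" by blast
  then have "\<bar>w - rq r\<bar> < eps i" by (simp add: abs_less_iff)
  then have "rq r \<in> S j" using i r(3) by blast
  with r S_iff [OF r(3)] show ?thesis by (intro exI [of _ r]) simp
qed

lemma f_ex: "\<exists>F. isfun F \<and> (\<forall>v\<in>UI. fv F v = eps (nn v))"
  and g_ex: "\<exists>G. isfun G \<and> (\<forall>v\<in>UI. fv G v = - emb (nn v))"
proof -
  have x: "defr [T1] (\<lambda>e. rv (xv 0 e))" by (rule rl_intros | (simp; fail))+
  have "defr [T1] (\<lambda>e. eps (nn (cl (rv (xv 0 e)))))" by (intro defr_q defq_eps defn_nn x)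
  from fun_ex [of "\<lambda>v. eps (nn (cl v))", OF this] show "\<exists>F. isfun F \<and> (\<forall>v\<in>UI. fv F v = eps (nn v))" by simp
  have "defr [T1] (\<lambda>e. - emb (nn (cl (rv (xv 0 e)))))" by (intro defr_q defq_uminus defq_emb defn_nn x)
  from fun_ex [of "\<lambda>v. - emb (nn (cl v))", OF this] show "\<exists>G. isfun G \<and> (\<forall>v\<in>UI. fv G v = - emb (nn v))" by simp
qed

context
  fixes f assumes f: "\<And>v. v \<in> UI \<Longrightarrow> f v = eps (nn v)"
begin

lemma f_uscont: assumes v: "v \<in> UI" shows "uscont f v"
  unfolding uscont_def ex_RP_eps'
proof
  fix e assume "e \<in> RP"
  then have e: "0 < e" using RP_D by blast
  obtain k where k: "\<forall>w\<in>UI. \<bar>v - w\<bar> < eps k \<longrightarrow> nn v \<le> nn w" using nn_locally_min [OF v] by blast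
  have "f w < f v + e" if "w \<in> UI" "\<bar>v - w\<bar> < eps k" for w
    using eps_mono [of "nn v" "nn w"] k that e unfolding f [OF v] f [OF that(1)] by fastforce
  then show "\<exists>k. \<forall>w\<in>UI. \<bar>v - w\<bar> < eps k \<longrightarrow> f w < f v + e" by blast
qed

text \<open>Near \<open>v\<close> the supremum is attained at \<open>v\<close> itself, while ranks
  are unbounded, so the infimum is 0. The oscillation is therefore \<open>f v\<close>.\<close>

lemma f_osc: "osc f f"
  unfolding osc_def
proof (intro ballI)
  fix v e assume v: "v \<in> UI" and "e \<in> RP"
  then have e: "0 < e" using RP_D by blast
  obtain m where m: "\<forall>w\<in>UI. \<bar>v - w\<bar> < eps m \<longrightarrow> nn v \<le> nn w" using nn_locally_min [OF v] by blast
  obtain j where j: "eps j < e" using eps_small [OF e] by blast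
  show "\<exists>m. \<forall>k. m \<le> k \<longrightarrow>
     (\<forall>y\<in>UI. \<forall>z\<in>UI. \<bar>v - y\<bar> < eps k \<and> \<bar>v - z\<bar> < eps k \<longrightarrow> f y \<le> f z + (f v + e)) \<and>
     (\<exists>y\<in>UI. \<exists>z\<in>UI. \<bar>v - y\<bar> < eps k \<and> \<bar>v - z\<bar> < eps k \<and> f z + f v < f y + e)"
  proof (intro exI [of _ m] allI impI conjI ballI)
    fix k y z assume k: "m \<le> k" and y: "y \<in> UI" and z: "z \<in> UI" and d: "\<bar>v - y\<bar> < eps k \<and> \<bar>v - z\<bar> < eps k"
    have "\<bar>v - y\<bar> < eps m" using d eps_mono [OF k] by linarith
    then have "eps (nn y) \<le> eps (nn v)" using m y by (intro eps_mono) blast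
    moreover have "0 < eps (nn z)" by simp
    ultimately show "f y \<le> f z + (f v + e)" unfolding f [OF v] f [OF y] f [OF z] using e by linarith
  next
    fix k
    obtain z where z: "z \<in> UI" "\<bar>v - z\<bar> < eps k" "j < nn z" using nn_unbounded [OF v] by blast
    have "f z + f v < f v + e" unfolding f [OF v] f [OF z(1)] using eps_mono [OF less_imp_le [OF z(3)]] j by linarith
    then show "\<exists>y\<in>UI. \<exists>z\<in>UI. \<bar>v - y\<bar> < eps k \<and> \<bar>v - z\<bar> < eps k \<and> f z + f v < f y + e"
      using v z by (intro bexI [OF _ v] bexI [OF _ z(1)]) simp
  qed
qed

text \<open>Ranks above \<open>nn v + 1\<close> at least halve the value, which leaves a gap of half
  of \<open>f v\<close>. Such points occur in every non-empty open set.\<close>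

lemma f_drop: assumes v: "v \<in> UI" and w: "w \<in> UI" "nn v + 1 < nn w" shows "\<not> f v < f w + eps (nn v + 1)"
proof -
  have "eps (nn w) \<le> eps (nn v + 1)" using w(2) by (intro eps_mono) simp
  moreover have "eps (nn v) = eps (nn v + 1) + eps (nn v + 1)" unfolding eps_Suc by simp
  ultimately show ?thesis unfolding f [OF v] f [OF w(1)] by linarith
qed

lemma f_not_lscont: assumes v: "v \<in> UI" shows "\<not> lscont f v"
proof
  assume "lscont f v"
  then obtain k where "\<forall>w\<in>UI. \<bar>v - w\<bar> < eps k \<longrightarrow> f v < f w + eps (nn v + 1)"
    using RP_eps [of "nn v + 1"] unfolding lscont_def ex_RP_eps' by blast
  then show False using nn_unbounded [OF v, of k "nn v + 1"] f_drop [OF v] by blast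
qed

lemma f_not_lquasi: assumes v: "v \<in> UI" shows "\<not> lquasi f v"
proof
  assume "lquasi f v"
  then obtain G w where G: "G \<in> OP" "w \<in> UI" "w \<in> G" "\<forall>w\<in>UI. w \<in> G \<longrightarrow> f v < f w + eps (nn v + 1)"
    using RP_eps [of "nn v + 1"] UI_OP v unfolding lquasi_def by blast
  then obtain k where "\<forall>x\<in>UI. \<bar>w - x\<bar> < eps k \<longrightarrow> x \<in> G" using OP_D unfolding opn_def by blast
  then show False using nn_unbounded [OF G(2), of k "nn v + 1"] f_drop [OF v] G(4) by blast
qed

text \<open>The term with index \<open>n\<close> is the rational of least code that lies between
  \<open>a n\<close> and \<open>b n\<close> and in \<open>S n\<close>: the rank exceeds
  \<open>n\<close>, which sends the values to 0. Used with \<open>v\<close> as one of the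
  end-points, the strict bounds keep the sequence on one side of \<open>v\<close>.\<close>

lemma f_null_sequence:
  assumes d: "defr [T0] (\<lambda>e. a (nv 0 e))" "defr [T0] (\<lambda>e. b (nv 0 e))" and ab: "\<And>n. a n \<in> UI" "\<And>n. b n \<in> UI" "\<And>n. a n < b n"
    and n: "\<And>n. b n - a n \<le> eps n" and v: "\<And>n. a n \<le> v" "\<And>n. v \<le> b n"
  shows "\<exists>s\<in>SEQ. (\<forall>n. s n \<in> UI \<and> a n < s n \<and> s n < b n) \<and> conv s v \<and> conv (\<lambda>n. f (s n)) 0"
proof -
  define P where "P q n \<longleftrightarrow> a n < rq q \<and> rq q < b n \<and> cl (rq q) \<in> S n" for q n
  define s where "s n = rq (lst (\<lambda>q. P q n))" for n
  have P: "P (lst (\<lambda>q. P q n)) n" for n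
  proof -
    obtain r where "rq r \<in> UI" "a n < rq r" "rq r < b n" "n < nn (rq r)" using nn_unbounded_rational ab by blast
    then have r: "P r n" unfolding P_def using S_iff by simp
    have "defp [T0] (\<lambda>e. P (nv 0 e) n)"
      unfolding P_def using ab by (intro defp_and defp_S defn_const defp_rless defr_const defr_q [OF defq_rq] defn_nv) simp_all
    from lst(1) [OF this r] show ?thesis .
  qed
  have s: "s n \<in> UI" "a n < s n" "s n < b n" "n < nn (s n)" for n
  proof -
    have c: "a n < s n" "s n < b n" "cl (s n) \<in> S n" using P [of n] unfolding P_def s_def by blast+
    then show "a n < s n" "s n < b n" by blast+
    show U: "s n \<in> UI"
    proof (rule UI_I)
      show "s n \<in> RM" by (simp add: s_def)
      show "0 \<le> s n" "s n \<le> 1" using c UI_nonneg [OF ab(1) [of n]] UI_le_1 [OF ab(2) [of n]] by linarith+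
    qed
    show "n < nn (s n)" using c(3) U S_iff by simp
  qed
  have "s \<in> SEQ"
  proof (rule SEQ_I)
    have "defp [T0, T0] (\<lambda>e. P (nv 0 e) (nv 1 e))"
      unfolding P_def
      using defr_tl [OF d(1), where \<tau> = T0] defr_tl [OF d(2), where \<tau> = T0]
      by (intro defp_and defp_S defp_rless defr_q [OF defq_rq] defn_nv) (simp_all add: v_tl)
    then have "defn [T0] (\<lambda>e. lst (\<lambda>q. P q (nv 0 e)))" by (intro defn_lst) (simp add: v_tl)
    then show "defr [T0] (\<lambda>e. s (nv 0 e))" unfolding s_def by (intro defr_q defq_rq)
  qed
  moreover have "conv s v"
    unfolding conv_def
  proof
    fix e assume "e \<in> RP"
    then obtain m where m: "eps m < e" using RP_eps_ex by blast
    have "\<bar>s n - v\<bar> < e" if "m \<le> n" for n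
      using eps_mono [OF that] m n [of n] s(2,3) [of n] v(1) [of n] v(2) [of n] by linarith
    then show "\<exists>m. \<forall>n. m \<le> n \<longrightarrow> \<bar>s n - v\<bar> < e" by blast
  qed
  moreover have "conv (\<lambda>n. f (s n)) 0"
    unfolding conv_def
  proof
    fix e assume "e \<in> RP"
    then obtain m where m: "eps m < e" using RP_eps_ex by blast
    have "\<bar>f (s n) - 0\<bar> < e" if "m \<le> n" for n
      using eps_mono [OF that] eps_mono [OF less_imp_le [OF s(4) [of n]]] m eps_pos [of "nn (s n)"] unfolding f [OF s(1)] by linarith
    then show "\<exists>m. \<forall>n. m \<le> n \<longrightarrow> \<bar>f (s n) - 0\<bar> < e" by blast
  qed
  ultimately show ?thesis using s by blast
qed

text \<open>The number 0 is a cluster value at every point, but \<open>f\<close> takes only powers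
  of 1/2 as values.\<close>

lemma f_not_darboux: assumes v: "v \<in> UI" shows "\<not> darboux f v"
proof
  assume D: "darboux f v"
  \<comment> \<open>Three quarters of \<open>f v\<close>, strictly between two consecutive powers of
    1/2 and hence never a value of \<open>f\<close>.\<close>
  define z where "z = eps (nn v + 1) + eps (nn v + 1 + 1)"
  have h: "eps (nn v) = eps (nn v + 1) + eps (nn v + 1)" "eps (nn v + 1) = eps (nn v + 1 + 1) + eps (nn v + 1 + 1)"
    unfolding eps_Suc by simp_all
  have b: "between z 0 (f v)" unfolding between_def z_def f [OF v] using h eps_pos [of "nn v + 1 + 1"] by linarith
  have no: "f w \<noteq> z" if w: "w \<in> UI" for w
  proof (cases "nn w \<le> nn v")
    case True
    then show ?thesis using eps_mono [OF True] h eps_pos [of "nn v + 1 + 1"] unfolding f [OF w] z_def by linarith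
  next
    case False
    then have "nn v + 1 \<le> nn w" by (simp add: Suc_le)
    then show ?thesis using eps_mono [of "nn v + 1" "nn w"] eps_pos [of "nn v + 1 + 1"] unfolding f [OF w] z_def by linarith
  qed
  have "lcluster f v 0 \<or> rcluster f v 0"
  proof (cases "0 < v")
    case True
    \<comment> \<open>The left end-points \<open>v - eps n\<close>, cut off at 0 to remain in the
      unit interval.\<close>
    define a where "a n = (if 0 \<le> v - eps n then v - eps n else 0)" for n
    have "\<exists>s\<in>SEQ. (\<forall>n. s n \<in> UI \<and> a n < s n \<and> s n < v) \<and> conv s v \<and> conv (\<lambda>n. f (s n)) 0"
    proof (rule f_null_sequence)
      show "defr [T0] (\<lambda>e. a (nv 0 e))"
        unfolding a_def using v
        by (intro defr_if defp_rle defr_diff defr_q [OF defq_eps] defr_q [OF defq_0] defr_const defn_nv) simp_all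
      show "a n \<in> UI" for n
      proof (rule UI_I)
        show "a n \<in> RM" using v by (simp add: a_def)
        show "0 \<le> a n" "a n \<le> 1" using UI_le_1 [OF v] eps_pos [of n] unfolding a_def by (simp_all, linarith)
      qed
      show "a n < v" "a n \<le> v" "v - a n \<le> eps n" for n using True eps_pos [of n] by (auto simp: a_def less_imp_le)
    qed (use v in \<open>simp_all add: defr_const\<close>)
    then show ?thesis unfolding lcluster_def using less_imp_le by blast
  next
    case False
    then have v0: "v = 0" using UI_nonneg [OF v] by linarith
    have "\<exists>s\<in>SEQ. (\<forall>n. s n \<in> UI \<and> v < s n \<and> s n < eps n) \<and> conv s v \<and> conv (\<lambda>n. f (s n)) 0"
    proof (rule f_null_sequence)
      show "defr [T0] (\<lambda>e. eps (nv 0 e))" by (intro defr_q [OF defq_eps] defn_nv) simp_all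
      show "eps n \<in> UI" for n using eps_mono [of 0 n] eps_pos [of n] by (intro UI_I) (simp_all add: less_imp_le)
      show "v < eps n" "v \<le> eps n" "eps n - v \<le> eps n" for n using v0 by (simp_all add: less_imp_le)
    qed (use v in \<open>simp_all add: defr_const\<close>)
    then show ?thesis unfolding rcluster_def using less_imp_le by blast
  qed
  moreover have "z \<in> RM" by (simp add: z_def)
  ultimately have "\<exists>w\<in>UI. f w = z" using D b RP_eps [of 0] RM_0 unfolding darboux_def by blast
  then show False using no by blast
qed

lemma f_ccont: "ccont f"
proof -
  have "defp [T0, T1] (\<lambda>e. nn (cl (rv (xv 1 e))) = nv 0 e)"
    by (intro defp_eq defn_nn defn_nv defr_rv deft_xv) simp_all
  from sets_ex [of "\<lambda>n v. nn (cl v) = n", OF this] obtain H where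
    H: "isseq H" "\<And>n. Sec H n = {v \<in> UI. nn v = n}" by (auto cong: conj_cong)
  show ?thesis
    unfolding ccont_def
    by (rule exI [of _ H], intro conjI H(1) allI ballI impI bexI [OF _ RP_eps [of 0]]) (auto simp: H(2) f RP_def)
qed

lemma f_pos: "v \<in> UI \<Longrightarrow> 0 < f v" by (simp add: f)
lemma f_inf: assumes "c \<in> UI" "d \<in> UI" "c < d" "e \<in> RP" shows "\<exists>w\<in>UI. c \<le> w \<and> w \<le> d \<and> \<not> e \<le> f w"
proof -
  obtain j where j: "eps j < e" using RP_eps_ex [OF assms(4)] by blast
  obtain r where r: "rq r \<in> UI" "c < rq r" "rq r < d" "j < nn (rq r)" using nn_unbounded_rational [OF assms(1-3)] by blast
  have "f (rq r) < e" using eps_mono [OF less_imp_le [OF r(4)]] j unfolding f [OF r(1)] by linarith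
  with r show ?thesis by (intro bexI [OF _ r(1)]) simp
qed

text \<open>Arbitrarily close to \<open>v\<close> on the left there are values at least
  \<open>eps m\<close>, and between such a point and \<open>v\<close> rationals with values at most
  \<open>eps (m + 1)\<close>. A limit cannot be within \<open>eps (m + 1 + 1)\<close> of
  both.\<close>

lemma f_not_one_sided:
  assumes v: "v \<in> UI" and one: "(\<And>k. \<exists>w\<in>UI. w < v \<and> \<bar>v - w\<bar> < eps k \<and> w \<notin> S m)"
  shows "\<not> llim f v l"
proof
  assume "llim f v l"
  then obtain k where k: "\<forall>w\<in>UI. w < v \<and> \<bar>v - w\<bar> < eps k \<longrightarrow> \<bar>f w - l\<bar> < eps (m + 1 + 1)"
    using RP_eps [of "m + 1 + 1"] unfolding llim_def ex_RP_eps by blast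
  obtain w where w: "w \<in> UI" "w < v" "\<bar>v - w\<bar> < eps k" "w \<notin> S m" using one by blast
  obtain r where r: "rq r \<in> UI" "w < rq r" "rq r < v" "m + 1 < nn (rq r)" using nn_unbounded_rational [OF w(1) v w(2)] by blast
  have "\<bar>v - rq r\<bar> < eps k" using r(2,3) w(2,3) by linarith
  then have 1: "\<bar>f (rq r) - l\<bar> < eps (m + 1 + 1)" using k r(1,3) by blast
  have 2: "\<bar>f w - l\<bar> < eps (m + 1 + 1)" using k w by blast
  have "nn w \<le> m" using w(4) S_iff [OF w(1)] by simp
  then have "eps m \<le> f w" using eps_mono f [OF w(1)] by simp
  moreover have "f (rq r) \<le> eps (m + 1)" using eps_mono [of "m + 1" "nn (rq r)"] r(4) f [OF r(1)] by simp
  moreover have "eps m = eps (m + 1) + eps (m + 1)" "eps (m + 1) = eps (m + 1 + 1) + eps (m + 1 + 1)"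
    unfolding eps_Suc by simp_all
  ultimately show False using 1 2 by linarith
qed

lemma f_not_one_sided_right:
  assumes v: "v \<in> UI" and one: "(\<And>k. \<exists>w\<in>UI. v < w \<and> \<bar>v - w\<bar> < eps k \<and> w \<notin> S m)"
  shows "\<not> rlim f v l"
proof
  assume "rlim f v l"
  then obtain k where k: "\<forall>w\<in>UI. v < w \<and> \<bar>v - w\<bar> < eps k \<longrightarrow> \<bar>f w - l\<bar> < eps (m + 1 + 1)"
    using RP_eps [of "m + 1 + 1"] unfolding rlim_def ex_RP_eps by blast
  obtain w where w: "w \<in> UI" "v < w" "\<bar>v - w\<bar> < eps k" "w \<notin> S m" using one by blast
  obtain r where r: "rq r \<in> UI" "v < rq r" "rq r < w" "m + 1 < nn (rq r)" using nn_unbounded_rational [OF v w(1,2)] by blast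
  have "\<bar>v - rq r\<bar> < eps k" using r(2,3) w(2,3) by linarith
  then have 1: "\<bar>f (rq r) - l\<bar> < eps (m + 1 + 1)" using k r(1,2) by blast
  have 2: "\<bar>f w - l\<bar> < eps (m + 1 + 1)" using k w by blast
  have "nn w \<le> m" using w(4) S_iff [OF w(1)] by simp
  then have "eps m \<le> f w" using eps_mono f [OF w(1)] by simp
  moreover have "f (rq r) \<le> eps (m + 1)" using eps_mono [of "m + 1" "nn (rq r)"] r(4) f [OF r(1)] by simp
  moreover have "eps m = eps (m + 1) + eps (m + 1)" "eps (m + 1) = eps (m + 1 + 1) + eps (m + 1 + 1)"
    unfolding eps_Suc by simp_all
  ultimately show False using 1 2 by linarith
qed

text \<open>The points outside \<open>S m\<close> accumulate from at least one side: if none lies to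
  the left within \<open>eps k\<close>, all closer ones lie to the right.\<close>

lemma f_not_regulated: assumes v: "v \<in> UI" shows "\<not> (llim f v l \<and> rlim f v r)"
proof -
  obtain m where m: "\<And>k. \<exists>w\<in>UI. w \<noteq> v \<and> \<bar>v - w\<bar> < eps k \<and> w \<notin> S m" using accumulation [OF v] by blast
  show ?thesis
  proof (cases "\<forall>k. \<exists>w\<in>UI. w < v \<and> \<bar>v - w\<bar> < eps k \<and> w \<notin> S m")
    case True
    then show ?thesis using f_not_one_sided [OF v] by blast
  next
    case False
    then obtain k where k: "\<not> (\<exists>w\<in>UI. w < v \<and> \<bar>v - w\<bar> < eps k \<and> w \<notin> S m)" by blast
    have "\<exists>w\<in>UI. v < w \<and> \<bar>v - w\<bar> < eps j \<and> w \<notin> S m" for j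
    proof -
      obtain w where w: "w \<in> UI" "w \<noteq> v" "\<bar>v - w\<bar> < eps (k + j)" "w \<notin> S m" using m by blast
      have "eps (k + j) \<le> eps k" "eps (k + j) \<le> eps j" by (rule eps_mono, simp)+
      then have "\<bar>v - w\<bar> < eps k" "\<bar>v - w\<bar> < eps j" using w(3) by linarith+
      then show ?thesis using w k by (metis linorder_neqE)
    qed
    then show ?thesis using f_not_one_sided_right [OF v] by blast
  qed
qed

end

context
  fixes g assumes g: "\<And>v. v \<in> UI \<Longrightarrow> g v = - emb (nn v)"
begin

lemma g_uscont: assumes v: "v \<in> UI" shows "uscont g v"
  unfolding uscont_def ex_RP_eps'
proof
  fix e assume "e \<in> RP"
  then have e: "0 < e" using RP_D by blast
  obtain k where k: "\<forall>w\<in>UI. \<bar>v - w\<bar> < eps k \<longrightarrow> nn v \<le> nn w" using nn_locally_min [OF v] by blast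
  have "g w < g v + e" if "w \<in> UI" "\<bar>v - w\<bar> < eps k" for w
  proof -
    have "emb (nn v) \<le> emb (nn w)" using k that by simp
    then show ?thesis using e unfolding g [OF v] g [OF that(1)] by linarith
  qed
  then show "\<exists>k. \<forall>w\<in>UI. \<bar>v - w\<bar> < eps k \<longrightarrow> g w < g v + e" by blast
qed

lemma g_not_cont: assumes v: "v \<in> UI" shows "\<not> cont g v"
proof
  assume "cont g v"
  then obtain k where k: "\<forall>w\<in>UI. \<bar>v - w\<bar> < eps k \<longrightarrow> \<bar>g v - g w\<bar> < eps 0"
    using RP_eps [of 0] unfolding cont_def ex_RP_eps' by blast
  obtain w where w: "w \<in> UI" "\<bar>v - w\<bar> < eps k" "nn v + 1 < nn w" using nn_unbounded [OF v] by blast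
  have "emb (nn v) + 1 < emb (nn w)" using w(3) emb_less [of "nn v + 1" "nn w"] by simp
  moreover have "\<bar>g v - g w\<bar> < 1" using k w by simp
  ultimately show False unfolding g [OF v] g [OF w(1)] by linarith
qed

lemma g_unbounded: assumes "c \<in> UI" "d \<in> UI" "c < d" shows "\<exists>w\<in>UI. c < w \<and> w < d \<and> \<not> q \<le> g w"
proof -
  obtain j where j: "- q < emb j" using emb_above by blast
  obtain r where r: "rq r \<in> UI" "c < rq r" "rq r < d" "j < nn (rq r)" using nn_unbounded_rational [OF assms] by blast
  have "emb j < emb (nn (rq r))" using r(4) by simp
  then have "g (rq r) < q" using j unfolding g [OF r(1)] by linarith
  with r show ?thesis by (intro bexI [OF _ r(1)]) simp
qed

end

end

section \<open>Deleting every other digit\<close>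

context nmodel
begin

text \<open>Two ways to compare with a grid point: for \<open>True\<close> the point belongs to the
  cell on its right, for \<open>False\<close> to the cell on its left. They select the two binary
  expansions of a dyadic number.\<close>

definition blw :: "bool \<Rightarrow> 'n rl \<Rightarrow> 'n rl \<Rightarrow> bool" where "blw s z y \<longleftrightarrow> (if s then z \<le> y else z < y)"
text \<open>The floor of \<open>y\<close> for \<open>True\<close>, and its ceiling minus 1 for
  \<open>False\<close>, both cut off at 0; written as a search so that it is definable.\<close>

definition fl :: "bool \<Rightarrow> 'n rl \<Rightarrow> 'n" where "fl s y = lst (\<lambda>n. \<not> blw s (emb (n + 1)) y)"
text \<open>The first binary digit after the point. Since \<open>Y j x\<close> is 4^j x,
  \<open>bit s (Y j x)\<close> is the digit of \<open>x\<close> at place 2 j + 1.\<close>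

definition bit :: "bool \<Rightarrow> 'n rl \<Rightarrow> bool" where "bit s y \<longleftrightarrow> blw s (emb (fl s y + fl s y + 1)) (y + y)"
definition Y :: "'n \<Rightarrow> 'n rl \<Rightarrow> 'n rl" where "Y j x = emb (pw (j + j)) * x"

lemma Y_RM [simp]: "x \<in> RM \<Longrightarrow> Y j x \<in> RM" by (simp add: Y_def)

lemma Y_nonneg: "0 \<le> x \<Longrightarrow> 0 \<le> Y j x" by (simp add: Y_def mult_nonneg_nonneg)
lemma RM_double [simp]: assumes "x \<in> RM" shows "2 * x \<in> RM"
  unfolding mult_2 by (rule RM_add [OF assms assms])
lemma rv_RM [simp]: "rv x \<in> RM"
  by (cases "isreal x") (simp add: RM_def, simp add: rv_def)
lemma blw_mono: "z' \<le> z \<Longrightarrow> blw s z y \<Longrightarrow> blw s z' y"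
  by (cases s) (auto simp: blw_def)
lemma Suc_pos: "0 < c + 1" for c :: 'n unfolding less_Suc by (rule nonneg)

lemma defp_blw: "defr \<sigma>s u \<Longrightarrow> defr \<sigma>s v \<Longrightarrow> defp \<sigma>s (\<lambda>e. blw s (u e) (v e))"
  by (cases s) (simp_all add: blw_def defp_rle defp_rless)
lemma defn_fl: "defr \<sigma>s u \<Longrightarrow> defn \<sigma>s (\<lambda>e. fl s (u e))"
  unfolding fl_def
  by (rule defn_lst defp_not defp_blw defr_q [OF defq_emb] defn_add defn_nv defn_const | erule defr_tl | (simp; fail))+
lemma defp_bit: "defr \<sigma>s u \<Longrightarrow> defp \<sigma>s (\<lambda>e. bit s (u e))"
  unfolding bit_def by (intro defp_blw defr_q [OF defq_emb] defn_add defn_fl defn_const defr_add)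
lemma defr_Y: "defn \<sigma>s t \<Longrightarrow> defr \<sigma>s u \<Longrightarrow> defr \<sigma>s (\<lambda>e. Y (t e) (u e))"
  unfolding Y_def by (intro defr_scale defq_emb defn_pw defn_add) simp_all

lemma fl_iff: assumes y: "y \<in> RM" and K: "0 < K" shows "blw s (emb K) y \<longleftrightarrow> K \<le> fl s y"
proof -
  have d: "defp [T0] (\<lambda>e. \<not> blw s (emb (nv 0 e + 1)) y)"
    using y by (intro defp_not defp_blw defr_q [OF defq_emb] defn_add defn_nv defn_const defr_const) simp_all
  obtain k where "y < emb k" using emb_above by blast
  then have k: "\<not> blw s (emb (k + 1)) y" by (auto simp: blw_def)
  note l = lst [OF d k, folded fl_def]
  show ?thesis
  proof
    assume b: "blw s (emb K) y"
    show "K \<le> fl s y"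
    proof (rule ccontr)
      assume "\<not> K \<le> fl s y"
      then have "fl s y + 1 \<le> K" by (simp add: Suc_le)
      then have "emb (fl s y + 1) \<le> emb K" unfolding emb_le .
      then have "blw s (emb (fl s y + 1)) y" using b by (rule blw_mono)
      then show False using l(1) by blast
    qed
  next
    assume le: "K \<le> fl s y"
    obtain m where m: "K = m + 1" using arith_nat_pos [OF K] by blast
    then have "m < fl s y" using le by (simp add: Suc_le)
    then show "blw s (emb K) y" using l(2) m by blast
  qed
qed

lemma fl_eq_iff: assumes y: "y \<in> RM" shows "fl s y = h \<longleftrightarrow> (h = 0 \<or> blw s (emb h) y) \<and> \<not> blw s (emb (h + 1)) y"
proof -
  have 1: "\<not> blw s (emb (h + 1)) y \<longleftrightarrow> fl s y \<le> h" unfolding fl_iff [OF y Suc_pos] Suc_le not_less ..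
  have 2: "(h = 0 \<or> blw s (emb h) y) \<longleftrightarrow> h \<le> fl s y"
  proof (cases "h = 0")
    case False
    then have "0 < h" using nonneg [of h] by (simp add: order.strict_iff_order)
    then show ?thesis using fl_iff [OF y] False by simp
  qed simp
  show ?thesis unfolding 1 2 by auto
qed

lemma blw_scale: "0 < c \<Longrightarrow> blw s (c * z) (c * y) \<longleftrightarrow> blw s z y" by (simp add: blw_def)

text \<open>Both points lie in the same cell of the grid of mesh 1 / (2 4^k), each with respect to
  its own convention. A cell fixes the deleted digits above place 2 k + 2 as well as the retained
  ones.\<close>

definition same :: "bool \<Rightarrow> 'n rl \<Rightarrow> bool \<Rightarrow> 'n rl \<Rightarrow> 'n \<Rightarrow> bool" where
  "same s x t w k \<longleftrightarrow> fl s (Y k x + Y k x) = fl t (Y k w + Y k w)"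

text \<open>Comparisons with all positive integers determine the floors, and unlike the floors they
  behave well under rescaling.\<close>

lemma same_iff: assumes "x \<in> RM" "w \<in> RM"
  shows "same s x t w k \<longleftrightarrow> (\<forall>K. 0 < K \<longrightarrow> blw s (emb K) (Y k x + Y k x) = blw t (emb K) (Y k w + Y k w))"
proof -
  have r: "Y k x + Y k x \<in> RM" "Y k w + Y k w \<in> RM" by (intro RM_add Y_RM assms)+
  have "a = b" if "\<forall>K. 0 < K \<longrightarrow> (K \<le> a) = (K \<le> b)" for a b :: 'n
  proof -
    have "a \<le> b" using that nonneg [of a] nonneg [of b] by (cases "0 < a") (auto simp: not_less intro: order.trans)
    moreover have "b \<le> a" using that nonneg [of a] nonneg [of b] by (cases "0 < b") (auto simp: not_less intro: order.trans)
    ultimately show ?thesis by simp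
  qed
  then show ?thesis unfolding same_def using fl_iff [OF r(1)] fl_iff [OF r(2)] by auto
qed

text \<open>Coarser grids are contained in finer ones: comparing with \<open>K\<close> at level
  \<open>j\<close> is comparing with 4^(k - j) \<open>K\<close> at level \<open>k\<close>.\<close>

lemma same_lower: assumes x: "x \<in> RM" "w \<in> RM" and s: "same s x t w k" and j: "j \<le> k" shows "same s x t w j"
  unfolding same_iff [OF x]
proof (intro allI impI)
  fix K :: 'n assume K: "0 < K"
  define i where "i = k - j"
  have k: "k = j + i" using le_add_diff_inverse2 [OF j] by (simp add: i_def add.commute)
  have scale: "Y k z + Y k z = emb (pw (i + i)) * (Y j z + Y j z)" for z
  proof -
    have "pw (k + k) = pw (i + i) * pw (j + j)" unfolding k pw_add [symmetric] by (simp add: ac_simps)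
    then show ?thesis by (simp add: Y_def algebra_simps)
  qed
  have "0 < pw (i + i) * K" using K by simp
  then have "blw s (emb (pw (i + i) * K)) (Y k x + Y k x) = blw t (emb (pw (i + i) * K)) (Y k w + Y k w)"
    using s unfolding same_iff [OF x] by blast
  then show "blw s (emb K) (Y j x + Y j x) = blw t (emb K) (Y j w + Y j w)"
    unfolding scale emb_hom blw_scale [OF emb_pw_pos] .
qed

text \<open>Both the floor of y and its first digit are determined by the comparisons of 2 y with
  integers.\<close>

lemma same_bit: assumes x: "x \<in> RM" "w \<in> RM" and s: "same s x t w j" shows "bit s (Y j x) = bit t (Y j w)"
proof -
  have double: "blw s (emb (K + K)) (y + y) \<longleftrightarrow> blw s (emb K) y" for s K y
    by (cases s) (simp_all add: blw_def)
  have b: "blw s (emb K) (Y j x) = blw t (emb K) (Y j w)" if "0 < K" for K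
  proof -
    have "0 < K + K" by (rule add_pos_pos [OF that that])
    then have "blw s (emb (K + K)) (Y j x + Y j x) = blw t (emb (K + K)) (Y j w + Y j w)"
      using s unfolding same_iff [OF x] by blast
    then show ?thesis unfolding double .
  qed
  have f: "fl s (Y j x) = fl t (Y j w)"
  proof -
    have "fl s (Y j x) = fl t (Y j w) \<longleftrightarrow> (fl t (Y j w) = 0 \<or> blw s (emb (fl t (Y j w))) (Y j x)) \<and> \<not> blw s (emb (fl t (Y j w) + 1)) (Y j x)"
      using x by (intro fl_eq_iff) simp
    moreover have "(fl t (Y j w) = 0 \<or> blw t (emb (fl t (Y j w))) (Y j w)) \<and> \<not> blw t (emb (fl t (Y j w) + 1)) (Y j w)"
      using fl_eq_iff [of "Y j w" t "fl t (Y j w)"] x by simp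
    moreover have "0 < fl t (Y j w) + 1" by (rule Suc_pos)
    moreover have "fl t (Y j w) = 0 \<or> 0 < fl t (Y j w)" using nonneg [of "fl t (Y j w)"] by (simp add: order.strict_iff_order)
    ultimately show ?thesis using b by metis
  qed
  have "0 < fl t (Y j w) + fl t (Y j w) + 1" by (rule Suc_pos)
  then show ?thesis unfolding bit_def f using s [unfolded same_iff [OF x]] by blast
qed

text \<open>The binary digits of \<open>psi True x\<close> are the digits at the odd places of the binary expansion of \<open>x\<close>;
  \<open>psi False x\<close> uses the expansion of \<open>x\<close> that does not terminate, i.e. it is the limit from the left.\<close>

definition isP :: "bool \<Rightarrow> 'n rl \<Rightarrow> ('n \<Rightarrow> 'n) \<Rightarrow> bool" where
  "isP s x F \<longleftrightarrow> defn [T0] (\<lambda>e. F (nv 0 e)) \<and> F 0 = 0 \<and> (\<forall>n. F (n + 1) = F n + F n + (if bit s (Y n x) then 1 else 0))"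
definition P :: "bool \<Rightarrow> 'n rl \<Rightarrow> 'n \<Rightarrow> 'n" where "P s x = (SOME F. isP s x F)"

text \<open>The digits are produced uniformly in the parameters of \<open>u\<close>; fixing an
  environment then yields the definability clause of \<open>isP\<close>.\<close>

lemma P_rec:
  assumes u: "defr \<sigma>s u"
  shows "\<exists>h. defn (T0 # \<sigma>s) (\<lambda>e. h (nv 0 e) (tl e)) \<and> (\<forall>e. typed_env e \<sigma>s \<longrightarrow> isP s (u e) (\<lambda>n. h n e))"
proof -
  have "defn (T0 # T0 # \<sigma>s) (\<lambda>e. nv 0 e + nv 0 e + (if bit s (Y (nv 1 e) (u (tl (tl e)))) then 1 else 0))"
    by (intro defn_add defn_if defp_bit defr_Y defr_tl [OF defr_tl [OF u]] defn_const defn_nv) simp_all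
  from recursion [where g = "\<lambda>a n e. a + a + (if bit s (Y n (u e)) then 1 else 0)", OF this defn_const [of \<sigma>s 0]]
  obtain h where h: "defn (T0 # \<sigma>s) (\<lambda>e. h (nv 0 e) (tl e))" "\<And>e. typed_env e \<sigma>s \<Longrightarrow> h 0 e = 0"
    "\<And>e n. typed_env e \<sigma>s \<Longrightarrow> h (n + 1) e = h n e + h n e + (if bit s (Y n (u e)) then 1 else 0)" by blast
  obtain g where g: "deft \<sigma>s T1 g" "\<And>e n. typed_env e \<sigma>s \<Longrightarrow> ap M (g e) (nd n) = nd (h n e)"
    using defn_lam [OF h(1)] by blast
  have "isP s (u e) (\<lambda>n. h n e)" if e: "typed_env e \<sigma>s" for e
  proof -
    have "defn [T0] (\<lambda>e'. nm (ap M (g e) (nd (nv 0 e'))))"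
      by (rule defn_ap [OF deft_const [OF deft_carr [OF g(1) e]]]) (intro defn_nv; simp)
    then have "defn [T0] (\<lambda>e'. h (nv 0 e') e)" using g(2) [OF e] by simp
    with h(2,3) [OF e] show ?thesis unfolding isP_def by blast
  qed
  with h(1) show ?thesis by blast
qed

text \<open>The definability clause in \<open>isP\<close> is what permits induction on the equation
  of the two sequences.\<close>

lemma isP_unique: assumes "isP s x F" "isP s x G" shows "F n = G n"
proof (rule induction [where P = "\<lambda>n. F n = G n"])
  show "defp [T0] (\<lambda>e. F (nv 0 e) = G (nv 0 e))" using assms unfolding isP_def by (intro defp_eq) blast+
qed (use assms in \<open>simp_all add: isP_def\<close>)

lemma isP_P: assumes x: "x \<in> RM" shows "isP s x (P s x)"
proof -
  obtain h where "isP s x (\<lambda>n. h n [])" using P_rec [OF defr_const [OF x, of "[]"], of s] by auto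
  then show ?thesis unfolding P_def by (rule someI [of "isP s x"])
qed

lemma P_0: "x \<in> RM \<Longrightarrow> P s x 0 = 0" and P_Suc: "x \<in> RM \<Longrightarrow> P s x (n + 1) = P s x n + P s x n + (if bit s (Y n x) then 1 else 0)"
  and defn_P_const: "x \<in> RM \<Longrightarrow> defn [T0] (\<lambda>e. P s x (nv 0 e))"
  using isP_P [of x s] unfolding isP_def by blast+

lemma defn_P: assumes u: "defr \<sigma>s u" and t: "defn \<sigma>s t" shows "defn \<sigma>s (\<lambda>e. P s (u e) (t e))"
proof -
  obtain h where h: "defn (T0 # \<sigma>s) (\<lambda>e. h (nv 0 e) (tl e))" "\<And>e. typed_env e \<sigma>s \<Longrightarrow> isP s (u e) (\<lambda>n. h n e)"
    using P_rec [OF u, of s] by blast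
  from defn_subst [OF h(1) t] have "defn \<sigma>s (\<lambda>e. h (t e) e)" .
  then show ?thesis
  proof (rule defn_cong)
    fix e assume e: "typed_env e \<sigma>s"
    show "h (t e) e = P s (u e) (t e)"
      by (rule isP_unique [OF h(2) [OF e] isP_P]) (rule defr_RM [OF u e])
  qed
qed

text \<open>Reading \<open>i\<close> more digits multiplies the prefix by 2^i and adds less than
  2^i, so the dyadic intervals given by the prefixes are nested.\<close>

lemma P_bounds: assumes x: "x \<in> RM" shows "P s x m * pw i \<le> P s x (m + i) \<and> P s x (m + i) + 1 \<le> (P s x m + 1) * pw i"
proof (rule induction [where P = "\<lambda>i. P s x m * pw i \<le> P s x (m + i) \<and> P s x (m + i) + 1 \<le> (P s x m + 1) * pw i"])
  show "defp [T0] (\<lambda>e. P s x m * pw (nv 0 e) \<le> P s x (m + nv 0 e) \<and> P s x (m + nv 0 e) + 1 \<le> (P s x m + 1) * pw (nv 0 e))"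
    by (intro defp_and defp_le defn_mult defn_add defn_const defn_pw defn_nv defn_P defr_const x) simp_all
next
  fix i assume IH: "P s x m * pw i \<le> P s x (m + i) \<and> P s x (m + i) + 1 \<le> (P s x m + 1) * pw i"
  define b :: 'n where "b = (if bit s (Y (m + i) x) then 1 else 0)"
  have b: "0 \<le> b" "b \<le> 1" by (simp_all add: b_def)
  have e: "P s x (m + (i + 1)) = P s x (m + i) + P s x (m + i) + b" using P_Suc [OF x, of s "m + i"] by (simp add: b_def add.assoc)
  have 1: "P s x m * pw (i + 1) \<le> P s x (m + i) + P s x (m + i)"
    using add_mono [OF conjunct1 [OF IH] conjunct1 [OF IH]] by (simp add: pw_Suc distrib_left)
  have "(P s x (m + i) + 1) + (P s x (m + i) + 1) \<le> (P s x m + 1) * pw (i + 1)"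
    using add_mono [OF conjunct2 [OF IH] conjunct2 [OF IH]] by (simp only: pw_Suc distrib_left)
  moreover have "P s x (m + i) + P s x (m + i) + b + 1 \<le> (P s x (m + i) + 1) + (P s x (m + i) + 1)"
    using add_left_mono [OF b(2), of "P s x (m + i) + P s x (m + i) + 1"] by (simp only: ac_simps)
  ultimately show "P s x m * pw (i + 1) \<le> P s x (m + (i + 1)) \<and> P s x (m + (i + 1)) + 1 \<le> (P s x m + 1) * pw (i + 1)"
    unfolding e using order.trans [OF 1] b(1) by (auto intro: order.trans)
qed simp

lemma eps_emb: "emb (pw n) * eps n = 1" using less_imp_neq [OF emb_pw_pos [of n]] by (simp add: eps_def)

lemma P_bounds_eps: assumes x: "x \<in> RM"
  shows "emb (P s x m) * eps m \<le> emb (P s x (m + i)) * eps (m + i)"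
    "(emb (P s x (m + i)) + 1) * eps (m + i) \<le> (emb (P s x m) + 1) * eps m"
proof -
  have e: "eps m = emb (pw i) * eps (m + i)" unfolding eps_add using eps_emb [of i] by (simp add: ac_simps) 
  have "emb (P s x m * pw i) \<le> emb (P s x (m + i))" "emb (P s x (m + i) + 1) \<le> emb ((P s x m + 1) * pw i)"
    unfolding emb_le using P_bounds [OF x, of s m i] by blast+
  then have "emb (P s x m * pw i) * eps (m + i) \<le> emb (P s x (m + i)) * eps (m + i)"
    "emb (P s x (m + i) + 1) * eps (m + i) \<le> emb ((P s x m + 1) * pw i) * eps (m + i)"
    by (simp_all only: mult_right_mono less_imp_le eps_pos)
  then show "emb (P s x m) * eps m \<le> emb (P s x (m + i)) * eps (m + i)"
    "(emb (P s x (m + i)) + 1) * eps (m + i) \<le> (emb (P s x m) + 1) * eps m"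
    unfolding e emb_hom by (simp_all only: mult.assoc)
qed

definition psi :: "bool \<Rightarrow> 'n rl \<Rightarrow> 'n rl" where
  "psi s x = (SOME y. y \<in> RM \<and> (\<forall>n. emb (P s x n) * eps n \<le> y \<and> y \<le> (emb (P s x n) + 1) * eps n))"

text \<open>The left end-points of the nested intervals form a definable fast Cauchy sequence, whose
  limit lies in all of the intervals.\<close>

lemma psi_ex: assumes x: "x \<in> RM"
  shows "\<exists>y. y \<in> RM \<and> (\<forall>n. emb (P s x n) * eps n \<le> y \<and> y \<le> (emb (P s x n) + 1) * eps n)"
proof -
  let ?a = "\<lambda>n. emb (P s x n) * eps n"
  \<comment> \<open>The shift by one place provides the strict inequality in the definition of a
    real: later end-points differ by at most \<open>eps (n + 1)\<close>, which is less than
    \<open>eps n\<close>.\<close>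
  define c where "c n = lst (\<lambda>q. rq q = ?a (n + 1))" for n
  have "defq_rat [] (\<lambda>e. ?a n)" for n by (intro defq_mult defq_emb defq_eps defn_const)
  then have ex: "\<exists>q. rq q = ?a n" for n by (rule defq_code)
  have c: "rq (c n) = ?a (n + 1)" for n
  proof -
    obtain q where q: "rq q = ?a (n + 1)" using ex by blast
    have "defp [T0] (\<lambda>e. rq (nv 0 e) = ?a (n + 1))"
      by (intro defp_qeq defq_rq defq_mult defq_emb defq_eps defn_const defn_nv) simp_all
    from lst(1) [OF this q] show ?thesis unfolding c_def .
  qed
  have "defp [T0, T0] (\<lambda>e. rq (nv 0 e) = ?a (nv 1 e + 1))"
    by (intro defp_qeq defq_rq defq_mult defq_emb defq_eps defn_const defn_nv defn_P defr_const x defn_add) simp_all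
  then have "defn [T0] (\<lambda>e. c (nv 0 e))" unfolding c_def by (intro defn_lst) (simp add: v_tl)
  then obtain g where g: "deft [] T1 g" "\<And>e n. typed_env e [] \<Longrightarrow> ap M (g e) (nd n) = nd (c n)"
    using defn_lam [of "[]" "\<lambda>n e. c n"] by auto
  have s: "sq (g []) n = ?a (n + 1)" for n using g(2) [of "[]" n] c by (simp add: sq_def)
  have inc: "?a n \<le> ?a (n + i)" "?a (n + i) \<le> ?a n + eps n" for n i
  proof -
    show "?a n \<le> ?a (n + i)" by (rule P_bounds_eps(1) [OF x])
    show "?a (n + i) \<le> ?a n + eps n"
      using P_bounds_eps(2) [OF x, of s n i] eps_pos [of "n + i"] unfolding distrib_right mult_1 by linarith
  qed
  have r: "isreal (g [])"
    unfolding isreal_def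
  proof (intro conjI allI)
    show "g [] \<in> carr M T1" using deft_carr [OF g(1), of "[]"] by simp
    fix n i :: 'n
    have e: "n + i + 1 = n + 1 + i" by (simp add: ac_simps)
    have "eps (n + 1) = eps n / 2" by (rule eps_Suc)
    then show "\<bar>sq (g []) n - sq (g []) (n + i)\<bar> < eps n"
      unfolding s e using inc [of "n + 1" i] eps_pos [of n] by linarith
  qed
  let ?y = "rv (g [])"
  have near: "\<bar>?a (n + i + 1) - ?y\<bar> \<le> eps i" for n i
    using rv [OF r, of "n + i"] eps_mono [of i "n + i"] unfolding s by simp
  have "?a n \<le> ?y \<and> ?y \<le> ?a n + eps n" for n
  proof (rule ccontr)
    assume "\<not> (?a n \<le> ?y \<and> ?y \<le> ?a n + eps n)"
    then have "0 < max (?a n - ?y) (?y - (?a n + eps n))" by auto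
    from eps_small [OF this] obtain i where i: "eps i < max (?a n - ?y) (?y - (?a n + eps n))" by blast
    have "?a n \<le> ?a (n + i + 1)" "?a (n + i + 1) \<le> ?a n + eps n" using inc [of n "i + 1"] by (simp_all add: add.assoc)
    then show False using near [of n i] i by linarith
  qed
  moreover have "?y \<in> RM" using r by (auto simp: RM_def simp del: UC_real)
  ultimately show ?thesis by (intro exI [of _ ?y]) (simp add: distrib_right)
qed

lemma psi: assumes "x \<in> RM"
  shows "psi s x \<in> RM" "emb (P s x n) * eps n \<le> psi s x" "psi s x \<le> (emb (P s x n) + 1) * eps n"
  using someI_ex [OF psi_ex [OF assms, of s], folded psi_def] by blast+

lemma psi_UI: "x \<in> RM \<Longrightarrow> psi s x \<in> UI"
  using psi(1) [of x s] psi(2,3) [of x s 0] by (intro UI_I) (simp_all add: P_0)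

text \<open>The left end-points come within \<open>eps n\<close> of the value, so its lower cut is
  described by a quantifier over \<open>n\<close>.\<close>

lemma defr_psi: assumes u: "defr \<sigma>s u" shows "defr \<sigma>s (\<lambda>e. psi s (u e))"
proof -
  have "defp (T0 # \<sigma>s) (\<lambda>e. \<exists>n. rq (nv 0 e) < emb (P s (u (tl e)) n) * eps n)"
    by (rule defp_ex defp_qless defq_rq defq_mult defq_emb defq_eps defn_P defr_tl [OF defr_tl [OF u]] defn_nv | simp only: v_tl | (simp; fail))+
  then show ?thesis
    unfolding defr_def
  proof (rule defp_cong)
    fix e assume "typed_env e (T0 # \<sigma>s)"
    then have "typed_env (tl e) \<sigma>s" by (auto simp: list_all2_Cons2)
    then have x: "u (tl e) \<in> RM" using defr_RM [OF u] by blast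
    let ?x = "u (tl e)" and ?q = "rq (nv 0 e)"
    show "(\<exists>n. ?q < emb (P s ?x n) * eps n) = (?q < psi s ?x)"
    proof
      assume "\<exists>n. ?q < emb (P s ?x n) * eps n"
      then show "?q < psi s ?x" using psi(2) [OF x] by (meson order.strict_trans2)
    next
      assume "?q < psi s ?x"
      then obtain n where n: "?q + eps n < psi s ?x" using eps_between by blast
      have "?q < emb (P s ?x n) * eps n" using n psi(3) [OF x, of s n] by (simp add: distrib_right)
      then show "\<exists>n. ?q < emb (P s ?x n) * eps n" ..
    qed
  qed
qed

lemma P_eq:
  assumes x: "x \<in> RM" "w \<in> RM" and b: "\<And>j. j < k \<Longrightarrow> bit s (Y j x) = bit t (Y j w)"
  shows "P s x k = P t w k"
proof -
  have "j \<le> k \<longrightarrow> P s x j = P t w j" for j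
  proof (rule induction [where P = "\<lambda>j. j \<le> k \<longrightarrow> P s x j = P t w j"])
    show "defp [T0] (\<lambda>e. nv 0 e \<le> k \<longrightarrow> P s x (nv 0 e) = P t w (nv 0 e))"
      by (intro defp_imp defp_le defp_eq defn_P_const x defn_nv defn_const) simp_all
    show "0 \<le> k \<longrightarrow> P s x 0 = P t w 0" using x by (simp add: P_0)
    show "j + 1 \<le> k \<longrightarrow> P s x (j + 1) = P t w (j + 1)" if "j \<le> k \<longrightarrow> P s x j = P t w j" for j
      using that b [of j] x by (auto simp: P_Suc Suc_le)
  qed
  then show ?thesis by blast
qed

text \<open>A cell of level \<open>k\<close> fixes the retained digits with indices 0 to
  \<open>k\<close>, hence the prefix of length \<open>k + 1\<close>.\<close>

lemma P_same: "x \<in> RM \<Longrightarrow> w \<in> RM \<Longrightarrow> same s x t w k \<Longrightarrow> P s x (k + 1) = P t w (k + 1)"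
proof (rule P_eq)
  fix j assume a: "x \<in> RM" "w \<in> RM" "same s x t w k" "j < k + 1"
  have "same s x t w j" by (rule same_lower [OF a(1-3)]) (use a(4) in \<open>simp only: less_Suc\<close>)
  then show "bit s (Y j x) = bit t (Y j w)" by (rule same_bit [OF a(1,2)])
qed

lemma psi_close: assumes x: "x \<in> RM" "w \<in> RM" "P s x k = P t w k" shows "\<bar>psi s x - psi t w\<bar> \<le> eps k"
  using psi(2,3) [OF x(1), of s k] psi(2,3) [OF x(2), of t k] unfolding x(3) distrib_right by linarith

lemma psi_eq: assumes x: "x \<in> RM" "w \<in> RM" and b: "\<And>j. bit s (Y j x) = bit t (Y j w)" shows "psi s x = psi t w"
proof (rule ccontr)
  assume "psi s x \<noteq> psi t w"
  then have "0 < \<bar>psi s x - psi t w\<bar>" by simp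
  from eps_small [OF this] obtain k where "eps k < \<bar>psi s x - psi t w\<bar>" by blast
  moreover have "P s x k = P t w k" by (rule P_eq [OF x b])
  ultimately show False using psi_close [OF x] by (meson not_less)
qed

text \<open>Adding an integer leaves the digits after the point alone. The sign condition is due to
  the cut-off of \<open>fl\<close> at 0.\<close>

lemma bit_shift: assumes y: "y \<in> RM" "if s then 0 \<le> y else 0 < y" shows "bit s (y + emb K) = bit s y"
proof -
  have f: "fl s (y + emb K) = fl s y + K"
  proof -
    have "y + emb K \<in> RM" using y by simp
    moreover have "fl s y + K = 0 \<or> blw s (emb (fl s y + K)) (y + emb K)"
    proof (cases "fl s y = 0")
      case True
      then show ?thesis using y(2) by (cases s) (simp_all add: blw_def)
    next
      case False
      then have "blw s (emb (fl s y)) y" using fl_eq_iff [OF y(1), of s "fl s y"] by simp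
      then show ?thesis by (cases s) (simp_all add: blw_def)
    qed
    moreover have "\<not> blw s (emb (fl s y + 1)) y" using fl_eq_iff [OF y(1), of s "fl s y"] by simp
    then have "\<not> blw s (emb (fl s y + K + 1)) (y + emb K)" by (cases s) (simp_all add: blw_def)
    ultimately show ?thesis using fl_eq_iff [of "y + emb K" s "fl s y + K"] by blast
  qed
  have "emb (fl s y + K + (fl s y + K) + 1) = emb (fl s y + fl s y + 1) + (emb K + emb K)" by simp
  moreover have "y + emb K + (y + emb K) = y + y + (emb K + emb K)" by simp
  ultimately show ?thesis unfolding bit_def f by (simp only: blw_def add_le_cancel_right add_less_cancel_right)
qed

lemma Y_add: "Y (m + i) x = emb (pw (i + i)) * Y m x"
proof -
  have "pw (m + i + (m + i)) = pw (i + i) * pw (m + m)" unfolding pw_add [symmetric] by (simp add: ac_simps)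
  then show ?thesis by (simp add: Y_def mult.assoc)
qed

text \<open>Here \<open>w\<close> is \<open>x\<close> plus 4^-(k+1), one unit at the deleted place 2
  k + 2. Retained digits up to index \<open>k\<close> agree because the cell is the same, later ones
  because the scaled points differ by an integer.\<close>

lemma psi_shift:
  assumes x: "x \<in> RM" "w \<in> RM" "if s then 0 \<le> x else 0 < x" and s: "same s x s w k" and Y: "Y (k + 1) w = Y (k + 1) x + 1"
  shows "psi s x = psi s w"
proof (rule psi_eq [OF x(1,2)])
  fix j
  show "bit s (Y j x) = bit s (Y j w)"
  proof (cases "j \<le> k")
    case True
    then show ?thesis using same_bit same_lower x s by blast
  next
    case False
    then have "k + 1 \<le> j" by (simp add: Suc_le)
    then have j: "j = k + 1 + (j - (k + 1))" using le_add_diff_inverse2 [of "k + 1" j] by (simp add: add.commute)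
    define i where "i = j - (k + 1)"
    have "Y j w = Y j x + emb (pw (i + i))"
      using j Y_add [of "k + 1" i w] Y_add [of "k + 1" i x] unfolding Y i_def by (simp add: distrib_left)
    moreover have "if s then 0 \<le> Y j x else 0 < Y j x" using x(3) emb_pw_pos [of "j + j"] by (cases s) (simp_all add: Y_def)
    ultimately show ?thesis using bit_shift [of "Y j x" s "pw (i + i)"] x by simp
  qed
qed

lemma Y_mono: "Y k x \<le> Y k w \<longleftrightarrow> x \<le> w" and Y_less: "Y k x < Y k w \<longleftrightarrow> x < w"
  using emb_pw_pos [of "k + k"] by (simp_all add: Y_def)
lemma Y_plus: "Y k (x + y) = Y k x + Y k y" and Y_minus: "Y k (x - y) = Y k x - Y k y" and Y_0 [simp]: "Y k 0 = 0" and Y_1 [simp]: "Y k 1 = emb (pw (k + k))"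
  by (simp_all add: Y_def algebra_simps)
lemma Y_step: "Y (k + 1) (eps (k + 1 + (k + 1))) = 1" "Y k (eps (k + 1 + (k + 1))) = 1 / 4"
proof -
  show 1: "Y (k + 1) (eps (k + 1 + (k + 1))) = 1" unfolding Y_def by (rule eps_emb)
  have "pw (1 + 1) = 4" using pw_Suc [of 0] pw_Suc [of 1] by simp
  then have "Y (k + 1) z = 4 * Y k z" for z unfolding Y_add by (simp add: emb_numeral)
  then show "Y k (eps (k + 1 + (k + 1))) = 1 / 4" using 1 by simp
qed

lemma same_sym: "same s x t w k \<Longrightarrow> same t w s x k" by (simp add: same_def)

text \<open>Arbitrarily late deleted digits can be changed, which moves the point a little and keeps
  its image. The convention \<open>s\<close> depends on \<open>v\<close> only because of the
  end-point 1.\<close>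

lemma psi_not_injective:
  assumes v: "v \<in> UI"
  shows "\<exists>s. \<forall>k. \<exists>w\<in>UI. w \<noteq> v \<and> \<bar>v - w\<bar> < eps k \<and> psi s w = psi s v"
proof (cases "v < 1")
  case True
  have "\<exists>w\<in>UI. w \<noteq> v \<and> \<bar>v - w\<bar> < eps k \<and> psi True w = psi True v" for k
  proof -
    \<comment> \<open>One unit at binary place 2 k + 2, the deleted digit that follows the cell of
      level \<open>k\<close>.\<close>
    define d where "d = eps (k + 1 + (k + 1))"
    have d: "0 < d" "d < eps k" "d \<in> RM" "Y (k + 1) d = 1" "Y k d = 1 / 4"
    proof -
      have "d \<le> eps (k + 1)" unfolding d_def by (rule eps_mono) simp
      also have "\<dots> < eps k" using eps_Suc [of k] eps_pos [of k] by linarith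
      finally show "d < eps k" .
    qed (use Y_step in \<open>simp_all add: d_def\<close>)
    define X where "X = Y k v + Y k v"
    define h where "h = fl True X"
    have X: "X \<in> RM" "0 \<le> X" using v Y_nonneg [of v k] by (simp_all add: X_def)
    have h: "emb h \<le> X" "X < emb h + 1" using fl_eq_iff [OF X(1), of True h] X(2) by (auto simp: h_def blw_def)
    \<comment> \<open>As \<open>v < 1\<close> and 1 is a grid point, the whole cell of
      \<open>v\<close> lies in the unit interval.\<close>
    have "X < emb (pw (k + k) + pw (k + k))" using True Y_less [of k v 1] by (simp add: X_def)
    then have "h < pw (k + k) + pw (k + k)" using h(1) by (metis emb_less order.strict_trans1)
    then have "emb (h + 1) \<le> emb (pw (k + k) + pw (k + k))" unfolding emb_le Suc_le .
    then have top: "emb h + 1 \<le> Y k 1 + Y k 1" by simp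
    have cell: "w \<in> UI" "same True w True v k" if w: "w \<in> RM" "emb h \<le> Y k w + Y k w" "Y k w + Y k w < emb h + 1" for w
    proof -
      have "0 \<le> Y k w + Y k w" using w(2) emb_nonneg [of h] by linarith
      then have "Y k 0 \<le> Y k w" by simp
      moreover have "Y k w \<le> Y k 1" using w(3) top by linarith
      ultimately show "w \<in> UI" using w(1) unfolding Y_mono by (rule UI_I [rotated])
      have "fl True (Y k w + Y k w) = h" using w by (subst fl_eq_iff) (simp_all add: blw_def)
      then show "same True w True v k" unfolding same_def h_def X_def .
    qed
    \<comment> \<open>In the scale of \<open>X\<close> the cell has length 1 and the shift has
      length 1/2, so either \<open>v + d\<close> or \<open>v - d\<close> remains in the
      cell.\<close>
    show ?thesis
    proof (cases "X + 1 / 2 < emb h + 1")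
      case True
      have w: "v + d \<in> RM" using v d by simp
      have "Y k (v + d) + Y k (v + d) = X + 1 / 2" using d(5) by (simp add: Y_plus X_def)
      then have c: "v + d \<in> UI" "same True (v + d) True v k" using cell [OF w] h True by simp_all
      have "psi True v = psi True (v + d)"
      proof (rule psi_shift [where k = k])
        show "same True v True (v + d) k" using c(2) by (rule same_sym)
        show "Y (k + 1) (v + d) = Y (k + 1) v + 1" by (simp only: Y_plus d(4))
      qed (use v w in simp_all)
      then show ?thesis using c d by (intro bexI [of _ "v + d"]) simp_all
    next
      case False
      have w: "v - d \<in> RM" using v d by simp
      have "Y k (v - d) + Y k (v - d) = X - 1 / 2" using d(5) by (simp add: Y_minus X_def)
      then have c: "v - d \<in> UI" "same True (v - d) True v k" using cell [OF w] h False by simp_all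
      have "psi True (v - d) = psi True v"
      proof (rule psi_shift [where k = k])
        show "same True (v - d) True v k" by (rule c(2))
        show "Y (k + 1) v = Y (k + 1) (v - d) + 1" by (simp only: Y_minus d(4) diff_add_cancel)
        show "if True then 0 \<le> v - d else 0 < v - d" using UI_nonneg [OF c(1)] by simp
      qed (use v w in simp_all)
      then show ?thesis using c d by (intro bexI [of _ "v - d"]) simp_all
    qed
  qed
  then show ?thesis by blast
next
  case False
  \<comment> \<open>For \<open>True\<close> the cell of 1 begins at 1 and leaves the unit interval;
    for \<open>False\<close> the point 1 belongs to the last cell inside it.\<close>
  then have v1: "v = 1" using UI_le_1 [OF v] by linarith
  have "\<exists>w\<in>UI. w \<noteq> v \<and> \<bar>v - w\<bar> < eps k \<and> psi False w = psi False v" for k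
  proof -
    define d where "d = eps (k + 1 + (k + 1))"
    have d2: "d \<le> eps k / 2" unfolding d_def eps_Suc [symmetric] by (rule eps_mono) simp
    have e1: "eps k \<le> 1" using eps_mono [of 0 k] by simp
    have d: "0 < d" "d \<in> RM" "Y (k + 1) d = 1" "Y k d = 1 / 4" unfolding d_def using Y_step by simp_all
    have d1: "d < eps k" "d \<le> 1 / 2" using d2 e1 eps_pos [of k] by linarith+
    have w: "1 - d \<in> RM" using d(2) by simp
    have w0: "0 < 1 - d" using d1(2) by linarith
    obtain h where h: "pw (k + k) + pw (k + k) = h + 1" using arith_nat_pos [OF add_pos_pos [OF pw_pos pw_pos]] by blast
    then have "emb (pw (k + k) + pw (k + k)) = emb (h + 1)" by simp
    then have e: "Y k 1 + Y k 1 = emb h + 1" by simp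
    have "fl False (Y k 1 + Y k 1) = h" unfolding e by (subst fl_eq_iff) (simp_all add: blw_def)
    moreover have "Y k (1 - d) + Y k (1 - d) = emb h + 1 / 2" using e d(4) unfolding Y_minus by linarith
    then have "fl False (Y k (1 - d) + Y k (1 - d)) = h" using w by (subst fl_eq_iff) (simp_all add: blw_def)
    ultimately have "same False (1 - d) False 1 k" by (simp add: same_def)
    then have "psi False (1 - d) = psi False 1"
    proof (rule psi_shift [rotated 3])
      show "Y (k + 1) 1 = Y (k + 1) (1 - d) + 1" by (simp only: Y_minus d(3) diff_add_cancel)
    qed (use w w0 in simp_all)
    then show ?thesis unfolding v1 using w w0 d(1) d1 by (intro bexI [of _ "1 - d"] UI_I) simp_all
  qed
  then show ?thesis by blast
qed

text \<open>Points slightly to the right of \<open>v\<close> share its cell in the sense of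
  \<open>True\<close>, points slightly to the left its cell in the sense of \<open>False\<close>. So
  every nearby image is close to one of the two images of \<open>v\<close>, and requiring both to
  lie in \<open>U\<close> suffices.\<close>

lemma psi_open:
  assumes U: "opn U" and v: "v \<in> UI" and p: "\<And>s. psi s v \<in> U"
  shows "\<exists>i. \<forall>w\<in>UI. \<bar>v - w\<bar> < eps i \<longrightarrow> (\<forall>s. psi s w \<in> U)"
proof -
  obtain k1 where k1: "\<forall>y\<in>UI. \<bar>psi True v - y\<bar> < eps k1 \<longrightarrow> y \<in> U" using U p [of True] unfolding opn_def by blast
  obtain k2 where k2: "\<forall>y\<in>UI. \<bar>psi False v - y\<bar> < eps k2 \<longrightarrow> y \<in> U" using U p [of False] unfolding opn_def by blast
  define k where "k = k1 + k2"
  have "eps (k + 1) = eps k / 2" by (rule eps_Suc)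
  moreover have "eps k \<le> eps k1" "eps k \<le> eps k2" unfolding k_def by (rule eps_mono, simp)+
  ultimately have k: "eps (k + 1) < eps k1" "eps (k + 1) < eps k2" using eps_pos [of k] by linarith+
  have near: "psi s w \<in> U" if "same t v s w k" "w \<in> UI" for s t w
  proof -
    have "\<bar>psi t v - psi s w\<bar> \<le> eps (k + 1)" using that v by (intro psi_close P_same) simp_all
    then have "\<bar>psi t v - psi s w\<bar> < eps k1" "\<bar>psi t v - psi s w\<bar> < eps k2" using k by linarith+
    then show ?thesis using k1 k2 psi_UI [of w s] that(2) by (cases t) auto
  qed
  define X where "X = Y k v + Y k v"
  have X: "X \<in> RM" "0 \<le> X" using v Y_nonneg [of v k] by (simp_all add: X_def)
  define c where "c = Y k 1 + Y k 1"
  have c: "0 < c" using emb_pw_pos [of "k + k"] by (simp add: c_def)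
  have Yc: "Y k w + Y k w = c * w" for w by (simp add: c_def Y_def algebra_simps)
  define h where "h = fl True X"
  define g where "g = fl False X"
  have h: "emb h \<le> X" "X < emb h + 1" using fl_eq_iff [OF X(1), of True h] X(2) by (auto simp: h_def blw_def)
  have g: "g = 0 \<or> emb g < X" "X \<le> emb g + 1" using fl_eq_iff [OF X(1), of False g] by (auto simp: g_def blw_def)
  \<comment> \<open>Distances from \<open>v\<close> to the right end of its \<open>True\<close> cell
    and to the left end of its \<open>False\<close> cell. In the lowest cell nothing has to be
    respected on the left, and 1 stands in.\<close>
  have d1: "0 < (emb h + 1 - X) / c" using h(2) c by simp
  have d2: "0 < (if g = 0 then 1 else (X - emb g) / c)" using g(1) c by auto
  obtain i where i: "eps i < (emb h + 1 - X) / c" "eps i < (if g = 0 then 1 else (X - emb g) / c)" using eps_min [OF d1 d2] by blast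
  have "psi s w \<in> U" if w: "w \<in> UI" "\<bar>v - w\<bar> < eps i" for s w
  proof -
    have wr: "c * w \<in> RM" using w(1) by (simp flip: Yc)
    consider "w = v" | "v < w" | "w < v" by (rule linorder_cases)
    then show ?thesis
    proof cases
      case 1
      then show ?thesis using p by simp
    next
      case 2
      then have "X < c * w" unfolding X_def Yc using c by simp
      moreover have "c * (w - v) < c * ((emb h + 1 - X) / c)" using w(2) 2 i(1) c by (intro mult_strict_left_mono) linarith+
      then have "c * (w - v) < emb h + 1 - X" using c by simp
      then have "c * w < emb h + 1" unfolding X_def Yc right_diff_distrib by linarith
      ultimately have "fl s (c * w) = h" using h(1) wr by (subst fl_eq_iff) (auto simp: blw_def)
      then have "same True v s w k" by (simp add: same_def h_def X_def Yc)
      then show ?thesis using near w(1) by blast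
    next
      case 3
      then have "c * w < X" unfolding X_def Yc using c by simp
      moreover have "g = 0 \<or> emb g < c * w"
      proof (cases "g = 0")
        case False
        then have "c * (v - w) < c * ((X - emb g) / c)" using w(2) 3 i(2) c by (intro mult_strict_left_mono) auto
        then have "c * (v - w) < X - emb g" using c by simp
        then have "emb g < c * w" unfolding X_def Yc right_diff_distrib by linarith
        then show ?thesis ..
      qed simp
      ultimately have "fl s (c * w) = g" using g(2) wr by (subst fl_eq_iff) (auto simp: blw_def)
      then have "same False v s w k" by (simp add: same_def g_def X_def Yc)
      then show ?thesis using near w(1) by blast
    qed
  qed
  then show ?thesis by blast
qed

text \<open>The centre of the cell with number \<open>h\<close> at level \<open>l\<close>. It lies
  off the grid of that level, so both conventions place it in the same cell.\<close>

definition ctr :: "'n \<Rightarrow> 'n \<Rightarrow> 'n rl" where "ctr l h = emb (h + h + 1) * eps (l + l + 1 + 1)"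

lemma ctr_RM [simp]: "ctr l h \<in> RM"
  unfolding ctr_def RM_iff by (intro defr_q defq_mult defq_emb defq_eps defn_const)

lemma Y_ctr: "Y l (ctr l h) + Y l (ctr l h) = emb h + 1 / 2"
proof -
  have "eps (l + l + 1 + 1) = eps (l + l) / 4" unfolding eps_Suc by simp
  moreover have "emb (pw (l + l)) * eps (l + l) = 1" by (rule eps_emb)
  ultimately have "Y l (ctr l h) = emb (h + h + 1) / 4" unfolding Y_def ctr_def by (simp add: mult.left_commute)
  then show ?thesis by simp
qed

lemma Y_Suc: "Y (l + 1) x = 4 * Y l x"
proof -
  have "pw (1 + 1) = 4" using pw_Suc [of 0] pw_Suc [of 1] by simp
  then show ?thesis unfolding Y_add by (simp add: emb_numeral)
qed

lemma parity: "\<exists>m'. m = m' + m' \<or> m = m' + m' + 1" for m :: 'n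
proof (rule induction [where P = "\<lambda>m. \<exists>m'. m = m' + m' \<or> m = m' + m' + 1"])
  show "defp [T0] (\<lambda>e. \<exists>m'. nv 0 e = m' + m' \<or> nv 0 e = m' + m' + 1)"
    by (rule num_intros | simp only: v_tl | (simp; fail))+
  show "\<exists>m' :: 'n. 0 = m' + m' \<or> 0 = m' + m' + 1" by (rule exI [of _ 0]) simp
  show "\<exists>m'. n + 1 = m' + m' \<or> n + 1 = m' + m' + 1" if n: "\<exists>m'. n = m' + m' \<or> n = m' + m' + 1" for n :: 'n
  proof -
    obtain m' where "n = m' + m' \<or> n = m' + m' + 1" using n by blast
    then show ?thesis
    proof
      assume "n = m' + m' + 1"
      then have "n + 1 = (m' + 1) + (m' + 1)" by (simp only: ac_simps)
      then show ?thesis by blast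
    qed blast
  qed
qed

text \<open>Of the four subcells with numbers from 4 h to 4 h + 3, the one with number 4 h + b has
  deleted digit 0 and next retained digit b.\<close>

lemma ctr_child:
  assumes b: "b = 0 \<or> b = 1"
  shows "P True (ctr (l + 1) (4 * h + b)) (l + 1 + 1) = P True (ctr l h) (l + 1) + P True (ctr l h) (l + 1) + b"
proof -
  let ?z = "ctr (l + 1) (4 * h + b)"
  have e: "emb (4 * h + b) = 4 * emb h + emb b" by (simp add: emb_numeral)
  have "4 * Y l ?z + 4 * Y l ?z = 4 * emb h + emb b + 1 / 2"
    using Y_ctr [of "l + 1" "4 * h + b"] unfolding Y_Suc e by simp
  then have z: "Y l ?z + Y l ?z = emb h + (emb b / 4 + 1 / 8)" by linarith
  have bb: "emb b = 0 \<or> emb b = 1" using b by auto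
  have zr: "emb h + (emb b / 4 + 1 / 8) \<in> RM" unfolding z [symmetric] by (intro RM_add Y_RM ctr_RM)
  have "fl True (Y l ?z + Y l ?z) = h"
    unfolding z fl_eq_iff [OF zr] using bb by (auto simp: blw_def)
  moreover have "fl True (Y l (ctr l h) + Y l (ctr l h)) = h"
    unfolding Y_ctr by (subst fl_eq_iff) (simp_all add: blw_def)
  ultimately have "P True ?z (l + 1) = P True (ctr l h) (l + 1)"
    by (intro P_same) (simp_all add: same_def)
  moreover have "bit True (Y (l + 1) ?z) \<longleftrightarrow> b = 1"
  proof -
    have y: "Y (l + 1) ?z + Y (l + 1) ?z = 4 * emb h + emb b + 1 / 2" using Y_ctr [of "l + 1" "4 * h + b"] unfolding e .
    then have y2: "Y (l + 1) ?z = 2 * emb h + (emb b / 2 + 1 / 4)" by linarith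
    have yr: "2 * emb h + (emb b / 2 + 1 / 4) \<in> RM" unfolding y2 [symmetric] by (intro Y_RM ctr_RM)
    have "fl True (Y (l + 1) ?z) = h + h"
      unfolding y2 fl_eq_iff [OF yr] using bb by (auto simp: blw_def)
    then have "bit True (Y (l + 1) ?z) \<longleftrightarrow> emb (h + h + (h + h) + 1) \<le> 4 * emb h + emb b + 1 / 2"
      unfolding bit_def y by (simp add: blw_def)
    also have "\<dots> \<longleftrightarrow> 1 \<le> emb b + 1 / 2" by simp
    also have "\<dots> \<longleftrightarrow> b = 1" using b by auto
    finally show ?thesis .
  qed
  ultimately show ?thesis using P_Suc [of ?z True "l + 1"] b by auto
qed

text \<open>Retained digits can be prescribed freely by descending through subcells; the bounds on
  \<open>h'\<close> say that the final cell is contained in the cell \<open>h\<close>.\<close>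

lemma digits_ex:
  fixes h t :: 'n
  defines "m0 \<equiv> P True (ctr t h) (t + 1)"
  shows "m0 * pw i \<le> m \<Longrightarrow> m < (m0 + 1) * pw i \<Longrightarrow>
    \<exists>h'. h * pw (i + i) \<le> h' \<and> h' + 1 \<le> (h + 1) * pw (i + i) \<and> P True (ctr (t + i) h') (t + i + 1) = m"
proof -
  \<comment> \<open>All \<open>m\<close> are treated at once, because the induction step removes the
    last digit of \<open>m\<close>.\<close>
  define C where "C i \<longleftrightarrow> (\<forall>m. m0 * pw i \<le> m \<and> m < (m0 + 1) * pw i \<longrightarrow>
    (\<exists>h'. h * pw (i + i) \<le> h' \<and> h' + 1 \<le> (h + 1) * pw (i + i) \<and> P True (ctr (t + i) h') (t + i + 1) = m))" for i
  have "C i"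
  proof (rule induction [where P = C])
    show "defp [T0] (\<lambda>e. C (nv 0 e))"
      unfolding C_def ctr_def
      by (rule num_intros defn_pw defn_P defr_q [OF defq_mult] defq_emb defq_eps | simp only: v_tl | (simp; fail))+
    show "C 0"
      unfolding C_def
    proof (intro allI impI)
      fix m assume "m0 * pw 0 \<le> m \<and> m < (m0 + 1) * pw 0"
      then have "m = m0" by (intro order.antisym) (simp_all add: less_Suc)
      then show "\<exists>h'. h * pw (0 + 0) \<le> h' \<and> h' + 1 \<le> (h + 1) * pw (0 + 0) \<and> P True (ctr (t + 0) h') (t + 0 + 1) = m"
        by (intro exI [of _ h]) (simp add: m0_def)
    qed
  next
    fix i assume IH: "C i"
    show "C (i + 1)"
      unfolding C_def
    proof (intro allI impI)
      fix m assume m: "m0 * pw (i + 1) \<le> m \<and> m < (m0 + 1) * pw (i + 1)"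
      obtain m' where "m = m' + m' \<or> m = m' + m' + 1" using parity by blast
      then obtain b where b: "b = 0 \<or> b = 1" "m = m' + m' + b" by (metis add_0_right)
      have "m0 * pw i \<le> m'"
      proof (rule ccontr)
        assume "\<not> m0 * pw i \<le> m'"
        then have "m' + 1 \<le> m0 * pw i" by (simp add: Suc_le)
        from add_mono [OF this this] have "m' + m' + 1 + 1 \<le> m0 * pw i + m0 * pw i" by (simp only: ac_simps)
        also have "\<dots> = m0 * pw (i + 1)" by (simp only: pw_Suc distrib_left)
        also have "\<dots> \<le> m" using m by blast
        finally have "m' + m' + 1 + 1 \<le> m" .
        then show False using b by (auto simp: Suc_le)
      qed
      moreover have "m' < (m0 + 1) * pw i"
      proof (rule ccontr)
        assume "\<not> m' < (m0 + 1) * pw i"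
        then have "(m0 + 1) * pw i \<le> m'" by (simp add: not_less)
        from add_mono [OF this this] have "(m0 + 1) * pw (i + 1) \<le> m' + m'" by (simp only: pw_Suc distrib_left)
        also have "m' + m' \<le> m" using b by auto
        finally show False using conjunct2 [OF m] by (simp add: not_less)
      qed
      ultimately obtain h' where h': "h * pw (i + i) \<le> h'" "h' + 1 \<le> (h + 1) * pw (i + i)" "P True (ctr (t + i) h') (t + i + 1) = m'"
        using IH unfolding C_def by blast
      have p: "pw (i + 1 + (i + 1)) = 4 * pw (i + i)"
      proof -
        have "pw (i + 1 + (i + 1)) = pw (i + i + 1 + 1)" by (simp only: ac_simps)
        also have "\<dots> = (pw (i + i) + pw (i + i)) + (pw (i + i) + pw (i + i))" unfolding pw_Suc ..
        also have "\<dots> = (1 + 1 + (1 + 1)) * pw (i + i)" by (simp only: distrib_right mult_1)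
        also have "(1 :: 'n) + 1 + (1 + 1) = 4" by simp
        finally show ?thesis .
      qed
      have "4 * (h * pw (i + i)) \<le> 4 * h'" by (rule mult_left_mono [OF h'(1)]) simp
      also have "4 * h' \<le> 4 * h' + b" by (rule add_increasing2 [OF nonneg order.refl])
      finally have "h * pw (i + 1 + (i + 1)) \<le> 4 * h' + b" unfolding p by (simp only: ac_simps)
      moreover have "4 * h' + b + 1 \<le> (h + 1) * pw (i + 1 + (i + 1))"
      proof -
        have "b + 1 \<le> 4" using b(1) by auto
        then have "4 * h' + (b + 1) \<le> 4 * (h' + 1)" by (simp add: distrib_left)
        also have "\<dots> \<le> 4 * ((h + 1) * pw (i + i))" by (rule mult_left_mono [OF h'(2)]) simp
        finally show ?thesis unfolding p by (simp only: ac_simps)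
      qed
      moreover have "P True (ctr (t + (i + 1)) (4 * h' + b)) (t + (i + 1) + 1) = m"
        using ctr_child [OF b(1), of "t + i" h'] unfolding h'(3) b(2) by (simp only: add.assoc)
      ultimately show "\<exists>h'. h * pw (i + 1 + (i + 1)) \<le> h' \<and> h' + 1 \<le> (h + 1) * pw (i + 1 + (i + 1)) \<and>
        P True (ctr (t + (i + 1)) h') (t + (i + 1) + 1) = m" by blast
    qed
  qed
  then show "m0 * pw i \<le> m \<Longrightarrow> m < (m0 + 1) * pw i \<Longrightarrow>
    \<exists>h'. h * pw (i + i) \<le> h' \<and> h' + 1 \<le> (h + 1) * pw (i + i) \<and> P True (ctr (t + i) h') (t + i + 1) = m"
    unfolding C_def by blast
qed

text \<open>Inside a cell near \<open>v\<close> the retained digits after a fixed prefix are free.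
  Density of \<open>U\<close> gives a point \<open>u\<close> in the dyadic interval of that prefix;
  enough of its digits are then realised by a subcell, whose centre is mapped close to
  \<open>u\<close>.\<close>

lemma psi_dense:
  assumes U: "opn U" "dns U" "U \<subseteq> UI" and v: "v \<in> UI"
  shows "\<exists>x\<in>UI. \<bar>v - x\<bar> < eps k \<and> (\<forall>s. psi s x \<in> U)"
proof -
  define X where "X = Y k v + Y k v"
  have X: "X \<in> RM" "0 \<le> X" using v Y_nonneg [of v k] by (simp_all add: X_def)
  define c where "c = Y k 1 + Y k 1"
  have c: "0 < c" "c = emb (pw (k + k) + pw (k + k))" using emb_pw_pos [of "k + k"] by (simp_all add: c_def)
  have Yc: "Y k w + Y k w = c * w" for w by (simp add: c_def Y_def algebra_simps)
  have ce: "1 / c < eps k"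
  proof -
    have "c * eps (k + k + 1) = 1" using eps_emb [of "k + k + 1"] unfolding c(2) pw_Suc .
    then have "1 / c = eps (k + k + 1)" using c(1) by (simp add: divide_eq_eq mult.commute)
    also have "\<dots> = eps (k + k) / 2" by (rule eps_Suc)
    also have "eps (k + k) \<le> eps k" by (rule eps_mono) simp
    then have "eps (k + k) / 2 < eps k" using eps_pos [of k] by linarith
    finally show ?thesis .
  qed
  \<comment> \<open>The convention \<open>False\<close> keeps the closed cell inside the unit
    interval even if \<open>v\<close> is 1.\<close>
  define h where "h = fl False X"
  have h: "emb h \<le> X" "X \<le> emb h + 1" using fl_eq_iff [OF X(1), of False h] X(2) by (auto simp: h_def blw_def)
  have h2: "h + 1 \<le> pw (k + k) + pw (k + k)"
  proof (cases "h = 0")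
    case True
    have "0 < pw (k + k) + pw (k + k)" by (rule add_pos_pos [OF pw_pos pw_pos])
    then show ?thesis unfolding Suc_le by (simp only: True)
  next
    case False
    then have "emb h < X" using fl_eq_iff [OF X(1), of False h] by (auto simp: h_def blw_def)
    also have "X \<le> c" unfolding X_def Yc using c(1) UI_le_1 [OF v] by simp
    finally show ?thesis unfolding c(2) emb_less Suc_le .
  qed
  define m0 where "m0 = P True (ctr k h) (k + 1)"
  let ?e = "eps (k + 1)"
  have m0: "m0 + 1 \<le> pw (k + 1)" using P_bounds [of "ctr k h" True 0 "k + 1"] by (simp add: m0_def P_0)
  \<comment> \<open>The midpoint of the dyadic interval with prefix \<open>m0\<close>; the ball of
    radius \<open>eps (k + 1 + 1)\<close> around it is the open interval, so \<open>u\<close> falls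
    strictly inside.\<close>
  define q where "q = emb (m0 + m0 + 1) * eps (k + 1 + 1)"
  have q: "q = emb m0 * ?e + ?e / 2" unfolding q_def eps_Suc by (simp add: algebra_simps)
  have qU: "q \<in> UI"
  proof (rule UI_I)
    show "q \<in> RM" unfolding q_def RM_iff by (intro defr_q defq_mult defq_emb defq_eps defn_const)
    show "0 \<le> q" unfolding q_def by (simp add: less_imp_le)
    have "emb (m0 + 1) * ?e \<le> emb (pw (k + 1)) * ?e" using m0 by (intro mult_right_mono) (simp_all add: less_imp_le del: emb_hom)
    then have "emb m0 * ?e + ?e \<le> 1" unfolding eps_emb by (simp add: distrib_right)
    then show "q \<le> 1" unfolding q using eps_pos [of "k + 1"] by linarith
  qed
  obtain u where u: "u \<in> U" "\<bar>q - u\<bar> < eps (k + 1 + 1)" using U(2) qU unfolding dns_def by blast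
  then have uU: "u \<in> UI" using U(3) by blast
  have u2: "emb m0 * ?e < u" "u < emb m0 * ?e + ?e" using u(2) unfolding q eps_Suc [of "k + 1"] by linarith+
  obtain j where j: "\<forall>y\<in>UI. \<bar>u - y\<bar> < eps j \<longrightarrow> y \<in> U" using U(1) u(1) unfolding opn_def by blast
  \<comment> \<open>A cell of level \<open>k + i\<close> fixes \<open>l\<close> retained digits, and
    \<open>l\<close> is large enough for \<open>eps l < eps j\<close>.\<close>
  define i where "i = j + 1"
  define l where "l = k + i + 1"
  have l: "l = k + 1 + i" by (simp add: l_def ac_simps)
  have lj: "eps l < eps j"
  proof -
    have "eps l \<le> eps (j + 1)" unfolding l i_def by (rule eps_mono) simp
    also have "\<dots> < eps j" using eps_Suc [of j] eps_pos [of j] by linarith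
    finally show ?thesis .
  qed
  \<comment> \<open>The integer part of \<open>V\<close> consists of the first \<open>l\<close>
    digits of \<open>u\<close>, the digits to be realised.\<close>
  define V where "V = emb (pw l) * u"
  define m where "m = fl True V"
  have V: "V \<in> RM" "0 \<le> V" using uU by (simp_all add: V_def mult_nonneg_nonneg less_imp_le)
  have m: "emb m \<le> V" "V < emb m + 1" using fl_eq_iff [OF V(1), of True m] V(2) by (auto simp: m_def blw_def)
  have pe: "emb (pw l) * ?e = emb (pw i)"
  proof -
    have "emb (pw l) * ?e = emb (pw i) * (emb (pw (k + 1)) * ?e)" unfolding l pw_add by (simp only: emb_hom ac_simps)
    then show ?thesis unfolding eps_emb by simp
  qed
  have "emb (pw l) * (emb m0 * ?e) < V" "V < emb (pw l) * (emb m0 * ?e + ?e)"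
    unfolding V_def using u2 by (simp_all only: mult_strict_left_mono emb_pw_pos)
  moreover have "emb (pw l) * (emb m0 * ?e) = emb (m0 * pw i)" using pe by (simp add: mult.left_commute mult.commute)
  moreover from this have "emb (pw l) * (emb m0 * ?e + ?e) = emb ((m0 + 1) * pw i)" using pe by (simp add: distrib_left distrib_right)
  ultimately have V2: "emb (m0 * pw i) < V" "V < emb ((m0 + 1) * pw i)" by simp_all
  have "emb (m0 * pw i) < emb (m + 1)" "emb m < emb ((m0 + 1) * pw i)" using V2 m unfolding emb_hom(1) [of m] emb_hom(4) by linarith+
  then have m1: "m0 * pw i \<le> m" "m < (m0 + 1) * pw i" unfolding emb_less less_Suc .
  from digits_ex [of k h i m, folded m0_def, OF this]
  obtain h' where h': "h * pw (i + i) \<le> h'" "h' + 1 \<le> (h + 1) * pw (i + i)" "P True (ctr (k + i) h') (k + i + 1) = m" by blast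
  define x where "x = ctr (k + i) h'"
  have xr: "x \<in> RM" by (simp add: x_def)
  have P: "P s x l = m" for s
  proof -
    \<comment> \<open>The centre avoids the grid, so one prefix serves both conventions.\<close>
    have "fl s (Y (k + i) x + Y (k + i) x) = h'" for s unfolding x_def Y_ctr by (subst fl_eq_iff) (simp_all add: blw_def)
    then have "same s x True x (k + i)" by (simp add: same_def)
    then show ?thesis using P_same [OF xr xr] h'(3) unfolding l_def x_def by metis
  qed
  have "psi s x \<in> U" for s
  proof -
    have "emb m * eps l \<le> u" "u \<le> (emb m + 1) * eps l"
    proof -
      have "V * eps l = u" unfolding V_def using eps_emb [of l] by (simp add: mult.commute mult.left_commute)
      moreover have "emb m * eps l \<le> V * eps l" "V * eps l \<le> (emb m + 1) * eps l"
        using m by (simp_all only: mult_right_mono less_imp_le eps_pos)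
      ultimately show "emb m * eps l \<le> u" "u \<le> (emb m + 1) * eps l" by simp_all
    qed
    then have "\<bar>u - psi s x\<bar> \<le> eps l" using psi(2,3) [OF xr, of s l] unfolding P distrib_right by linarith
    then show ?thesis using lj j psi_UI [OF xr] by (meson order.strict_trans1)
  qed
  moreover have cx: "emb h \<le> c * x" "c * x \<le> emb h + 1"
  proof -
    have e: "emb (pw (i + i)) * (c * x) = emb h' + 1 / 2"
      using Y_ctr [of "k + i" h'] unfolding x_def [symmetric] Y_add Yc [symmetric] by (simp only: distrib_left)
    have "emb (h * pw (i + i)) \<le> emb h'" "emb (h' + 1) \<le> emb ((h + 1) * pw (i + i))" unfolding emb_le using h' by blast+
    then have "emb (pw (i + i)) * emb h \<le> emb (pw (i + i)) * (c * x)" "emb (pw (i + i)) * (c * x) \<le> emb (pw (i + i)) * (emb h + 1)"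
      unfolding e by (simp_all add: ac_simps distrib_left)
    then show "emb h \<le> c * x" "c * x \<le> emb h + 1" by (simp_all only: mult_le_cancel_left_pos emb_pw_pos)
  qed
  then have "\<bar>c * v - c * x\<bar> \<le> 1" using h unfolding X_def Yc by linarith
  then have "c * \<bar>v - x\<bar> \<le> 1" using c(1) by (simp add: abs_mult flip: right_diff_distrib)
  then have "\<bar>v - x\<bar> \<le> 1 / c" using c(1) by (simp add: le_divide_eq mult.commute)
  then have "\<bar>v - x\<bar> < eps k" using ce by linarith
  moreover have "x \<in> UI"
  proof (rule UI_I [OF xr])
    have "0 \<le> c * x" using cx(1) emb_nonneg [of h] by linarith
    then show "0 \<le> x" using c(1) by (simp add: zero_le_mult_iff)
    have "emb (h + 1) \<le> c" using h2 unfolding c(2) emb_le .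
    then have "c * x \<le> c * 1" using cx(2) by simp
    then show "x \<le> 1" by (simp only: mult_le_cancel_left_pos [OF c(1)])
  qed
  ultimately show ?thesis by blast
qed

text \<open>A point is kept if both of its images lie in the given set. \<open>psi_open\<close> and
  \<open>psi_dense\<close> preserve openness and density, while \<open>psi_not_injective\<close>
  turns an image outside the set with index m into nearby points outside the pulled-back set with
  the same index.\<close>

lemma cover_ex: assumes "\<not> bct" shows "\<exists>E. cover M nd E"
proof -
  from assms obtain E where E: "fits E" "\<And>v. v \<in> UI \<Longrightarrow> \<exists>n. v \<notin> Sec E n" unfolding bct_def by blast
  have Ec: "E \<in> carr M (T1 \<rightarrow> T0 \<rightarrow> T0)" "\<And>n. isset (\<lambda>x. ap M (ap M E x) (nd n))" using E(1) unfolding fits_def by blast+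
  define S where "S n x \<longleftrightarrow> psi True (cl x) \<in> Sec E n \<and> psi False (cl x) \<in> Sec E n" for n x
  have "defp [T0, T1] (\<lambda>e. S (nv 0 e) (rv (xv 1 e)))"
    unfolding S_def
    by (intro defp_and defp_sv [OF Ec] defn_nv defr_psi defr_cl defr_rv deft_xv psi_UI) simp_all
  then obtain F where F: "F \<in> carr M (T1 \<rightarrow> T0 \<rightarrow> T0)" "\<And>n. isset (\<lambda>x. ap M (ap M F x) (nd n))" "\<And>n. Sec F n = {v \<in> UI. S n v}"
    using sets_ex [of S] by blast
  have S: "v \<in> Sec F n \<longleftrightarrow> (\<forall>s. psi s v \<in> Sec E n)" if "v \<in> UI" for v n
    using that by (simp add: F(3) S_def all_bool_eq)
  have sub: "Sec F n \<subseteq> UI" for n using F(3) by blast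
  have "fits F"
    unfolding fits_def
  proof (intro conjI allI F)
    fix n
    have o: "opn (Sec E n)" "dns (Sec E n)" "Sec E (n + 1) \<subseteq> Sec E n" using E(1) unfolding fits_def by blast+
    show "opn (Sec F n)"
      unfolding opn_def
    proof
      fix v assume v: "v \<in> Sec F n"
      then have vU: "v \<in> UI" using sub by blast
      have "\<exists>i. \<forall>w\<in>UI. \<bar>v - w\<bar> < eps i \<longrightarrow> (\<forall>s. psi s w \<in> Sec E n)"
        by (rule psi_open [OF o(1) vU]) (use v S [OF vU] in blast)
      then show "\<exists>k. \<forall>w\<in>UI. \<bar>v - w\<bar> < eps k \<longrightarrow> w \<in> Sec F n" using S by blast
    qed
    show "dns (Sec F n)"
      unfolding dns_def
    proof (intro ballI allI)
      fix v k assume "v \<in> UI"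
      from psi_dense [OF o(1,2) sv_UI this] obtain x where "x \<in> UI" "\<bar>v - x\<bar> < eps k" "\<forall>s. psi s x \<in> Sec E n" by blast
      then show "\<exists>w\<in>Sec F n. \<bar>v - w\<bar> < eps k" using S by blast
    qed
    show "Sec F (n + 1) \<subseteq> Sec F n" using o(3) S sub by blast
  qed
  moreover have "\<exists>n. v \<notin> Sec F n" if "v \<in> UI" for v
    using E(2) [OF psi_UI [OF UI_RM [OF that]], of True] S [OF that] by blast
  moreover have "\<exists>m. \<forall>k. \<exists>w\<in>UI. w \<noteq> v \<and> \<bar>v - w\<bar> < eps k \<and> w \<notin> Sec F m" if v: "v \<in> UI" for v
  proof -
    obtain s where s: "\<forall>k. \<exists>w\<in>UI. w \<noteq> v \<and> \<bar>v - w\<bar> < eps k \<and> psi s w = psi s v" using psi_not_injective [OF v] by blast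
    obtain m where m: "psi s v \<notin> Sec E m" using E(2) [OF psi_UI [OF UI_RM [OF v]]] by blast
    have "\<exists>w\<in>UI. w \<noteq> v \<and> \<bar>v - w\<bar> < eps k \<and> w \<notin> Sec F m" for k
    proof -
      obtain w where "w \<in> UI" "w \<noteq> v" "\<bar>v - w\<bar> < eps k" "psi s w = psi s v" using s by blast
      moreover from this have "w \<notin> Sec F m" using S m by metis
      ultimately show ?thesis by blast
    qed
    then show ?thesis by blast
  qed
  ultimately have "cover M nd F" by unfold_locales blast+
  then show ?thesis ..
qed

end

section \<open>The equivalence in a model\<close>

definition point_properties :: "(tmb \<Rightarrow> tmb \<Rightarrow> fmb) set" where
  "point_properties = {cont_at, regulated_at, quasi_cont_at, lower_quasi_cont_at, cadlag_at, Darboux_at, lsc_at}"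

text \<open>All variants are collected in one set, because in each model they share a single truth
  value. This covers all combinations of restrictions and point properties at once.\<close>

definition statements :: "fm set" where
  "statements = {BCT, BCT_null} \<union> (\<Union>H\<in>{usc, usc_C_null}. \<Union>Pr\<in>point_properties.
     {item_b H Pr, item_c H Pr, item_d H Pr, item_e H, item_f H, item_g H})"

lemma statements_cases:
  assumes A: "A \<in> statements"
  obtains "A = BCT" | "A = BCT_null"
    | H Pr where "H \<in> {usc, usc_C_null}" "Pr \<in> point_properties" "A \<in> {item_b H Pr, item_c H Pr, item_d H Pr, item_e H, item_f H, item_g H}"
proof -
  have "A = BCT \<or> A = BCT_null \<or> (\<exists>H\<in>{usc, usc_C_null}. \<exists>Pr\<in>point_properties. A \<in> {item_b H Pr, item_c H Pr, item_d H Pr, item_e H, item_f H, item_g H})"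
    using A unfolding statements_def by (simp only: Un_iff UN_iff insert_iff empty_iff simp_thms disj_assoc)
  then show thesis
  proof (elim disjE bexE)
    assume "A = BCT"
    then show thesis by (rule that(1))
  next
    assume "A = BCT_null"
    then show thesis by (rule that(2))
  next
    fix H Pr assume "H \<in> {usc, usc_C_null}" "Pr \<in> point_properties" "A \<in> {item_b H Pr, item_c H Pr, item_d H Pr, item_e H, item_f H, item_g H}"
    then show thesis by (rule that(3))
  qed
qed

context nmodel
begin

text \<open>Negates only the weakest properties: each member of \<open>point_properties\<close>
  implies lower semi-continuity, lower quasi-continuity, the Darboux property or the existence of
  both one-sided limits.\<close>

definition nowhere :: "('n rl \<Rightarrow> 'n rl) \<Rightarrow> 'n rl \<Rightarrow> bool" where
  "nowhere f v \<longleftrightarrow> \<not> lscont f v \<and> \<not> lquasi f v \<and> \<not> darboux f v \<and> (\<forall>l r. \<not> (llim f v l \<and> rlim f v r))"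

lemma no_bct_f: assumes "\<not> bct"
  shows "\<exists>F. isfun F \<and> (\<forall>v\<in>UI. uscont (fv F) v) \<and> osc (fv F) (fv F) \<and> ccont (fv F) \<and> (\<forall>v\<in>UI. 0 < fv F v) \<and>
    (\<forall>c\<in>UI. \<forall>d\<in>UI. \<forall>e\<in>RP. c < d \<longrightarrow> (\<exists>w\<in>UI. c \<le> w \<and> w \<le> d \<and> \<not> e \<le> fv F w)) \<and> (\<forall>v\<in>UI. nowhere (fv F) v)"
proof -
  obtain E where "cover M nd E" using cover_ex [OF assms] by blast
  then interpret cover M nd E .
  obtain F where F: "isfun F" "\<And>v. v \<in> UI \<Longrightarrow> fv F v = eps (nn v)" using f_ex by blast
  note [intro] = f_uscont [of "fv F", OF F(2)] f_osc [of "fv F", OF F(2)] f_ccont [of "fv F", OF F(2)] f_pos [of "fv F", OF F(2)]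
  have "nowhere (fv F) v" if "v \<in> UI" for v
    unfolding nowhere_def
    using f_not_lscont [of "fv F", OF F(2)] f_not_lquasi [of "fv F", OF F(2)] f_not_darboux [of "fv F", OF F(2)]
      f_not_regulated [of "fv F", OF F(2)] that by blast
  then show ?thesis using F(1) f_inf [of "fv F", OF F(2)] by (intro exI [of _ F] conjI ballI impI) auto
qed

lemma no_bct_g: assumes "\<not> bct"
  shows "\<exists>G. isfun G \<and> (\<forall>v\<in>UI. uscont (fv G) v) \<and> (\<forall>v\<in>UI. \<not> cont (fv G) v) \<and>
    (\<forall>q. \<forall>c\<in>UI. \<forall>d\<in>UI. c < d \<longrightarrow> (\<exists>w\<in>UI. c < w \<and> w < d \<and> \<not> q \<le> fv G w))"
proof -
  obtain E where "cover M nd E" using cover_ex [OF assms] by blast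
  then interpret cover M nd E .
  obtain G where G: "isfun G" "\<And>v. v \<in> UI \<Longrightarrow> fv G v = - emb (nn v)" using g_ex by blast
  show ?thesis
    using G(1) g_uscont [of "fv G", OF G(2)] g_not_cont [of "fv G", OF G(2)] g_unbounded [of "fv G", OF G(2)]
    by (intro exI [of _ G] conjI ballI allI impI) auto
qed

abbreviation "sat_H H f \<equiv> sat M [f] (H (vr 0) (Suc 0))"
abbreviation "sat_P Pr f x \<equiv> sat M [x, f] (Pr (vr 0) (vr (Suc 0)) (Suc (Suc 0)))"

lemma sat_items:
  "sat M [] (item_b H Pr) \<longleftrightarrow> (\<forall>f. isfun f \<longrightarrow> sat_H H f \<longrightarrow> (\<exists>x\<in>UC. sat_P Pr f x))"
  "sat M [] (item_c H Pr) \<longleftrightarrow> (\<forall>f. isfun f \<longrightarrow> sat_H H f \<and> (\<exists>g. isfun g \<and> osc (fv g) (fv f)) \<longrightarrow> (\<exists>x\<in>UC. sat_P Pr f x))"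
  "sat M [] (item_d H Pr) \<longleftrightarrow> (\<forall>f. isfun f \<longrightarrow> sat_H H f \<and> osc (fv f) (fv f) \<longrightarrow> (\<exists>x\<in>UC. sat_P Pr f x))"
  "sat M [] (item_e H) \<longleftrightarrow> (\<forall>f. isfun f \<longrightarrow> sat_H H f \<and> ccont (fv f) \<longrightarrow> (\<exists>v\<in>UI. cont (fv f) v))"
  "sat M [] (item_f H) \<longleftrightarrow> (\<forall>f. isfun f \<longrightarrow> sat_H H f \<longrightarrow>
    (\<exists>q. \<exists>c\<in>UI. \<exists>d\<in>UI. c < d \<and> (\<forall>y\<in>UI. c < y \<and> y < d \<longrightarrow> rq q \<le> fv f y)))"
  "sat M [] (item_g H) \<longleftrightarrow> (\<forall>f. isfun f \<longrightarrow> sat_H H f \<and> (\<forall>v\<in>UI. 0 < fv f v) \<longrightarrow>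
    (\<exists>c\<in>UI. \<exists>d\<in>UI. c < d \<and> (\<exists>e\<in>RP. \<forall>y\<in>UI. c \<le> y \<and> y \<le> d \<longrightarrow> e \<le> fv f y)))"
proof -
  have g: "(\<exists>g\<in>carr M (T1 \<rightarrow> T1). isfun g \<and> Q g) \<longleftrightarrow> (\<exists>g. isfun g \<and> Q g)" for Q using isfun_carr by blast
  show "sat M [] (item_b H Pr) \<longleftrightarrow> (\<forall>f. isfun f \<longrightarrow> sat_H H f \<longrightarrow> (\<exists>x\<in>UC. sat_P Pr f x))"
    by (simp add: item_b_def)
  show "sat M [] (item_c H Pr) \<longleftrightarrow> (\<forall>f. isfun f \<longrightarrow> sat_H H f \<and> (\<exists>g. isfun g \<and> osc (fv g) (fv f)) \<longrightarrow> (\<exists>x\<in>UC. sat_P Pr f x))"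
    by (simp add: item_c_def g cong: bounded_cong)
  show "sat M [] (item_d H Pr) \<longleftrightarrow> (\<forall>f. isfun f \<longrightarrow> sat_H H f \<and> osc (fv f) (fv f) \<longrightarrow> (\<exists>x\<in>UC. sat_P Pr f x))"
    by (simp add: item_d_def)
  show "sat M [] (item_e H) \<longleftrightarrow> (\<forall>f. isfun f \<longrightarrow> sat_H H f \<and> ccont (fv f) \<longrightarrow> (\<exists>v\<in>UI. cont (fv f) v))"
    by (simp add: item_e_def UI_def cong: bounded_cong)
  show "sat M [] (item_f H) \<longleftrightarrow> (\<forall>f. isfun f \<longrightarrow> sat_H H f \<longrightarrow>
    (\<exists>q. \<exists>c\<in>UI. \<exists>d\<in>UI. c < d \<and> (\<forall>y\<in>UI. c < y \<and> y < d \<longrightarrow> rq q \<le> fv f y)))"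
    by (simp add: item_f_def UI_def cong: bounded_cong)
  show "sat M [] (item_g H) \<longleftrightarrow> (\<forall>f. isfun f \<longrightarrow> sat_H H f \<and> (\<forall>v\<in>UI. 0 < fv f v) \<longrightarrow>
    (\<exists>c\<in>UI. \<exists>d\<in>UI. c < d \<and> (\<exists>e\<in>RP. \<forall>y\<in>UI. c \<le> y \<and> y \<le> d \<longrightarrow> e \<le> fv f y)))"
    by (simp add: item_g_def UI_def RP_image cong: bounded_cong)
qed

lemma sat_P_cont:
  assumes Pr: "Pr \<in> point_properties" and f: "isfun f" and x: "x \<in> UC" and c: "cont (fv f) (rv x)"
  shows "sat_P Pr f x"
proof -
  have v: "rv x \<in> UI" using x by (simp add: UI_def)
  have r: "fv f (rv x) \<in> RM" by (rule fv_RM [OF f v])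
  from Pr show ?thesis
    unfolding point_properties_def
    by (elim insertE emptyE)
      (use f x c r cont_lscont [OF c] cont_quasi [OF c v] quasi_lquasi [OF cont_quasi [OF c v]] cont_darboux [OF c] cont_limits [OF c] in auto)
qed

lemma sat_P_nowhere:
  assumes Pr: "Pr \<in> point_properties" and f: "isfun f" and x: "x \<in> UC" and c: "nowhere (fv f) (rv x)"
  shows "\<not> sat_P Pr f x"
  using Pr unfolding point_properties_def
  by (elim insertE emptyE) (use f x c cont_lscont quasi_lquasi in \<open>auto simp: nowhere_def\<close>)

lemma sat_H_usc: "H \<in> {usc, usc_C_null} \<Longrightarrow> isfun f \<Longrightarrow> sat_H H f \<Longrightarrow> \<forall>v\<in>UI. uscont (fv f) v"
  using sat_usc_C_null_D by auto
lemma sat_H_I: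
  "H \<in> {usc, usc_C_null} \<Longrightarrow> isfun f \<Longrightarrow> \<forall>v\<in>UI. uscont (fv f) v \<Longrightarrow> \<forall>v\<in>UI. \<not> cont (fv f) v \<Longrightarrow> sat_H H f"
  using sat_usc_C_null by auto

text \<open>The interval is placed on the side of \<open>v\<close> where the unit interval has room,
  which depends on whether \<open>v\<close> is at most 1/2.\<close>

lemma interval_near:
  assumes v: "v \<in> UI" shows "\<exists>c\<in>UI. \<exists>d\<in>UI. c < d \<and> (\<forall>y. c \<le> y \<and> y \<le> d \<longrightarrow> \<bar>v - y\<bar> < eps k)"
proof -
  have e: "eps (k + 1) = eps k / 2" by (rule eps_Suc)
  have e1: "eps k \<le> 1" using eps_mono [of 0 k] by simp
  show ?thesis
  proof (cases "v \<le> 1 / 2")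
    case True
    have "v + eps (k + 1) \<in> UI"
    proof (rule UI_I)
      show "0 \<le> v + eps (k + 1)" "v + eps (k + 1) \<le> 1" using UI_nonneg [OF v] True e e1 eps_pos [of k] by linarith+
    qed (use v in simp)
    moreover have "v < v + eps (k + 1)" by simp
    moreover have "\<forall>y. v \<le> y \<and> y \<le> v + eps (k + 1) \<longrightarrow> \<bar>v - y\<bar> < eps k"
    proof (intro allI impI)
      fix y assume "v \<le> y \<and> y \<le> v + eps (k + 1)"
      then show "\<bar>v - y\<bar> < eps k" using e eps_pos [of k] by linarith
    qed
    ultimately show ?thesis using v by blast
  next
    case False
    have "v - eps (k + 1) \<in> UI"
    proof (rule UI_I)
      show "0 \<le> v - eps (k + 1)" "v - eps (k + 1) \<le> 1" using UI_le_1 [OF v] False e e1 eps_pos [of k] by linarith+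
    qed (use v in simp)
    moreover have "v - eps (k + 1) < v" by simp
    moreover have "\<forall>y. v - eps (k + 1) \<le> y \<and> y \<le> v \<longrightarrow> \<bar>v - y\<bar> < eps k"
    proof (intro allI impI)
      fix y assume "v - eps (k + 1) \<le> y \<and> y \<le> v"
      then show "\<bar>v - y\<bar> < eps k" using e eps_pos [of k] by linarith
    qed
    ultimately show ?thesis using v by blast
  qed
qed

lemma cont_lower_bound:
  assumes c: "cont f v" and v: "v \<in> UI" and e: "e \<in> RP"
  shows "\<exists>c\<in>UI. \<exists>d\<in>UI. c < d \<and> (\<forall>y\<in>UI. c \<le> y \<and> y \<le> d \<longrightarrow> f v - e \<le> f y)"
proof -
  obtain k where k: "\<forall>w\<in>UI. \<bar>v - w\<bar> < eps k \<longrightarrow> \<bar>f v - f w\<bar> < e" using c e unfolding cont_def ex_RP_eps' by blast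
  obtain c d where cd: "c \<in> UI" "d \<in> UI" "c < d" "\<forall>y. c \<le> y \<and> y \<le> d \<longrightarrow> \<bar>v - y\<bar> < eps k" using interval_near [OF v] by blast
  have "f v - e \<le> f y" if "y \<in> UI" "c \<le> y" "y \<le> d" for y
  proof -
    have "\<bar>f v - f y\<bar> < e" using k cd(4) that by blast
    then show ?thesis by linarith
  qed
  then show ?thesis using cd by blast
qed

lemma bct_items:
  assumes b: bct and H: "H \<in> {usc, usc_C_null}" and Pr: "Pr \<in> point_properties"
  shows "sat M [] (item_b H Pr)" "sat M [] (item_c H Pr)" "sat M [] (item_d H Pr)"
    "sat M [] (item_e H)" "sat M [] (item_f H)" "sat M [] (item_g H)"
proof -
  have c: "\<exists>v\<in>UI. cont (fv f) v" if "isfun f" "sat_H H f" for f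
    by (rule bct_cont [OF b that(1) sat_H_usc [OF H that]])
  have p: "\<exists>x\<in>UC. sat_P Pr f x" if f: "isfun f" "sat_H H f" for f
  proof -
    obtain x where "x \<in> UC" "cont (fv f) (rv x)" using c [OF f] unfolding UI_def by blast
    then show ?thesis using sat_P_cont [OF Pr f(1)] by blast
  qed
  show "sat M [] (item_b H Pr)" "sat M [] (item_c H Pr)" "sat M [] (item_d H Pr)" "sat M [] (item_e H)"
    unfolding sat_items using c p by blast+
  show "sat M [] (item_f H)"
    unfolding sat_items
  proof (intro allI impI)
    fix f assume f: "isfun f" "sat_H H f"
    obtain v where v: "v \<in> UI" "cont (fv f) v" using c [OF f] by blast
    obtain c d where cd: "c \<in> UI" "d \<in> UI" "c < d" "\<forall>y\<in>UI. c \<le> y \<and> y \<le> d \<longrightarrow> fv f v - eps 0 \<le> fv f y"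
      using cont_lower_bound [OF v(2,1) RP_eps [of 0]] by blast
    obtain q where q: "rq q < fv f v - eps 0" using rq_dense [of "fv f v - eps 0 - 1" "fv f v - eps 0"] by auto
    have "rq q \<le> fv f y" if "y \<in> UI" "c < y" "y < d" for y
    proof -
      have "fv f v - eps 0 \<le> fv f y" using cd(4) that by (simp only: less_imp_le)
      then show ?thesis using q by linarith
    qed
    then show "\<exists>q. \<exists>c\<in>UI. \<exists>d\<in>UI. c < d \<and> (\<forall>y\<in>UI. c < y \<and> y < d \<longrightarrow> rq q \<le> fv f y)" using cd by blast
  qed
  show "sat M [] (item_g H)"
    unfolding sat_items
  proof (intro allI impI)
    fix f assume f: "isfun f" and h: "sat_H H f \<and> (\<forall>v\<in>UI. 0 < fv f v)"
    obtain v where v: "v \<in> UI" "cont (fv f) v" using c [OF f] h by blast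
    have e: "fv f v / 2 \<in> RP" using h v(1) fv_RM [OF f v(1)] by (intro RP_I) simp_all
    obtain c d where cd: "c \<in> UI" "d \<in> UI" "c < d" "\<forall>y\<in>UI. c \<le> y \<and> y \<le> d \<longrightarrow> fv f v - fv f v / 2 \<le> fv f y"
      using cont_lower_bound [OF v(2,1) e] by blast
    have "fv f v - fv f v / 2 = fv f v / 2" by simp
    then show "\<exists>c\<in>UI. \<exists>d\<in>UI. c < d \<and> (\<exists>e\<in>RP. \<forall>y\<in>UI. c \<le> y \<and> y \<le> d \<longrightarrow> e \<le> fv f y)"
      using cd e by metis
  qed
qed

text \<open>The function \<open>F\<close> is bounded below by 0 and cannot refute the item about
  rational lower bounds; that one is refuted by the unbounded function \<open>G\<close>.\<close>

lemma no_bct_items: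
  assumes b: "\<not> bct" and H: "H \<in> {usc, usc_C_null}" and Pr: "Pr \<in> point_properties"
  shows "\<not> sat M [] (item_b H Pr)" "\<not> sat M [] (item_c H Pr)" "\<not> sat M [] (item_d H Pr)"
    "\<not> sat M [] (item_e H)" "\<not> sat M [] (item_f H)" "\<not> sat M [] (item_g H)"
proof -
  obtain F where F: "isfun F" "\<forall>v\<in>UI. uscont (fv F) v" "osc (fv F) (fv F)" "ccont (fv F)" "\<forall>v\<in>UI. 0 < fv F v"
    "\<forall>c\<in>UI. \<forall>d\<in>UI. \<forall>e\<in>RP. c < d \<longrightarrow> (\<exists>w\<in>UI. c \<le> w \<and> w \<le> d \<and> \<not> e \<le> fv F w)" "\<forall>v\<in>UI. nowhere (fv F) v"
    using no_bct_f [OF b] by blast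
  have nc: "\<forall>v\<in>UI. \<not> cont (fv F) v" using F(7) cont_lscont unfolding nowhere_def by blast
  have h: "sat_H H F" by (rule sat_H_I [OF H F(1,2) nc])
  have p: "\<not> (\<exists>x\<in>UC. sat_P Pr F x)" using sat_P_nowhere [OF Pr F(1)] F(7) by (auto simp: UI_def)
  show "\<not> sat M [] (item_b H Pr)" "\<not> sat M [] (item_c H Pr)" "\<not> sat M [] (item_d H Pr)"
    unfolding sat_items using F(1,3) h p by blast+
  show "\<not> sat M [] (item_e H)" unfolding sat_items using F(1,4) h nc by blast
  show "\<not> sat M [] (item_g H)" unfolding sat_items using F(1,5,6) h by blast
  obtain G where G: "isfun G" "\<forall>v\<in>UI. uscont (fv G) v" "\<forall>v\<in>UI. \<not> cont (fv G) v"
    "\<forall>q. \<forall>c\<in>UI. \<forall>d\<in>UI. c < d \<longrightarrow> (\<exists>w\<in>UI. c < w \<and> w < d \<and> \<not> q \<le> fv G w)" using no_bct_g [OF b] by blast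
  have "sat_H H G" by (rule sat_H_I [OF H G(1-3)])
  then show "\<not> sat M [] (item_f H)" unfolding sat_items using G(1,4) by blast
qed

lemma sat_statements: assumes A: "A \<in> statements" shows "sat M [] A \<longleftrightarrow> bct"
proof -
  from A show ?thesis
  proof (cases rule: statements_cases)
    case 3
    show ?thesis
    proof (cases bct)
      case True
      show ?thesis using 3(3) bct_items [OF True 3(1,2)] True by (elim insertE emptyE) simp_all
    next
      case False
      show ?thesis using 3(3) no_bct_items [OF False 3(1,2)] False by (elim insertE emptyE) simp_all
    qed
  qed (simp_all add: sat_BCT sat_BCT_null)
qed

end

lemma wff_statements: assumes A: "A \<in> statements" shows "wff [] A"
proof -
  have H: "wff \<Delta> (H f d)" if "H \<in> {usc, usc_C_null}" "length \<Delta> = d" "tyb \<Delta> f (T1 \<rightarrow> T1)" for H \<Delta> f d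
    using that by auto
  have Pr: "wff \<Delta> (Pr f x d)" if "Pr \<in> point_properties" "length \<Delta> = d" "tyb \<Delta> f (T1 \<rightarrow> T1)" "tyb \<Delta> x T1" for Pr \<Delta> f x d
    using that unfolding point_properties_def by auto
  from A show ?thesis
  proof (cases rule: statements_cases)
    case (3 H Pr)
    from wff_items [of H Pr, OF H [OF 3(1)] Pr [OF 3(2)]] show ?thesis using 3(3) by (elim insertE emptyE) simp_all
  qed (simp_all add: wff_BCT)
qed

section \<open>A type of numbers\<close>

text \<open>The numbers of a model form a set, but the reals over them are constructed from a type. Since types
  cannot depend on a model, one model is chosen in advance, which refutes one of the implications if any model does.\<close>

definition refuting :: "tm set str \<Rightarrow> bool" where
  "refuting M \<longleftrightarrow> aca M \<and> (\<exists>A\<in>statements. \<exists>B\<in>statements. sat M [] A \<and> \<not> sat M [] B)"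
definition R :: "tm set str" where "R = (SOME M. refuting M)"
text \<open>Codes the standard natural numbers as sets of terms. They serve as a default, so that
  the type of numbers exists even if no model refutes an implication.\<close>

definition std :: "nat \<Rightarrow> tm set" where "std n = {Var n}"

definition "num_set = (if refuting R then carr R T0 else range std)"
definition "num_0 = (if refuting R then con R Zero else std 0)"
definition "num_1 = (if refuting R then con R One else std 1)"
definition "num_plus = (if refuting R then pl R else (\<lambda>a b. std (inv std a + inv std b)))"
definition "num_times = (if refuting R then ti R else (\<lambda>a b. std (inv std a * inv std b)))"
definition "num_less = (if refuting R then ltr R else (\<lambda>a b. inv std a < inv std b))"

lemma nat_str_range:
  fixes c :: "nat \<Rightarrow> 'a" assumes "inj c"
  shows "nat_str (range c) (c 0) (c 1) (\<lambda>a b. c (inv c a + inv c b)) (\<lambda>a b. c (inv c a * inv c b)) (\<lambda>a b. inv c a < inv c b)"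
proof -
  have [simp]: "inv c (c n) = n" for n using assms by (rule inv_f_f)
  show ?thesis
  proof
    fix a b assume "a \<in> range c" "b \<in> range c" "inv c a < inv c b"
    then obtain m n where mn: "a = c m" "b = c n" "m < n" by auto
    then show "\<exists>d\<in>range c. c (inv c a + inv c d) = b" by (intro bexI [of _ "c (n - m)"]) auto
    show "inv c (c (inv c a + inv c (c 1))) < inv c b \<or> c (inv c a + inv c (c 1)) = b"
      using mn by (cases "Suc m = n") auto
  qed (auto simp: algebra_simps intro: gr0I)
qed

lemma num_str: "nat_str num_set num_0 num_1 num_plus num_times num_less"
proof (cases "refuting R")
  case True
  then have "aca R" by (simp add: refuting_def)
  from aca.nat_str [OF this] show ?thesis
    using True by (simp add: num_set_def num_0_def num_1_def num_plus_def num_times_def num_less_def)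
next
  case False
  have "inj std" by (auto simp: inj_def std_def)
  from nat_str_range [OF this] show ?thesis
    using False by (simp add: num_set_def num_0_def num_1_def num_plus_def num_times_def num_less_def)
qed

typedef nmb = num_set using nat_str.closed(1) [OF num_str] by blast
setup_lifting type_definition_nmb

instantiation nmb :: "{zero, one, plus, times, ord, minus}"
begin
lift_definition zero_nmb :: nmb is num_0 by (rule nat_str.closed [OF num_str])
lift_definition one_nmb :: nmb is num_1 by (rule nat_str.closed [OF num_str])
lift_definition plus_nmb :: "nmb \<Rightarrow> nmb \<Rightarrow> nmb" is num_plus by (rule nat_str.closed [OF num_str])
lift_definition times_nmb :: "nmb \<Rightarrow> nmb \<Rightarrow> nmb" is num_times by (rule nat_str.closed [OF num_str])
lift_definition less_nmb :: "nmb \<Rightarrow> nmb \<Rightarrow> bool" is num_less .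
definition less_eq_nmb :: "nmb \<Rightarrow> nmb \<Rightarrow> bool" where "less_eq_nmb a b \<longleftrightarrow> a < b \<or> a = b"
definition minus_nmb :: "nmb \<Rightarrow> nmb \<Rightarrow> nmb" where "minus_nmb a b = (if b < a then THE c. b + c = a else 0)"
instance ..
end

lemma nmb_add_assoc: "(a + b) + c = a + (b + c :: nmb)" by transfer (rule nat_str.p_assoc [OF num_str])
lemma nmb_add_comm: "a + b = b + (a :: nmb)" by transfer (rule nat_str.p_comm [OF num_str])
lemma nmb_add_0: "a + 0 = (a :: nmb)" by transfer (rule nat_str.p_zero [OF num_str])
lemma nmb_mult_assoc: "(a * b) * c = a * (b * c :: nmb)" by transfer (rule nat_str.t_assoc [OF num_str])
lemma nmb_mult_comm: "a * b = b * (a :: nmb)" by transfer (rule nat_str.t_comm [OF num_str])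
lemma nmb_mult_1: "a * 1 = (a :: nmb)" by transfer (rule nat_str.t_one [OF num_str])
lemma nmb_mult_0: "a * 0 = (0 :: nmb)" by transfer (rule nat_str.t_zero [OF num_str])
lemma nmb_distrib: "a * (b + c) = a * b + a * (c :: nmb)" by transfer (rule nat_str.distrib [OF num_str])
lemma nmb_irrefl: "\<not> a < (a :: nmb)" by transfer (rule nat_str.l_irrefl [OF num_str])
lemma nmb_trans: "a < b \<Longrightarrow> b < c \<Longrightarrow> a < (c :: nmb)" by transfer (rule nat_str.l_trans [OF num_str])
lemma nmb_total: "a < b \<or> a = b \<or> b < (a :: nmb)" by transfer (rule nat_str.l_total [OF num_str])
lemma nmb_add_mono: "a < b \<Longrightarrow> a + c < b + (c :: nmb)" by transfer (rule nat_str.p_mono [OF num_str])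
lemma nmb_mult_mono: "a < b \<Longrightarrow> 0 < c \<Longrightarrow> a * c < b * (c :: nmb)" by transfer (rule nat_str.t_mono [OF num_str])
lemma nmb_0_1: "0 < (1 :: nmb)" by transfer (rule nat_str.zero_one [OF num_str])
lemma nmb_0_least: "0 < a \<or> 0 = (a :: nmb)" by transfer (rule nat_str.zero_least [OF num_str])
lemma nmb_subtract: "a < b \<Longrightarrow> \<exists>c. a + c = (b :: nmb)" by transfer (use nat_str.subtract [OF num_str] in blast)
lemma nmb_discrete: "a < b \<Longrightarrow> a + 1 < b \<or> a + 1 = (b :: nmb)" by transfer (rule nat_str.discrete [OF num_str])

lemma nmb_cancel: "a + b = a + c \<Longrightarrow> b = (c :: nmb)"
  using nmb_total [of b c] nmb_add_mono [of b c a] nmb_add_mono [of c b a] nmb_irrefl [of "a + b"] by (auto simp: nmb_add_comm)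
lemma nmb_less_add: "0 < c \<Longrightarrow> b < b + (c :: nmb)"
  using nmb_add_mono [of 0 c b] unfolding nmb_add_comm [of 0 b] nmb_add_comm [of c b] nmb_add_0 .
lemma nmb_minus: "b + c = a \<Longrightarrow> a - b = (c :: nmb)"
proof -
  assume a: "b + c = a"
  show ?thesis
  proof (cases "0 < c")
    case True
    then have "b < a" using nmb_less_add a by blast
    then show ?thesis unfolding minus_nmb_def using a nmb_cancel by (auto intro!: the_equality)
  next
    case False
    then have "c = 0" using nmb_0_least [of c] by blast
    then show ?thesis using a nmb_irrefl by (simp add: minus_nmb_def nmb_add_0)
  qed
qed
lemma nmb_minus_0: "a \<le> b \<Longrightarrow> a - b = (0 :: nmb)"
proof -
  assume "a \<le> b"
  then have "\<not> b < a" unfolding less_eq_nmb_def using nmb_trans nmb_irrefl by metis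
  then show ?thesis by (simp add: minus_nmb_def)
qed
lemma nmb_le_ex: "b \<le> a \<Longrightarrow> \<exists>c. b + c = (a :: nmb)"
  unfolding less_eq_nmb_def using nmb_subtract nmb_add_0 by blast
lemma nmb_linear: "a \<le> b \<or> b \<le> (a :: nmb)"
  unfolding less_eq_nmb_def using nmb_total by blast

instance nmb :: arith_nat
proof
  fix a b c :: nmb
  show "a + b + c = a + (b + c)" by (rule nmb_add_assoc)
  show "a + b = b + a" by (rule nmb_add_comm)
  show "0 + a = a" using nmb_add_0 nmb_add_comm by metis
  show "a * b * c = a * (b * c)" by (rule nmb_mult_assoc)
  show "a * b = b * a" by (rule nmb_mult_comm)
  show "1 * a = a" using nmb_mult_1 nmb_mult_comm by metis
  show "a * (b + c) = a * b + a * c" by (rule nmb_distrib)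
  show "(a + b) * c = a * c + b * c" using nmb_distrib nmb_mult_comm by metis
  show "0 * a = 0" "a * 0 = 0" using nmb_mult_0 nmb_mult_comm by metis+
  show "(0 :: nmb) \<noteq> 1" using nmb_0_1 nmb_irrefl by metis
  show "a + b - a = b" by (rule nmb_minus) simp
  show "a - b - c = a - (b + c)"
  proof (cases "b + c \<le> a")
    case True
    then obtain d where "b + c + d = a" using nmb_le_ex by blast
    then show ?thesis using nmb_minus nmb_add_assoc by metis
  next
    case False
    then have 1: "a \<le> b + c" using nmb_linear by blast
    then have 2: "a - (b + c) = 0" by (rule nmb_minus_0)
    show ?thesis
    proof (cases "b \<le> a")
      case True
      then obtain d where d: "b + d = a" using nmb_le_ex by blast
      then have "a - b = d" by (rule nmb_minus)
      moreover have "d \<le> c"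
      proof (rule ccontr)
        assume "\<not> d \<le> c"
        then have "c < d" using nmb_total unfolding less_eq_nmb_def by blast
        then have "b + c < a" using nmb_add_mono [of c d b] d by (simp add: nmb_add_comm)
        then show False using 1 nmb_trans nmb_irrefl unfolding less_eq_nmb_def by metis
      qed
      ultimately show ?thesis using 2 nmb_minus_0 by simp
    next
      case False
      then have "a - b = 0" using nmb_linear nmb_minus_0 by blast
      moreover have "0 \<le> c" using nmb_0_least unfolding less_eq_nmb_def by blast
      ultimately show ?thesis using 2 nmb_minus_0 by simp
    qed
  qed
  show less_le: "a < b \<longleftrightarrow> a \<le> b \<and> \<not> b \<le> a" unfolding less_eq_nmb_def using nmb_trans nmb_irrefl by metis
  show "a \<le> a" by (simp add: less_eq_nmb_def)
  show "a \<le> b \<Longrightarrow> b \<le> c \<Longrightarrow> a \<le> c" unfolding less_eq_nmb_def using nmb_trans by metis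
  show "a \<le> b \<Longrightarrow> b \<le> a \<Longrightarrow> a = b" unfolding less_eq_nmb_def using nmb_trans nmb_irrefl by metis
  show "a \<le> b \<or> b \<le> a" by (rule nmb_linear)
  show "a \<le> b \<Longrightarrow> c + a \<le> c + b" unfolding less_eq_nmb_def using nmb_add_mono nmb_add_comm by metis
  show "a < b \<Longrightarrow> 0 < c \<Longrightarrow> c * a < c * b" using nmb_mult_mono nmb_mult_comm by metis
  show "(0 :: nmb) < 1" by (rule nmb_0_1)
  show "b \<le> a \<Longrightarrow> a - b + b = a" using nmb_le_ex nmb_minus nmb_add_comm by metis
  show "a < b \<longleftrightarrow> a + 1 \<le> b"
    unfolding less_eq_nmb_def using nmb_discrete nmb_less_add [OF nmb_0_1] nmb_trans by metis
  show "0 \<le> a" unfolding less_eq_nmb_def using nmb_0_least by blast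
  show "a \<le> b \<Longrightarrow> a - b = 0" by (rule nmb_minus_0)
  show "a * (b - c) = a * b - a * c"
  proof (cases "c \<le> b")
    case True
    then obtain d where d: "c + d = b" using nmb_le_ex by blast
    then have "a * c + a * d = a * b" using nmb_distrib by metis
    then show ?thesis using nmb_minus d by metis
  next
    case False
    then have "b < c" using nmb_total unfolding less_eq_nmb_def by blast
    then have "a * b \<le> a * c" unfolding less_eq_nmb_def using nmb_mult_mono nmb_mult_comm nmb_0_least nmb_mult_0 by metis
    then show ?thesis using nmb_minus_0 False nmb_linear nmb_mult_0 by metis
  qed
  show "a \<noteq> 0 \<Longrightarrow> b \<noteq> 0 \<Longrightarrow> a * b \<noteq> 0"
    using nmb_mult_mono [of 0 a b] nmb_0_least [of a] nmb_0_least [of b] nmb_irrefl [of 0] nmb_mult_0 nmb_mult_comm by metis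
qed

text \<open>If some model were refuting, so would be \<open>R\<close>, and the type
  \<open>nmb\<close> would be a copy of its numbers. Then \<open>sat_statements\<close> applies to
  \<open>R\<close> and gives all statements the same truth value there.\<close>

lemma not_refuting: "\<not> refuting M"
proof
  assume "refuting M"
  then have R: "refuting R" unfolding R_def by (rule someI)
  then interpret aca R by (simp add: refuting_def)
  interpret nmodel R Rep_nmb
  proof
    show "bij_betw Rep_nmb UNIV (carr R T0)"
      using type_definition.Rep_range [OF type_definition_nmb] R
      by (simp add: bij_betw_def inj_def Rep_nmb_inject num_set_def)
    show "pl R (Rep_nmb a) (Rep_nmb b) = Rep_nmb (a + b)" for a b using R by (simp add: plus_nmb.rep_eq num_plus_def)
    show "ti R (Rep_nmb a) (Rep_nmb b) = Rep_nmb (a * b)" for a b using R by (simp add: times_nmb.rep_eq num_times_def)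
    show "con R Zero = Rep_nmb 0" using R by (simp add: zero_nmb.rep_eq num_0_def)
    show "con R One = Rep_nmb 1" using R by (simp add: one_nmb.rep_eq num_1_def)
    show "ltr R (Rep_nmb a) (Rep_nmb b) \<longleftrightarrow> a < b" for a b using R by (simp add: less_nmb.rep_eq num_less_def)
  qed
  show False using R sat_statements unfolding refuting_def by blast
qed

lemma statements_equivalent: assumes "A \<in> statements" "B \<in> statements" shows "ACA0w \<turnstile> Imp A B"
proof (rule ccontr)
  assume n: "\<not> ACA0w \<turnstile> Imp A B"
  have "ext_axiom \<rho> \<tau> \<in> ACA0w" for \<rho> \<tau> unfolding ACA0w_def RCA0w_def by blast
  moreover have "wff [] (Imp A B)" using wff_statements assms by simp
  ultimately obtain M :: "tm set str" where M: "ext_str M" "\<forall>B\<in>ACA0w. sat M [] B" "\<not> sat M [] (Imp A B)"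
    using countermodel [OF wff_ACA0w] n by blast
  have "aca M" using M by (intro aca.intro aca_axioms.intro) blast+
  moreover have "sat M [] A \<and> \<not> sat M [] B" using M(3) by simp
  ultimately have "refuting M" unfolding refuting_def using assms by blast
  then show False using not_refuting by blast
qed

lemma statements_I:
  "BCT \<in> statements" "BCT_null \<in> statements"
  "H \<in> {usc, usc_C_null} \<Longrightarrow> Pr \<in> point_properties \<Longrightarrow> {item_b H Pr, item_c H Pr, item_d H Pr, item_e H, item_f H, item_g H} \<subseteq> statements"
  unfolding statements_def by blast+

lemma proves_equivalent_statements:
  assumes "A \<in> {BCT, BCT_null}" "H \<in> {usc, usc_C_null}" "Pr \<in> point_properties"
  shows "proves_equivalent ACA0w {A, item_b H Pr, item_c H Pr, item_d H Pr, item_e H, item_f H, item_g H}"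
proof -
  have "A \<in> statements" using assms(1) statements_I(1,2) by (elim insertE emptyE) (simp_all only:)
  then have "{A, item_b H Pr, item_c H Pr, item_d H Pr, item_e H, item_f H, item_g H} \<subseteq> statements" using statements_I(3) [OF assms(2,3)] by (rule insert_subsetI)
  then show ?thesis unfolding proves_equivalent_def using statements_equivalent by blast
qed

theorem theorem2p5:
  shows
    "proves_equivalent ACA0w
       {BCT, item_b usc cont_at, item_c usc cont_at, item_d usc cont_at,
        item_e usc, item_f usc, item_g usc}
     \<and> (\<forall>P \<in> {regulated_at, quasi_cont_at, lower_quasi_cont_at, cadlag_at, Darboux_at, lsc_at}.
          proves_equivalent ACA0w
            {BCT, item_b usc P, item_c usc P, item_d usc P,
             item_e usc, item_f usc, item_g usc})
     \<and> proves_equivalent ACA0w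
         {BCT, item_b usc_C_null cont_at, item_c usc_C_null cont_at, item_d usc_C_null cont_at,
          item_e usc_C_null, item_f usc_C_null, item_g usc_C_null}
     \<and> proves_equivalent ACA0w
         {BCT_null, item_b usc cont_at, item_c usc cont_at, item_d usc cont_at,
          item_e usc, item_f usc, item_g usc}"
  by (intro conjI ballI proves_equivalent_statements) (auto simp: point_properties_def)

end
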